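(* Let $d\in[1,+\infty]$ and let $(D_t)_{t\ge0}=(\mathbb A_{r(t)})_{t\ge0}$ be a non-degenerate canonical domain system of order $d$. Then a function $G:\mathcal D\to\mathbb C$, where $\mathcal D:=\{(z,t):t\ge0,\ z\in D_t\}$, is a semicomplete weak holomorphic vector field of order $d$ if and only if there exist functions $p:\mathcal D\to\mathbb C$ and $C:[0,+\infty)\to\mathbb R$ such that: (i) $G(w,t)=w\big[iC(t)+r'(t)p(w,t)/r(t)\big]$ for a.e. $t\ge0$ and all $w\in D_t$; (ii) for each $w\in D:=\bigcup_{t\ge0}D_t$ the function $p(w,\cdot)$ is measurable in $E_w:=\{t\ge0:(w,t)\in\mathcal D\}$; (iii) for each $t\ge0$ the function $p(\cdot,t)$ belongs to the class $\mathcal V_{r(t)}$; (iv) $C\in L^d_{\rm loc}([0,+\infty),\mathbb R)$.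
   Context: Notation: $\mathbb A_\rho:=\{z\in\mathbb C:\rho<|z|<1\}$; $\mathbb T$ is the unit circle. $AC^d(X,Y)$ is the class of locally absolutely continuous functions $f:X\to Y$ with $f'\in L^d_{\rm loc}(X)$. $\omega(\rho):=-\pi/\log \rho$ for $\rho\in(0,1)$, $\omega(0):=0$. Measurable means Lebesgue measurable. Canonical domain system of order $d$: a family of annuli $D_t=\mathbb A_{r(t)}$, $t\ge0$, with $r:[0,+\infty)\to[0,1)$, such that $t\mapsto\omega(r(t))$ belongs to $AC^d([0,+\infty),[0,+\infty))$ and is non-increasing. It is non-degenerate if $r(t)>0$ for all $t\ge0$. Weak holomorphic vector field of order $d$ in $\mathcal D$: a function $G:\mathcal D\to\mathbb C$ such that (WHVF1) for each $z\in\mathbb C$ the function $G(z,\cdot)$ is measurable in $E_z=\{t:(z,t)\in\mathcal D\}$; (WHVF2) for each $t\ge0$ the function $G(\cdot,t)$ is holomorphic in $D_t$; (WHVF3) for each compact $K\subset\mathcal D$ there is a non-negative $k_K\in L^d(\mathrm{pr}_{\mathbb R}(K),\mathbb R)$, where $\mathrm{pr}_{\mathbb R}(K):=\{t:\exists z\ (z,t)\in K\}$, with $|G(z,t)|\le k_K(t)$ for all $(z,t)\in K$. It is semicomplete if for every $(z,s)\in\mathcal D$ the problem $\dot w=G(w,t)$, $w(s)=z$, has a solution defined on all of $[s,+\infty)$ (i.e. a locally absolutely continuous $w$ with $(w(t),t)\in\mathcal D$, satisfying the equation for a.e. $t$ and the initial condition). Villat kernel: for $r\in(0,1)$, $$\mathcal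 K_r(z):=\lim_{n\to+\infty}\sum_{\nu=-n}^n\frac{1+r^{2\nu}z}{1-r^{2\nu}z},\qquad z\in\mathbb A_r.$$ Class $\mathcal V_r$, $r\in(0,1)$: all holomorphic $p:\mathbb A_r\to\mathbb C$ having the representation $$p(z)=\int_{\mathbb T}\mathcal K_r(z/\xi)\,d\mu_1(\xi)+\int_{\mathbb T}\big[1-\mathcal K_r(r\xi/z)\big]\,d\mu_2(\xi),\quad z\in\mathbb A_r,$$ where $\mu_1,\mu_2$ are positive Borel measures on $\mathbb T$ with $\mu_1(\mathbb T)+\mu_2(\mathbb T)=1$.
   Formalization: The "if" direction additionally requires G(·,t) to be holomorphic in D_t for every t ≥ 0, because (i) constrains G only for a.e. t, so (i)–(iv) alone do not give (WHVF2) on the exceptional null set of times. *)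

theory Defs
  imports "HOL-Analysis.Analysis" "HOL-Complex_Analysis.Complex_Analysis"
begin

text \<open>
  Functions on a subset of a type are total functions of which only the values on that subset are
  used. The exponent \<open>d\<close> is an extended nonnegative real, with \<open>d = \<infinity>\<close> allowed.
\<close>

definition Ld_on :: "ennreal \<Rightarrow> real set \<Rightarrow> (real \<Rightarrow> 'a::real_normed_vector) \<Rightarrow> bool" where
  "Ld_on d X f \<longleftrightarrow>
     f \<in> borel_measurable (lebesgue_on X) \<and>
     (if d = \<infinity> then (\<exists>M. AE t in lebesgue_on X. norm (f t) \<le> M)
      else (\<integral>\<^sup>+t. ennreal (norm (f t) powr enn2real d) \<partial>(lebesgue_on X)) < \<infinity>)"

definition Ld_loc :: "ennreal \<Rightarrow> real set \<Rightarrow> (real \<Rightarrow> 'a::real_normed_vector) \<Rightarrow> bool" where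
  "Ld_loc d X f \<longleftrightarrow> (\<forall>K. compact K \<longrightarrow> K \<subseteq> X \<longrightarrow> Ld_on d K f)"

definition abs_continuous_on_interval ::
    "real \<Rightarrow> real \<Rightarrow> (real \<Rightarrow> 'a::metric_space) \<Rightarrow> bool" where
  "abs_continuous_on_interval a b f \<longleftrightarrow>
     (\<forall>\<epsilon>>0. \<exists>\<delta>>0. \<forall>(n::nat) u v.
        (\<forall>i<n. a \<le> u i \<and> u i \<le> v i \<and> v i \<le> b) \<longrightarrow>
        (\<forall>i<n. \<forall>j<n. i \<noteq> j \<longrightarrow> {u i<..<v i} \<inter> {u j<..<v j} = {}) \<longrightarrow>
        (\<Sum>i<n. v i - u i) < \<delta> \<longrightarrow>
        (\<Sum>i<n. dist (f (u i)) (f (v i))) < \<epsilon>)"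

definition locally_abs_continuous_on :: "real set \<Rightarrow> (real \<Rightarrow> 'a::metric_space) \<Rightarrow> bool" where
  "locally_abs_continuous_on X f \<longleftrightarrow>
     (\<forall>a b. a \<le> b \<longrightarrow> {a..b} \<subseteq> X \<longrightarrow> abs_continuous_on_interval a b f)"

text \<open>
  The class \<open>AC\<^sup>d(X, Y)\<close>, for an interval \<open>X\<close>. The condition \<open>f' \<in> L\<^sup>d\<^sub>loc(X)\<close> presupposes that the
  derivative exists almost everywhere; the values of \<open>vector_derivative\<close> on the exceptional null set
  are arbitrary and do not matter.
\<close>

definition AC :: "ennreal \<Rightarrow> real set \<Rightarrow> 'a set \<Rightarrow> (real \<Rightarrow> 'a::real_normed_vector) \<Rightarrow> bool" where
  "AC d X Y f \<longleftrightarrow>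
     (\<forall>t\<in>X. f t \<in> Y) \<and>
     locally_abs_continuous_on X f \<and>
     (AE t in lebesgue_on X. f differentiable (at t within X)) \<and>
     Ld_loc d X (\<lambda>t. vector_derivative f (at t within X))"

definition annulus :: "real \<Rightarrow> complex set" where
  "annulus \<rho> = {z. \<rho> < norm z \<and> norm z < 1}"

definition omega :: "real \<Rightarrow> real" where
  "omega \<rho> = (if \<rho> = 0 then 0 else - pi / ln \<rho>)"

text \<open>The domain system \<open>(annulus (r t))\<close>, \<open>t \<ge> 0\<close>, is given by its function \<open>r\<close> of inner radii.\<close>

definition canonical_domain_system :: "ennreal \<Rightarrow> (real \<Rightarrow> real) \<Rightarrow> bool" where
  "canonical_domain_system d r \<longleftrightarrow>
     (\<forall>t\<ge>0. 0 \<le> r t \<and> r t < 1) \<and>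
     AC d {0..} {0..} (\<lambda>t. omega (r t)) \<and>
     antimono_on {0..} (\<lambda>t. omega (r t))"

definition nondegenerate :: "(real \<Rightarrow> real) \<Rightarrow> bool" where
  "nondegenerate r \<longleftrightarrow> (\<forall>t\<ge>0. 0 < r t)"

definition total_domain :: "(real \<Rightarrow> real) \<Rightarrow> (complex \<times> real) set" where
  "total_domain r = {(z, t). 0 \<le> t \<and> z \<in> annulus (r t)}"

definition time_section :: "(complex \<times> real) set \<Rightarrow> complex \<Rightarrow> real set" where
  "time_section \<D> z = {t. (z, t) \<in> \<D>}"

definition weak_holomorphic_vector_field ::
    "ennreal \<Rightarrow> (real \<Rightarrow> real) \<Rightarrow> (complex \<times> real \<Rightarrow> complex) \<Rightarrow> bool" where
  "weak_holomorphic_vector_field d r G \<longleftrightarrow>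
     (\<forall>z. (\<lambda>t. G (z, t)) \<in> borel_measurable (lebesgue_on (time_section (total_domain r) z))) \<and>
     (\<forall>t\<ge>0. (\<lambda>z. G (z, t)) holomorphic_on annulus (r t)) \<and>
     (\<forall>K. compact K \<longrightarrow> K \<subseteq> total_domain r \<longrightarrow>
        (\<exists>k :: real \<Rightarrow> real. Ld_on d (snd ` K) k \<and> (\<forall>t\<in>snd ` K. 0 \<le> k t) \<and>
           (\<forall>(z, t)\<in>K. norm (G (z, t)) \<le> k t)))"

definition semicomplete :: "(real \<Rightarrow> real) \<Rightarrow> (complex \<times> real \<Rightarrow> complex) \<Rightarrow> bool" where
  "semicomplete r G \<longleftrightarrow>
     (\<forall>(z, s)\<in>total_domain r. \<exists>w :: real \<Rightarrow> complex.
        locally_abs_continuous_on {s..} w \<and>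
        (\<forall>t\<ge>s. (w t, t) \<in> total_domain r) \<and>
        (AE t in lebesgue_on {s..}. (w has_vector_derivative G (w t, t)) (at t within {s..})) \<and>
        w s = z)"

definition villat_kernel :: "real \<Rightarrow> complex \<Rightarrow> complex" where
  "villat_kernel r z =
     lim (\<lambda>n::nat. \<Sum>\<nu>\<in>{- int n..int n}.
       (1 + of_real (r powi (2 * \<nu>)) * z) / (1 - of_real (r powi (2 * \<nu>)) * z))"

text \<open>Borel measures on the unit circle are measures on the trace of the Borel sigma-algebra.\<close>

definition villat_class :: "real \<Rightarrow> (complex \<Rightarrow> complex) set" where
  "villat_class r =
     {p. p holomorphic_on annulus r \<and>
        (\<exists>\<mu>\<^sub>1 \<mu>\<^sub>2 :: complex measure.
           sets \<mu>\<^sub>1 = sets (restrict_space borel (sphere 0 1)) \<and>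
           sets \<mu>\<^sub>2 = sets (restrict_space borel (sphere 0 1)) \<and>
           emeasure \<mu>\<^sub>1 (sphere 0 1) + emeasure \<mu>\<^sub>2 (sphere 0 1) = 1 \<and>
           (\<forall>z\<in>annulus r.
              p z = (\<integral>\<xi>. villat_kernel r (z / \<xi>) \<partial>\<mu>\<^sub>1)
                  + (\<integral>\<xi>. 1 - villat_kernel r (of_real r * \<xi> / z) \<partial>\<mu>\<^sub>2)))}"

end

theory Submission
  imports Defs "HOL-Probability.Probability"
begin

text \<open>
  In the coordinate \<open>\<zeta> = ln z\<close> the field becomes \<open>F(\<zeta>, t) = G(z, t) / z\<close> on the strips \<open>ln r(t) < Re \<zeta> < 0\<close>.

  If \<open>G\<close> is semicomplete, the solutions that start at time \<open>s\<close> give functions \<open>L\<^sub>h(z) = ln (w(s + h) / z)\<close>,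
  holomorphic in \<open>z\<close>, with \<open>ln r(s + h) - ln \<bar>z\<bar> < Re L\<^sub>h < - ln \<bar>z\<bar>\<close>. Near the two boundary circles these
  inequalities bound \<open>Re L\<^sub>h / h\<close> by positive densities of total mass about \<open>(ln r(s) - ln r(s + h)) / h\<close>.
  For almost every \<open>s\<close>, \<open>L\<^sub>h / h\<close> tends to \<open>F(\<cdot>, s)\<close> and, by Helly's theorem, the densities have weak limits
  along a sequence \<open>h \<rightarrow> 0\<close>. Comparing Laurent coefficients with the expansion of the Villat kernel yields
  the representation of \<open>G(\<cdot>, s)\<close> by positive measures of total mass \<open>- r'(s) / r(s)\<close>.

  Conversely, functions of the Villat class are locally bounded uniformly in the inner radius, so the formula
  defines a weak holomorphic vector field. Moreover \<open>Re p\<close> is at least \<open>- M \<bar>ln \<bar>z\<bar>\<bar>\<close> near the unit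
  circle and at most \<open>1 + M ln (\<bar>z\<bar> / r)\<close> near the inner one, so by a Gronwall argument no trajectory
  reaches the moving boundary in finite time.
\<close>

section \<open>Absolutely continuous functions\<close>

text \<open>Semicompleteness supplies, for each starting point, an equation that holds outside a
  null set depending on that point, so the flow cannot be differentiated directly at one time for
  all points. The trajectories are therefore used in integrated form, started at one fixed time, and
  compared with time averages of the field at countably many points of one fixed circle; the
  exceptional set of times then depends on the field alone. Convergence on this circle is enough:
  Laurent coefficients do not depend on the radius, so no estimate of the flow near the boundary
  enters. Positivity, in contrast, is available only near the boundary; the circles on which it is
  used approach the boundary at distance of order h^2, so that after division by h the additional
  mass tends to 0. In the converse direction the field may be unbounded near the boundary.
  Trajectories are constructed for a field truncated to a strip whose margins shrink at a rate
  dictated by the linear bounds on Re p, and comparison then shows that the truncation is never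
  active.\<close>

lemma measure_between:
  fixes x y :: real
  shows "measure lborel {min x y..max x y} = \<bar>y - x\<bar>"
    and "measure lebesgue {min x y..max x y} = \<bar>y - x\<bar>"
  by (auto simp: content_real min_def max_def)

text \<open>Henstock's lemma controls the total defect of a tagged partial division. If the quotient
  at \<open>x\<close> fails by more than \<open>e\<close>, arbitrarily short intervals with endpoint
  \<open>x\<close> have a defect above \<open>e\<close> times their length. Vitali's theorem covers
  almost all such \<open>x\<close> by countably many disjoint ones, and Henstock's lemma forces the
  lengths of any finite selection to add up to less than \<eta>.\<close>

theorem AE_has_vector_derivative_integral:
  fixes f :: "real \<Rightarrow> 'a::euclidean_space"
  assumes f: "f integrable_on {a..b}"
  shows "AE x in lebesgue. x \<in> {a..b} \<longrightarrow>
    ((\<lambda>t. integral {a..t} f) has_vector_derivative f x) (at x within {a..b})"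
proof -
  define Q where "Q = (\<lambda>x y. norm (integral {min x y..max x y} f - \<bar>y - x\<bar> *\<^sub>R f x))"
  define B where "B = (\<lambda>e. {x\<in>{a..b}. \<forall>\<delta>>0. \<exists>y\<in>{a..b}. y \<noteq> x \<and> \<bar>y - x\<bar> < \<delta> \<and> Q x y > e * \<bar>y - x\<bar>})"
  have negl: "negligible (B e)" if "e > 0" for e
    unfolding negligible_outer_le
  proof (intro allI impI)
    fix \<eta> :: real assume "\<eta> > 0"
    then have "e * \<eta> > 0" using \<open>e > 0\<close> by simp
    with f obtain \<gamma> where \<gamma>: "gauge \<gamma>"
      and hen: "\<And>p. p tagged_partial_division_of (cbox a b) \<Longrightarrow> \<gamma> fine p \<Longrightarrow>
             sum (\<lambda>(x,k). norm (measure lborel k *\<^sub>R f x - integral k f)) p < e * \<eta>"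
      using Henstock_lemma[of f a b "e * \<eta>"] by (auto simp: cbox_interval)
    \<comment> \<open>A pair (x, y) stands for the interval between \<open>x\<close> and
      \<open>y\<close>, tagged at its endpoint \<open>x\<close>. It is described as a ball with
      midpoint \<open>m\<close> and radius \<open>R\<close>, the form in which the covering theorem
      is stated.\<close>
    define K where "K = {(x, y). x \<in> {a..b} \<and> y \<in> {a..b} \<and> y \<noteq> x \<and> {min x y..max x y} \<subseteq> \<gamma> x \<and> Q x y > e * \<bar>y - x\<bar>}"
    define m where "m = (\<lambda>(x::real, y::real). (x + y) / 2)"
    define R where "R = (\<lambda>(x::real, y::real). \<bar>y - x\<bar> / 2)"
    have cb: "cball (m i) (R i) = {min (fst i) (snd i)..max (fst i) (snd i)}" for i
      by (cases i) (auto simp: m_def R_def cball_eq_atLeastAtMost min_def max_def abs_if field_simps)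
    have "\<exists>i. i \<in> K \<and> x \<in> cball (m i) (R i) \<and> R i < d" if x: "x \<in> B e" "0 < d" for x d
    proof -
      obtain \<rho> where \<rho>: "\<rho> > 0" "ball x \<rho> \<subseteq> \<gamma> x"
        using \<gamma> unfolding gauge_def by (meson openE)
      obtain y where y: "y \<in> {a..b}" "y \<noteq> x" "\<bar>y - x\<bar> < min d \<rho>" "Q x y > e * \<bar>y - x\<bar>"
        using x \<rho> unfolding B_def by (smt (verit) mem_Collect_eq)
      have "{min x y..max x y} \<subseteq> ball x \<rho>"
        using y(3) by (auto simp: dist_real_def)
      then have "(x, y) \<in> K" using x y \<rho> by (auto simp: K_def B_def)
      moreover have "x \<in> cball (m (x, y)) (R (x, y))" by (simp add: cb del: mem_cball)
      moreover have "R (x, y) < d" using y by (auto simp: R_def)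
      ultimately show ?thesis by blast
    qed
    then obtain C where C: "countable C" "C \<subseteq> K"
      and disj: "pairwise (\<lambda>i j. disjnt (cball (m i) (R i)) (cball (m j) (R j))) C"
      and neg: "negligible (B e - (\<Union>i\<in>C. cball (m i) (R i)))"
      using Vitali_covering_theorem_cballs[of K R "B e" m]
      by (smt (verit, best) K_def R_def case_prodE mem_Collect_eq case_prod_conv half_gt_zero zero_less_abs_iff right_minus_eq)
    define U where "U = (\<lambda>i. cball (m i) (R i))"
    have meas: "measure lebesgue (\<Union>i\<in>D. U i) \<le> \<eta>" if D: "D \<subseteq> C" "finite D" for D
    proof -
      have injU: "inj_on U D"
      proof (rule inj_onI)
        fix i j assume "i \<in> D" "j \<in> D" "U i = U j"
        moreover have "m i \<in> U i" by (cases i) (auto simp: U_def R_def)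
        ultimately show "i = j" using disj D unfolding pairwise_def disjnt_def U_def by blast
      qed
      define p where "p = (\<lambda>i. (fst i, U i)) ` D"
      have inj2: "inj_on (\<lambda>i. (fst i, U i)) D"
        using injU by (auto simp: inj_on_def)
      have "p tagged_partial_division_of (cbox a b)"
        unfolding tagged_partial_division_of_def
      proof (intro conjI allI impI)
        show "finite p" using D by (simp add: p_def)
      next
        fix x k assume "(x, k) \<in> p"
        then obtain i where i: "i \<in> D" "x = fst i" "k = U i" by (auto simp: p_def)
        then have iK: "i \<in> K" using D C by auto
        show "x \<in> k" using i by (simp add: U_def cb del: mem_cball)
        show "k \<subseteq> cbox a b" using iK i by (auto simp: U_def cb K_def simp del: mem_cball)
        have "k = cbox (min (fst i) (snd i)) (max (fst i) (snd i))" using i by (simp only: U_def cb cbox_interval)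
        then show "\<exists>a b. k = cbox a b" by blast
      next
        fix x1 k1 x2 k2 assume "(x1, k1) \<in> p \<and> (x2, k2) \<in> p \<and> (x1, k1) \<noteq> (x2, k2)"
        then obtain i j where "i \<in> D" "j \<in> D" "i \<noteq> j" "k1 = U i" "k2 = U j" by (auto simp: p_def)
        then have "k1 \<inter> k2 = {}" using disj D unfolding pairwise_def disjnt_def U_def by blast
        then show "interior k1 \<inter> interior k2 = {}"
          using interior_subset by blast
      qed
      moreover have "\<gamma> fine p"
        using D C by (force simp: fine_def p_def U_def cb K_def simp del: mem_cball)
      ultimately have "sum (\<lambda>(x,k). norm (measure lborel k *\<^sub>R f x - integral k f)) p < e * \<eta>"
        by (rule hen)
      moreover have "sum (\<lambda>(x,k). norm (measure lborel k *\<^sub>R f x - integral k f)) p =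
          (\<Sum>i\<in>D. Q (fst i) (snd i))"
        unfolding p_def sum.reindex[OF inj2] o_def
        by (intro sum.cong refl)
           (simp only: Q_def U_def cb measure_between prod.case norm_minus_commute)
      moreover have "(\<Sum>i\<in>D. Q (fst i) (snd i)) \<ge> (\<Sum>i\<in>D. e * \<bar>snd i - fst i\<bar>)"
        using D C by (intro sum_mono) (force simp: K_def)
      ultimately have "e * (\<Sum>i\<in>D. \<bar>snd i - fst i\<bar>) < e * \<eta>" by (simp add: sum_distrib_left)
      then have le: "(\<Sum>i\<in>D. \<bar>snd i - fst i\<bar>) < \<eta>" using \<open>e > 0\<close> by simp
      have "measure lebesgue (\<Union>i\<in>D. U i) \<le> (\<Sum>i\<in>D. measure lebesgue (U i))"
        using D by (intro measure_UNION_le) (auto simp: U_def)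
      also have "\<dots> = (\<Sum>i\<in>D. \<bar>snd i - fst i\<bar>)"
        by (intro sum.cong refl)
          (simp add: U_def cb measure_between del: mem_cball)
      finally show ?thesis using le by simp
    qed
    have Um: "U i \<in> lmeasurable" for i by (simp add: U_def)
    have "(\<Union>i\<in>C. U i) \<in> lmeasurable \<and> measure lebesgue (\<Union>i\<in>C. U i) \<le> \<eta>"
      using fmeasurable_UN_bound[of C U lebesgue \<eta>] measure_UN_bound[of C U lebesgue \<eta>] C(1) Um meas
      by blast
    then have "(\<Union>i\<in>C. U i) \<in> lmeasurable" and le: "measure lebesgue (\<Union>i\<in>C. U i) \<le> \<eta>" by auto
    moreover have N: "B e - (\<Union>i\<in>C. U i) \<in> lmeasurable" "measure lebesgue (B e - (\<Union>i\<in>C. U i)) = 0"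
      using neg by (auto simp: U_def negligible_imp_measurable negligible_imp_measure0)
    ultimately have "measure lebesgue ((\<Union>i\<in>C. U i) \<union> (B e - (\<Union>i\<in>C. U i))) \<le> \<eta>"
      using measure_Un_le[of "(\<Union>i\<in>C. U i)" lebesgue "B e - (\<Union>i\<in>C. U i)"] by (auto dest: fmeasurableD)
    with N \<open>(\<Union>i\<in>C. U i) \<in> lmeasurable\<close>
    show "\<exists>T. B e \<subseteq> T \<and> T \<in> lmeasurable \<and> measure lebesgue T \<le> \<eta>"
      by (intro exI[of _ "(\<Union>i\<in>C. U i) \<union> (B e - (\<Union>i\<in>C. U i))"] conjI fmeasurable.Un) auto
  qed
  have "negligible (\<Union>n::nat. B (1 / Suc n))"
    by (intro negligible_Union_nat negl) simp
  then have "AE x in lebesgue. x \<notin> (\<Union>n::nat. B (1 / Suc n))"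
    unfolding negligible_iff_null_sets by (rule AE_not_in)
  then show ?thesis
  proof (eventually_elim, intro impI)
    fix x assume nB: "x \<notin> (\<Union>n::nat. B (1 / Suc n))" and x: "x \<in> {a..b}"
    show "((\<lambda>t. integral {a..t} f) has_vector_derivative f x) (at x within {a..b})"
      unfolding has_vector_derivative_def has_derivative_within_alt
    proof (intro conjI allI impI bounded_linear_scaleR_left)
      fix e :: real assume "e > 0"
      then obtain n where n: "1 / Suc n < e" by (meson nat_approx_posE)
      from nB have "x \<notin> B (1 / Suc n)" by blast
      with x have "\<exists>\<delta>>0. \<forall>y\<in>{a..b}. y \<noteq> x \<longrightarrow> \<bar>y - x\<bar> < \<delta> \<longrightarrow> Q x y \<le> 1 / Suc n * \<bar>y - x\<bar>"
        unfolding B_def mem_Collect_eq by (meson not_less)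
      then obtain \<delta> where "\<delta> > 0"
        and \<delta>: "\<And>y. y \<in> {a..b} \<Longrightarrow> y \<noteq> x \<Longrightarrow> \<bar>y - x\<bar> < \<delta> \<Longrightarrow> Q x y \<le> 1 / Suc n * \<bar>y - x\<bar>"
        by blast
      have "norm (integral {a..y} f - integral {a..x} f - (y - x) *\<^sub>R f x) \<le> e * norm (y - x)"
        if y: "y \<in> {a..b}" "norm (y - x) < \<delta>" for y
      proof (cases "y = x")
        case False
        have comb: "integral {a..u} f + integral {u..v} f = integral {a..v} f"
          if "a \<le> u" "u \<le> v" "v \<le> b" for u v
          using that by (intro Henstock_Kurzweil_Integration.integral_combine integrable_on_subinterval[OF f]) auto
        have "norm (integral {a..y} f - integral {a..x} f - (y - x) *\<^sub>R f x) = Q x y"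
        proof (cases "x \<le> y")
          case True
          then have "integral {a..y} f - integral {a..x} f = integral {x..y} f"
            using comb[of x y] x y by (simp add: diff_eq_eq add.commute)
          then show ?thesis using True by (simp add: Q_def)
        next
          case False
          then have "integral {a..y} f - integral {a..x} f - (y - x) *\<^sub>R f x =
            - (integral {y..x} f - \<bar>y - x\<bar> *\<^sub>R f x)"
            using comb[of y x] x y by (simp add: diff_eq_eq add.commute scaleR_diff_left flip: comb[of y x])
          then show ?thesis using False by (simp add: Q_def norm_minus_commute)
        qed
        also have "\<dots> \<le> 1 / Suc n * \<bar>y - x\<bar>" using \<delta> y False by auto
        also have "\<dots> \<le> e * norm (y - x)" using mult_right_mono[OF less_imp_le[OF n], of "norm (y - x)"] by simp
        finally show ?thesis .
      qed simp
      then show "\<exists>d>0. \<forall>y\<in>{a..b}. norm (y - x) < d \<longrightarrow>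
        norm (integral {a..y} f - integral {a..x} f - (y - x) *\<^sub>R f x) \<le> e * norm (y - x)"
        using \<open>\<delta> > 0\<close> by blast
    qed
  qed
qed

section \<open>Absolute continuity and the fundamental theorem of calculus\<close>

lemma sum_length_disjoint_intervals_le:
  fixes u v :: "nat \<Rightarrow> real"
  assumes uv: "\<And>i. i < n \<Longrightarrow> u i \<le> v i"
    and disj: "\<And>i j. i < n \<Longrightarrow> j < n \<Longrightarrow> i \<noteq> j \<Longrightarrow> {u i<..<v i} \<inter> {u j<..<v j} = {}"
    and V: "\<And>i. i < n \<Longrightarrow> {u i<..<v i} \<subseteq> V" "V \<in> lmeasurable"
  shows "(\<Sum>i<n. v i - u i) \<le> measure lebesgue V"
proof -
  have "(\<Sum>i<n. v i - u i) = (\<Sum>i<n. measure lebesgue {u i<..<v i})"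
    using uv by (intro sum.cong refl) (auto simp: )
  also have "\<dots> = measure lebesgue (\<Union>i\<in>{..<n}. {u i<..<v i})"
    using disj uv by (intro measure_finite_Union[symmetric]) (auto simp: disjoint_family_on_def)
  also have "\<dots> \<le> measure lebesgue V"
    using V by (intro measure_mono_fmeasurable) auto
  finally show ?thesis .
qed

lemma abs_continuous_on_intervalE:
  assumes "abs_continuous_on_interval a b f" "\<epsilon> > 0"
  obtains \<delta> where "\<delta> > 0" "\<And>(n::nat) u v.
        (\<forall>i<n. a \<le> u i \<and> u i \<le> v i \<and> v i \<le> b) \<Longrightarrow>
        (\<forall>i<n. \<forall>j<n. i \<noteq> j \<longrightarrow> {u i<..<v i} \<inter> {u j<..<v j} = {}) \<Longrightarrow>
        (\<Sum>i<n. v i - u i) < \<delta> \<Longrightarrow> (\<Sum>i<n. dist (f (u i)) (f (v i))) < \<epsilon>"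
proof -
  from assms obtain \<delta> where "\<delta> > 0" and *: "\<forall>(n::nat) u v.
        (\<forall>i<n. a \<le> u i \<and> u i \<le> v i \<and> v i \<le> b) \<longrightarrow>
        (\<forall>i<n. \<forall>j<n. i \<noteq> j \<longrightarrow> {u i<..<v i} \<inter> {u j<..<v j} = {}) \<longrightarrow>
        (\<Sum>i<n. v i - u i) < \<delta> \<longrightarrow> (\<Sum>i<n. dist (f (u i)) (f (v i))) < \<epsilon>"
    unfolding abs_continuous_on_interval_def by blast
  show thesis by (rule that[OF \<open>\<delta> > 0\<close>]) (use * in blast)
qed

lemma abs_continuous_on_interval_subset:
  assumes "abs_continuous_on_interval a b f" "a \<le> c" "d \<le> b"
  shows "abs_continuous_on_interval c d f"
  unfolding abs_continuous_on_interval_def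
proof (intro allI impI)
  fix \<epsilon> :: real assume "\<epsilon> > 0"
  obtain \<delta> where "\<delta> > 0" and \<delta>: "\<And>(n::nat) u v.
        (\<forall>i<n. a \<le> u i \<and> u i \<le> v i \<and> v i \<le> b) \<Longrightarrow>
        (\<forall>i<n. \<forall>j<n. i \<noteq> j \<longrightarrow> {u i<..<v i} \<inter> {u j<..<v j} = {}) \<Longrightarrow>
        (\<Sum>i<n. v i - u i) < \<delta> \<Longrightarrow> (\<Sum>i<n. dist (f (u i)) (f (v i))) < \<epsilon>"
    by (rule abs_continuous_on_intervalE[OF assms(1) \<open>\<epsilon> > 0\<close>]) (rule that)
  show "\<exists>\<delta>>0. \<forall>(n::nat) u v.
        (\<forall>i<n. c \<le> u i \<and> u i \<le> v i \<and> v i \<le> d) \<longrightarrow>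
        (\<forall>i<n. \<forall>j<n. i \<noteq> j \<longrightarrow> {u i<..<v i} \<inter> {u j<..<v j} = {}) \<longrightarrow>
        (\<Sum>i<n. v i - u i) < \<delta> \<longrightarrow> (\<Sum>i<n. dist (f (u i)) (f (v i))) < \<epsilon>"
  proof (intro exI[of _ \<delta>] conjI allI impI)
    fix n :: nat and u v
    assume "\<forall>i<n. c \<le> u i \<and> u i \<le> v i \<and> v i \<le> d"
    then have "\<forall>i<n. a \<le> u i \<and> u i \<le> v i \<and> v i \<le> b" using assms(2,3) by force
    then show "(\<Sum>i<n. dist (f (u i)) (f (v i))) < \<epsilon>"
      if "\<forall>i<n. \<forall>j<n. i \<noteq> j \<longrightarrow> {u i<..<v i} \<inter> {u j<..<v j} = {}" "(\<Sum>i<n. v i - u i) < \<delta>"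
      using that by (rule \<delta>)
  qed fact
qed

text \<open>Lipschitz images are the case \<open>f\<close> = \<open>g\<close>; products of
  absolutely continuous functions need both dominating terms.\<close>

lemma abs_continuous_on_interval_dominated2:
  assumes f: "abs_continuous_on_interval a b f" and g: "abs_continuous_on_interval a b g"
    and "C > 0"
    and le: "\<And>u v. u \<in> {a..b} \<Longrightarrow> v \<in> {a..b} \<Longrightarrow> dist (h u) (h v) \<le> C * (dist (f u) (f v) + dist (g u) (g v))"
  shows "abs_continuous_on_interval a b h"
  unfolding abs_continuous_on_interval_def
proof (intro allI impI)
  fix \<epsilon> :: real assume "\<epsilon> > 0"
  then have e: "\<epsilon> / (2 * C) > 0" using \<open>C > 0\<close> by simp
  obtain \<delta>1 where "\<delta>1 > 0" and \<delta>1: "\<And>(n::nat) u v.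
        (\<forall>i<n. a \<le> u i \<and> u i \<le> v i \<and> v i \<le> b) \<Longrightarrow>
        (\<forall>i<n. \<forall>j<n. i \<noteq> j \<longrightarrow> {u i<..<v i} \<inter> {u j<..<v j} = {}) \<Longrightarrow>
        (\<Sum>i<n. v i - u i) < \<delta>1 \<Longrightarrow> (\<Sum>i<n. dist (f (u i)) (f (v i))) < \<epsilon> / (2 * C)"
    by (rule abs_continuous_on_intervalE[OF f e]) (rule that)
  obtain \<delta>2 where "\<delta>2 > 0" and \<delta>2: "\<And>(n::nat) u v.
        (\<forall>i<n. a \<le> u i \<and> u i \<le> v i \<and> v i \<le> b) \<Longrightarrow>
        (\<forall>i<n. \<forall>j<n. i \<noteq> j \<longrightarrow> {u i<..<v i} \<inter> {u j<..<v j} = {}) \<Longrightarrow>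
        (\<Sum>i<n. v i - u i) < \<delta>2 \<Longrightarrow> (\<Sum>i<n. dist (g (u i)) (g (v i))) < \<epsilon> / (2 * C)"
    by (rule abs_continuous_on_intervalE[OF g e]) (rule that)
  have "(\<Sum>i<n. dist (h (u i)) (h (v i))) < \<epsilon>"
    if 1: "\<forall>i<n. a \<le> u i \<and> u i \<le> v i \<and> v i \<le> b"
      and 2: "\<forall>i<n. \<forall>j<n. i \<noteq> j \<longrightarrow> {u i<..<v i} \<inter> {u j<..<v j} = {}"
      and 3: "(\<Sum>i<n. v i - u i) < min \<delta>1 \<delta>2" for n :: nat and u v
  proof -
    have "(\<Sum>i<n. dist (h (u i)) (h (v i))) \<le>
        (\<Sum>i<n. C * (dist (f (u i)) (f (v i)) + dist (g (u i)) (g (v i))))"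
      using 1 by (intro sum_mono le) force+
    also have "\<dots> = C * ((\<Sum>i<n. dist (f (u i)) (f (v i))) + (\<Sum>i<n. dist (g (u i)) (g (v i))))"
      by (subst sum.distrib[symmetric]) (simp add: sum_distrib_left)
    also have "\<dots> < C * (\<epsilon> / (2 * C) + \<epsilon> / (2 * C))"
      using \<delta>1[OF 1 2] \<delta>2[OF 1 2] 3 \<open>C > 0\<close> by (intro mult_strict_left_mono add_strict_mono) auto
    finally show ?thesis using \<open>C > 0\<close> by simp
  qed
  then show "\<exists>\<delta>>0. \<forall>(n::nat) u v.
        (\<forall>i<n. a \<le> u i \<and> u i \<le> v i \<and> v i \<le> b) \<longrightarrow>
        (\<forall>i<n. \<forall>j<n. i \<noteq> j \<longrightarrow> {u i<..<v i} \<inter> {u j<..<v j} = {}) \<longrightarrow>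
        (\<Sum>i<n. v i - u i) < \<delta> \<longrightarrow> (\<Sum>i<n. dist (h (u i)) (h (v i))) < \<epsilon>"
    using \<open>\<delta>1 > 0\<close> \<open>\<delta>2 > 0\<close> by (intro exI[of _ "min \<delta>1 \<delta>2"]) auto
qed

lemma abs_continuous_on_interval_imp_continuous_on:
  assumes "abs_continuous_on_interval a b f"
  shows "continuous_on {a..b} f"
  unfolding continuous_on_iff
proof (intro ballI allI impI)
  fix x \<epsilon> :: real assume x: "x \<in> {a..b}" and "\<epsilon> > 0"
  obtain \<delta> where "\<delta> > 0" and \<delta>: "\<And>(n::nat) u v.
        (\<forall>i<n. a \<le> u i \<and> u i \<le> v i \<and> v i \<le> b) \<Longrightarrow>
        (\<forall>i<n. \<forall>j<n. i \<noteq> j \<longrightarrow> {u i<..<v i} \<inter> {u j<..<v j} = {}) \<Longrightarrow>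
        (\<Sum>i<n. v i - u i) < \<delta> \<Longrightarrow> (\<Sum>i<n. dist (f (u i)) (f (v i))) < \<epsilon>"
    by (rule abs_continuous_on_intervalE[OF assms \<open>\<epsilon> > 0\<close>]) (rule that)
  have "dist (f y) (f x) < \<epsilon>" if "y \<in> {a..b}" "dist y x < \<delta>" for y
    using \<delta>[of 1 "\<lambda>_. min x y" "\<lambda>_. max x y"] that x
    by (cases "x \<le> y") (auto simp: dist_real_def dist_commute)
  then show "\<exists>d>0. \<forall>x'\<in>{a..b}. dist x' x < d \<longrightarrow> dist (f x') (f x) < \<epsilon>"
    using \<open>\<delta> > 0\<close> by blast
qed

text \<open>Tags outside \<open>N\<close> contribute at most \<open>e'\<close> times the length, by
  differentiability. Tags in \<open>N\<close> are confined by the gauge to an open set of measure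
  below \<delta>, so absolute continuity makes the increments of \<open>f\<close> over their
  intervals small in total, while the integrand has been set to 0 at these tags.\<close>

theorem abs_continuous_on_interval_has_integral:
  fixes f :: "real \<Rightarrow> 'a::real_normed_vector"
  assumes ab: "a \<le> b" and ac: "abs_continuous_on_interval a b f"
    and N: "negligible N"
    and der: "\<And>x. x \<in> {a..b} - N \<Longrightarrow> (f has_vector_derivative g x) (at x within {a..b})"
  shows "(g has_integral f b - f a) {a..b}"
proof -
  define g0 where "g0 = (\<lambda>x. if x \<in> N then 0 else g x)"
  have "(g0 has_integral f b - f a) (cbox a b)"
    unfolding has_integral
  proof (intro allI impI)
    fix e :: real assume e: "e > 0"
    define e' where "e' = e / (2 * (b - a + 1))"
    have e': "e' > 0" "e' * (b - a) \<le> e / 2" using e ab by (auto simp: e'_def field_simps)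
    obtain \<delta> where "\<delta> > 0" and \<delta>: "\<And>(n::nat) u v.
        (\<forall>i<n. a \<le> u i \<and> u i \<le> v i \<and> v i \<le> b) \<Longrightarrow>
        (\<forall>i<n. \<forall>j<n. i \<noteq> j \<longrightarrow> {u i<..<v i} \<inter> {u j<..<v j} = {}) \<Longrightarrow>
        (\<Sum>i<n. v i - u i) < \<delta> \<Longrightarrow> (\<Sum>i<n. dist (f (u i)) (f (v i))) < e / 2"
      by (rule abs_continuous_on_intervalE[OF ac half_gt_zero[OF e]]) (rule that)
    obtain U where U: "open U" "N \<subseteq> U" "U \<in> lmeasurable" "measure lebesgue U < \<delta>"
    proof -
      obtain T where T: "open T" "N \<subseteq> T" "T - N \<in> lmeasurable" "emeasure lebesgue (T - N) < ennreal \<delta>"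
        using sets_lebesgue_outer_open[of N \<delta>] N \<open>\<delta> > 0\<close> negligible_imp_sets by metis
      have "T = (T - N) \<union> N" using T by auto
      moreover have "(T - N) \<union> N \<in> lmeasurable"
        using T N by (intro fmeasurable.Un) (auto simp: negligible_imp_measurable)
      moreover have "measure lebesgue ((T - N) \<union> N) = measure lebesgue (T - N)"
        using T N by (intro measure_Un_null_set) (auto simp: negligible_iff_null_sets dest: fmeasurableD)
      moreover have "measure lebesgue (T - N) < \<delta>"
        using T \<open>\<delta> > 0\<close> by (simp add: emeasure_eq_measure2 ennreal_less_iff)
      ultimately show ?thesis using that[of T] T by simp
    qed
    have "\<exists>\<rho>>0. x \<in> {a..b} - N \<longrightarrow> (\<forall>y\<in>{a..b}. \<bar>y - x\<bar> < \<rho> \<longrightarrow>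
        norm (f y - f x - (y - x) *\<^sub>R g x) \<le> e' * \<bar>y - x\<bar>)" (is "\<exists>\<rho>>0. ?P x \<rho>") for x
    proof (cases "x \<in> {a..b} - N")
      case True
      from der[OF this] e'(1) show ?thesis
        unfolding has_vector_derivative_def has_derivative_within_alt by auto
    qed (auto intro: exI[of _ 1])
    then have "\<forall>x. \<exists>\<rho>. \<rho> > 0 \<and> ?P x \<rho>" by blast
    from choice[OF this] obtain \<rho> where \<rho>P: "\<forall>x. \<rho> x > 0 \<and> ?P x (\<rho> x)" ..
    then have \<rho>: "\<And>x. \<rho> x > 0"
      and \<rho>': "\<And>x y. x \<in> {a..b} \<Longrightarrow> x \<notin> N \<Longrightarrow> y \<in> {a..b} \<Longrightarrow> \<bar>y - x\<bar> < \<rho> x \<Longrightarrow>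
        norm (f y - f x - (y - x) *\<^sub>R g x) \<le> e' * \<bar>y - x\<bar>"
      by blast+
    define \<gamma> where "\<gamma> = (\<lambda>x. if x \<in> N then U else ball x (\<rho> x))"
    have ga: "gauge \<gamma>" using U \<rho> by (auto simp: gauge_def \<gamma>_def)
    have main: "norm ((\<Sum>(x,k)\<in>D. measure lborel k *\<^sub>R g0 x) - (f b - f a)) < e"
      if D: "D tagged_division_of cbox a b" and fine: "\<gamma> fine D" for D
    proof -
      note tdD = tagged_division_ofD[OF D]
      have fin: "finite D" by (rule tdD)
      have int: "\<exists>u v. k = {u..v} \<and> u \<le> x \<and> x \<le> v \<and> a \<le> u \<and> v \<le> b \<and> Inf k = u \<and> Sup k = v"
        if xk: "(x, k) \<in> D" for x k
      proof -
        obtain u v where "k = {u..v}" using tdD(4)[OF xk] by auto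
        with tdD(2,3)[OF xk] show ?thesis by (intro exI[of _ u] exI[of _ v]) auto
      qed
      define \<Delta> where "\<Delta> = (\<lambda>k. f (Sup k) - f (Inf k))"
      have tele: "(\<Sum>(x,k)\<in>D. \<Delta> k) = f b - f a"
        unfolding \<Delta>_def using D ab by (intro additive_tagged_division_1) (auto simp: cbox_interval)
      define D1 where "D1 = {(x,k)\<in>D. x \<in> N}"
      have D1: "D1 \<subseteq> D" "finite D1" using fin by (auto simp: D1_def intro: finite_subset)
      have "(\<Sum>(x,k)\<in>D. measure lborel k *\<^sub>R g0 x) - (f b - f a) =
          (\<Sum>(x,k)\<in>D. measure lborel k *\<^sub>R g0 x - \<Delta> k)"
        unfolding tele[symmetric] by (simp add: sum_subtractf case_prod_unfold)
      also have "\<dots> = (\<Sum>(x,k)\<in>D - D1. measure lborel k *\<^sub>R g0 x - \<Delta> k) +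
          (\<Sum>(x,k)\<in>D1. measure lborel k *\<^sub>R g0 x - \<Delta> k)"
        using D1 fin by (intro sum.subset_diff)
      finally have "norm ((\<Sum>(x,k)\<in>D. measure lborel k *\<^sub>R g0 x) - (f b - f a)) \<le>
          norm (\<Sum>(x,k)\<in>D - D1. measure lborel k *\<^sub>R g0 x - \<Delta> k) +
          norm (\<Sum>(x,k)\<in>D1. measure lborel k *\<^sub>R g0 x - \<Delta> k)"
        by (simp add: norm_triangle_ineq)
      moreover have "norm (\<Sum>(x,k)\<in>D - D1. measure lborel k *\<^sub>R g0 x - \<Delta> k) \<le> e / 2"
      proof -
        have "norm (\<Sum>(x,k)\<in>D - D1. measure lborel k *\<^sub>R g0 x - \<Delta> k) \<le> (\<Sum>(x,k)\<in>D - D1. e' * measure lborel k)"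
        proof (rule sum_norm_le, clarify)
          fix x k assume xk: "(x, k) \<in> D" "(x, k) \<notin> D1"
          then have xN: "x \<notin> N" by (auto simp: D1_def)
          obtain u v where uv: "k = {u..v}" "u \<le> x" "x \<le> v" "a \<le> u" "v \<le> b" "Inf k = u" "Sup k = v"
            using int[OF xk(1)] by blast
          have "k \<subseteq> ball x (\<rho> x)" using fine xk(1) xN unfolding fine_def \<gamma>_def by fastforce
          then have near: "\<bar>u - x\<bar> < \<rho> x" "\<bar>v - x\<bar> < \<rho> x" proof -
            have "u \<in> k" "v \<in> k" using uv by auto
            then have "u \<in> ball x (\<rho> x)" "v \<in> ball x (\<rho> x)" using \<open>k \<subseteq> ball x (\<rho> x)\<close> by blast+
            then show "\<bar>u - x\<bar> < \<rho> x" "\<bar>v - x\<bar> < \<rho> x" by (auto simp: dist_real_def abs_minus_commute)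
          qed
          have "norm ((v - u) *\<^sub>R g x - (f v - f u)) =
              norm ((f u - f x - (u - x) *\<^sub>R g x) - (f v - f x - (v - x) *\<^sub>R g x))"
            by (simp add: algebra_simps)
          also have "\<dots> \<le> e' * \<bar>u - x\<bar> + e' * \<bar>v - x\<bar>"
            using \<rho>'[of x u] \<rho>'[of x v] xN near uv
            by (intro order_trans[OF norm_triangle_ineq4 add_mono]) auto
          also have "\<dots> = e' * (v - u)" using uv by (simp add: algebra_simps)
          finally show "norm (measure lborel k *\<^sub>R g0 x - \<Delta> k) \<le> e' * measure lborel k"
            using uv xN by (simp add: \<Delta>_def g0_def)
        qed
        also have "\<dots> \<le> (\<Sum>(x,k)\<in>D. e' * measure lborel k)"
          using fin e'(1) by (intro sum_mono2) auto
        also have "\<dots> = e' * (\<Sum>(x,k)\<in>D. measure lborel k)"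
          by (simp add: sum_distrib_left case_prod_unfold)
        also have "\<dots> = e' * (b - a)"
          using additive_content_tagged_division[OF D] ab by simp
        finally show ?thesis using e'(2) by simp
      qed
      moreover have "norm (\<Sum>(x,k)\<in>D1. measure lborel k *\<^sub>R g0 x - \<Delta> k) < e / 2"
      proof -
        obtain h n where h: "bij_betw h {..<n::nat} D1"
          using D1(2) ex_bij_betw_nat_finite[of D1] by (auto simp: atLeast0LessThan)
        define u where "u = (\<lambda>i. Inf (snd (h i)))"
        define v where "v = (\<lambda>i. Sup (snd (h i)))"
        have hD: "(fst (h i), snd (h i)) \<in> D" "fst (h i) \<in> N" if "i < n" for i
        proof -
          have "h i \<in> D1" using h that by (auto dest: bij_betwE)
          then show "(fst (h i), snd (h i)) \<in> D" "fst (h i) \<in> N" by (auto simp: D1_def)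
        qed
        have k: "snd (h i) = {u i..v i} \<and> a \<le> u i \<and> u i \<le> v i \<and> v i \<le> b" if "i < n" for i
          using int[OF hD(1)[OF that]] by (auto simp: u_def v_def)
        have disj: "{u i<..<v i} \<inter> {u j<..<v j} = {}" if "i < n" "j < n" "i \<noteq> j" for i j
        proof -
          have "h i \<noteq> h j" using h that by (auto simp: bij_betw_def inj_on_def)
          then have "interior (snd (h i)) \<inter> interior (snd (h j)) = {}"
            using tdD(5)[OF hD(1)[OF that(1)] hD(1)[OF that(2)]] by (simp add: prod_eq_iff)
          then show ?thesis using k that by simp
        qed
        have "{u i<..<v i} \<subseteq> U" if "i < n" for i
        proof -
          have "snd (h i) \<subseteq> U" using fine hD[OF that] unfolding fine_def \<gamma>_def by fastforce
          then show ?thesis using k[OF that] by auto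
        qed
        then have "(\<Sum>i<n. v i - u i) \<le> measure lebesgue U"
          using k disj U by (intro sum_length_disjoint_intervals_le) auto
        then have lt: "(\<Sum>i<n. dist (f (u i)) (f (v i))) < e / 2"
          using \<delta>[of n u v] k disj U by auto
        have "norm (\<Sum>(x,k)\<in>D1. measure lborel k *\<^sub>R g0 x - \<Delta> k) = norm (\<Sum>(x,k)\<in>D1. \<Delta> k)"
        proof -
          have "(\<Sum>(x,k)\<in>D1. measure lborel k *\<^sub>R g0 x - \<Delta> k) = (\<Sum>(x,k)\<in>D1. - \<Delta> k)"
            by (intro sum.cong) (auto simp: D1_def g0_def)
          then show ?thesis by (simp add: sum_negf case_prod_unfold)
        qed
        also have "\<dots> \<le> (\<Sum>(x,k)\<in>D1. norm (\<Delta> k))" by (intro sum_norm_le) auto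
        also have "\<dots> = (\<Sum>i<n. norm (\<Delta> (snd (h i))))"
          using sum.reindex_bij_betw[OF h, of "\<lambda>(x,k). norm (\<Delta> k)"] by (simp add: case_prod_unfold)
        also have "\<dots> = (\<Sum>i<n. dist (f (u i)) (f (v i)))"
          by (simp add: \<Delta>_def u_def v_def dist_norm norm_minus_commute)
        finally show ?thesis using lt by simp
      qed
      ultimately show ?thesis by linarith
    qed
    show "\<exists>\<gamma>. gauge \<gamma> \<and> (\<forall>\<D>. \<D> tagged_division_of cbox a b \<and> \<gamma> fine \<D> \<longrightarrow>
        norm ((\<Sum>(x,k)\<in>\<D>. measure lborel k *\<^sub>R g0 x) - (f b - f a)) < e)"
      by (intro exI[of _ \<gamma>] conjI allI impI ga; elim conjE; rule main; assumption)
  qed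
  then show ?thesis
    by (intro has_integral_spike[OF N, of "{a..b}" g g0 "f b - f a"]) (auto simp: g0_def)
qed


lemma abs_continuous_on_interval_has_integral_AE:
  fixes f :: "real \<Rightarrow> 'a::real_normed_vector"
  assumes "a \<le> b" "abs_continuous_on_interval a b f"
    and "AE x in lebesgue. x \<in> {a..b} \<longrightarrow> (f has_vector_derivative g x) (at x within {a..b})"
  shows "(g has_integral f b - f a) {a..b}"
proof -
  obtain N where "N \<in> null_sets lebesgue"
    "{x. \<not> (x \<in> {a..b} \<longrightarrow> (f has_vector_derivative g x) (at x within {a..b}))} \<subseteq> N"
    using assms(3) by (auto simp: eventually_ae_filter)
  then show ?thesis
    using assms(1,2)
    by (intro abs_continuous_on_interval_has_integral[of a b f N]) (auto simp: negligible_iff_null_sets)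
qed

lemma integrable_on_excess:
  fixes f :: "real \<Rightarrow> 'a::euclidean_space"
  assumes "f absolutely_integrable_on {a..b}" and that: "c \<ge> 0"
  shows "(\<lambda>x. max 0 (norm (f x) - c)) integrable_on {a..b}"
proof (rule measurable_bounded_by_integrable_imp_integrable)
  have "f \<in> borel_measurable (lebesgue_on {a..b})"
    using assms by (intro absolutely_integrable_imp_borel_measurable) auto
  then show "(\<lambda>x. max 0 (norm (f x) - c)) \<in> borel_measurable (lebesgue_on {a..b})" by measurable
  show "(\<lambda>x. norm (f x)) integrable_on {a..b}"
    using assms by (simp add: absolutely_integrable_on_def)
qed (use that in auto)

text \<open>The excess \<open>h k\<close> of the norm of \<open>f\<close> over the level
  \<open>k\<close> has an integral that tends to 0, by dominated convergence. What lies below the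
  level contributes at most \<open>k\<close> times the total length of the intervals.\<close>

theorem abs_continuous_on_interval_integral:
  fixes f :: "real \<Rightarrow> 'a::euclidean_space"
  assumes f: "f absolutely_integrable_on {a..b}"
  shows "abs_continuous_on_interval a b (\<lambda>t. integral {a..t} f)"
  unfolding abs_continuous_on_interval_def
proof (intro allI impI)
  fix \<epsilon> :: real assume "\<epsilon> > 0"
  define h where "h = (\<lambda>(k::nat) x. max 0 (norm (f x) - real k))"
  have nf: "(\<lambda>x. norm (f x)) integrable_on {a..b}" and fi: "f integrable_on {a..b}"
    using f by (auto simp: absolutely_integrable_on_def)
  have hi: "h k integrable_on {a..b}" for k
    unfolding h_def by (rule integrable_on_excess[OF f]) simp
  have "(\<lambda>k. integral {a..b} (h k)) \<longlonglongrightarrow> integral {a..b} (\<lambda>_. 0)"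
  proof (rule dominated_convergence(2)[OF hi nf])
    show "(\<lambda>k. h k x) \<longlonglongrightarrow> 0" for x
    proof (rule tendsto_eventually, rule eventually_sequentiallyI)
      fix k assume "k \<ge> nat \<lceil>norm (f x)\<rceil>"
      then show "h k x = 0" by (simp add: h_def)
    qed
  qed (auto simp: h_def)
  then have "\<forall>\<^sub>F k in sequentially. integral {a..b} (h k) < \<epsilon> / 2"
    using \<open>\<epsilon> > 0\<close> by (intro order_tendstoD(2)[of _ 0]) auto
  then obtain k where k: "integral {a..b} (h k) < \<epsilon> / 2"
    by (auto dest: eventually_happens)
  show "\<exists>\<delta>>0. \<forall>(n::nat) u v.
        (\<forall>i<n. a \<le> u i \<and> u i \<le> v i \<and> v i \<le> b) \<longrightarrow>
        (\<forall>i<n. \<forall>j<n. i \<noteq> j \<longrightarrow> {u i<..<v i} \<inter> {u j<..<v j} = {}) \<longrightarrow>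
        (\<Sum>i<n. v i - u i) < \<delta> \<longrightarrow>
        (\<Sum>i<n. dist (integral {a..u i} f) (integral {a..v i} f)) < \<epsilon>"
  proof (intro exI[of _ "\<epsilon> / (2 * (real k + 1))"] conjI allI impI)
    show "\<epsilon> / (2 * (real k + 1)) > 0" using \<open>\<epsilon> > 0\<close> by simp
    fix n :: nat and u v
    assume uv: "\<forall>i<n. a \<le> u i \<and> u i \<le> v i \<and> v i \<le> b"
      and disj: "\<forall>i<n. \<forall>j<n. i \<noteq> j \<longrightarrow> {u i<..<v i} \<inter> {u j<..<v j} = {}"
      and len: "(\<Sum>i<n. v i - u i) < \<epsilon> / (2 * (real k + 1))"
    have 1: "dist (integral {a..u i} f) (integral {a..v i} f) \<le> integral {u i..v i} (h k) + real k * (v i - u i)"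
      if "i < n" for i
    proof -
      have i: "a \<le> u i" "u i \<le> v i" "v i \<le> b" using uv that by auto
      have sub: "g integrable_on {u i..v i}" if "g integrable_on {a..b}" for g :: "real \<Rightarrow> 'b::banach"
        using that by (rule integrable_on_subinterval) (use i in auto)
      have "integral {a..u i} f + integral {u i..v i} f = integral {a..v i} f"
        using i by (intro Henstock_Kurzweil_Integration.integral_combine integrable_on_subinterval[OF fi]) auto
      then have "dist (integral {a..u i} f) (integral {a..v i} f) = norm (integral {u i..v i} f)"
        by (metis add_diff_cancel_left' dist_commute dist_norm)
      also have "\<dots> \<le> integral {u i..v i} (\<lambda>x. h k x + real k)"
        using sub[OF fi] sub[OF hi]
        by (intro Henstock_Kurzweil_Integration.integral_norm_bound_integral
            Henstock_Kurzweil_Integration.integrable_add) (auto simp: h_def)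
      also have "\<dots> = integral {u i..v i} (h k) + real k * (v i - u i)"
        using sub[OF hi] i by (subst Henstock_Kurzweil_Integration.integral_add) auto
      finally show ?thesis .
    qed
    have "((\<lambda>x. \<Sum>i<n. if x \<in> box (u i) (v i) then h k x else 0) has_integral
        (\<Sum>i<n. integral {u i..v i} (h k))) (cbox a b)"
    proof (intro has_integral_sum finite_lessThan has_integral_restrict_open_subinterval)
      fix i assume "i \<in> {..<n}"
      then have i: "a \<le> u i" "u i \<le> v i" "v i \<le> b" using uv by auto
      show "(h k has_integral integral {u i..v i} (h k)) (cbox (u i) (v i))"
        using hi[of k] i by (auto intro!: integrable_integral intro: integrable_on_subinterval)
      show "cbox (u i) (v i) \<subseteq> cbox a b" using i by auto
    qed
    moreover have "(h k has_integral integral {a..b} (h k)) (cbox a b)"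
      using hi[of k] by auto
    moreover have "(\<Sum>i<n. if x \<in> box (u i) (v i) then h k x else 0) \<le> h k x" for x
    proof (cases "\<exists>i<n. x \<in> box (u i) (v i)")
      case True
      then obtain i where i: "i < n" "x \<in> {u i<..<v i}" by auto
      have "(\<Sum>j<n. if x \<in> box (u j) (v j) then h k x else 0) = (\<Sum>j\<in>{i}. h k x)"
      proof (intro sum.mono_neutral_cong_right ballI)
        fix j assume j: "j \<in> {..<n} - {i}"
        then have "{u i<..<v i} \<inter> {u j<..<v j} = {}" using i disj by blast
        then have "x \<notin> box (u j) (v j)" using i(2) unfolding box_real by blast
        then show "(if x \<in> box (u j) (v j) then h k x else 0) = 0" by auto
      qed (use i in auto)
      then show ?thesis by simp
    next
      case False
      then have "(\<Sum>i<n. if x \<in> box (u i) (v i) then h k x else 0) = 0" by (intro sum.neutral) auto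
      then show ?thesis by (simp add: h_def)
    qed
    ultimately have 2: "(\<Sum>i<n. integral {u i..v i} (h k)) \<le> integral {a..b} (h k)"
      by (rule has_integral_le)
    have "(\<Sum>i<n. dist (integral {a..u i} f) (integral {a..v i} f)) \<le>
        (\<Sum>i<n. integral {u i..v i} (h k) + real k * (v i - u i))"
      using 1 by (intro sum_mono) auto
    also have "\<dots> = (\<Sum>i<n. integral {u i..v i} (h k)) + real k * (\<Sum>i<n. v i - u i)"
      by (simp only: sum.distrib sum_distrib_left)
    also have "\<dots> \<le> integral {a..b} (h k) + real k * (\<epsilon> / (2 * (real k + 1)))"
      using 2 len by (intro add_mono mult_left_mono) auto
    also have "\<dots> < \<epsilon> / 2 + \<epsilon> / 2"
    proof (intro add_less_le_mono k)
      have "real k * (\<epsilon> / (2 * (real k + 1))) = (\<epsilon> / 2) * (real k / (real k + 1))" by simp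
      also have "\<dots> \<le> (\<epsilon> / 2) * 1" using \<open>\<epsilon> > 0\<close> by (intro mult_left_mono) auto
      finally show "real k * (\<epsilon> / (2 * (real k + 1))) \<le> \<epsilon> / 2" by simp
    qed
    finally show "(\<Sum>i<n. dist (integral {a..u i} f) (integral {a..v i} f)) < \<epsilon>" by simp
  qed
qed

lemma indefinite_integral_AC:
  fixes y g :: "real \<Rightarrow> 'a::euclidean_space"
  assumes g: "g absolutely_integrable_on {a..b}"
    and y: "\<And>t. t \<in> {a..b} \<Longrightarrow> y t = c + integral {a..t} g"
  shows "abs_continuous_on_interval a b y"
    and "AE t in lebesgue. t \<in> {a..b} \<longrightarrow> (y has_vector_derivative g t) (at t within {a..b})"
proof -
  show "abs_continuous_on_interval a b y"
    by (rule abs_continuous_on_interval_dominated2[OF abs_continuous_on_interval_integral[OF g]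
          abs_continuous_on_interval_integral[OF g] zero_less_one]) (simp add: y)
  have "AE t in lebesgue. t \<in> {a..b} \<longrightarrow>
      ((\<lambda>t. integral {a..t} g) has_vector_derivative g t) (at t within {a..b})"
    using g by (intro AE_has_vector_derivative_integral) (simp add: absolutely_integrable_on_def)
  then show "AE t in lebesgue. t \<in> {a..b} \<longrightarrow> (y has_vector_derivative g t) (at t within {a..b})"
  proof eventually_elim
    case (elim t)
    show ?case
    proof
      assume t: "t \<in> {a..b}"
      with elim have "((\<lambda>t. c + integral {a..t} g) has_vector_derivative 0 + g t) (at t within {a..b})"
        by (intro has_vector_derivative_add) auto
      then show "(y has_vector_derivative g t) (at t within {a..b})"
        using y t by (auto intro: has_vector_derivative_transform)
    qed
  qed
qed

lemma norm_exp_diff_le: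
  fixes z w :: complex
  assumes "norm z \<le> M" "norm w \<le> M"
  shows "norm (exp z - exp w) \<le> exp M * norm (z - w)"
proof (rule field_differentiable_bound[of "cball 0 M" exp exp])
  show "(exp has_field_derivative exp u) (at u within cball 0 M)" for u :: complex
    by (rule DERIV_subset[OF DERIV_exp]) auto
  show "norm (exp u) \<le> exp M" if "u \<in> cball 0 M" for u :: complex
    using that norm_exp[of u] by (auto intro: order_trans)
qed (use assms in auto)

lemma continuous_on_Icc_norm_bound:
  fixes y :: "real \<Rightarrow> 'a::real_normed_vector"
  assumes "continuous_on {s..T} y"
  shows "\<exists>Y>0. \<forall>t\<in>{s..T}. norm (y t) \<le> Y"
  using compact_imp_bounded[OF compact_continuous_image[OF assms]] by (auto simp: bounded_pos)

text \<open>The function y exp(- A) is absolutely continuous and has derivative 0 almost everywhere,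
  hence is constant. The integrand \<open>g\<close> is kept apart from \<open>a t * y t\<close>
  because the two agree only almost everywhere.\<close>

theorem linear_ode_exp:
  fixes y a g :: "real \<Rightarrow> complex"
  assumes a: "a absolutely_integrable_on {s..T}" and g: "g absolutely_integrable_on {s..T}"
    and y: "\<And>t. t \<in> {s..T} \<Longrightarrow> y t = y s + integral {s..t} g"
    and ga: "AE t in lebesgue. t \<in> {s..T} \<longrightarrow> g t = a t * y t"
    and t: "t \<in> {s..T}"
  shows "y t = y s * exp (integral {s..t} a)"
proof -
  define A where "A = (\<lambda>t. integral {s..t} a)"
  define z where "z = (\<lambda>t. y t * exp (- A t))"
  have yAC: "abs_continuous_on_interval s T y"
      "AE t in lebesgue. t \<in> {s..T} \<longrightarrow> (y has_vector_derivative g t) (at t within {s..T})"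
    by (rule indefinite_integral_AC[OF g], erule y)+
  note AAC = indefinite_integral_AC[OF a, of A 0, unfolded A_def, simplified, folded A_def]
  obtain Y where Y: "\<And>t. t \<in> {s..T} \<Longrightarrow> norm (y t) \<le> Y" "Y > 0"
    using continuous_on_Icc_norm_bound[OF abs_continuous_on_interval_imp_continuous_on[OF yAC(1)]] by blast
  obtain M where M: "\<And>t. t \<in> {s..T} \<Longrightarrow> norm (A t) \<le> M" "M > 0"
    using continuous_on_Icc_norm_bound[OF abs_continuous_on_interval_imp_continuous_on[OF AAC(1)]] by blast
  have dz: "dist (z u) (z v) \<le> exp M * (1 + Y) * (dist (y u) (y v) + dist (A u) (A v))"
    if uv: "u \<in> {s..T}" "v \<in> {s..T}" for u v
  proof -
    have "z u - z v = (y u - y v) * exp (- A u) + y v * (exp (- A u) - exp (- A v))"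
      by (simp add: z_def algebra_simps)
    then have "norm (z u - z v) \<le> norm (y u - y v) * norm (exp (- A u)) + norm (y v) * norm (exp (- A u) - exp (- A v))"
      by (metis norm_mult norm_triangle_ineq)
    also have "\<dots> \<le> norm (y u - y v) * exp M + Y * (exp M * norm (A u - A v))"
    proof (intro add_mono mult_mono Y uv)
      show "norm (exp (- A u)) \<le> exp M" using norm_exp[of "- A u"] M(1)[OF uv(1)] by (auto intro: order_trans)
      show "norm (exp (- A u) - exp (- A v)) \<le> exp M * norm (A u - A v)"
        using norm_exp_diff_le[of "- A u" M "- A v"] M(1) uv by (simp add: norm_minus_commute)
    qed (use Y in auto)
    also have "\<dots> \<le> exp M * (1 + Y) * (norm (y u - y v) + norm (A u - A v))"
      using Y(2) by (simp add: algebra_simps)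
    finally show ?thesis by (simp add: dist_norm)
  qed
  have zAC: "abs_continuous_on_interval s T z"
    using Y(2) by (intro abs_continuous_on_interval_dominated2[OF yAC(1) AAC(1) _ dz]) auto
  have "AE x in lebesgue. x \<in> {s..t} \<longrightarrow> (z has_vector_derivative 0) (at x within {s..t})"
    using yAC(2) AAC(2) ga
  proof eventually_elim
    case (elim x)
    show ?case
    proof
      assume x: "x \<in> {s..t}"
      then have x': "x \<in> {s..T}" using t by auto
      have "((\<lambda>t. - A t) has_vector_derivative - a x) (at x within {s..T})"
        using elim(2) x' by (intro has_vector_derivative_minus) auto
      then have "((exp \<circ> (\<lambda>t. - A t)) has_vector_derivative - a x * exp (- A x)) (at x within {s..T})"
        by (intro field_vector_diff_chain_within) (auto intro: DERIV_subset[OF DERIV_exp])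
      with elim(1) x' have "(z has_vector_derivative y x * (- a x * exp (- A x)) + g x * exp (- A x)) (at x within {s..T})"
        unfolding z_def o_def by (intro has_vector_derivative_mult) auto
      moreover have "y x * (- a x * exp (- A x)) + g x * exp (- A x) = 0"
        using elim(3) x' by simp
      ultimately show "(z has_vector_derivative 0) (at x within {s..t})"
        using t by (auto intro: has_vector_derivative_within_subset)
    qed
  qed
  then have "((\<lambda>_. 0) has_integral z t - z s) {s..t}"
    using t by (intro abs_continuous_on_interval_has_integral_AE abs_continuous_on_interval_subset[OF zAC]) auto
  then have "z t = z s" by (simp add: has_integral_is_0 has_integral_0_eq)
  then have "y t * exp (- A t) = y s" by (simp add: z_def A_def)
  then have "y t = y s * exp (A t)" by (metis exp_minus_inverse mult.assoc mult.commute mult.right_neutral)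
  then show ?thesis by (simp add: A_def)
qed

section \<open>Laurent series and measures on the unit circle\<close>

abbreviation cis2pi :: "real \<Rightarrow> complex" where
  "cis2pi x \<equiv> exp (2 * of_real pi * \<i> * of_real x)"

lemma norm_cis2pi [simp]: "norm (cis2pi x) = 1"
  by (simp add: norm_exp_eq_Re)

lemma cis2pi_powi: "cis2pi x powi n = exp (2 * of_real pi * \<i> * of_real (of_int n * x))"
  by (simp add: exp_power_int mult_ac)

lemma continuous_on_cis2pi [continuous_intros]: "continuous_on S cis2pi"
  by (intro continuous_intros)

lemma integral_cis2pi_powi: "integral {0..1} (\<lambda>x. cis2pi x powi n) = (if n = 0 then 1 else 0)"
proof (cases "n = 0")
  case False
  define c where "c = 2 * of_real pi * \<i> * of_int n"
  have c: "c \<noteq> 0" using False by (simp add: c_def)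
  have "((\<lambda>x. exp (c * of_real x)) has_integral exp (c * of_real 1) / c - exp (c * of_real 0) / c) {0..1}"
  proof (rule fundamental_theorem_of_calculus)
    fix x :: real
    have "((\<lambda>z. exp (c * z) / c) has_field_derivative exp (c * of_real x)) (at (of_real x))"
      using c by (auto intro!: derivative_eq_intros)
    then show "((\<lambda>x. exp (c * of_real x) / c) has_vector_derivative exp (c * of_real x)) (at x within {0..1})"
      by (rule has_vector_derivative_real_field[where s = "{0..1}"])
  qed simp
  moreover have "exp c = 1"
    unfolding c_def exp_eq_1 by (auto intro!: exI[of _ n])
  ultimately have "((\<lambda>x. exp (c * of_real x)) has_integral 0) {0..1}" by simp
  then have "integral {0..1} (\<lambda>x. exp (c * of_real x)) = 0" by (rule integral_unique)
  moreover have "(\<lambda>x. cis2pi x powi n) = (\<lambda>x. exp (c * of_real x))"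
    unfolding cis2pi_powi c_def by (simp add: mult_ac)
  ultimately show ?thesis using False by simp
qed simp

text \<open>The contour integral of f(w) w^(-n-1) divided by 2 pi i, written over the parameter
  interval: limits and measurability in time then concern integrals over [0, 1].\<close>

definition laurent_coeff :: "(complex \<Rightarrow> complex) \<Rightarrow> real \<Rightarrow> int \<Rightarrow> complex" where
  "laurent_coeff f \<rho> n = integral {0..1} (\<lambda>x. f (of_real \<rho> * cis2pi x) * (of_real \<rho> * cis2pi x) powi (-n))"

lemma open_annulus [simp]: "open (annulus r)"
proof -
  have "annulus r = ball 0 1 - cball 0 r" by (auto simp: annulus_def)
  then show ?thesis by (simp add: open_Diff)
qed

lemma circle_in_annulus: "0 \<le> r \<Longrightarrow> r < \<rho> \<Longrightarrow> \<rho> < 1 \<Longrightarrow> of_real \<rho> * cis2pi x \<in> annulus r"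
  by (simp add: annulus_def norm_mult)

lemma annulus_nonzero: "0 \<le> r \<Longrightarrow> z \<in> annulus r \<Longrightarrow> z \<noteq> 0"
  by (auto simp: annulus_def)

lemma laurent_coeff_contour:
  assumes "\<rho> > 0"
  shows "contour_integral (circlepath 0 \<rho>) (\<lambda>w. f w * w powi (-n - 1)) = 2 * of_real pi * \<i> * laurent_coeff f \<rho> n"
proof -
  have "contour_integral (circlepath 0 \<rho>) (\<lambda>w. f w * w powi (-n - 1)) =
     integral {0..1} (\<lambda>x. 2 * of_real pi * \<i> * (f (of_real \<rho> * cis2pi x) * (of_real \<rho> * cis2pi x) powi (-n)))"
    unfolding contour_integral_integral
  proof (intro Henstock_Kurzweil_Integration.integral_cong)
    fix x :: real assume x: "x \<in> {0..1}"
    define W where "W = of_real \<rho> * cis2pi x"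
    have nz: "W \<noteq> 0" using assms by (simp add: W_def)
    have "circlepath 0 \<rho> x = W" by (simp add: circlepath_def part_circlepath_def linepath_def W_def)
         (simp add: exp_eq_polar mult_ac)
    moreover have "vector_derivative (circlepath 0 \<rho>) (at x) = 2 * of_real pi * \<i> * W"
      by (subst vector_derivative_circlepath) (simp add: W_def mult_ac)
    ultimately have "f (circlepath 0 \<rho> x) * circlepath 0 \<rho> x powi (-n - 1) * vector_derivative (circlepath 0 \<rho>) (at x) =
      f W * W powi (-n - 1) * (2 * of_real pi * \<i> * W)" by simp
    also have "\<dots> = 2 * of_real pi * \<i> * (f W * (W powi (-n - 1) * W))" by (simp only: mult_ac)
    also have "W powi (-n - 1) * W = W powi (-n)"
      using power_int_add_1[OF disjI1[OF nz], of "-n - 1"] by simp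
    finally show "f (circlepath 0 \<rho> x) * circlepath 0 \<rho> x powi (-n - 1) * vector_derivative (circlepath 0 \<rho>) (at x) =
      2 * of_real pi * \<i> * (f (of_real \<rho> * cis2pi x) * (of_real \<rho> * cis2pi x) powi (-n))"
      by (simp only: W_def)
  qed
  then show ?thesis by (simp add: laurent_coeff_def)
qed

text \<open>Concentric circles are linearly homotopic inside the annulus. This is what carries
  limits found on one fixed circle to circles close to the boundary.\<close>

lemma laurent_coeff_radius:
  assumes f: "f holomorphic_on annulus r" and r: "0 \<le> r" "r < \<rho>" "\<rho> < 1" "r < \<rho>'" "\<rho>' < 1"
  shows "laurent_coeff f \<rho> n = laurent_coeff f \<rho>' n"
proof -
  have "contour_integral (circlepath 0 \<rho>) (\<lambda>w. f w * w powi (-n - 1)) =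
        contour_integral (circlepath 0 \<rho>') (\<lambda>w. f w * w powi (-n - 1))"
  proof (rule Cauchy_theorem_homotopic_loops[where S = "annulus r"])
    show "homotopic_loops (annulus r) (circlepath 0 \<rho>) (circlepath 0 \<rho>')"
    proof (rule homotopic_loops_linear)
      fix x t :: real
      have cp: "circlepath 0 \<rho> t = of_real \<rho> * cis2pi t" for \<rho> t
        by (simp add: circlepath_def part_circlepath_def linepath_def) (simp add: exp_eq_polar mult_ac)
      show "closed_segment (circlepath 0 \<rho> t) (circlepath 0 \<rho>' t) \<subseteq> annulus r"
      proof
        fix w assume "w \<in> closed_segment (circlepath 0 \<rho> t) (circlepath 0 \<rho>' t)"
        then obtain u where u: "0 \<le> u" "u \<le> 1" "w = (1 - u) *\<^sub>R (of_real \<rho> * cis2pi t) + u *\<^sub>R (of_real \<rho>' * cis2pi t)"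
          by (auto simp: closed_segment_def cp)
        then have "w = of_real ((1 - u) * \<rho> + u * \<rho>') * cis2pi t"
          by (simp add: scaleR_conv_of_real algebra_simps)
        moreover have "(1 - u) * \<rho> + u * \<rho>' \<in> {r<..<1}"
          using convexD_alt[OF convex_real_interval(8), of \<rho> r 1 \<rho>' u] u r by simp
        ultimately show "w \<in> annulus r"
          using circle_in_annulus[OF r(1), of "(1 - u) * \<rho> + u * \<rho>'" t] by (simp only: greaterThanLessThan_iff)
      qed
    qed auto
    show "(\<lambda>w. f w * w powi (-n - 1)) holomorphic_on annulus r"
      using f r(1) by (intro holomorphic_intros) (auto dest: annulus_nonzero)
  qed auto
  then show ?thesis using r by (simp add: laurent_coeff_contour)
qed

lemma continuous_on_circle:
  assumes f: "f holomorphic_on annulus r" and r: "0 \<le> r" "r < \<rho>" "\<rho> < 1"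
  shows "continuous_on S (\<lambda>x. f (of_real \<rho> * cis2pi x))"
  by (rule continuous_on_compose2[OF holomorphic_on_imp_continuous_on[OF f]])
     (use circle_in_annulus[OF r] in \<open>auto intro!: continuous_intros\<close>)

lemma continuous_on_circle_powi:
  assumes "\<rho> > 0"
  shows "continuous_on S (\<lambda>x. (of_real \<rho> * cis2pi x) powi n)"
  using assms by (intro continuous_intros) auto

lemma laurent_coeff_bound:
  assumes f: "f holomorphic_on annulus r" and r: "0 \<le> r" "r < \<rho>" "\<rho> < 1"
  shows "\<exists>C. \<forall>n. norm (laurent_coeff f \<rho> n) \<le> C * \<rho> powi (-n)"
proof -
  obtain C where C: "\<forall>x\<in>{0..1}. norm (f (of_real \<rho> * cis2pi x)) \<le> C"
    using continuous_on_Icc_norm_bound[OF continuous_on_circle[OF assms]] by blast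
  have "norm (laurent_coeff f \<rho> n) \<le> C * \<rho> powi (-n)" for n
  proof -
    have "norm (integral {0..1} (\<lambda>x. f (of_real \<rho> * cis2pi x) * (of_real \<rho> * cis2pi x) powi (-n))) \<le>
      integral {0..1::real} (\<lambda>x. C * \<rho> powi (-n))"
    proof (intro Henstock_Kurzweil_Integration.integral_norm_bound_integral integrable_continuous_interval)
      show "continuous_on {0..1} (\<lambda>x. f (of_real \<rho> * cis2pi x) * (of_real \<rho> * cis2pi x) powi (-n))"
        using r by (intro continuous_on_mult continuous_on_circle[OF f] continuous_on_circle_powi) auto
      show "norm (f (of_real \<rho> * cis2pi x) * (of_real \<rho> * cis2pi x) powi (-n)) \<le> C * \<rho> powi (-n)"
        if "x \<in> {0..1}" for x
        using C that r by (auto simp: norm_mult norm_power_int intro!: mult_right_mono)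
    qed auto
    then show ?thesis by (simp add: laurent_coeff_def)
  qed
  then show ?thesis by blast
qed

lemma sum_symmetric_int:
  fixes g :: "int \<Rightarrow> 'a::comm_monoid_add"
  shows "(\<Sum>n\<in>{- int N..int N}. g n) = g 0 + (\<Sum>n=1..N. g (int n) + g (- int n))"
proof (induction N)
  case (Suc N)
  have "{- int (Suc N)..int (Suc N)} = insert (int (Suc N)) (insert (- int (Suc N)) {- int N..int N})"
    by auto
  then have "(\<Sum>n\<in>{- int (Suc N)..int (Suc N)}. g n) =
      g (int (Suc N)) + (g (- int (Suc N)) + (\<Sum>n\<in>{- int N..int N}. g n))"
    by simp
  then show ?case using Suc by (simp add: ac_simps)
qed simp

lemma sum_telescope_int:
  fixes c :: "int \<Rightarrow> 'a::ab_group_add"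
  shows "(\<Sum>n\<in>{- int N..int N}. c n - c (n + 1)) = c (- int N) - c (int N + 1)"
proof (induction N)
  case (Suc N)
  have "{- int (Suc N)..int (Suc N)} = insert (int (Suc N)) (insert (- int (Suc N)) {- int N..int N})"
    by auto
  then have "(\<Sum>n\<in>{- int (Suc N)..int (Suc N)}. c n - c (n + 1)) =
      (c (int (Suc N)) - c (int (Suc N) + 1)) + ((c (- int (Suc N)) - c (- int (Suc N) + 1)) + (c (- int N) - c (int N + 1)))"
    using Suc by simp
  then show ?case by (simp add: algebra_simps)
qed simp

text \<open>
  The coefficients of \<open>g w = (f w - f z) / (w - z)\<close> satisfy \<open>a\<^sub>n - [n = 0] f z = b\<^sub>n\<^sub>-\<^sub>1 - z b\<^sub>n\<close>,
  so that the partial sums of the Laurent series telescope.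
\<close>

theorem laurent_expansion:
  assumes f: "f holomorphic_on annulus r" and r: "0 < r" and z: "z \<in> annulus r" and \<rho>: "r < \<rho>" "\<rho> < 1"
  shows "(\<lambda>N. \<Sum>n\<in>{- int N..int N}. laurent_coeff f \<rho> n * z powi n) \<longlonglongrightarrow> f z"
proof -
  define g where "g = (\<lambda>w. if w = z then deriv f z else (f w - f z) / (w - z))"
  have g: "g holomorphic_on annulus r"
    unfolding g_def by (rule pole_lemma_open[OF f]) simp
  have gf: "f w = f z + (w - z) * g w" for w by (simp add: g_def)
  have z0: "z \<noteq> 0" and zr: "r < norm z" "norm z < 1" using z r by (auto simp: annulus_def)
  define a where "a = laurent_coeff f \<rho>"
  define b where "b = laurent_coeff g \<rho>"
  have rec: "a n = (if n = 0 then f z else 0) + b (n - 1) - z * b n" for n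
  proof -
    let ?w = "\<lambda>x. of_real \<rho> * cis2pi x"
    have nz: "?w x \<noteq> 0" for x using r \<rho> by simp
    have "f (?w x) * ?w x powi (-n) = f z * ?w x powi (-n) + g (?w x) * ?w x powi (-(n-1)) - z * (g (?w x) * ?w x powi (-n))" for x
    proof -
      have "?w x powi (-(n-1)) = ?w x powi (-n) * ?w x"
        using power_int_add_1[OF disjI1[OF nz], of x "-n"] by (simp add: algebra_simps)
      then show ?thesis by (subst gf) (simp only: algebra_simps)
    qed
    moreover have "(\<lambda>x. g (?w x) * ?w x powi k) integrable_on {0..1}" for k
      using r \<rho> by (intro integrable_continuous_interval continuous_on_mult continuous_on_circle[OF g] continuous_on_circle_powi) auto
    moreover have "(\<lambda>x. ?w x powi k) integrable_on {0..1}" for k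
      using r \<rho> by (intro integrable_continuous_interval continuous_on_circle_powi) auto
    ultimately have "a n = f z * integral {0..1} (\<lambda>x. ?w x powi (-n)) + b (n - 1) - z * b n"
      unfolding a_def b_def laurent_coeff_def
      by (simp add: Henstock_Kurzweil_Integration.integral_add Henstock_Kurzweil_Integration.integral_diff
          Henstock_Kurzweil_Integration.integrable_add integrable_on_mult_right)
    moreover have "integral {0..1} (\<lambda>x. ?w x powi (-n)) = (if n = 0 then 1 else 0)"
      using integral_cis2pi_powi[of "-n"] by (simp add: power_int_mult_distrib)
    ultimately show ?thesis by simp
  qed
  have partial: "(\<Sum>n\<in>{- int N..int N}. a n * z powi n) = f z + (b (- int N - 1) * z powi (- int N) - b (int N) * z powi (int N + 1))" for N
  proof -
    define c where "c = (\<lambda>n. b (n - 1) * z powi n)"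
    have "a n * z powi n = (if n = 0 then f z else 0) + (c n - c (n + 1))" for n
    proof -
      have "z powi (n + 1) = z powi n * z" using z0 by (simp add: power_int_add_1)
      then show ?thesis by (auto simp: rec c_def algebra_simps)
    qed
    then have "(\<Sum>n\<in>{- int N..int N}. a n * z powi n) =
        (\<Sum>n\<in>{- int N..int N}. if n = 0 then f z else 0) + (c (- int N) - c (int N + 1))"
      by (simp only: sum.distrib sum_telescope_int)
    then show ?thesis by (simp add: c_def)
  qed
  \<comment> \<open>The coefficients of \<open>g\<close> may be computed on a circle inside and on a
    circle outside the one through \<open>z\<close>. The inner one gives geometric decay of the
    remainder with negative index, the outer one of that with positive index.\<close>
  obtain \<rho>1 where \<rho>1: "r < \<rho>1" "\<rho>1 < norm z" using dense zr by blast
  obtain \<rho>2 where \<rho>2: "norm z < \<rho>2" "\<rho>2 < 1" using dense zr by blast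
  have b_alt: "b n = laurent_coeff g \<rho>' n" if "r < \<rho>'" "\<rho>' < 1" for \<rho>' n
    unfolding b_def using r \<rho> that by (intro laurent_coeff_radius[OF g]) auto
  obtain C1 where C1: "\<And>n. norm (b n) \<le> C1 * \<rho>1 powi (-n)"
    using laurent_coeff_bound[OF g _ \<rho>1(1)] b_alt[of \<rho>1] \<rho>1 r zr by auto
  obtain C2 where C2: "\<And>n. norm (b n) \<le> C2 * \<rho>2 powi (-n)"
    using laurent_coeff_bound[OF g _ _ \<rho>2(2)] b_alt[of \<rho>2] \<rho>2 r zr by auto
  have "(\<lambda>N. b (- int N - 1) * z powi (- int N)) \<longlonglongrightarrow> 0"
  proof (rule Lim_null_comparison[OF always_eventually])
    show "\<forall>N. norm (b (- int N - 1) * z powi (- int N)) \<le> C1 * \<rho>1 * (\<rho>1 / norm z) ^ N"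
    proof
      fix N
      have "norm (b (- int N - 1)) \<le> C1 * \<rho>1 powi (int N + 1)" using C1[of "- int N - 1"] by (simp add: add.commute)
      also have "\<rho>1 powi (int N + 1) = \<rho>1 * \<rho>1 ^ N" using \<rho>1 r by (simp add: power_int_add_1)
      finally have "norm (b (- int N - 1)) * norm z powi (- int N) \<le> C1 * (\<rho>1 * \<rho>1 ^ N) * norm z powi (- int N)"
        by (intro mult_right_mono) auto
      then show "norm (b (- int N - 1) * z powi (- int N)) \<le> C1 * \<rho>1 * (\<rho>1 / norm z) ^ N"
        by (simp add: norm_mult norm_divide norm_power norm_power_int power_int_minus power_divide field_simps)
    qed
    have "(\<lambda>N. (\<rho>1 / norm z) ^ N) \<longlonglongrightarrow> 0" using \<rho>1 r zr by (intro LIMSEQ_power_zero) (auto simp: divide_less_eq_1)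
    then show "(\<lambda>N. C1 * \<rho>1 * (\<rho>1 / norm z) ^ N) \<longlonglongrightarrow> 0" by (rule tendsto_mult_right_zero)
  qed
  moreover have "(\<lambda>N. b (int N) * z powi (int N + 1)) \<longlonglongrightarrow> 0"
  proof (rule Lim_null_comparison[OF always_eventually])
    show "\<forall>N. norm (b (int N) * z powi (int N + 1)) \<le> C2 * norm z * (norm z / \<rho>2) ^ N"
    proof
      fix N
      have e: "norm z powi (int N + 1) = norm z * norm z ^ N" using z0 by (simp add: power_int_add_1)
      have "norm (b (int N)) * norm z powi (int N + 1) \<le> C2 * \<rho>2 powi (- int N) * norm z powi (int N + 1)"
        using C2 by (intro mult_right_mono) auto
      also have "C2 * \<rho>2 powi (- int N) * norm z powi (int N + 1) = C2 * norm z * (norm z / \<rho>2) ^ N"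
        unfolding e by (simp add: power_int_minus power_divide field_simps)
      finally show "norm (b (int N) * z powi (int N + 1)) \<le> C2 * norm z * (norm z / \<rho>2) ^ N"
        by (simp only: norm_mult norm_power_int)
    qed
    have "(\<lambda>N. (norm z / \<rho>2) ^ N) \<longlonglongrightarrow> 0" using \<rho>2 r zr by (intro LIMSEQ_power_zero) (auto simp: divide_less_eq_1)
    then show "(\<lambda>N. C2 * norm z * (norm z / \<rho>2) ^ N) \<longlonglongrightarrow> 0" by (rule tendsto_mult_right_zero)
  qed
  ultimately have "(\<lambda>N. f z + (b (- int N - 1) * z powi (- int N) - b (int N) * z powi (int N + 1))) \<longlonglongrightarrow> f z + (0 - 0)"
    by (intro tendsto_intros)
  then show ?thesis unfolding partial[symmetric] a_def by simp
qed

text \<open>Places a density on [0, 1] among the distributions on the real line, to which Helly's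
  selection theorem applies. The half-open interval \<open>{-1<..1}\<close> contains [0, 1] and has
  the form that the definition of tightness asks for.\<close>

lemma density_Icc_real_distribution:
  fixes h :: "real \<Rightarrow> real"
  assumes h: "continuous_on {0..1} h" and nn: "\<forall>x\<in>{0..1}. h x \<ge> 0"
    and one: "integral {0..1} h = 1"
  defines "P \<equiv> density lborel (\<lambda>x. ennreal (indicator {0..1} x * h x))"
  shows "real_distribution P" and "measure P {-1<..1} = 1"
    and "\<And>g::real \<Rightarrow> complex. continuous_on UNIV g \<Longrightarrow> integral\<^sup>L P g = integral {0..1} (\<lambda>x. h x * g x)"
proof -
  have m: "(\<lambda>x. indicator {0..1} x * h x) \<in> borel_measurable borel"
    using borel_measurable_continuous_on_indicator[OF _ h] by simp
  have nn': "indicator {0..1} x * h x \<ge> 0" for x using nn by (auto simp: indicator_def)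
  have hl: "set_integrable lborel {0..1} h"
    unfolding set_integrable_def using borel_integrable_compact[OF compact_Icc h]
    by simp
  have int: "integrable lborel (\<lambda>x. indicator {0..1} x * h x)"
    using hl by (simp add: set_integrable_def)
  have val: "integral\<^sup>L lborel (\<lambda>x. indicator {0..1} x * h x) = 1"
    using set_borel_integral_eq_integral(2)[OF hl] one by (simp add: set_lebesgue_integral_def)
  have em: "emeasure P A = (\<integral>\<^sup>+x. ennreal (indicator {0..1} x * h x) * indicator A x \<partial>lborel)"
    if "A \<in> sets borel" for A
    unfolding P_def using m that by (subst emeasure_density) auto
  have tot: "(\<integral>\<^sup>+x. ennreal (indicator {0..1} x * h x) \<partial>lborel) = 1"
    using nn_integral_eq_integral[OF int] nn' val by simp
  have "emeasure P UNIV = 1" using em[of UNIV] tot by simp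
  then have "prob_space P" by (intro prob_spaceI) (simp add: P_def)
  then show "real_distribution P"
    by (simp add: real_distribution_def real_distribution_axioms_def P_def)
  have "emeasure P {-1<..1} = (\<integral>\<^sup>+x. ennreal (indicator {0..1} x * h x) \<partial>lborel)"
    by (subst em) (auto intro!: nn_integral_cong simp: indicator_def)
  then show "measure P {-1<..1} = 1" using tot by (simp add: measure_def)
  fix g :: "real \<Rightarrow> complex" assume g: "continuous_on UNIV g"
  then have gm: "g \<in> borel_measurable borel" by (rule borel_measurable_continuous_onI)
  have "integral\<^sup>L P g = integral\<^sup>L lborel (\<lambda>x. (indicator {0..1} x * h x) *\<^sub>R g x)"
    unfolding P_def using m gm nn' by (subst integral_density) auto
  also have "\<dots> = set_lebesgue_integral lborel {0..1} (\<lambda>x. h x * g x)"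
    unfolding set_lebesgue_integral_def
    by (intro Bochner_Integration.integral_cong refl) (auto simp: indicator_def scaleR_conv_of_real)
  also have "\<dots> = integral {0..1} (\<lambda>x. h x * g x)"
  proof (rule set_borel_integral_eq_integral(2))
    have "continuous_on {0..1} (\<lambda>x. complex_of_real (h x) * g x)"
      by (intro continuous_intros h continuous_on_subset[OF g]) auto
    then show "set_integrable lborel {0..1} (\<lambda>x. complex_of_real (h x) * g x)"
      unfolding set_integrable_def by (intro borel_integrable_compact) auto
  qed
  finally show "integral\<^sup>L P g = integral {0..1} (\<lambda>x. h x * g x)" .
qed

text \<open>After normalisation to mass 1 the densities are tight, since all of them live on [0, 1].
  The limit distribution is carried to the circle by \<open>cis2pi\<close> and scaled by \<alpha>.
  The moments are integrals of bounded continuous functions, so all of them converge along the same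
  subsequence.\<close>

theorem Helly_circle:
  fixes h :: "nat \<Rightarrow> real \<Rightarrow> real"
  assumes h: "\<And>j. continuous_on {0..1} (h j)" and nn: "\<And>j x. x \<in> {0..1} \<Longrightarrow> h j x \<ge> 0"
    and lim: "(\<lambda>j. integral {0..1} (h j)) \<longlonglongrightarrow> \<alpha>"
  shows "\<exists>(m :: complex measure) s. strict_mono (s :: nat \<Rightarrow> nat) \<and>
    sets m = sets (restrict_space borel (sphere 0 1)) \<and> emeasure m (sphere 0 1) = ennreal \<alpha> \<and>
    (\<forall>n::int. (\<lambda>j. integral {0..1} (\<lambda>x. h (s j) x * cis2pi x powi n)) \<longlonglongrightarrow> (\<integral>\<xi>. \<xi> powi n \<partial>m))"
proof -
  define \<beta> where "\<beta> = (\<lambda>j. integral {0..1} (h j))"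
  have \<beta>0: "\<beta> j \<ge> 0" for j unfolding \<beta>_def
    by (intro Henstock_Kurzweil_Integration.integral_nonneg integrable_continuous_interval h nn)
  have \<alpha>0: "\<alpha> \<ge> 0" using lim \<beta>0 by (intro LIMSEQ_le_const[OF lim]) (auto simp: \<beta>_def)
  \<comment> \<open>If \<open>h j\<close> has mass 0, it vanishes on [0, 1], being continuous and
    nonnegative there. The density 1 may then stand in for it, as it is multiplied by
    \<open>\<beta> j = 0\<close> in the end.\<close>
  define k where "k = (\<lambda>j x. if \<beta> j = 0 then 1 else h j x / \<beta> j)"
  have k: "continuous_on {0..1} (k j)" for j
    by (cases "\<beta> j = 0") (auto simp: k_def intro!: continuous_intros h)
  have knn: "\<forall>x\<in>{0..1}. k j x \<ge> 0" for j
    using nn \<beta>0 by (auto simp: k_def)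
  have kone: "integral {0..1} (k j) = 1" for j
  proof (cases "\<beta> j = 0")
    case False
    then have "integral {0..1} (k j) = integral {0..1} (\<lambda>x. h j x / \<beta> j)" by (simp add: k_def)
    also have "\<dots> = \<beta> j / \<beta> j" unfolding \<beta>_def by (rule Henstock_Kurzweil_Integration.integral_divide)
    finally show ?thesis using False by simp
  qed (simp add: k_def)
  have hk: "h j x = \<beta> j * k j x" if "x \<in> {0..1}" for j x
  proof (cases "\<beta> j = 0")
    case True
    then have "(h j has_integral 0) (cbox 0 1)"
      using integrable_integral[OF integrable_continuous_interval[OF h[of j]]] by (simp add: \<beta>_def)
    then have "h j x = 0"
      using that h[of j] nn by (intro has_integral_0_cbox_imp_0[of 0 1 "h j"]) auto
    then show ?thesis using True by simp
  qed (simp add: k_def)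
  define P where "P = (\<lambda>j. density lborel (\<lambda>x. ennreal (indicator {0..1} x * k j x)))"
  have Pprops: "real_distribution (P j)" "measure (P j) {-1<..1} = 1"
      "continuous_on UNIV g \<Longrightarrow> integral\<^sup>L (P j) g = integral {0..1} (\<lambda>x. k j x * g x)"
    for j and g :: "real \<Rightarrow> complex"
    unfolding P_def using density_Icc_real_distribution[OF k[of j] knn kone] by auto
  have "tight P"
    unfolding tight_def
  proof (intro conjI allI impI)
    show "real_distribution (P n)" for n by (rule Pprops(1))
    fix \<epsilon> :: real assume "\<epsilon> > 0"
    then show "\<exists>a b. a < b \<and> (\<forall>n. 1 - \<epsilon> < measure (P n) {a<..b})"
      using Pprops(2) by (intro exI[of _ "-1"] exI[of _ 1]) auto
  qed
  then obtain s M where s: "strict_mono (s :: nat \<Rightarrow> nat)" and M: "real_distribution M"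
    and conv: "weak_conv_m (P \<circ> id \<circ> s) M"
    using tight_imp_convergent_subsubsequence[of P id] strict_mono_id by blast
  interpret M: real_distribution M by fact
  define S where "S = restrict_space borel (sphere (0::complex) 1)"
  have Em: "cis2pi \<in> measurable M S"
    unfolding S_def by (intro measurable_restrict_space2) (auto intro!: borel_measurable_continuous_onI continuous_intros)
  define m where "m = density (distr M S cis2pi) (\<lambda>_. ennreal \<alpha>)"
  have "emeasure (distr M S cis2pi) (sphere 0 1) = 1"
  proof -
    have "sphere 0 1 \<in> sets S" by (auto simp: S_def sets_restrict_space intro!: image_eqI[of _ _ UNIV])
    then show ?thesis using Em M.emeasure_space_1
      by (subst emeasure_distr) (auto simp: vimage_def)
  qed
  moreover have "sphere 0 1 \<in> sets (distr M S cis2pi)" by (auto simp: S_def sets_restrict_space intro!: image_eqI[of _ _ UNIV])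
  ultimately have "emeasure m (sphere 0 1) = ennreal \<alpha>"
    unfolding m_def by (subst emeasure_density_const) auto
  moreover have "sets m = sets S" by (simp add: m_def)
  moreover have "(\<lambda>j. integral {0..1} (\<lambda>x. h (s j) x * cis2pi x powi n)) \<longlonglongrightarrow> (\<integral>\<xi>. \<xi> powi n \<partial>m)" for n :: int
  proof -
    have cont: "continuous_on UNIV (\<lambda>x. cis2pi x powi n)" by (intro continuous_intros) auto
    have "(\<lambda>j. integral\<^sup>L ((P \<circ> id \<circ> s) j) (\<lambda>x. cis2pi x powi n)) \<longlonglongrightarrow> integral\<^sup>L M (\<lambda>x. cis2pi x powi n)"
    proof (rule weak_conv_imp_integral_bdd_continuous_conv[where B = 1])
      show "isCont (\<lambda>x. cis2pi x powi n) x" for x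
        using cont by (simp add: continuous_on_eq_continuous_at)
    qed (use Pprops(1) M conv in \<open>auto simp: norm_power_int o_def\<close>)
    moreover have "(\<lambda>j. of_real (\<beta> (s j))) \<longlonglongrightarrow> complex_of_real \<alpha>"
      using LIMSEQ_subseq_LIMSEQ[OF lim s] by (auto simp: \<beta>_def o_def intro: tendsto_of_real)
    ultimately have "(\<lambda>j. of_real (\<beta> (s j)) * integral\<^sup>L ((P \<circ> id \<circ> s) j) (\<lambda>x. cis2pi x powi n))
        \<longlonglongrightarrow> of_real \<alpha> * integral\<^sup>L M (\<lambda>x. cis2pi x powi n)"
      by (rule tendsto_mult[rotated])
    moreover have "of_real (\<beta> (s j)) * integral\<^sup>L ((P \<circ> id \<circ> s) j) (\<lambda>x. cis2pi x powi n) =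
        integral {0..1} (\<lambda>x. h (s j) x * cis2pi x powi n)" for j
    proof -
      have "integral {0..1} (\<lambda>x. h (s j) x * cis2pi x powi n) =
          integral {0..1} (\<lambda>x. of_real (\<beta> (s j)) * (k (s j) x * cis2pi x powi n))"
        by (intro Henstock_Kurzweil_Integration.integral_cong) (simp add: hk)
      also have "\<dots> = of_real (\<beta> (s j)) * integral {0..1} (\<lambda>x. k (s j) x * cis2pi x powi n)" by simp
      finally show ?thesis using Pprops(3)[OF cont, of "s j"] by simp
    qed
    moreover have "of_real \<alpha> * integral\<^sup>L M (\<lambda>x. cis2pi x powi n) = (\<integral>\<xi>. \<xi> powi n \<partial>m)"
    proof -
      have "(\<lambda>\<xi>. \<xi> powi n) \<in> borel_measurable S"
        unfolding S_def by (intro borel_measurable_continuous_on_restrict continuous_intros) auto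
      then have "(\<integral>\<xi>. \<xi> powi n \<partial>m) = (\<integral>\<xi>. \<alpha> *\<^sub>R \<xi> powi n \<partial>(distr M S cis2pi))"
        unfolding m_def using \<alpha>0 by (subst integral_density) auto
      also have "\<dots> = (\<integral>x. \<alpha> *\<^sub>R cis2pi x powi n \<partial>M)"
        using Em \<open>(\<lambda>\<xi>. \<xi> powi n) \<in> borel_measurable S\<close> by (subst integral_distr) auto
      finally show ?thesis by (simp add: scaleR_conv_of_real)
    qed
    ultimately show ?thesis by simp
  qed
  ultimately show ?thesis using s by (auto simp: S_def)
qed

section \<open>The Villat kernel\<close>

text \<open>
  The coefficients in \<open>\<K>\<^sub>r z = (1 + z) / (1 - z) + 2 \<Sum> q\<^sub>k (z\<^sup>k - z\<^sup>-\<^sup>k)\<close> and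
  \<open>1 - \<K>\<^sub>r (r / z) = 2 \<Sum> p\<^sub>k (z\<^sup>k - z\<^sup>-\<^sup>k)\<close>, where \<open>k \<ge> 1\<close>. At \<open>k = 0\<close> both are the junk value \<open>1 / 0 = 0\<close>.
\<close>

definition villat_q :: "real \<Rightarrow> nat \<Rightarrow> real" where
  "villat_q r k = r ^ (2 * k) / (1 - r ^ (2 * k))"

definition villat_p :: "real \<Rightarrow> nat \<Rightarrow> real" where
  "villat_p r k = r ^ k / (1 - r ^ (2 * k))"

lemma villat_q_0 [simp]: "villat_q r 0 = 0" and villat_p_0 [simp]: "villat_p r 0 = 0"
  by (auto simp: villat_q_def villat_p_def)

lemma power_even_bounds:
  fixes r :: real
  assumes "0 < r" "r < 1" "k > 0"
  shows "r ^ (2 * k) \<le> r ^ 2" "1 - r ^ 2 > 0" "1 - r ^ (2 * k) > 0"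
proof -
  show "r ^ (2 * k) \<le> r ^ 2" using assms by (intro power_decreasing) auto
  moreover show "1 - r ^ 2 > 0" using assms by (simp add: power_less_one_iff)
  ultimately show "1 - r ^ (2 * k) > 0" by simp
qed

lemma villat_q_bounds:
  assumes "0 < r" "r < 1"
  shows "0 \<le> villat_q r k" "villat_q r k \<le> r ^ (2 * k) / (1 - r ^ 2)"
proof -
  have "0 \<le> villat_q r k \<and> villat_q r k \<le> r ^ (2 * k) / (1 - r ^ 2)"
  proof (cases "k = 0")
    case False
    then show ?thesis using power_even_bounds[OF assms, of k] assms
      by (auto simp: villat_q_def intro!: divide_left_mono)
  qed (use assms in \<open>auto simp: power_le_one\<close>)
  then show "0 \<le> villat_q r k" "villat_q r k \<le> r ^ (2 * k) / (1 - r ^ 2)" by auto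
qed

lemma villat_p_bounds:
  assumes "0 < r" "r < 1"
  shows "0 \<le> villat_p r k" "villat_p r k \<le> r ^ k / (1 - r ^ 2)"
proof -
  have "0 \<le> villat_p r k \<and> villat_p r k \<le> r ^ k / (1 - r ^ 2)"
  proof (cases "k = 0")
    case False
    then show ?thesis using power_even_bounds[OF assms, of k] assms
      by (auto simp: villat_p_def intro!: divide_left_mono)
  qed (use assms in \<open>auto simp: power_le_one\<close>)
  then show "0 \<le> villat_p r k" "villat_p r k \<le> r ^ k / (1 - r ^ 2)" by auto
qed

lemma villat_q_p:
  assumes "0 < r" "r < 1" "k > 0"
  shows "(1 + villat_q r k) * r ^ k = villat_p r k" "villat_q r k = villat_p r k * r ^ k"
proof -
  note b = power_even_bounds[OF assms]
  have "1 + villat_q r k = 1 / (1 - r ^ (2 * k))" using b by (simp add: villat_q_def field_simps)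
  then show "(1 + villat_q r k) * r ^ k = villat_p r k" by (simp add: villat_p_def)
  show "villat_q r k = villat_p r k * r ^ k" by (simp add: villat_q_def villat_p_def mult_2 power_add)
qed

lemma norm_power_diff_inverse_le:
  fixes z :: complex
  assumes "0 < norm z" "norm z < 1"
  shows "norm (z ^ k - inverse z ^ k) \<le> 2 * inverse (norm z) ^ k"
proof -
  have "norm (z ^ k - inverse z ^ k) \<le> norm z ^ k + inverse (norm z) ^ k"
    using norm_triangle_ineq4[of "z ^ k" "inverse z ^ k"] by (simp add: norm_power norm_inverse)
  moreover have "norm z ^ k \<le> 1" "1 \<le> inverse (norm z) ^ k"
    using assms by (auto intro!: power_le_one one_le_power simp: one_le_inverse_iff)
  ultimately show ?thesis by linarith
qed

text \<open>With w = z^k, the real part of w - 1 / w is Re w times 1 - 1 / |w|^2 and so vanishes on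
  the unit circle. The factor - ln |z| gained here is what makes the one-sided estimates of Re p
  linear in the distance from the boundary.\<close>

lemma abs_Re_power_diff_inverse_le:
  fixes z :: complex
  assumes "0 < norm z" "norm z < 1"
  shows "\<bar>Re (z ^ k - inverse z ^ k)\<bar> \<le> 2 * real k * (- ln (norm z)) * inverse (norm z) ^ k"
proof -
  define w where "w = z ^ k"
  define x where "x = norm w"
  have x: "0 < x" "x \<le> 1" using assms by (auto simp: x_def w_def norm_power power_le_one)
  then have x2: "x\<^sup>2 \<le> 1" by (simp add: power_le_one)
  have "Re (w - inverse w) = Re w * (1 - 1 / x\<^sup>2)"
    by (simp add: inverse_complex.sel x_def cmod_power2 right_diff_distrib)
  then have "\<bar>Re (w - inverse w)\<bar> = \<bar>Re w\<bar> * (1 / x\<^sup>2 - 1)"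
    using x x2 by (simp add: abs_mult abs_minus_commute)
  also have "\<dots> \<le> x * (1 / x\<^sup>2 - 1)"
    using x x2 abs_Re_le_cmod[of w] by (intro mult_right_mono) (auto simp: x_def)
  also have "\<dots> = (1 - x\<^sup>2) / x" using x by (simp add: field_simps power2_eq_square)
  also have "\<dots> \<le> (- ln (x\<^sup>2)) / x"
    using ln_le_minus_one[of "x\<^sup>2"] x by (intro divide_right_mono) auto
  also have "\<dots> = 2 * real k * (- ln (norm z)) * inverse (norm z) ^ k"
    using x assms by (simp add: ln_realpow x_def w_def norm_power field_simps)
  finally show ?thesis by (simp add: w_def power_inverse)
qed

lemma half_plane_sums:
  fixes x :: complex
  assumes "norm x < 1"
  shows "(\<lambda>k. 2 * x ^ k) sums ((1 + x) / (1 - x) + 1)"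
proof -
  have "1 - x \<noteq> 0" using assms by auto
  then have "(1 + x) / (1 - x) + 1 = 2 * (1 / (1 - x))" by (simp add: field_simps)
  then show ?thesis using sums_mult[OF geometric_sums[OF assms], of 2] by simp
qed

text \<open>These are the terms of index n and -n of the Villat sum, for s = r^(2n). The second one,
  rewritten in s / z, is a half-plane function with the opposite sign, so the constants cancel and
  two geometric series remain; the condition s < |z| makes the second series converge.\<close>

lemma villat_kernel_pair_sums:
  fixes z :: complex and s :: real
  assumes s: "0 < s" "s < norm z" "s < 1" and z: "norm z < 1"
  shows "(\<lambda>k. 2 * of_real (s ^ k) * (z ^ k - inverse z ^ k)) sums
    ((1 + of_real s * z) / (1 - of_real s * z) + (1 + of_real (inverse s) * z) / (1 - of_real (inverse s) * z))"
proof -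
  have z0: "z \<noteq> 0" using s by auto
  have 1: "norm (of_real s * z) < 1" using s z by (simp add: norm_mult) (meson dual_order.strict_trans less_le_trans mult_left_le_one_le mult_less_cancel_right2 norm_ge_zero order_le_less_trans less_imp_le)
  have "norm (of_real s * inverse z) = s / norm z" using s by (simp add: norm_mult norm_inverse divide_inverse)
  also have "\<dots> < 1" using s by (simp add: divide_less_eq_1)
  finally have 2: "norm (of_real s * inverse z) < 1" .
  have ne: "of_real s \<noteq> z" using s by auto
  have "(1 + of_real (inverse s) * z) / (1 - of_real (inverse s) * z) = (of_real s + z) / (of_real s - z)"
    using s ne by (simp add: field_simps)
  also have "\<dots> = - ((1 + of_real s * inverse z) / (1 - of_real s * inverse z))"
  proof -
    have "1 + of_real s * inverse z = (z + of_real s) / z" "1 - of_real s * inverse z = (z - of_real s) / z"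
      using z0 by (auto simp: field_simps)
    then have "(1 + of_real s * inverse z) / (1 - of_real s * inverse z) = (z + of_real s) / (z - of_real s)"
      using z0 by simp
    also have "\<dots> = - ((of_real s + z) / (of_real s - z))"
      using minus_divide_right[of "of_real s + z" "of_real s - z"] by (simp add: add.commute)
    finally show ?thesis by simp
  qed
  finally have eq: "(1 + of_real (inverse s) * z) / (1 - of_real (inverse s) * z) = - ((1 + of_real s * inverse z) / (1 - of_real s * inverse z))" .
  have "(\<lambda>k. 2 * (of_real s * z) ^ k - 2 * (of_real s * inverse z) ^ k) sums
    (((1 + of_real s * z) / (1 - of_real s * z) + 1) - ((1 + of_real s * inverse z) / (1 - of_real s * inverse z) + 1))"
    using 1 2 by (intro sums_diff half_plane_sums)
  then show ?thesis unfolding eq by (simp add: power_mult_distrib algebra_simps)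
qed

text \<open>Since |z| > r, one has r^(2k) |z|^(-k) \<le> r^k. The majorant is thus independent of
  \<open>z\<close>, although |z^(-k)| alone can be as large as r^(-k).\<close>

lemma villat_kernel_term_bound:
  assumes r: "0 < r" "r < 1" and z: "z \<in> annulus r" and c: "0 \<le> c" "c \<le> r ^ (2 * k) / (1 - r ^ 2)"
  shows "norm (of_real c * (z ^ k - inverse z ^ k)) \<le> 2 / (1 - r ^ 2) * r ^ k"
proof -
  have nz: "0 < norm z" "norm z < 1" "r < norm z" using r z by (auto simp: annulus_def)
  have "norm (of_real c * (z ^ k - inverse z ^ k)) \<le> r ^ (2 * k) / (1 - r ^ 2) * (2 * inverse (norm z) ^ k)"
    unfolding norm_mult using c norm_power_diff_inverse_le[OF nz(1,2), of k] power_even_bounds(2)[OF r, of 1]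
    by (intro mult_mono) auto
  also have "\<dots> = 2 / (1 - r ^ 2) * (r ^ k * (r / norm z) ^ k)"
  proof -
    have e1: "r ^ (2 * k) = r ^ k * r ^ k" by (simp add: mult_2 power_add)
    have e2: "(r / norm z) ^ k = r ^ k * inverse (norm z) ^ k" by (simp only: divide_inverse power_mult_distrib)
    show ?thesis unfolding e1 e2 by simp
  qed
  also have "\<dots> \<le> 2 / (1 - r ^ 2) * (r ^ k * 1)"
  proof -
    have "r / norm z \<le> 1" using nz(1,3) by simp
    then have "(r / norm z) ^ k \<le> 1" using r nz by (intro power_le_one) auto
    then have "r ^ k * (r / norm z) ^ k \<le> r ^ k * 1" using r by (intro mult_left_mono) auto
    then show ?thesis by (rule mult_left_mono) (use power_even_bounds(2)[OF r, of 1] in auto)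
  qed
  finally show ?thesis by simp
qed

text \<open>Paired terms of the Villat sum expand in z^k - z^(-k). For fixed k the coefficients form
  a geometric sum over the index of the pair, with ratio r^(2k), and its limit is
  \<open>villat_q r k\<close>. Tannery's theorem with the majorant r^k permits exchanging this limit
  with the sum over k.\<close>

theorem villat_kernel_expansion:
  assumes r: "0 < r" "r < 1" and z: "z \<in> annulus r"
  shows "summable (\<lambda>k. norm (of_real (villat_q r k) * (z ^ k - inverse z ^ k)))"
    and "villat_kernel r z = (1 + z) / (1 - z) + 2 * (\<Sum>k. of_real (villat_q r k) * (z ^ k - inverse z ^ k))"
proof -
  have nz: "0 < norm z" "norm z < 1" "r < norm z" using r z by (auto simp: annulus_def)
  show sum: "summable (\<lambda>k. norm (of_real (villat_q r k) * (z ^ k - inverse z ^ k)))"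
  proof (rule summable_comparison_test)
    show "\<exists>N. \<forall>n\<ge>N. norm (norm (of_real (villat_q r n) * (z ^ n - inverse z ^ n))) \<le> 2 / (1 - r ^ 2) * r ^ n"
      using villat_kernel_term_bound[OF r z villat_q_bounds[OF r]] by auto
  qed (use r in \<open>auto intro!: summable_mult summable_geometric\<close>)
  define T where "T = (\<lambda>\<nu>::int. (1 + of_real (r powi (2 * \<nu>)) * z) / (1 - of_real (r powi (2 * \<nu>)) * z))"
  define a where "a = (\<lambda>k N. of_real (\<Sum>n=1..N. (r ^ (2 * n)) ^ k) * (z ^ k - inverse z ^ k))"
  have pair: "(\<lambda>k. 2 * of_real ((r ^ (2 * n)) ^ k) * (z ^ k - inverse z ^ k)) sums (T (int n) + T (- int n))"
    if "n \<in> {1..N}" for n N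
  proof -
    have le: "r ^ (2 * n) \<le> r ^ 1" using that r by (intro power_decreasing) auto
    have eq: "T (int n) = (1 + of_real (r ^ (2 * n)) * z) / (1 - of_real (r ^ (2 * n)) * z)"
      "T (- int n) = (1 + of_real (inverse (r ^ (2 * n))) * z) / (1 - of_real (inverse (r ^ (2 * n))) * z)"
    proof -
      have e1: "r powi (2 * int n) = r ^ (2 * n)" using power_int_of_nat[of r "2 * n"] by simp
      have e2: "r powi (2 * - int n) = inverse (r ^ (2 * n))" using power_int_minus[of r "2 * int n"] e1 by simp
      show "T (int n) = (1 + of_real (r ^ (2 * n)) * z) / (1 - of_real (r ^ (2 * n)) * z)"
        "T (- int n) = (1 + of_real (inverse (r ^ (2 * n))) * z) / (1 - of_real (inverse (r ^ (2 * n))) * z)"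
        by (simp_all only: T_def e1 e2)
    qed
    show ?thesis unfolding eq by (rule villat_kernel_pair_sums) (use le r nz in auto)
  qed
  have part: "(\<Sum>\<nu>\<in>{- int N..int N}. T \<nu>) = (1 + z) / (1 - z) + 2 * (\<Sum>k. a k N)" for N
  proof -
    have "(\<lambda>k. \<Sum>n=1..N. 2 * of_real ((r ^ (2 * n)) ^ k) * (z ^ k - inverse z ^ k)) sums (\<Sum>n=1..N. T (int n) + T (- int n))"
      by (rule sums_sum) (rule pair)
    moreover have "(\<lambda>k. \<Sum>n=1..N. 2 * of_real ((r ^ (2 * n)) ^ k) * (z ^ k - inverse z ^ k)) = (\<lambda>k. 2 * a k N)"
      by (simp add: a_def sum_distrib_left sum_distrib_right mult_ac)
    ultimately have "(\<lambda>k. 2 * a k N) sums (\<Sum>n=1..N. T (int n) + T (- int n))" by simp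
    then have "(\<lambda>k. a k N) sums ((\<Sum>n=1..N. T (int n) + T (- int n)) / 2)"
      using sums_divide[of "\<lambda>k. 2 * a k N" _ 2] by simp
    then have "(\<Sum>n=1..N. T (int n) + T (- int n)) / 2 = (\<Sum>k. a k N)" by (rule sums_unique)
    then have "(\<Sum>n=1..N. T (int n) + T (- int n)) = 2 * (\<Sum>k. a k N)" by simp
    moreover have "T 0 = (1 + z) / (1 - z)" by (simp add: T_def)
    ultimately show ?thesis by (simp add: sum_symmetric_int)
  qed
  have "(\<lambda>N. \<Sum>k. a k N) \<longlonglongrightarrow> (\<Sum>k. of_real (villat_q r k) * (z ^ k - inverse z ^ k))"
  proof (rule conjunct2[OF conjunct2[OF tannerys_theorem]])
    fix k
    show "(\<lambda>N. a k N) \<longlonglongrightarrow> of_real (villat_q r k) * (z ^ k - inverse z ^ k)"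
    proof (cases "k = 0")
      case False
      define x where "x = r ^ (2 * k)"
      have x: "0 < x" "x < 1" using r False by (auto simp: x_def power_less_one_iff)
      have eq: "(\<Sum>n=1..N. (r ^ (2 * n)) ^ k) = x * (\<Sum>n<N. x ^ n)" for N
      proof -
        have "(r ^ (2 * n)) ^ k = x ^ n" for n by (simp add: x_def mult_ac flip: power_mult)
        then show ?thesis
          using sum.atLeast1_atMost_eq[of "\<lambda>n. x ^ n" N] by (simp add: sum_distrib_left)
      qed
      have "(\<lambda>N. x * (\<Sum>n<N. x ^ n)) \<longlonglongrightarrow> x * (1 / (1 - x))"
        using geometric_sums[of x] x by (intro tendsto_mult tendsto_const) (auto simp: sums_def)
      then show ?thesis
        unfolding a_def eq by (intro tendsto_mult tendsto_of_real tendsto_const) (simp add: villat_q_def x_def)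
    qed (simp add: a_def)
  next
    have "norm (a k N) \<le> 2 / (1 - r ^ 2) * r ^ k" for k N
    proof (cases "k = 0")
      case False
      define x where "x = r ^ (2 * k)"
      have x: "0 < x" "x < 1" "x \<le> r ^ 2" using r False by (auto simp: x_def power_less_one_iff intro!: power_decreasing)
      have "(r ^ (2 * n)) ^ k = x ^ n" for n by (simp add: x_def mult_ac flip: power_mult)
      then have eq: "(\<Sum>n=1..N. (r ^ (2 * n)) ^ k) = x * (\<Sum>n<N. x ^ n)"
        using sum.atLeast1_atMost_eq[of "\<lambda>n. x ^ n" N] by (simp add: sum_distrib_left)
      have "(\<Sum>n<N. x ^ n) \<le> 1 / (1 - x)"
        using sum_le_suminf[of "\<lambda>n. x ^ n" "{..<N}"] x by (simp add: suminf_geometric summable_geometric)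
      also have "\<dots> \<le> 1 / (1 - r ^ 2)"
        using x power_even_bounds(2)[OF r, of 1] by (intro divide_left_mono) auto
      finally have "x * (\<Sum>n<N. x ^ n) \<le> x * (1 / (1 - r ^ 2))" using x by (intro mult_left_mono) auto
      then have "(\<Sum>n=1..N. (r ^ (2 * n)) ^ k) \<le> r ^ (2 * k) / (1 - r ^ 2)" by (simp only: eq) (simp add: x_def)
      then show ?thesis unfolding a_def using r
        by (intro villat_kernel_term_bound[OF r z]) (auto intro!: sum_nonneg)
    qed (use power_even_bounds(2)[OF r, of 1] in \<open>auto simp: a_def\<close>)
    then show "\<forall>\<^sub>F (k, N) in at_top \<times>\<^sub>F sequentially. norm (a k N) \<le> 2 / (1 - r ^ 2) * r ^ k"
      by (intro always_eventually) auto
    show "summable (\<lambda>k. 2 / (1 - r ^ 2) * r ^ k)"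
      using r by (intro summable_mult summable_geometric) auto
  qed simp
  then have "(\<lambda>N. \<Sum>\<nu>\<in>{- int N..int N}. T \<nu>) \<longlonglongrightarrow>
      (1 + z) / (1 - z) + 2 * (\<Sum>k. of_real (villat_q r k) * (z ^ k - inverse z ^ k))"
    unfolding part by (intro tendsto_intros)
  then show "villat_kernel r z = (1 + z) / (1 - z) + 2 * (\<Sum>k. of_real (villat_q r k) * (z ^ k - inverse z ^ k))"
    unfolding villat_kernel_def T_def by (rule limI)
qed

lemma villat_kernel_sums:
  assumes r: "0 < r" "r < 1" and z: "z \<in> annulus r"
  shows "(\<lambda>k. if k = 0 then 1 else 2 * (of_real (1 + villat_q r k) * z ^ k - of_real (villat_q r k) * inverse z ^ k)) sums villat_kernel r z"
proof -
  have nz: "norm z < 1" using z by (auto simp: annulus_def)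
  have "(\<lambda>k. of_real (villat_q r k) * (z ^ k - inverse z ^ k)) sums (\<Sum>k. of_real (villat_q r k) * (z ^ k - inverse z ^ k))"
    by (rule summable_sums[OF summable_norm_cancel[OF villat_kernel_expansion(1)[OF assms]]])
  \<comment> \<open>The series of \<open>half_plane_sums\<close> has 2 at k = 0, where the kernel
    has 1; the last term corrects this on both sides.\<close>
  then have "(\<lambda>k. 2 * z ^ k + 2 * (of_real (villat_q r k) * (z ^ k - inverse z ^ k)) - (if k = 0 then 1 else 0)) sums
     ((1 + z) / (1 - z) + 1 + 2 * (\<Sum>k. of_real (villat_q r k) * (z ^ k - inverse z ^ k)) - 1)"
    by (intro sums_diff sums_add half_plane_sums nz sums_mult sums_single)
  moreover have "(\<lambda>k. 2 * z ^ k + 2 * (of_real (villat_q r k) * (z ^ k - inverse z ^ k)) - (if k = 0 then 1 else 0)) =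
    (\<lambda>k. if k = 0 then 1 else 2 * (of_real (1 + villat_q r k) * z ^ k - of_real (villat_q r k) * inverse z ^ k))"
    by (auto simp: algebra_simps)
  ultimately show ?thesis by (simp add: villat_kernel_expansion(2)[OF assms])
qed

lemma annulus_reflect:
  assumes "0 < r" "z \<in> annulus r"
  shows "of_real r / z \<in> annulus r"
proof -
  have z: "r < norm z" "norm z < 1" "0 < norm z" using assms by (auto simp: annulus_def)
  have "r * norm z < r" using z assms mult_strict_left_mono[of "norm z" 1 r] by simp
  then have "r < r / norm z" using z by (simp add: less_divide_eq)
  moreover have "r / norm z < 1" using z by (simp add: divide_less_eq_1)
  ultimately show ?thesis using assms by (simp add: annulus_def norm_divide)
qed

text \<open>Under the substitution of r / z the coefficients 1 + q_k and q_k both turn into p_k, and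
  subtraction from 1 removes the constant term. The reflected kernel is therefore formally
  antisymmetric under z -> 1 / z and contributes nothing in degree 0.\<close>

lemma villat_co_kernel_sums:
  assumes r: "0 < r" "r < 1" and z: "z \<in> annulus r"
  shows "(\<lambda>k. 2 * of_real (villat_p r k) * (z ^ k - inverse z ^ k)) sums (1 - villat_kernel r (of_real r / z))"
proof -
  have z0: "z \<noteq> 0" using z r by (auto simp: annulus_def)
  define u where "u = of_real r / z"
  have "(\<lambda>k. (if k = 0 then 1 else 0) - (if k = 0 then 1 else 2 * (of_real (1 + villat_q r k) * u ^ k - of_real (villat_q r k) * inverse u ^ k)))
     sums (1 - villat_kernel r u)"
    using annulus_reflect[OF r(1) z] by (intro sums_diff sums_single villat_kernel_sums r) (simp add: u_def)
  moreover have "(if k = 0 then 1 else 0) - (if k = 0 then 1 else 2 * (of_real (1 + villat_q r k) * u ^ k - of_real (villat_q r k) * inverse u ^ k)) =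
     2 * of_real (villat_p r k) * (z ^ k - inverse z ^ k)" for k
  proof (cases "k = 0")
    case False
    have "of_real (1 + villat_q r k) * u ^ k = of_real ((1 + villat_q r k) * r ^ k) * inverse z ^ k"
      by (simp add: u_def power_divide power_inverse divide_inverse power_mult_distrib)
    also have "(1 + villat_q r k) * r ^ k = villat_p r k" using villat_q_p(1)[OF r, of k] False by simp
    finally have "of_real (1 + villat_q r k) * u ^ k = of_real (villat_p r k) * inverse z ^ k" .
    moreover have "of_real (villat_q r k) * inverse u ^ k = of_real (villat_p r k) * z ^ k"
      using villat_q_p(2)[OF r, of k] False r by (simp add: u_def power_divide power_inverse)
    ultimately show ?thesis using False by (simp only: if_False) (simp add: algebra_simps)
  qed simp
  ultimately show ?thesis by (simp add: u_def)
qed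

text \<open>The inner radius moves with time; the constants are allowed to depend only on an upper
  bound \<open>R\<close> for it, which will be \<open>r 0\<close>.\<close>

lemma norm_villat_kernel_le:
  assumes r: "0 < r" "r \<le> R" "R < 1" and z: "z \<in> annulus r"
  shows "norm (villat_kernel r z) \<le> 2 / (1 - norm z) + 4 / ((1 - R ^ 2) * (1 - R))"
proof -
  have r1: "r < 1" using r by simp
  have nz: "norm z < 1" using z by (auto simp: annulus_def)
  have R: "1 - R ^ 2 > 0" "r ^ 2 \<le> R ^ 2" using r by (auto simp: power_less_one_iff intro!: power_mono)
  have "norm ((1 + z) / (1 - z)) \<le> 2 / (1 - norm z)"
    unfolding norm_divide using nz norm_triangle_ineq[of 1 z] norm_triangle_ineq2[of 1 z]
    by (intro frac_le) auto
  moreover have "norm (\<Sum>k. of_real (villat_q r k) * (z ^ k - inverse z ^ k)) \<le> (\<Sum>k. 2 / (1 - R ^ 2) * R ^ k)"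
  proof (rule norm_suminf_le)
    show "norm (of_real (villat_q r k) * (z ^ k - inverse z ^ k)) \<le> 2 / (1 - R ^ 2) * R ^ k" for k
    proof -
      have "norm (of_real (villat_q r k) * (z ^ k - inverse z ^ k)) \<le> 2 / (1 - r ^ 2) * r ^ k"
        by (rule villat_kernel_term_bound[OF r(1) r1 z villat_q_bounds[OF r(1) r1]])
      also have "\<dots> \<le> 2 / (1 - R ^ 2) * R ^ k"
      proof -
        have "2 / (1 - r ^ 2) \<le> 2 / (1 - R ^ 2)" using R by (intro frac_le) auto
        then show ?thesis using R r by (intro mult_mono power_mono) auto
      qed
      finally show ?thesis .
    qed
    show "summable (\<lambda>k. 2 / (1 - R ^ 2) * R ^ k)"
      using r by (intro summable_mult summable_geometric) auto
  qed
  moreover have "(\<Sum>k. 2 / (1 - R ^ 2) * R ^ k) = 2 / (1 - R ^ 2) * (1 / (1 - R))"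
    using r by (subst suminf_mult) (auto simp: suminf_geometric summable_geometric)
  ultimately have "norm (villat_kernel r z) \<le> 2 / (1 - norm z) + 2 * (2 / (1 - R ^ 2) * (1 / (1 - R)))"
    unfolding villat_kernel_expansion(2)[OF r(1) r1 z]
    by (intro order_trans[OF norm_triangle_ineq add_mono]) (auto simp: norm_mult)
  then show ?thesis by simp
qed

text \<open>One factor 2 comes from the 2 in front of the series of the kernels, the other from
  \<open>abs_Re_power_diff_inverse_le\<close>; 1 / (1 - R^2) bounds the denominators of the
  coefficients. The powers of \<open>sqrt R\<close> come from the restriction to |z| \<ge> sqrt R,
  where r / |z| \<le> sqrt R < 1.\<close>

definition villat_bound :: "real \<Rightarrow> real" where
  "villat_bound R = 4 / (1 - R ^ 2) * (\<Sum>k. real k * sqrt R ^ k)"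

lemma summable_real_mult_power:
  fixes x :: real
  assumes "0 \<le> x" "x < 1"
  shows "summable (\<lambda>k. real k * x ^ k)"
proof -
  have "summable (\<lambda>k. x * (real (Suc k) * x ^ k))"
    using geometric_deriv_sums[of x] assms by (intro summable_mult) (auto simp: sums_iff)
  then have "summable (\<lambda>k. real (Suc k) * x ^ Suc k)" by (simp add: mult_ac)
  then show ?thesis using summable_Suc_iff[of "\<lambda>k. real k * x ^ k"] by simp
qed

lemma villat_bound_nonneg: "0 \<le> R \<Longrightarrow> R < 1 \<Longrightarrow> villat_bound R \<ge> 0"
  unfolding villat_bound_def
  by (intro mult_nonneg_nonneg suminf_nonneg summable_real_mult_power divide_nonneg_nonneg)
     (auto simp: power_le_one)

lemma Re_suminf_villat_ge:
  assumes R: "0 < R" "R < 1" and z: "0 < norm z" "norm z < 1"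
    and c: "\<And>k. 0 \<le> c k" "\<And>k. c k * inverse (norm z) ^ k \<le> sqrt R ^ k / (1 - R ^ 2)"
    and s: "(\<lambda>k. of_real (c k) * (z ^ k - inverse z ^ k)) sums S"
  shows "2 * Re S \<ge> - villat_bound R * (- ln (norm z))"
proof -
  define L where "L = - ln (norm z)"
  have L: "L \<ge> 0" using z by (simp add: L_def)
  have sR: "0 \<le> sqrt R" "sqrt R < 1" using R by auto
  have A: "(\<lambda>k. 2 * Re (of_real (c k) * (z ^ k - inverse z ^ k))) sums (2 * Re S)"
    using s by (intro sums_mult) (auto simp: sums_complex_iff)
  have B: "(\<lambda>k. - (4 / (1 - R ^ 2) * L) * (real k * sqrt R ^ k)) sums
      (- (4 / (1 - R ^ 2) * L) * (\<Sum>k. real k * sqrt R ^ k))"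
    using sR by (intro sums_mult summable_sums summable_real_mult_power)
  have C: "\<And>k. - (4 / (1 - R ^ 2) * L) * (real k * sqrt R ^ k) \<le> 2 * Re (of_real (c k) * (z ^ k - inverse z ^ k))"
  proof -
    fix k
    define u where "u = Re (of_real (c k) * (z ^ k - inverse z ^ k))"
    have "\<bar>u\<bar> = c k * \<bar>Re (z ^ k - inverse z ^ k)\<bar>"
      using c(1)[of k] by (simp add: u_def abs_mult)
    also have "\<dots> \<le> c k * (2 * real k * L * inverse (norm z) ^ k)"
      using abs_Re_power_diff_inverse_le[OF z, of k] c(1) by (intro mult_left_mono) (auto simp: L_def)
    also have "\<dots> = 2 * real k * L * (c k * inverse (norm z) ^ k)" by simp
    also have "\<dots> \<le> 2 * real k * L * (sqrt R ^ k / (1 - R ^ 2))"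
      using c(2) L by (intro mult_left_mono) auto
    finally have "- (2 * real k * L * (sqrt R ^ k / (1 - R ^ 2))) \<le> u" by linarith
    moreover have "- (4 / (1 - R ^ 2) * L) * (real k * sqrt R ^ k) = 2 * - (2 * real k * L * (sqrt R ^ k / (1 - R ^ 2)))"
      by simp
    ultimately show "- (4 / (1 - R ^ 2) * L) * (real k * sqrt R ^ k) \<le> 2 * Re (of_real (c k) * (z ^ k - inverse z ^ k))"
      unfolding u_def by (metis mult_left_mono zero_le_numeral)
  qed
  have "- (4 / (1 - R ^ 2) * L) * (\<Sum>k. real k * sqrt R ^ k) \<le> 2 * Re S"
    by (rule sums_le[OF C B A])
  then show ?thesis by (simp add: villat_bound_def L_def mult_ac)
qed

text \<open>The fraction (1 + z) / (1 - z) has nonnegative real part in the disc. The rest of the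
  first kernel, and the whole of the second, is a series in z^k - z^(-k) with nonnegative
  coefficients, whose real part is of order - ln |z|.\<close>

lemma Re_villat_kernel_ge:
  assumes r: "0 < r" "r \<le> R" "R < 1" and z: "sqrt R \<le> norm z" "norm z < 1"
  shows "Re (villat_kernel r z) \<ge> - villat_bound R * (- ln (norm z))"
    and "Re (1 - villat_kernel r (of_real r / z)) \<ge> - villat_bound R * (- ln (norm z))"
proof -
  have R: "0 < R" "R < 1" "r < 1" using r by auto
  then have "R = sqrt R * sqrt R" "sqrt R < 1" "0 < sqrt R" by auto
  then have RsR: "R < sqrt R" using mult_strict_left_mono[of "sqrt R" 1 "sqrt R"] by linarith
  then have za: "z \<in> annulus r" and z0: "0 < norm z" using r z R by (auto simp: annulus_def)
  have R2: "1 - R ^ 2 > 0" "r ^ 2 \<le> R ^ 2" using r by (auto simp: power_less_one_iff intro!: power_mono)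
  have rz: "r / norm z \<le> sqrt R"
  proof -
    have "r / norm z \<le> R / sqrt R" using r z R by (intro frac_le) auto
    then show ?thesis using R by (simp add: real_div_sqrt)
  qed
  have key: "c * inverse (norm z) ^ k \<le> sqrt R ^ k / (1 - R ^ 2)" if "0 \<le> c" "c \<le> r ^ k / (1 - r ^ 2)" for c k
  proof -
    have "c * inverse (norm z) ^ k \<le> r ^ k / (1 - r ^ 2) * inverse (norm z) ^ k"
      using that by (intro mult_right_mono) auto
    also have "\<dots> = (r / norm z) ^ k / (1 - r ^ 2)" by (simp add: power_divide power_inverse divide_inverse power_mult_distrib mult_ac)
    also have "\<dots> \<le> sqrt R ^ k / (1 - R ^ 2)"
      using rz r R2 by (intro frac_le power_mono) auto
    finally show ?thesis .
  qed
  have "2 * Re (\<Sum>k. of_real (villat_q r k) * (z ^ k - inverse z ^ k)) \<ge> - villat_bound R * (- ln (norm z))"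
  proof (rule Re_suminf_villat_ge[OF R(1,2) z0 z(2)])
    show "(\<lambda>k. of_real (villat_q r k) * (z ^ k - inverse z ^ k)) sums (\<Sum>k. of_real (villat_q r k) * (z ^ k - inverse z ^ k))"
      by (rule summable_sums[OF summable_norm_cancel[OF villat_kernel_expansion(1)[OF r(1) R(3) za]]])
    show "villat_q r k * inverse (norm z) ^ k \<le> sqrt R ^ k / (1 - R ^ 2)" for k
    proof (rule key)
      have "r ^ (2 * k) \<le> r ^ k" using r by (intro power_decreasing) auto
      then have "r ^ (2 * k) / (1 - r ^ 2) \<le> r ^ k / (1 - r ^ 2)"
        using R2 by (intro divide_right_mono) auto
      then show "villat_q r k \<le> r ^ k / (1 - r ^ 2)" using villat_q_bounds(2)[OF r(1) R(3), of k] by linarith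
    qed (use villat_q_bounds[OF r(1) R(3)] in auto)
  qed (use villat_q_bounds[OF r(1) R(3)] in auto)
  moreover have "Re ((1 + z) / (1 - z)) \<ge> 0"
  proof -
    have "norm z ^ 2 \<le> 1" using z by (simp add: power_le_one)
    then have "(Re z)\<^sup>2 + (Im z)\<^sup>2 \<le> 1" by (simp add: cmod_power2)
    then have "(1 + Re z) * (1 - Re z) + Im z * (- Im z) \<ge> 0" by (simp add: power2_eq_square algebra_simps)
    then show ?thesis by (simp add: Re_divide)
  qed
  ultimately show "Re (villat_kernel r z) \<ge> - villat_bound R * (- ln (norm z))"
    unfolding villat_kernel_expansion(2)[OF r(1) R(3) za] by simp
  have "2 * Re ((1 - villat_kernel r (of_real r / z)) / 2) \<ge> - villat_bound R * (- ln (norm z))"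
  proof (rule Re_suminf_villat_ge[OF R(1,2) z0 z(2)])
    show "(\<lambda>k. of_real (villat_p r k) * (z ^ k - inverse z ^ k)) sums ((1 - villat_kernel r (of_real r / z)) / 2)"
      using sums_divide[OF villat_co_kernel_sums[OF r(1) R(3) za], of 2] by simp
    show "villat_p r k * inverse (norm z) ^ k \<le> sqrt R ^ k / (1 - R ^ 2)" for k
      using villat_p_bounds[OF r(1) R(3)] by (intro key) auto
  qed (use villat_p_bounds[OF r(1) R(3)] in auto)
  then show "Re (1 - villat_kernel r (of_real r / z)) \<ge> - villat_bound R * (- ln (norm z))" by simp
qed

section \<open>Integrals of the kernels against measures on the circle\<close>

lemma circle_measure_space:
  assumes "sets m = sets (restrict_space borel (sphere (0::complex) 1))"
  shows "space m = sphere 0 1" and "sphere 0 1 \<in> sets m"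
proof -
  show "space m = sphere 0 1" using sets_eq_imp_space_eq[OF assms] by (simp add: space_restrict_space)
  then show "sphere 0 1 \<in> sets m" by (metis sets.top)
qed

lemma circle_measurable:
  fixes g :: "complex \<Rightarrow> 'a::topological_space"
  assumes "sets m = sets (restrict_space borel (sphere (0::complex) 1))" and "continuous_on (sphere 0 1) g"
  shows "g \<in> borel_measurable m"
  unfolding measurable_cong_sets[OF assms(1) refl]
  by (rule borel_measurable_continuous_on_restrict[OF assms(2)])

text \<open>On the unit circle the terms are bounded by the summable constants |a k| + |b k|, so sum
  and integral may be exchanged. An integral of a kernel thereby becomes a series in the moments of
  the measure.\<close>

lemma circle_series_integral:
  fixes a b :: "nat \<Rightarrow> complex"
  assumes m: "sets m = sets (restrict_space borel (sphere (0::complex) 1))" "emeasure m (sphere 0 1) < \<infinity>"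
    and s: "\<And>\<xi>. norm \<xi> = 1 \<Longrightarrow> (\<lambda>k. a k * \<xi> powi (- int k) + b k * \<xi> powi int k) sums g \<xi>"
    and a: "summable (\<lambda>k. norm (a k))" and b: "summable (\<lambda>k. norm (b k))"
  shows "integrable m g"
    and "(\<lambda>k. a k * (\<integral>\<xi>. \<xi> powi (- int k) \<partial>m) + b k * (\<integral>\<xi>. \<xi> powi int k \<partial>m)) sums (\<integral>\<xi>. g \<xi> \<partial>m)"
proof -
  note sp = circle_measure_space[OF m(1)]
  interpret finite_measure m by (intro finite_measureI) (use m sp in auto)
  define f where "f = (\<lambda>k \<xi>. a k * \<xi> powi (- int k) + b k * \<xi> powi int k)"
  have pint: "integrable m (\<lambda>\<xi>. \<xi> powi n)" for n
    by (rule integrable_const_bound[where B = 1])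
       (use sp in \<open>auto intro!: AE_I2 circle_measurable[OF m(1)] continuous_intros simp: norm_power_int\<close>)
  have fint: "integrable m (f k)" for k
    unfolding f_def by (intro Bochner_Integration.integrable_add integrable_mult_right pint)
  have fb: "norm (f k \<xi>) \<le> norm (a k) + norm (b k)" if "\<xi> \<in> space m" for k \<xi>
    using norm_triangle_ineq[of "a k * \<xi> powi (- int k)" "b k * \<xi> powi int k"] that sp(1)
    by (simp add: f_def norm_mult norm_power norm_power_int)
  have sab: "summable (\<lambda>k. norm (a k) + norm (b k))" using a b by (rule summable_add)
  have S1: "AE \<xi> in m. summable (\<lambda>k. norm (f k \<xi>))"
    using fb by (intro AE_I2 summable_comparison_test[OF _ sab]) auto
  have S2: "summable (\<lambda>k. \<integral>\<xi>. norm (f k \<xi>) \<partial>m)"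
  proof (rule summable_comparison_test)
    have "(\<integral>\<xi>. norm (f k \<xi>) \<partial>m) \<le> measure m (space m) * (norm (a k) + norm (b k))" for k
    proof -
      have "(\<integral>\<xi>. norm (f k \<xi>) \<partial>m) \<le> (\<integral>\<xi>. norm (a k) + norm (b k) \<partial>m)"
        using fint fb by (intro Bochner_Integration.integral_mono integrable_norm) auto
      then show ?thesis by simp
    qed
    then show "\<exists>N. \<forall>k\<ge>N. norm (\<integral>\<xi>. norm (f k \<xi>) \<partial>m) \<le> measure m (space m) * (norm (a k) + norm (b k))"
      by (auto simp: )
    show "summable (\<lambda>k. measure m (space m) * (norm (a k) + norm (b k)))"
      using sab by (rule summable_mult)
  qed
  have g: "g \<xi> = (\<Sum>k. f k \<xi>)" if "\<xi> \<in> space m" for \<xi>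
    using s[of \<xi>] that sp(1) by (simp add: f_def sums_iff)
  show "integrable m g"
    using integrable_suminf[OF fint S1 S2] by (subst Bochner_Integration.integrable_cong[OF refl g])
  have "(\<lambda>k. \<integral>\<xi>. f k \<xi> \<partial>m) sums (\<integral>\<xi>. (\<Sum>k. f k \<xi>) \<partial>m)"
    by (rule sums_integral[OF fint S1 S2])
  moreover have "(\<integral>\<xi>. f k \<xi> \<partial>m) = a k * (\<integral>\<xi>. \<xi> powi (- int k) \<partial>m) + b k * (\<integral>\<xi>. \<xi> powi int k \<partial>m)" for k
    unfolding f_def Bochner_Integration.integral_add[OF integrable_mult_right[OF pint] integrable_mult_right[OF pint]]
    by simp
  moreover have "(\<integral>\<xi>. (\<Sum>k. f k \<xi>) \<partial>m) = (\<integral>\<xi>. g \<xi> \<partial>m)"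
    by (intro Bochner_Integration.integral_cong refl) (simp add: g)
  ultimately show "(\<lambda>k. a k * (\<integral>\<xi>. \<xi> powi (- int k) \<partial>m) + b k * (\<integral>\<xi>. \<xi> powi int k \<partial>m)) sums (\<integral>\<xi>. g \<xi> \<partial>m)"
    by simp
qed

lemma villat_summable:
  assumes r: "0 < r" "r < 1" and z: "z \<in> annulus r"
  shows "summable (\<lambda>k. norm (of_real (villat_q r k) * inverse z ^ k))"
    and "summable (\<lambda>k. norm (of_real (villat_p r k) * inverse z ^ k))"
    and "summable (\<lambda>k. norm (of_real (villat_q r k) * z ^ k))"
    and "summable (\<lambda>k. norm (of_real (villat_p r k) * z ^ k))"
    and "summable (\<lambda>k. norm (z ^ k))"
proof -
  have nz: "r < norm z" "norm z < 1" "0 < norm z" using r z by (auto simp: annulus_def)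
  have c: "1 - r ^ 2 > 0" using power_even_bounds(2)[OF r, of 1] by simp
  show sz: "summable (\<lambda>k. norm (z ^ k))" using nz by (simp add: norm_power summable_geometric)
  have rz: "summable (\<lambda>k. (r / norm z) ^ k / (1 - r ^ 2))"
    using nz r by (intro summable_divide summable_geometric) (simp add: divide_less_eq_1)
  have q: "0 \<le> villat_q r k" "villat_q r k \<le> r ^ k / (1 - r ^ 2)" for k
  proof -
    have "r ^ (2 * k) \<le> r ^ k" using r by (intro power_decreasing) auto
    then have "r ^ (2 * k) / (1 - r ^ 2) \<le> r ^ k / (1 - r ^ 2)" using c by (intro divide_right_mono) auto
    then show "0 \<le> villat_q r k" "villat_q r k \<le> r ^ k / (1 - r ^ 2)"
      using villat_q_bounds[OF r, of k] by linarith+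
  qed
  have A: "summable (\<lambda>k. norm (of_real (c k) * inverse z ^ k))"
    if "\<And>k. 0 \<le> c k" "\<And>k. c k \<le> r ^ k / (1 - r ^ 2)" for c :: "nat \<Rightarrow> real"
  proof (rule summable_comparison_test[OF _ rz])
    have "norm (of_real (c k) * inverse z ^ k) \<le> (r / norm z) ^ k / (1 - r ^ 2)" for k
    proof -
      have "norm (of_real (c k) * inverse z ^ k) = c k * inverse (norm z) ^ k"
        using that(1)[of k] by (simp add: norm_mult norm_power norm_inverse)
      also have "\<dots> \<le> r ^ k / (1 - r ^ 2) * inverse (norm z) ^ k"
        using that(2) by (intro mult_right_mono) auto
      also have "\<dots> = (r / norm z) ^ k / (1 - r ^ 2)"
        by (simp only: divide_inverse power_mult_distrib mult_ac)
      finally show ?thesis .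
    qed
    then show "\<exists>N. \<forall>k\<ge>N. norm (norm (of_real (c k) * inverse z ^ k)) \<le> (r / norm z) ^ k / (1 - r ^ 2)" by simp
  qed
  have B: "summable (\<lambda>k. norm (of_real (c k) * z ^ k))"
    if "\<And>k. 0 \<le> c k" "\<And>k. c k \<le> r ^ k / (1 - r ^ 2)" for c :: "nat \<Rightarrow> real"
  proof (rule summable_comparison_test)
    have "norm (of_real (c k) * z ^ k) \<le> 1 / (1 - r ^ 2) * norm (z ^ k)" for k
    proof -
      have "r ^ k \<le> 1" using r by (intro power_le_one) auto
      then have "r ^ k / (1 - r ^ 2) \<le> 1 / (1 - r ^ 2)" using c by (intro divide_right_mono) auto
      then have "c k \<le> 1 / (1 - r ^ 2)" using that(2)[of k] by linarith
      then show ?thesis using that(1)[of k] by (simp add: norm_mult mult_right_mono del: times_divide_eq_left)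
    qed
    then show "\<exists>N. \<forall>k\<ge>N. norm (norm (of_real (c k) * z ^ k)) \<le> 1 / (1 - r ^ 2) * norm (z ^ k)" by simp
    show "summable (\<lambda>k. 1 / (1 - r ^ 2) * norm (z ^ k))" using sz by (rule summable_mult)
  qed
  show "summable (\<lambda>k. norm (of_real (villat_q r k) * inverse z ^ k))" by (rule A[OF q])
  show "summable (\<lambda>k. norm (of_real (villat_p r k) * inverse z ^ k))" by (rule A[OF villat_p_bounds[OF r]])
  show "summable (\<lambda>k. norm (of_real (villat_q r k) * z ^ k))" by (rule B[OF q])
  show "summable (\<lambda>k. norm (of_real (villat_p r k) * z ^ k))" by (rule B[OF villat_p_bounds[OF r]])
qed

lemma annulus_rotate: "norm \<xi> = 1 \<Longrightarrow> z / \<xi> \<in> annulus r \<longleftrightarrow> z \<in> annulus r"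
  by (simp add: annulus_def norm_divide)

lemma divide_power_powi:
  fixes z \<xi> :: complex
  shows "(z / \<xi>) ^ k = z ^ k * \<xi> powi (- int k)" and "inverse (z / \<xi>) ^ k = inverse z ^ k * \<xi> powi int k"
  by (simp_all add: power_divide power_int_minus divide_inverse power_mult_distrib power_inverse)

lemma villat_kernel_integral:
  assumes r: "0 < r" "r < 1" and z: "z \<in> annulus r"
    and m: "sets m = sets (restrict_space borel (sphere (0::complex) 1))" "emeasure m (sphere 0 1) < \<infinity>"
  defines "e \<equiv> \<lambda>n. \<integral>\<xi>. \<xi> powi n \<partial>m"
  shows "integrable m (\<lambda>\<xi>. villat_kernel r (z / \<xi>))"
    and "(\<lambda>k. if k = 0 then e 0 else 2 * (of_real (1 + villat_q r k) * z ^ k * e (- int k) - of_real (villat_q r k) * inverse z ^ k * e (int k)))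
      sums (\<integral>\<xi>. villat_kernel r (z / \<xi>) \<partial>m)"
    and "integrable m (\<lambda>\<xi>. 1 - villat_kernel r (of_real r * \<xi> / z))"
    and "(\<lambda>k. 2 * of_real (villat_p r k) * (z ^ k * e (- int k) - inverse z ^ k * e (int k)))
      sums (\<integral>\<xi>. 1 - villat_kernel r (of_real r * \<xi> / z) \<partial>m)"
proof -
  define a where "a = (\<lambda>k. if k = 0 then 1 else 2 * (of_real (1 + villat_q r k) * z ^ k))"
  define b where "b = (\<lambda>k. - 2 * (of_real (villat_q r k) * inverse z ^ k))"
  have "summable (\<lambda>k. norm (2 * z ^ k) + norm (2 * (of_real (villat_q r k) * z ^ k)))"
    using villat_summable[OF r z] by (intro summable_add) (simp_all only: norm_mult summable_mult)
  moreover have "norm (a k) \<le> norm (2 * z ^ k) + norm (2 * (of_real (villat_q r k) * z ^ k))" for k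
  proof (cases "k = 0")
    case False
    then have "a k = 2 * z ^ k + 2 * (of_real (villat_q r k) * z ^ k)" by (simp add: a_def algebra_simps)
    then show ?thesis using norm_triangle_ineq by metis
  qed (simp add: a_def)
  ultimately have a: "summable (\<lambda>k. norm (a k))"
    by (intro summable_comparison_test[of "\<lambda>k. norm (a k)"]) auto
  have b: "summable (\<lambda>k. norm (b k))"
    using summable_mult[OF villat_summable(1)[OF r z], of 2] by (simp add: b_def norm_mult)
  have s: "(\<lambda>k. a k * \<xi> powi (- int k) + b k * \<xi> powi int k) sums villat_kernel r (z / \<xi>)" if "norm \<xi> = 1" for \<xi>
  proof -
    have "z / \<xi> \<in> annulus r" using z that by (simp add: annulus_rotate)
    from villat_kernel_sums[OF r this, unfolded divide_power_powi] show ?thesis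
      by (rule sums_cong[THEN iffD1, rotated]) (auto simp: a_def b_def algebra_simps)
  qed
  show "integrable m (\<lambda>\<xi>. villat_kernel r (z / \<xi>))"
    by (rule circle_series_integral(1)[OF m s a b])
  have "(\<lambda>k. a k * e (- int k) + b k * e (int k)) sums (\<integral>\<xi>. villat_kernel r (z / \<xi>) \<partial>m)"
    unfolding e_def by (rule circle_series_integral(2)[OF m s a b])
  then show "(\<lambda>k. if k = 0 then e 0 else 2 * (of_real (1 + villat_q r k) * z ^ k * e (- int k) - of_real (villat_q r k) * inverse z ^ k * e (int k)))
      sums (\<integral>\<xi>. villat_kernel r (z / \<xi>) \<partial>m)"
    by (rule sums_cong[THEN iffD1, rotated]) (auto simp: a_def b_def algebra_simps)
next
  define a where "a = (\<lambda>k. 2 * (of_real (villat_p r k) * z ^ k))"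
  define b where "b = (\<lambda>k. - 2 * (of_real (villat_p r k) * inverse z ^ k))"
  have a: "summable (\<lambda>k. norm (a k))"
    using summable_mult[OF villat_summable(4)[OF r z], of 2] by (simp add: a_def norm_mult)
  have b: "summable (\<lambda>k. norm (b k))"
    using summable_mult[OF villat_summable(2)[OF r z], of 2] by (simp add: b_def norm_mult)
  have s: "(\<lambda>k. a k * \<xi> powi (- int k) + b k * \<xi> powi int k) sums (1 - villat_kernel r (of_real r * \<xi> / z))" if "norm \<xi> = 1" for \<xi>
  proof -
    have "z / \<xi> \<in> annulus r" using z that by (simp add: annulus_rotate)
    from villat_co_kernel_sums[OF r this, unfolded divide_power_powi]
    have "(\<lambda>k. 2 * of_real (villat_p r k) * (z ^ k * \<xi> powi (- int k) - inverse z ^ k * \<xi> powi int k)) sums (1 - villat_kernel r (of_real r * \<xi> / z))"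
      by simp
    then show ?thesis
      by (rule sums_cong[THEN iffD1, rotated]) (auto simp: a_def b_def algebra_simps)
  qed
  show "integrable m (\<lambda>\<xi>. 1 - villat_kernel r (of_real r * \<xi> / z))"
    by (rule circle_series_integral(1)[OF m s a b])
  have "(\<lambda>k. a k * e (- int k) + b k * e (int k)) sums (\<integral>\<xi>. 1 - villat_kernel r (of_real r * \<xi> / z) \<partial>m)"
    unfolding e_def by (rule circle_series_integral(2)[OF m s a b])
  then show "(\<lambda>k. 2 * of_real (villat_p r k) * (z ^ k * e (- int k) - inverse z ^ k * e (int k)))
      sums (\<integral>\<xi>. 1 - villat_kernel r (of_real r * \<xi> / z) \<partial>m)"
    by (rule sums_cong[THEN iffD1, rotated]) (auto simp: a_def b_def algebra_simps)
qed

text \<open>Write e1 and e2 for the moments. By the expansions of the kernels, the coefficient of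
  z^n in the sum of the two integrals is 2 (e1(-n) + r^n e2(-n)) / (1 - r^(2n)); this one formula
  serves both signs of n, so \<open>coeff\<close> is a single condition. It settles every degree
  except 0, where the sum of the integrals contributes the mass of \<open>m1\<close>, and the
  constants in front account for that.\<close>

theorem villat_representation:
  assumes r: "0 < r" "r < 1" and f: "f holomorphic_on annulus r" and \<rho>: "r < \<rho>" "\<rho> < 1"
    and m1: "sets m1 = sets (restrict_space borel (sphere (0::complex) 1))" "emeasure m1 (sphere 0 1) < \<infinity>"
    and m2: "sets m2 = sets (restrict_space borel (sphere (0::complex) 1))" "emeasure m2 (sphere 0 1) < \<infinity>"
    and coeff: "\<And>n. n \<noteq> 0 \<Longrightarrow> (\<integral>\<xi>. \<xi> powi (-n) \<partial>m1) + of_real (r powi n) * (\<integral>\<xi>. \<xi> powi (-n) \<partial>m2) =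
        - laurent_coeff f \<rho> n * of_real (1 - r powi (2 * n)) / 2"
    and z: "z \<in> annulus r"
  shows "f z = laurent_coeff f \<rho> 0 + (\<integral>\<xi>. 1 \<partial>m1) -
    ((\<integral>\<xi>. villat_kernel r (z / \<xi>) \<partial>m1) + (\<integral>\<xi>. 1 - villat_kernel r (of_real r * \<xi> / z) \<partial>m2))"
proof -
  define a where "a = laurent_coeff f \<rho>"
  define e1 where "e1 = (\<lambda>n. \<integral>\<xi>. \<xi> powi n \<partial>m1)"
  define e2 where "e2 = (\<lambda>n. \<integral>\<xi>. \<xi> powi n \<partial>m2)"
  define T where "T = (\<lambda>k. (if k = 0 then e1 0 else 2 * (of_real (1 + villat_q r k) * z ^ k * e1 (- int k) - of_real (villat_q r k) * inverse z ^ k * e1 (int k)))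
     + 2 * of_real (villat_p r k) * (z ^ k * e2 (- int k) - inverse z ^ k * e2 (int k)))"
  define H where "H = (\<integral>\<xi>. villat_kernel r (z / \<xi>) \<partial>m1) + (\<integral>\<xi>. 1 - villat_kernel r (of_real r * \<xi> / z) \<partial>m2)"
  have T: "T sums H"
    unfolding T_def H_def e1_def e2_def
    by (intro sums_add villat_kernel_integral(2,4) r z m1 m2)
  have co: "e1 (-n) + of_real (r powi n) * e2 (-n) = - a n * of_real (1 - r powi (2 * n)) / 2" if "n \<noteq> 0" for n
    using coeff[OF that] by (simp add: e1_def e2_def a_def)
  have Tk: "T k = - (a (int k) * z powi int k + a (- int k) * z powi (- int k))" if "k > 0" for k
  proof -
    define x where "x = r ^ k"
    have x: "0 < x" "x < 1" using r that by (auto simp: x_def power_less_one_iff)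
    have x2: "x * x < 1" using mult_strict_mono[of x 1 x 1] x by simp
    then have cx: "complex_of_real (x * x) \<noteq> 1" using of_real_eq_1_iff[of "x * x"] by (metis less_irrefl)
    have pw: "r powi int k = x" "r powi (- int k) = inverse x" "r powi (2 * int k) = x * x" "r powi (2 * - int k) = inverse (x * x)"
    proof -
      show 1: "r powi int k = x" "r powi (- int k) = inverse x" by (simp_all add: x_def power_int_minus)
      have "r powi (2 * int k) = r ^ (2 * k)" using power_int_of_nat[of r "2 * k"] by simp
      moreover have "r ^ (2 * k) = x * x" by (simp add: x_def mult_2 power_add)
      ultimately show "r powi (2 * int k) = x * x" by simp
      then show "r powi (2 * - int k) = inverse (x * x)" using power_int_minus[of r "2 * int k"] by simp
    qed
    have qp: "villat_q r k = x * x / (1 - x * x)" "1 + villat_q r k = 1 / (1 - x * x)" "villat_p r k = x / (1 - x * x)"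
    proof -
      have "r ^ (2 * k) = x * x" by (simp add: x_def mult_2 power_add)
      then show "villat_q r k = x * x / (1 - x * x)" "1 + villat_q r k = 1 / (1 - x * x)" "villat_p r k = x / (1 - x * x)"
        using x2 by (simp_all add: villat_q_def villat_p_def flip: x_def) (simp add: field_simps)
    qed
    have A: "a (int k) = - 2 * (e1 (- int k) + x * e2 (- int k)) / (1 - x * x)"
      using co[of "int k"] that x2 cx unfolding pw by (simp add: field_simps)
    have B: "a (- int k) = 2 * (x * x * e1 (int k) + x * e2 (int k)) / (1 - x * x)"
    proof -
      have "e1 (int k) + inverse x * e2 (int k) = - a (- int k) * of_real (1 - inverse (x * x)) / 2"
        using co[of "- int k"] that unfolding pw by simp
      then have "(x * x) * (e1 (int k) + inverse x * e2 (int k)) = (x * x) * (- a (- int k) * of_real (1 - inverse (x * x)) / 2)"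
        by simp
      moreover have "(x * x) * (e1 (int k) + inverse x * e2 (int k)) = x * x * e1 (int k) + x * e2 (int k)"
        using x by (simp add: field_simps)
      moreover have "(x * x) * (- a (- int k) * of_real (1 - inverse (x * x)) / 2) = a (- int k) * (1 - x * x) / 2"
        using x by (simp add: field_simps)
      ultimately have "x * x * e1 (int k) + x * e2 (int k) = a (- int k) * (1 - x * x) / 2" by (simp only:)
      then show ?thesis using cx by (simp add: field_simps)
    qed
    have "T k = 2 * (1 / (1 - x * x) * (e1 (- int k) + x * e2 (- int k))) * z ^ k - 2 * (1 / (1 - x * x) * (x * x * e1 (int k) + x * e2 (int k))) * inverse z ^ k"
      using that unfolding T_def unfolding qp(2) unfolding qp(1,3) by (simp add: algebra_simps)
    also have "\<dots> = - (a (int k) * z powi int k + a (- int k) * z powi (- int k))"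
      unfolding A B by (simp add: power_int_minus power_inverse divide_inverse algebra_simps)
    finally show ?thesis .
  qed
  have T0: "T 0 = e1 0" by (simp add: T_def)
  have "(\<Sum>k<Suc N. T k) = e1 0 + a 0 - (\<Sum>n\<in>{- int N..int N}. a n * z powi n)" for N
  proof -
    have "(\<Sum>k<Suc N. T k) = T 0 + (\<Sum>k=1..N. T k)"
      using sum.lessThan_Suc_shift[of T N] sum.atLeast1_atMost_eq[of T N] by simp
    also have "(\<Sum>k=1..N. T k) = (\<Sum>k=1..N. - (a (int k) * z powi int k + a (- int k) * z powi (- int k)))"
      by (intro sum.cong refl) (simp add: Tk)
    finally show ?thesis unfolding T0 sum_symmetric_int sum_negf by simp
  qed
  moreover have "(\<lambda>N. e1 0 + a 0 - (\<Sum>n\<in>{- int N..int N}. a n * z powi n)) \<longlonglongrightarrow> e1 0 + a 0 - f z"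
    unfolding a_def by (intro tendsto_intros laurent_expansion[OF f r(1) z \<rho>])
  moreover have "(\<lambda>N. \<Sum>k<Suc N. T k) \<longlonglongrightarrow> H"
    using T unfolding sums_def by (rule LIMSEQ_Suc)
  ultimately have "H = e1 0 + a 0 - f z" by (simp only: LIMSEQ_unique)
  then show ?thesis by (simp add: H_def e1_def a_def)
qed

section \<open>Integral equations with holomorphic right-hand side\<close>

text \<open>The integral form has no exceptional set of times and passes to limits. Integrability is
  demanded explicitly, since \<open>integral\<close> has a default value on functions that are not
  integrable; its absolute form yields absolute continuity of the solution.\<close>

definition integral_solution :: "(real \<Rightarrow> complex \<Rightarrow> complex) \<Rightarrow> real \<Rightarrow> real \<Rightarrow> (real \<Rightarrow> complex) \<Rightarrow> bool" where
  "integral_solution F s T x \<longleftrightarrow> (\<lambda>t. F t (x t)) absolutely_integrable_on {s..T} \<and>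
     (\<forall>t\<in>{s..T}. x t = x s + integral {s..t} (\<lambda>\<tau>. F \<tau> (x \<tau>)))"

lemma integral_solution_subset:
  assumes "integral_solution F s T x" "s \<le> T'" "T' \<le> T"
  shows "integral_solution F s T' x"
proof -
  have "(\<lambda>t. F t (x t)) absolutely_integrable_on {s..T'}"
    using assms unfolding integral_solution_def
    by (auto intro: absolutely_integrable_on_subinterval)
  moreover have "\<forall>t\<in>{s..T'}. x t = x s + integral {s..t} (\<lambda>\<tau>. F \<tau> (x \<tau>))"
    using assms unfolding integral_solution_def by (meson atLeastAtMost_iff order_trans)
  ultimately show ?thesis unfolding integral_solution_def ..
qed

lemma integral_solution_AC:
  assumes "integral_solution F s T x"
  shows "abs_continuous_on_interval s T x"
    and "AE t in lebesgue. t \<in> {s..T} \<longrightarrow> (x has_vector_derivative F t (x t)) (at t within {s..T})"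
  using assms unfolding integral_solution_def
  by (blast intro: indefinite_integral_AC[where g = "\<lambda>t. F t (x t)" and c = "x s"])+

lemma integral_solution_continuous:
  assumes "integral_solution F s T x"
  shows "continuous_on {s..T} x"
  using integral_solution_AC(1)[OF assms] by (rule abs_continuous_on_interval_imp_continuous_on)

lemma continuous_on_Icc_measurable:
  fixes x :: "real \<Rightarrow> complex"
  assumes "continuous_on {s..T} x"
  shows "x \<in> borel_measurable (lebesgue_on {s..T})"
  using assms by (rule continuous_imp_measurable_on_sets_lebesgue) simp

text \<open>With the difference quotient \<open>a\<close> of the field along the two solutions,
  their difference satisfies a linear equation, to which \<open>linear_ode_exp\<close> applies. At
  times where the solutions coincide \<open>a\<close> is 0, and the increment of the field is still
  \<open>a t\<close> times that of the solutions. The exponential formula, beyond the Gronwall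
  bound, is what later yields the derivative with respect to the initial value.\<close>

lemma integral_solution_difference:
  assumes x: "integral_solution F s T x" and y: "integral_solution F s T y"
    and \<kappa>: "\<kappa> integrable_on {s..T}"
    and lip: "\<And>t. t \<in> {s..T} \<Longrightarrow> norm (F t (x t) - F t (y t)) \<le> \<kappa> t * norm (x t - y t)"
    and \<kappa>0: "\<And>t. t \<in> {s..T} \<Longrightarrow> 0 \<le> \<kappa> t"
  defines "a \<equiv> \<lambda>t. if x t = y t then 0 else (F t (x t) - F t (y t)) / (x t - y t)"
  shows "a absolutely_integrable_on {s..T}"
    and "\<And>t. t \<in> {s..T} \<Longrightarrow> norm (a t) \<le> \<kappa> t"
    and "\<And>t. t \<in> {s..T} \<Longrightarrow> x t - y t = (x s - y s) * exp (integral {s..t} a)"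
    and "\<And>t. t \<in> {s..T} \<Longrightarrow> norm (x t - y t) \<le> norm (x s - y s) * exp (integral {s..T} \<kappa>)"
proof -
  have Fx: "(\<lambda>t. F t (x t)) absolutely_integrable_on {s..T}" and Fy: "(\<lambda>t. F t (y t)) absolutely_integrable_on {s..T}"
    using x y by (auto simp: integral_solution_def)
  show b: "norm (a t) \<le> \<kappa> t" if "t \<in> {s..T}" for t
    using lip[OF that] \<kappa>0[OF that] by (auto simp: a_def norm_divide divide_le_eq)
  have [measurable]: "(\<lambda>t. F t (x t)) \<in> borel_measurable (lebesgue_on {s..T})"
    "(\<lambda>t. F t (y t)) \<in> borel_measurable (lebesgue_on {s..T})"
    using Fx Fy by (auto intro!: absolutely_integrable_imp_borel_measurable)
  have [measurable]: "x \<in> borel_measurable (lebesgue_on {s..T})" "y \<in> borel_measurable (lebesgue_on {s..T})"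
    using x y by (auto intro!: continuous_on_Icc_measurable integral_solution_continuous)
  have am: "a \<in> borel_measurable (lebesgue_on {s..T})"
    unfolding a_def by measurable
  show a: "a absolutely_integrable_on {s..T}"
    by (rule measurable_bounded_by_integrable_imp_absolutely_integrable[OF am _ \<kappa> b]) auto
  have aF: "F t (x t) - F t (y t) = a t * (x t - y t)" for t by (simp add: a_def)
  have eq: "x t - y t = x s - y s + integral {s..t} (\<lambda>\<tau>. F \<tau> (x \<tau>) - F \<tau> (y \<tau>))" if "t \<in> {s..T}" for t
  proof -
    have "(\<lambda>\<tau>. F \<tau> (x \<tau>)) integrable_on {s..t}" "(\<lambda>\<tau>. F \<tau> (y \<tau>)) integrable_on {s..t}"
      using Fx Fy that by (auto intro: integrable_on_subinterval simp: absolutely_integrable_on_def)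
    then have "integral {s..t} (\<lambda>\<tau>. F \<tau> (x \<tau>) - F \<tau> (y \<tau>)) = integral {s..t} (\<lambda>\<tau>. F \<tau> (x \<tau>)) - integral {s..t} (\<lambda>\<tau>. F \<tau> (y \<tau>))"
      by (rule Henstock_Kurzweil_Integration.integral_diff)
    moreover have "x t = x s + integral {s..t} (\<lambda>\<tau>. F \<tau> (x \<tau>))" "y t = y s + integral {s..t} (\<lambda>\<tau>. F \<tau> (y \<tau>))"
      using x y that unfolding integral_solution_def by blast+
    ultimately show ?thesis by (simp add: algebra_simps)
  qed
  show ex: "x t - y t = (x s - y s) * exp (integral {s..t} a)" if "t \<in> {s..T}" for t
    by (rule linear_ode_exp[OF a set_integral_diff(1)[OF Fx Fy] _ _ that]) (erule eq, simp add: aF)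
  show "norm (x t - y t) \<le> norm (x s - y s) * exp (integral {s..T} \<kappa>)" if t: "t \<in> {s..T}" for t
  proof -
    have "norm (integral {s..t} a) \<le> integral {s..t} \<kappa>"
      using a \<kappa> b t by (intro Henstock_Kurzweil_Integration.integral_norm_bound_integral)
        (auto intro: integrable_on_subinterval simp: absolutely_integrable_on_def)
    also have "\<dots> \<le> integral {s..T} \<kappa>"
      using t \<kappa> \<kappa>0 by (intro integral_subset_le) (auto intro: integrable_on_subinterval)
    finally have "norm (exp (integral {s..t} a)) \<le> exp (integral {s..T} \<kappa>)"
      using norm_exp[of "integral {s..t} a"] by (meson dual_order.trans exp_le_cancel_iff)
    then show ?thesis unfolding ex[OF t] norm_mult by (intro mult_left_mono) auto
  qed
qed

text \<open>Cauchy's inequality on discs of radius \<open>e\<close> bounds the derivative on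
  \<open>S\<close>, and convexity of \<open>S\<close> allows integrating the bound along
  segments.\<close>

lemma holomorphic_Lipschitz:
  fixes f :: "complex \<Rightarrow> complex"
  assumes S: "convex S" and f: "f holomorphic_on U" and e: "e > 0"
    and sub: "\<And>z. z \<in> S \<Longrightarrow> cball z e \<subseteq> U" and B: "\<And>z. z \<in> U \<Longrightarrow> norm (f z) \<le> B"
    and zw: "z \<in> S" "w \<in> S"
  shows "norm (f z - f w) \<le> B / e * norm (z - w)"
proof (rule field_differentiable_bound[OF S _ _ zw])
  fix u assume u: "u \<in> S"
  have hol: "f holomorphic_on ball u e" using f sub[OF u] ball_subset_cball by (meson holomorphic_on_subset order_trans)
  then have "(f has_field_derivative deriv f u) (at u)"
    using e by (intro holomorphic_derivI[of f "ball u e"]) auto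
  then show "(f has_field_derivative deriv f u) (at u within S)" by (rule DERIV_subset) auto
  have "norm ((deriv ^^ 1) f u) \<le> fact 1 * B / e ^ 1"
  proof (rule Cauchy_inequality[OF hol])
    show "continuous_on (cball u e) f"
      using f sub[OF u] by (intro holomorphic_on_imp_continuous_on) (rule holomorphic_on_subset)
    show "norm (f x) \<le> B" if "norm (u - x) = e" for x
      using that sub[OF u] by (intro B) (auto simp: dist_norm subset_iff)
  qed (use e in auto)
  then show "norm (deriv f u) \<le> B / e" by simp
qed

text \<open>At the first time when \<open>f\<close> reaches \<open>c\<close>, the premise of
  \<open>step\<close> holds by continuity and its conclusion fails. In this bootstrap an estimate
  may be proved under the weak inequality, provided that it returns the strict one.\<close>

lemma continuous_below:
  fixes f :: "real \<Rightarrow> real"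
  assumes f: "continuous_on {s..T} f" and "f s < c"
    and step: "\<And>\<tau>. \<tau> \<in> {s..T} \<Longrightarrow> (\<And>u. u \<in> {s..\<tau>} \<Longrightarrow> f u \<le> c) \<Longrightarrow> f \<tau> < c"
    and t: "t \<in> {s..T}"
  shows "f t < c"
proof (rule ccontr)
  assume far: "\<not> f t < c"
  define A where "A = {u \<in> {s..T}. c \<le> f u}"
  have "closed A" unfolding A_def
    by (rule continuous_on_closed_Collect_le[OF continuous_on_const f closed_atLeastAtMost])
  moreover have "A = {s..T} \<inter> A" by (auto simp: A_def)
  ultimately have "compact A" using compact_Int_closed[OF compact_Icc, of A s T] by simp
  moreover have "A \<noteq> {}" using far t by (auto simp: A_def)
  ultimately obtain u where u: "u \<in> A" and least: "\<And>v. v \<in> A \<Longrightarrow> u \<le> v"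
    using compact_attains_inf[of A] by blast
  have uT: "u \<in> {s..T}" and uc: "c \<le> f u" using u by (auto simp: A_def)
  have "s < u" using uT uc \<open>f s < c\<close> by (cases "u = s") auto
  have below: "f v < c" if "v \<in> {s..<u}" for v
    using least[of v] that uT by (auto simp: A_def not_le[symmetric])
  have "f u \<le> c"
  proof (rule continuous_le_on_closure[of "{s..<u}" f])
    show "continuous_on (closure {s..<u}) f"
      using \<open>s < u\<close> uT by (auto intro: continuous_on_subset[OF f])
    show "u \<in> closure {s..<u}" using \<open>s < u\<close> by simp
  qed (use below in \<open>auto intro: less_imp_le\<close>)
  then have "f v \<le> c" if "v \<in> {s..u}" for v
    using below[of v] that by (cases "v = u") auto
  then have "f u < c" by (rule step[OF uT])
  then show False using uc by simp
qed

text \<open>The Lipschitz constant \<open>2 * \<kappa> t / e\<close> is Cauchy's estimate on discs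
  of radius e / 2 and is available only while \<open>y\<close> is within \<open>e\<close> of
  \<open>x\<close>. The condition \<open>close\<close> makes the Gronwall bound smaller than
  \<open>e\<close>, which closes the bootstrap.\<close>

lemma integral_solution_stays_close:
  assumes x: "integral_solution F s T x" and y: "integral_solution F s T y"
    and \<kappa>: "\<kappa> integrable_on {s..T}" and e: "e > 0"
    and hol: "\<And>t. t \<in> {s..T} \<Longrightarrow> F t holomorphic_on ball (x t) (2 * e)"
    and bd: "\<And>t z. t \<in> {s..T} \<Longrightarrow> z \<in> ball (x t) (2 * e) \<Longrightarrow> norm (F t z) \<le> \<kappa> t"
    and close: "norm (y s - x s) * exp (integral {s..T} (\<lambda>t. 2 * \<kappa> t / e)) < e"
    and t: "t \<in> {s..T}"
  shows "norm (y t - x t) < e"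
proof -
  define \<kappa>1 where "\<kappa>1 = (\<lambda>t. 2 * \<kappa> t / e)"
  have \<kappa>1: "\<kappa>1 integrable_on {s..T}" unfolding \<kappa>1_def using \<kappa> by (intro integrable_on_divide integrable_on_mult_right)
  have \<kappa>0: "\<kappa> u \<ge> 0" if "u \<in> {s..T}" for u
    using bd[OF that, of "x u"] e order_trans[OF norm_ge_zero] by simp
  have cx: "continuous_on {s..T} (\<lambda>u. norm (y u - x u))"
    using x y by (intro continuous_intros integral_solution_continuous)
  show ?thesis
  proof (rule continuous_below[where f = "\<lambda>t. norm (y t - x t)", OF cx _ _ t])
    have "0 \<le> integral {s..T} \<kappa>1" using \<kappa>1 \<kappa>0 e by (intro Henstock_Kurzweil_Integration.integral_nonneg) (auto simp: \<kappa>1_def)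
    then have "norm (y s - x s) * 1 \<le> norm (y s - x s) * exp (integral {s..T} \<kappa>1)" by (intro mult_left_mono) auto
    then show "norm (y s - x s) < e" using close by (simp add: \<kappa>1_def)
    fix u assume uT: "u \<in> {s..T}" and le: "\<And>v. v \<in> {s..u} \<Longrightarrow> norm (y v - x v) \<le> e"
    have sub: "integral_solution F s u x" "integral_solution F s u y" "\<kappa>1 integrable_on {s..u}"
      using x y \<kappa>1 uT by (auto intro: integral_solution_subset integrable_on_subinterval)
    have lip: "norm (F v (y v) - F v (x v)) \<le> \<kappa>1 v * norm (y v - x v)" if v: "v \<in> {s..u}" for v
    proof -
      have vT: "v \<in> {s..T}" using v uT by auto
      have "norm (F v (y v) - F v (x v)) \<le> \<kappa> v / (e / 2) * norm (y v - x v)"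
      proof (rule holomorphic_Lipschitz[of "cball (x v) e", OF _ hol[OF vT]])
        show "cball z (e / 2) \<subseteq> ball (x v) (2 * e)" if "z \<in> cball (x v) e" for z
        proof
          fix q assume "q \<in> cball z (e / 2)"
          then show "q \<in> ball (x v) (2 * e)" using that e dist_triangle[of "x v" q z] by auto
        qed
      qed (use e bd[OF vT] le[OF v] in \<open>auto simp: dist_norm norm_minus_commute\<close>)
      then show ?thesis by (simp add: \<kappa>1_def mult.commute)
    qed
    have "norm (y u - x u) \<le> norm (y s - x s) * exp (integral {s..u} \<kappa>1)"
      by (rule integral_solution_difference(4)[OF sub(2,1,3) lip]) (use \<kappa>0 uT e in \<open>auto simp: \<kappa>1_def\<close>)
    also have "\<dots> \<le> norm (y s - x s) * exp (integral {s..T} \<kappa>1)"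
    proof -
      have "\<kappa>1 v \<ge> 0" if "v \<in> {s..T}" for v using \<kappa>0[OF that] e by (simp add: \<kappa>1_def)
      then have "integral {s..u} \<kappa>1 \<le> integral {s..T} \<kappa>1"
        using uT \<kappa>1 sub(3) by (intro integral_subset_le) auto
      then show ?thesis by (intro mult_left_mono) auto
    qed
    also have "\<dots> < e" using close by (simp add: \<kappa>1_def)
    finally show "norm (y u - x u) < e" .
  qed
qed

text \<open>
  The difference quotient of the flow with respect to the initial value is
  \<open>exp (\<integral> a\<^sub>n)\<close>, where \<open>a\<^sub>n\<close> is the difference quotient of the field along two solutions.
\<close>

theorem integral_solution_holomorphic_dependence:
  assumes U: "open U" "\<zeta>0 \<in> U"
    and X: "\<And>\<zeta>. \<zeta> \<in> U \<Longrightarrow> integral_solution F s T (X \<zeta>)" "\<And>\<zeta>. \<zeta> \<in> U \<Longrightarrow> X \<zeta> s = \<zeta>"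
    and \<kappa>: "\<kappa> integrable_on {s..T}" and e: "e > 0" and sT: "s \<le> T"
    and hol: "\<And>t. t \<in> {s..T} \<Longrightarrow> F t holomorphic_on ball (X \<zeta>0 t) (2 * e)"
    and bd: "\<And>t z. t \<in> {s..T} \<Longrightarrow> z \<in> ball (X \<zeta>0 t) (2 * e) \<Longrightarrow> norm (F t z) \<le> \<kappa> t"
  shows "(\<lambda>\<zeta>. X \<zeta> T) field_differentiable (at \<zeta>0)"
proof -
  define x where "x = X \<zeta>0"
  define \<kappa>1 where "\<kappa>1 = (\<lambda>t. 2 * \<kappa> t / e)"
  have \<kappa>1: "\<kappa>1 integrable_on {s..T}" unfolding \<kappa>1_def using \<kappa> by (intro integrable_on_divide integrable_on_mult_right)
  have \<kappa>0: "\<kappa> u \<ge> 0" if "u \<in> {s..T}" for u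
    using bd[OF that, of "X \<zeta>0 u"] e order_trans[OF norm_ge_zero] by simp
  have \<kappa>10: "\<kappa>1 u \<ge> 0" if "u \<in> {s..T}" for u using \<kappa>0[OF that] e by (simp add: \<kappa>1_def)
  \<comment> \<open>\<open>E\<close> is the Gronwall factor, and \<delta> = e / E is the radius of
    the initial values whose solutions remain within \<open>e\<close> of \<open>x\<close>.\<close>
  define E where "E = exp (integral {s..T} \<kappa>1)"
  have E: "E > 0" by (simp add: E_def)
  define \<delta> where "\<delta> = e / E"
  have \<delta>: "\<delta> > 0" using e E by (simp add: \<delta>_def)
  define D where "D = (\<lambda>t. deriv (F t) (x t))"
  have x: "integral_solution F s T x" "x s = \<zeta>0" using X U by (auto simp: x_def)
  have near: "norm (X \<zeta> t - x t) < e" if "\<zeta> \<in> U" "norm (\<zeta> - \<zeta>0) < \<delta>" "t \<in> {s..T}" for \<zeta> t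
  proof (rule integral_solution_stays_close[OF x(1) X(1)[OF that(1)] \<kappa> e _ _ _ that(3)])
    have "norm (\<zeta> - \<zeta>0) * E < e" using that(2) E by (simp add: \<delta>_def pos_less_divide_eq)
    then show "norm (X \<zeta> s - x s) * exp (integral {s..T} (\<lambda>t. 2 * \<kappa> t / e)) < e"
      using X(2)[OF that(1)] x(2) by (simp add: E_def \<kappa>1_def)
  qed (use hol bd in \<open>auto simp: x_def\<close>)
  have lip: "norm (F t (X \<zeta> t) - F t (x t)) \<le> \<kappa>1 t * norm (X \<zeta> t - x t)"
    if "\<zeta> \<in> U" "norm (\<zeta> - \<zeta>0) < \<delta>" "t \<in> {s..T}" for \<zeta> t
  proof -
    have "norm (F t (X \<zeta> t) - F t (x t)) \<le> \<kappa> t / (e / 2) * norm (X \<zeta> t - x t)"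
    proof (rule holomorphic_Lipschitz[of "cball (x t) e", OF _ hol[OF that(3)]])
      show "cball z (e / 2) \<subseteq> ball (X \<zeta>0 t) (2 * e)" if "z \<in> cball (x t) e" for z
      proof
        fix q assume "q \<in> cball z (e / 2)"
        then show "q \<in> ball (X \<zeta>0 t) (2 * e)" using that e dist_triangle[of "x t" q z] by (auto simp: x_def)
      qed
    qed (use e bd[OF that(3)] near[OF that] in \<open>auto simp: dist_norm norm_minus_commute\<close>)
    then show ?thesis by (simp add: \<kappa>1_def mult.commute)
  qed
  define a where "a = (\<lambda>\<zeta> t. if X \<zeta> t = x t then 0 else (F t (X \<zeta> t) - F t (x t)) / (X \<zeta> t - x t))"
  have quot: "a \<zeta> absolutely_integrable_on {s..T} \<and> (\<forall>t\<in>{s..T}. norm (a \<zeta> t) \<le> \<kappa>1 t) \<and>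
      (\<forall>t\<in>{s..T}. X \<zeta> t - x t = (\<zeta> - \<zeta>0) * exp (integral {s..t} (a \<zeta>))) \<and>
      (\<forall>t\<in>{s..T}. norm (X \<zeta> t - x t) \<le> norm (\<zeta> - \<zeta>0) * E)"
    if "\<zeta> \<in> U" "norm (\<zeta> - \<zeta>0) < \<delta>" for \<zeta>
    using integral_solution_difference[OF X(1)[OF that(1)] x(1) \<kappa>1 lip[OF that] \<kappa>10] x(2) X(2)[OF that(1)]
    unfolding a_def E_def by auto
  have "((\<lambda>\<zeta>. (X \<zeta> T - X \<zeta>0 T) / (\<zeta> - \<zeta>0)) \<longlongrightarrow> exp (integral {s..T} D)) (at \<zeta>0)"
    unfolding tendsto_at_iff_sequentially
  proof (intro allI impI)
    fix Z :: "nat \<Rightarrow> complex" assume Z: "\<forall>i. Z i \<in> UNIV - {\<zeta>0}" "Z \<longlonglongrightarrow> \<zeta>0"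
    have "\<forall>\<^sub>F i in sequentially. Z i \<in> U" using topological_tendstoD[OF Z(2) U] .
    moreover have "\<forall>\<^sub>F i in sequentially. norm (Z i - \<zeta>0) < \<delta>"
      using tendstoD[OF Z(2) \<delta>] by (simp add: dist_norm)
    ultimately have "\<forall>\<^sub>F i in sequentially. Z i \<in> U \<and> norm (Z i - \<zeta>0) < \<delta>" by (rule eventually_conj)
    then obtain N where N: "\<And>i. i \<ge> N \<Longrightarrow> Z i \<in> U \<and> norm (Z i - \<zeta>0) < \<delta>"
      by (auto simp: eventually_sequentially)
    have lim: "(\<lambda>i. a (Z (i + N)) t) \<longlonglongrightarrow> D t" if t: "t \<in> {s..T}" for t
    proof -
      \<comment> \<open>The exponential factor never vanishes: solutions with different initial
        values do not meet, and the quotient \<open>a\<close> is never in its default case along the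
        sequence.\<close>
      have ne: "X (Z (i + N)) t \<noteq> x t" for i
      proof -
        have "X (Z (i + N)) t - x t = (Z (i + N) - \<zeta>0) * exp (integral {s..t} (a (Z (i + N))))"
          using quot[of "Z (i + N)"] N[of "i + N"] t by auto
        moreover have "Z (i + N) \<noteq> \<zeta>0" using Z(1) by blast
        ultimately show ?thesis by auto
      qed
      have "(\<lambda>i. X (Z (i + N)) t - x t) \<longlonglongrightarrow> 0"
      proof (rule Lim_null_comparison)
        show "\<forall>\<^sub>F i in sequentially. norm (X (Z (i + N)) t - x t) \<le> norm (Z (i + N) - \<zeta>0) * E"
          using quot[THEN conjunct2, THEN conjunct2, THEN conjunct2] N t by (intro always_eventually) (meson le_add2)
        have "(\<lambda>i. norm (Z (i + N) - \<zeta>0) * E) \<longlonglongrightarrow> norm (\<zeta>0 - \<zeta>0) * E"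
          by (intro tendsto_intros LIMSEQ_ignore_initial_segment Z(2))
        then show "(\<lambda>i. norm (Z (i + N) - \<zeta>0) * E) \<longlonglongrightarrow> 0" by simp
      qed
      then have conv: "(\<lambda>i. X (Z (i + N)) t) \<longlonglongrightarrow> x t" by (simp add: LIM_zero_iff)
      have "(F t has_field_derivative D t) (at (x t))"
        unfolding D_def using hol[OF t] e by (intro holomorphic_derivI) (auto simp: x_def)
      then have quot_lim: "((\<lambda>z. (F t z - F t (x t)) / (z - x t)) \<longlongrightarrow> D t) (at (x t))"
        by (simp add: has_field_derivative_iff)
      have "((\<lambda>z. (F t z - F t (x t)) / (z - x t)) \<circ> (\<lambda>i. X (Z (i + N)) t)) \<longlonglongrightarrow> D t"
        by (rule quot_lim[unfolded tendsto_at_iff_sequentially, rule_format]) (use conv ne in auto)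
      then show ?thesis by (simp add: a_def ne o_def)
    qed
    have "(\<lambda>i. integral {s..T} (a (Z (i + N)))) \<longlonglongrightarrow> integral {s..T} D"
    proof (rule dominated_convergence(2)[OF _ \<kappa>1 _ lim])
      show "a (Z (i + N)) integrable_on {s..T}" for i
        using quot[of "Z (i + N)"] N[of "i + N"] by (auto simp: absolutely_integrable_on_def)
      show "norm (a (Z (i + N)) t) \<le> \<kappa>1 t" if "t \<in> {s..T}" for i t
        using quot[of "Z (i + N)"] N[of "i + N"] that by auto
    qed
    then have "(\<lambda>i. exp (integral {s..T} (a (Z (i + N))))) \<longlonglongrightarrow> exp (integral {s..T} D)" by (rule tendsto_exp)
    moreover have "((\<lambda>\<zeta>. (X \<zeta> T - X \<zeta>0 T) / (\<zeta> - \<zeta>0)) \<circ> Z) (i + N) = exp (integral {s..T} (a (Z (i + N))))" for i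
    proof -
      have "Z (i + N) \<noteq> \<zeta>0" using Z(1) by blast
      then show ?thesis using quot[of "Z (i + N)"] N[of "i + N"] sT by (auto simp: x_def)
    qed
    ultimately have "(\<lambda>i. ((\<lambda>\<zeta>. (X \<zeta> T - X \<zeta>0 T) / (\<zeta> - \<zeta>0)) \<circ> Z) (i + N)) \<longlonglongrightarrow> exp (integral {s..T} D)" by simp
    then show "((\<lambda>\<zeta>. (X \<zeta> T - X \<zeta>0 T) / (\<zeta> - \<zeta>0)) \<circ> Z) \<longlonglongrightarrow> exp (integral {s..T} D)"
      by (rule LIMSEQ_offset)
  qed
  then show ?thesis unfolding field_differentiable_def has_field_derivative_iff by blast
qed

section \<open>Canonical domain systems\<close>

lemma Ld_on_dominated2:
  fixes f :: "real \<Rightarrow> 'a::real_normed_vector" and g :: "real \<Rightarrow> 'b::real_normed_vector"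
    and h :: "real \<Rightarrow> 'c::real_normed_vector"
  assumes d: "1 \<le> d" and f: "Ld_on d S f" and g: "Ld_on d S g"
    and h: "h \<in> borel_measurable (lebesgue_on S)" and AB: "0 \<le> A" "0 \<le> B"
    and le: "AE t in lebesgue_on S. norm (h t) \<le> A * norm (f t) + B * norm (g t)"
  shows "Ld_on d S h"
proof (cases "d = \<infinity>")
  case True
  obtain M1 where M1: "AE t in lebesgue_on S. norm (f t) \<le> M1" using f True by (auto simp: Ld_on_def)
  obtain M2 where M2: "AE t in lebesgue_on S. norm (g t) \<le> M2" using g True by (auto simp: Ld_on_def)
  have "AE t in lebesgue_on S. norm (h t) \<le> A * M1 + B * M2"
    using M1 M2 le
  proof eventually_elim
    case (elim t)
    have "A * norm (f t) + B * norm (g t) \<le> A * M1 + B * M2"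
      using elim AB by (intro add_mono mult_left_mono) auto
    then show ?case using elim by linarith
  qed
  then show ?thesis using h True by (auto simp: Ld_on_def)
next
  case False
  define p where "p = enn2real d"
  have p: "p \<ge> 1"
    using d False enn2real_mono[of 1 d] by (auto simp: p_def top.not_eq_extremum)
  have [measurable]: "f \<in> borel_measurable (lebesgue_on S)" "g \<in> borel_measurable (lebesgue_on S)"
    using f g by (auto simp: Ld_on_def)
  have I1: "(\<integral>\<^sup>+t. ennreal (norm (f t) powr p) \<partial>(lebesgue_on S)) < \<infinity>"
    and I2: "(\<integral>\<^sup>+t. ennreal (norm (g t) powr p) \<partial>(lebesgue_on S)) < \<infinity>"
    using f g False by (auto simp: Ld_on_def p_def)
  have pw: "(A * x + B * y) powr p \<le> (2 * A) powr p * x powr p + (2 * B) powr p * y powr p" if "0 \<le> x" "0 \<le> y" for x y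
  proof -
    have e: "(2 * A * x) powr p = (2 * A) powr p * x powr p" "(2 * B * y) powr p = (2 * B) powr p * y powr p"
      using AB that by (auto intro!: powr_mult)
    have nn: "0 \<le> A * x" "0 \<le> B * y" using AB that by auto
    show ?thesis
    proof (cases "A * x \<le> B * y")
      case True
      then have "(A * x + B * y) powr p \<le> (2 * B * y) powr p" using nn p by (intro powr_mono2) auto
      then show ?thesis unfolding e using powr_ge_zero[of "2*A" p] powr_ge_zero[of x p] by (smt (verit) mult_nonneg_nonneg)
    next
      case False
      then have "(A * x + B * y) powr p \<le> (2 * A * x) powr p" using nn p by (intro powr_mono2) auto
      then show ?thesis unfolding e using powr_ge_zero[of "2*B" p] powr_ge_zero[of y p] by (smt (verit) mult_nonneg_nonneg)
    qed
  qed
  have "(\<integral>\<^sup>+t. ennreal (norm (h t) powr p) \<partial>(lebesgue_on S)) \<le>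
      (\<integral>\<^sup>+t. ennreal ((2 * A) powr p) * ennreal (norm (f t) powr p) + ennreal ((2 * B) powr p) * ennreal (norm (g t) powr p) \<partial>(lebesgue_on S))"
  proof (rule nn_integral_mono_AE)
    show "AE t in lebesgue_on S. ennreal (norm (h t) powr p) \<le>
        ennreal ((2 * A) powr p) * ennreal (norm (f t) powr p) + ennreal ((2 * B) powr p) * ennreal (norm (g t) powr p)"
      using le
    proof eventually_elim
      case (elim t)
      have "norm (h t) powr p \<le> (A * norm (f t) + B * norm (g t)) powr p"
        using elim p by (intro powr_mono2) auto
      also have "\<dots> \<le> (2 * A) powr p * norm (f t) powr p + (2 * B) powr p * norm (g t) powr p"
        by (intro pw) auto
      finally show ?case by (simp add: ennreal_leI flip: ennreal_mult' ennreal_plus)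
    qed
  qed
  also have "\<dots> = ennreal ((2 * A) powr p) * (\<integral>\<^sup>+t. ennreal (norm (f t) powr p) \<partial>(lebesgue_on S)) +
      ennreal ((2 * B) powr p) * (\<integral>\<^sup>+t. ennreal (norm (g t) powr p) \<partial>(lebesgue_on S))"
    by (subst nn_integral_add) (auto simp: nn_integral_cmult)
  also have "\<dots> < \<infinity>" using I1 I2 by (simp add: ennreal_mult_less_top)
  finally show ?thesis using h False by (simp add: Ld_on_def p_def)
qed

lemma emeasure_lebesgue_on_finite:
  assumes "S \<in> lmeasurable"
  shows "emeasure (lebesgue_on S) S < \<infinity>"
proof -
  have "emeasure (lebesgue_on S) S = emeasure lebesgue S"
    using assms by (intro emeasure_restrict_space) (auto dest: fmeasurableD)
  then show ?thesis using fmeasurableD2[OF assms] by (simp only: infinity_ennreal_def top.not_eq_extremum)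
qed

lemma Ld_on_subset:
  fixes f :: "real \<Rightarrow> 'a::real_normed_vector"
  assumes "Ld_on d S f" "T \<subseteq> S" "T \<in> sets lebesgue" "S \<in> sets lebesgue"
  shows "Ld_on d T f"
proof -
  have m: "f \<in> borel_measurable (lebesgue_on T)"
    using assms unfolding Ld_on_def by (meson measurable_restrict_mono)
  show ?thesis
  proof (cases "d = \<infinity>")
    case True
    then obtain M where "AE t in lebesgue_on S. norm (f t) \<le> M" using assms(1) by (auto simp: Ld_on_def)
    then have "AE t in lebesgue. t \<in> S \<longrightarrow> norm (f t) \<le> M" using assms by (simp add: AE_restrict_space_iff)
    then have "AE t in lebesgue. t \<in> T \<longrightarrow> norm (f t) \<le> M" by eventually_elim (use assms in auto)
    then show ?thesis using m True assms by (auto simp: Ld_on_def AE_restrict_space_iff)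
  next
    case False
    have "(\<integral>\<^sup>+t. ennreal (norm (f t) powr enn2real d) \<partial>(lebesgue_on T)) \<le>
        (\<integral>\<^sup>+t. ennreal (norm (f t) powr enn2real d) \<partial>(lebesgue_on S))"
      using assms by (auto simp: nn_integral_restrict_space intro!: nn_integral_mono split: split_indicator)
    also have "\<dots> < \<infinity>" using assms False by (simp add: Ld_on_def)
    finally show ?thesis using m False by (simp add: Ld_on_def)
  qed
qed

text \<open>For finite \<open>d\<close> this is x \<le> 1 + x^p, valid for p \<ge> 1, integrated
  over a set of finite measure.\<close>

lemma Ld_on_imp_absolutely_integrable:
  fixes f :: "real \<Rightarrow> 'a::euclidean_space"
  assumes d: "1 \<le> d" and f: "Ld_on d S f" and S: "S \<in> lmeasurable"
  shows "f absolutely_integrable_on S"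
proof -
  note fin = emeasure_lebesgue_on_finite[OF S]
  have m: "f \<in> borel_measurable (lebesgue_on S)" using f by (simp add: Ld_on_def)
  have "(\<integral>\<^sup>+t. ennreal (norm (f t)) \<partial>(lebesgue_on S)) < \<infinity>"
  proof (cases "d = \<infinity>")
    case True
    then obtain M where M: "AE t in lebesgue_on S. norm (f t) \<le> M" using f by (auto simp: Ld_on_def)
    have "(\<integral>\<^sup>+t. ennreal (norm (f t)) \<partial>(lebesgue_on S)) \<le> (\<integral>\<^sup>+t. ennreal M \<partial>(lebesgue_on S))"
      using M by (intro nn_integral_mono_AE) (auto elim!: eventually_mono intro: ennreal_leI)
    also have "\<dots> < \<infinity>" using fin
      by (simp add: ennreal_mult_less_top)
    finally show ?thesis .
  next
    case False
    define p where "p = enn2real d"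
    have p: "p \<ge> 1"
      using d False enn2real_mono[of 1 d] by (auto simp: p_def top.not_eq_extremum)
    have le: "x \<le> 1 + x powr p" if "0 \<le> x" for x :: real
    proof (cases "x \<le> 1")
      case True
      then show ?thesis using powr_ge_zero[of x p] by linarith
    next
      case False
      then have "x powr 1 \<le> x powr p" using p by (intro powr_mono) auto
      then show ?thesis using False by simp
    qed
    have "(\<integral>\<^sup>+t. ennreal (norm (f t)) \<partial>(lebesgue_on S)) \<le> (\<integral>\<^sup>+t. ennreal 1 + ennreal (norm (f t) powr p) \<partial>(lebesgue_on S))"
    proof (rule nn_integral_mono)
      fix t
      have "ennreal (norm (f t)) \<le> ennreal (1 + norm (f t) powr p)" by (intro ennreal_leI le) simp
      also have "\<dots> = ennreal 1 + ennreal (norm (f t) powr p)" by (rule ennreal_plus) auto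
      finally show "ennreal (norm (f t)) \<le> ennreal 1 + ennreal (norm (f t) powr p)" .
    qed
    also have "\<dots> = emeasure (lebesgue_on S) S + (\<integral>\<^sup>+t. ennreal (norm (f t) powr p) \<partial>(lebesgue_on S))"
      using m by (subst nn_integral_add) auto
    also have "\<dots> < \<infinity>" using fin S f False
      by (simp add: Ld_on_def p_def)
    finally show ?thesis .
  qed
  then have "integrable (lebesgue_on S) f" using m by (intro integrableI_bounded) auto
  then show ?thesis using S by (simp add: set_integrable_def integrable_restrict_space fmeasurableD)
qed

lemma Ld_locI:
  fixes f :: "real \<Rightarrow> 'a::real_normed_vector"
  assumes "\<And>T. T \<ge> 0 \<Longrightarrow> Ld_on d {0..T} f"
  shows "Ld_loc d {0..} f"
  unfolding Ld_loc_def
proof (intro allI impI)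
  fix K :: "real set" assume K: "compact K" "K \<subseteq> {0..}"
  then obtain T where "\<forall>x\<in>K. \<bar>x\<bar> \<le> T" using compact_imp_bounded[OF K(1)] by (auto simp: bounded_iff)
  then have "K \<subseteq> {0..max 0 T}" using K by force
  then show "Ld_on d K f"
    using K by (intro Ld_on_subset[OF assms[of "max 0 T"]]) (auto intro: lmeasurable_compact fmeasurableD)
qed

lemma AE_Ici_iff: "(AE t in lebesgue_on {a::real..}. P t) \<longleftrightarrow> (AE t in lebesgue. a \<le> t \<longrightarrow> P t)"
  by (simp add: AE_restrict_space_iff)

locale nondegenerate_domain_system =
  fixes d :: ennreal and r :: "real \<Rightarrow> real"
  assumes d: "1 \<le> d" and cds: "canonical_domain_system d r" and nd: "nondegenerate r"
begin

text \<open>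
  \<open>W\<close>, \<open>l\<close> and \<open>Lam\<close> are \<open>\<omega>(r(t))\<close>, \<open>ln r(t)\<close> and \<open>- r'(t) / r(t)\<close>. The last one is expressed through
  \<open>W'\<close> by \<open>l = - \<pi> / W\<close>, since absolute continuity is only assumed for \<open>W\<close>.
\<close>

definition "W t = omega (r t)"
definition "l t = ln (r t)"
definition "Lam t = - (pi * vector_derivative W (at t within {0..}) / (W t)\<^sup>2)"

lemma r_bounds: "t \<ge> 0 \<Longrightarrow> 0 < r t" "t \<ge> 0 \<Longrightarrow> r t < 1"
  using cds nd by (auto simp: canonical_domain_system_def nondegenerate_def)

lemma l_neg: "t \<ge> 0 \<Longrightarrow> l t < 0"
  using r_bounds by (simp add: l_def)

lemma exp_l: "t \<ge> 0 \<Longrightarrow> exp (l t) = r t"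
  using r_bounds by (simp add: l_def)

lemma W_eq: "t \<ge> 0 \<Longrightarrow> W t = - pi / l t"
  using r_bounds[of t] by (simp add: W_def l_def omega_def)

lemma W_pos: "t \<ge> 0 \<Longrightarrow> W t > 0"
  using l_neg[of t] by (simp add: W_eq divide_less_0_iff)

lemma l_eq: "t \<ge> 0 \<Longrightarrow> l t = - pi / W t"
  using l_neg[of t] by (simp add: W_eq)

lemma W_antimono: "0 \<le> s \<Longrightarrow> s \<le> t \<Longrightarrow> W t \<le> W s"
  using cds by (auto simp: canonical_domain_system_def monotone_on_def W_def)

lemma l_antimono: "0 \<le> s \<Longrightarrow> s \<le> t \<Longrightarrow> l t \<le> l s"
  using W_antimono[of s t] W_pos[of s] W_pos[of t] by (simp add: l_eq frac_le)

lemma r_antimono: "0 \<le> s \<Longrightarrow> s \<le> t \<Longrightarrow> r t \<le> r s"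
  using l_antimono[of s t] exp_l[of s] exp_l[of t] by (metis exp_le_cancel_iff order_trans)

lemma annulus_mono: "0 \<le> s \<Longrightarrow> s \<le> t \<Longrightarrow> annulus (r s) \<subseteq> annulus (r t)"
  using r_antimono[of s t] by (auto simp: annulus_def)

lemma W_AC: "0 \<le> a \<Longrightarrow> a \<le> b \<Longrightarrow> abs_continuous_on_interval a b W"
  using cds by (auto simp: canonical_domain_system_def AC_def locally_abs_continuous_on_def W_def[abs_def])

text \<open>The map w -> - pi / w is Lipschitz with constant pi / (W b)^2 on [W b, \<infinity>), and
  \<open>W\<close>, being non-increasing, stays in this range on [a, b].\<close>

lemma l_AC:
  assumes "0 \<le> a" "a \<le> b"
  shows "abs_continuous_on_interval a b l"
proof (rule abs_continuous_on_interval_dominated2[OF W_AC[OF assms] W_AC[OF assms]])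
  show "pi / (W b)\<^sup>2 > 0" using W_pos[of b] assms by simp
  fix u v assume uv: "u \<in> {a..b}" "v \<in> {a..b}"
  have W: "W b \<le> W u" "W b \<le> W v" "0 < W b" "0 < W u" "0 < W v"
    using uv assms W_antimono[of u b] W_antimono[of v b] W_pos by auto
  have "l u - l v = pi * (W u - W v) / (W u * W v)"
    using uv assms W by (simp add: l_eq field_simps)
  then have "dist (l u) (l v) = pi / (W u * W v) * dist (W u) (W v)"
    using W by (simp add: dist_real_def abs_mult)
  also have "\<dots> \<le> pi / (W b)\<^sup>2 * dist (W u) (W v)"
    using W by (intro mult_right_mono divide_left_mono) (auto simp: power2_eq_square intro!: mult_mono)
  also have "\<dots> \<le> pi / (W b)\<^sup>2 * (dist (W u) (W v) + dist (W u) (W v))"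
    by (intro mult_left_mono) auto
  finally show "dist (l u) (l v) \<le> pi / (W b)\<^sup>2 * (dist (W u) (W v) + dist (W u) (W v))" .
qed

lemma l_continuous: "continuous_on {0..} l"
proof -
  have "\<forall>t\<in>{0..}. continuous (at t within {0..}) l"
  proof
    fix t :: real assume t: "t \<in> {0..}"
    have "continuous_on {0..t+1} l"
      using t by (intro abs_continuous_on_interval_imp_continuous_on l_AC) auto
    then have "continuous (at t within {0..t+1}) l" using t by (auto simp: continuous_on_eq_continuous_within)
    moreover have "at t within {0..t+1} = at t within {0..}"
      using t by (intro at_within_nhd[of t "{..<t+1}"]) auto
    ultimately show "continuous (at t within {0..}) l" by simp
  qed
  then show ?thesis by (simp add: continuous_on_eq_continuous_within)
qed

lemma r_continuous: "continuous_on {0..} r"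
  using continuous_on_exp[OF l_continuous] by (rule continuous_on_eq) (simp add: exp_l)

text \<open>The chain rule for l = - pi / W and r = exp l transfers differentiability from
  \<open>W\<close>, the function for which it is assumed. The sign of \<open>Lam\<close> expresses
  that \<open>W\<close> is non-increasing.\<close>

lemma AE_derivatives:
  "AE t in lebesgue. 0 \<le> t \<longrightarrow> (l has_vector_derivative - Lam t) (at t within {0..}) \<and>
     vector_derivative r (at t within {0..}) = - r t * Lam t \<and> Lam t \<ge> 0"
proof -
  have "AE t in lebesgue. 0 \<le> t \<longrightarrow> W differentiable (at t within {0..})"
    using cds by (auto simp: canonical_domain_system_def AC_def AE_Ici_iff W_def[abs_def])
  \<comment> \<open>The endpoint 0 is discarded, so that derivatives within \<open>{0..}\<close> are
    ordinary two-sided ones.\<close>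
  moreover have "AE t in lebesgue. t \<noteq> (0::real)"
    using AE_not_in[of "{0::real}" lebesgue] by (auto simp flip: negligible_iff_null_sets)
  ultimately show ?thesis
  proof eventually_elim
    case (elim t)
    show ?case
    proof
      assume t: "0 \<le> t"
      then have t0: "0 < t" using elim(2) by simp
      then have at: "at t within {0..} = at t" by (intro at_within_interior) auto
      define W' where "W' = vector_derivative W (at t within {0..})"
      have W': "(W has_real_derivative W') (at t within {0..})"
        using elim(1) t vector_derivative_works unfolding W'_def has_real_derivative_iff_has_vector_derivative by blast
      have "((\<lambda>t. - pi / W t) has_real_derivative pi * W' / (W t)\<^sup>2) (at t within {0..})"
        using W' W_pos[OF t] by (auto intro!: derivative_eq_intros simp: power2_eq_square)
      then have l': "(l has_real_derivative pi * W' / (W t)\<^sup>2) (at t within {0..})"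
        by (rule has_field_derivative_transform_within[of _ _ _ _ 1]) (use t in \<open>auto simp: l_eq\<close>)
      have L: "pi * W' / (W t)\<^sup>2 = - Lam t" by (simp add: Lam_def W'_def)
      have "((\<lambda>t. exp (l t)) has_real_derivative exp (l t) * (- Lam t)) (at t within {0..})"
        using l' unfolding L by (auto intro!: derivative_eq_intros)
      then have "(r has_real_derivative exp (l t) * (- Lam t)) (at t within {0..})"
        by (rule has_field_derivative_transform_within[of _ _ _ _ 1]) (use t in \<open>auto simp: exp_l\<close>)
      then have vd: "vector_derivative r (at t within {0..}) = exp (l t) * (- Lam t)"
        unfolding has_real_derivative_iff_has_vector_derivative at by (rule vector_derivative_at)
      have W0: "W' \<le> 0"
      proof -
        have "mono_on {0..} (\<lambda>t. - W t)" using W_antimono by (auto simp: mono_on_def)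
        moreover have "((\<lambda>t. - W t) has_real_derivative - W') (at t)"
          using W' unfolding at by (rule DERIV_minus)
        ultimately have "- W' \<ge> 0" using t0 by (intro mono_on_imp_deriv_nonneg[of "{0..}"]) auto
        then show ?thesis by simp
      qed
      have "Lam t = pi / (W t)\<^sup>2 * (- W')" by (simp add: Lam_def W'_def)
      moreover have "0 \<le> pi / (W t)\<^sup>2 * (- W')" using W0 by (intro mult_nonneg_nonneg) auto
      ultimately have "Lam t \<ge> 0" by (simp only:)
      moreover have "(l has_vector_derivative - Lam t) (at t within {0..})"
        using l' unfolding L has_real_derivative_iff_has_vector_derivative .
      ultimately show "(l has_vector_derivative - Lam t) (at t within {0..}) \<and>
          vector_derivative r (at t within {0..}) = - r t * Lam t \<and> Lam t \<ge> 0"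
        using vd by (simp add: exp_l[OF t])
    qed
  qed
qed

lemma W_measurable: "0 \<le> T \<Longrightarrow> W \<in> borel_measurable (lebesgue_on {0..T})"
  by (intro continuous_imp_measurable_on_sets_lebesgue abs_continuous_on_interval_imp_continuous_on W_AC) auto

lemma Lam_Ld:
  assumes "0 \<le> T"
  shows "Ld_on d {0..T} Lam"
proof -
  have W': "Ld_on d {0..T} (\<lambda>t. vector_derivative W (at t within {0..}))"
    using cds assms by (auto simp: canonical_domain_system_def AC_def Ld_loc_def W_def[abs_def])
  show ?thesis
  proof (rule Ld_on_dominated2[OF d W' W', where A = "pi / (W T)\<^sup>2" and B = 0])
    have [measurable]: "W \<in> borel_measurable (lebesgue_on {0..T})" by (rule W_measurable[OF assms])
    have [measurable]: "(\<lambda>t. vector_derivative W (at t within {0..})) \<in> borel_measurable (lebesgue_on {0..T})"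
      using W' by (simp add: Ld_on_def)
    show "Lam \<in> borel_measurable (lebesgue_on {0..T})" unfolding Lam_def by measurable
    show "AE t in lebesgue_on {0..T}. norm (Lam t) \<le> pi / (W T)\<^sup>2 * norm (vector_derivative W (at t within {0..})) +
        0 * norm (vector_derivative W (at t within {0..}))"
    proof (rule AE_I2)
      fix t assume "t \<in> space (lebesgue_on {0..T})"
      then have W: "W T \<le> W t" "0 < W T" using W_antimono[of t T] W_pos[of T] assms by auto
      have "norm (Lam t) = pi / (W t)\<^sup>2 * \<bar>vector_derivative W (at t within {0..})\<bar>"
        by (simp add: Lam_def abs_mult)
      also have "\<dots> \<le> pi / (W T)\<^sup>2 * \<bar>vector_derivative W (at t within {0..})\<bar>"
        using W by (intro mult_right_mono divide_left_mono power_mono) auto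
      finally show "norm (Lam t) \<le> pi / (W T)\<^sup>2 * norm (vector_derivative W (at t within {0..})) +
        0 * norm (vector_derivative W (at t within {0..}))" by simp
    qed
  qed auto
qed

lemma Lam_absolutely_integrable: "0 \<le> a \<Longrightarrow> Lam absolutely_integrable_on {a..b}"
proof (cases "a \<le> b")
  case True
  assume "0 \<le> a"
  then have "Lam absolutely_integrable_on {0..b}"
    using True by (intro Ld_on_imp_absolutely_integrable[OF d] Lam_Ld) auto
  then show ?thesis by (rule absolutely_integrable_on_subinterval) (use \<open>0 \<le> a\<close> in auto)
qed auto

lemma Lam_has_integral:
  assumes "0 \<le> a" "a \<le> b"
  shows "(Lam has_integral l a - l b) {a..b}"
proof -
  have "((\<lambda>t. - Lam t) has_integral l b - l a) {a..b}"
  proof (rule abs_continuous_on_interval_has_integral_AE[OF assms(2) l_AC[OF assms]])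
    show "AE t in lebesgue. t \<in> {a..b} \<longrightarrow> (l has_vector_derivative - Lam t) (at t within {a..b})"
      using AE_derivatives
      by eventually_elim (use assms in \<open>auto intro: has_vector_derivative_within_subset\<close>)
  qed
  from has_integral_neg[OF this] show ?thesis by simp
qed

end

section \<open>Semicomplete vector fields\<close>

lemma measurable_lebesgue_on_subset:
  fixes f :: "real \<Rightarrow> 'a::topological_space"
  assumes "f \<in> borel_measurable (lebesgue_on S)" "T \<subseteq> S" "S \<in> sets lebesgue" "T \<in> sets lebesgue"
  shows "f \<in> borel_measurable (lebesgue_on T)"
  using assms by (meson measurable_restrict_mono)

text \<open>The path is sampled at the last grid point before \<open>t\<close>, so that only
  countably many fixed arguments occur, and continuity recovers the limit. Sampling from the left is
  forced: measurability of \<open>f t (w \<sigma>)\<close> is assumed only from \<sigma> on, because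
  in the application \<open>w \<sigma>\<close> is guaranteed to lie in the domain at time
  \<open>t\<close> only for t \<ge> \<sigma>.\<close>

lemma Caratheodory_measurable:
  fixes f :: "real \<Rightarrow> 'b \<Rightarrow> complex" and w :: "real \<Rightarrow> 'b"
  assumes m: "\<And>\<sigma>. \<sigma> \<in> {s..T} \<Longrightarrow> (\<lambda>t. f t (w \<sigma>)) \<in> borel_measurable (lebesgue_on {\<sigma>..T})"
    and c: "\<And>t \<sigma>. t \<in> {s..T} \<Longrightarrow> (\<And>n. \<sigma> n \<in> {s..t}) \<Longrightarrow> \<sigma> \<longlonglongrightarrow> t \<Longrightarrow> (\<lambda>n::nat. f t (w (\<sigma> n))) \<longlonglongrightarrow> f t (w t)"
  shows "(\<lambda>t. f t (w t)) \<in> borel_measurable (lebesgue_on {s..T})"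
proof -
  define q where "q = (\<lambda>(n::nat) (i::int). max s (of_int i / real (Suc n)))"
  define Q where "Q = (\<lambda>n t. q n \<lfloor>t * real (Suc n)\<rfloor>)"
  have Q: "Q n t \<in> {s..t}" "t - Q n t \<le> 1 / real (Suc n)" if "s \<le> t" for n t
  proof -
    have a: "of_int \<lfloor>t * real (Suc n)\<rfloor> \<le> t * real (Suc n)" "t * real (Suc n) < of_int \<lfloor>t * real (Suc n)\<rfloor> + 1"
      by linarith+
    have 1: "of_int \<lfloor>t * real (Suc n)\<rfloor> / real (Suc n) \<le> t"
      using a(1) by (simp add: pos_divide_le_eq)
    have "t < (of_int \<lfloor>t * real (Suc n)\<rfloor> + 1) / real (Suc n)"
      using a(2) by (simp add: pos_less_divide_eq)
    then have 2: "t - of_int \<lfloor>t * real (Suc n)\<rfloor> / real (Suc n) \<le> 1 / real (Suc n)"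
      by (simp add: add_divide_distrib)
    show "Q n t \<in> {s..t}" using 1 that by (simp add: Q_def q_def)
    show "t - Q n t \<le> 1 / real (Suc n)" using 2 by (simp add: Q_def q_def)
  qed
  \<comment> \<open>The value 0 fills in the times before the grid point, for which nothing is
    known.\<close>
  define h where "h = (\<lambda>n i t. if t \<in> {q n i..T} then f t (w (q n i)) else 0)"
  have hm: "h n i \<in> borel_measurable lebesgue" for n i
  proof (cases "q n i \<le> T")
    case True
    then have "q n i \<in> {s..T}" by (simp add: q_def)
    from m[OF this] show ?thesis unfolding h_def by (intro borel_measurable_if_I) auto
  next
    case False
    then have "h n i = (\<lambda>_. 0)" by (intro ext) (auto simp: h_def)
    then show ?thesis by simp
  qed
  have fl: "(\<lambda>t::real. \<lfloor>t * real (Suc n)\<rfloor>) \<in> measurable lebesgue (count_space UNIV)" for n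
  proof -
    have "(\<lambda>t::real. \<lfloor>t * real (Suc n)\<rfloor>) \<in> measurable borel (count_space UNIV)" by measurable
    then have "(\<lambda>t::real. \<lfloor>t * real (Suc n)\<rfloor>) \<in> measurable lborel (count_space UNIV)"
      unfolding measurable_cong_sets[OF sets_lborel refl] .
    then show ?thesis by (rule measurable_completion)
  qed
  have m2: "(\<lambda>t. h n \<lfloor>t * real (Suc n)\<rfloor> t) \<in> borel_measurable (lebesgue_on {s..T})" for n
    by (rule measurable_restrict_space1) (rule measurable_compose_countable[OF hm fl])
  show ?thesis
  proof (rule borel_measurable_LIMSEQ_metric[OF m2])
    fix t assume "t \<in> space (lebesgue_on {s..T})"
    then have t: "t \<in> {s..T}" by simp
    then have hQ: "h n \<lfloor>t * real (Suc n)\<rfloor> t = f t (w (Q n t))" for n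
      using Q(1)[of t n] by (auto simp: h_def Q_def)
    have "(\<lambda>n. Q n t) \<longlonglongrightarrow> t"
    proof (rule tendsto_sandwich[of "\<lambda>n. t - 1 / real (Suc n)" _ _ "\<lambda>_. t"])
      show "\<forall>\<^sub>F n in sequentially. t - 1 / real (Suc n) \<le> Q n t"
        using Q(2)[of t] t by (intro always_eventually allI) (simp add: algebra_simps)
      show "\<forall>\<^sub>F n in sequentially. Q n t \<le> t" using Q(1)[of t] t by auto
      have "(\<lambda>n. t - 1 / real (Suc n)) \<longlonglongrightarrow> t - 0"
        by (intro tendsto_diff tendsto_const LIMSEQ_Suc[OF lim_1_over_n])
      then show "(\<lambda>n. t - 1 / real (Suc n)) \<longlonglongrightarrow> t" by simp
    qed simp
    then show "(\<lambda>n. h n \<lfloor>t * real (Suc n)\<rfloor> t) \<longlonglongrightarrow> f t (w t)"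
      unfolding hQ using Q(1)[of t] t by (intro c) auto
  qed
qed

context nondegenerate_domain_system
begin

lemma total_domain_iff: "(z, t) \<in> total_domain r \<longleftrightarrow> 0 \<le> t \<and> r t < norm z \<and> norm z < 1"
  by (auto simp: total_domain_def annulus_def)

lemma annulus_exp_iff: "t \<ge> 0 \<Longrightarrow> exp \<zeta> \<in> annulus (r t) \<longleftrightarrow> l t < Re \<zeta> \<and> Re \<zeta> < 0"
  using exp_l[of t] by (auto simp: annulus_def simp flip: exp_l)

text \<open>These moving tubes are the compact sets to which the majorant condition is applied. The
  majorant lives on the projection to the time axis, hence the claim that the projection is the
  whole interval.\<close>

lemma compact_tube:
  assumes s: "0 \<le> s" and A: "continuous_on {s..T} A" and B: "continuous_on {s..T} B"
    and AB: "\<forall>t\<in>{s..T}. l t < A t \<and> A t \<le> B t \<and> B t < 0"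
  defines "K \<equiv> {(z, t). t \<in> {s..T} \<and> exp (A t) \<le> norm z \<and> norm z \<le> exp (B t)}"
  shows "compact K" "K \<subseteq> total_domain r" "snd ` K = {s..T}"
proof -
  note AB = AB[rule_format]
  define C where "C = cball (0::complex) 1 \<times> {s..T}"
  have C: "compact C" unfolding C_def by (intro compact_Times) auto
  have AB': "continuous_on C (\<lambda>p. exp (A (snd p)))" "continuous_on C (\<lambda>p. exp (B (snd p)))"
    "continuous_on C (\<lambda>p. norm (fst p))"
    unfolding C_def
    by (intro continuous_intros continuous_on_compose2[OF A] continuous_on_compose2[OF B]; auto)+
  have KC: "K = C \<inter> ({p\<in>C. exp (A (snd p)) \<le> norm (fst p)} \<inter> {p\<in>C. norm (fst p) \<le> exp (B (snd p))})"
  proof -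
    have "norm z \<le> 1" if "norm z \<le> exp (B t)" "t \<in> {s..T}" for z :: complex and t
      using that AB[of t] by (meson exp_le_one_iff less_imp_le order_trans)
    then show ?thesis by (auto simp: K_def C_def)
  qed
  have "closed ({p\<in>C. exp (A (snd p)) \<le> norm (fst p)} \<inter> {p\<in>C. norm (fst p) \<le> exp (B (snd p))})"
    using AB' C by (intro closed_Int continuous_on_closed_Collect_le compact_imp_closed)
  then show "compact K" unfolding KC by (rule compact_Int_closed[OF C])
  show "K \<subseteq> total_domain r"
  proof clarify
    fix z t assume "(z, t) \<in> K"
    then have t: "t \<in> {s..T}" "exp (A t) \<le> norm z" "norm z \<le> exp (B t)" by (auto simp: K_def)
    have "norm z < 1" using t(3) AB[OF t(1)] by (meson exp_less_one_iff le_less_trans)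
    moreover have "exp (l t) < exp (A t)" using AB[OF t(1)] by simp
    moreover have "exp (l t) = r t" using t s by (intro exp_l) auto
    ultimately show "(z, t) \<in> total_domain r" using t s by (auto simp: total_domain_iff)
  qed
  show "snd ` K = {s..T}"
  proof
    show "{s..T} \<subseteq> snd ` K"
    proof
      fix t assume t: "t \<in> {s..T}"
      then have "(of_real (exp (A t)), t) \<in> K" using AB[OF t] by (simp add: K_def norm_of_real)
      then show "t \<in> snd ` K" by force
    qed
  qed (auto simp: K_def)
qed

lemma time_section_Ici:
  assumes "0 \<le> s" "z \<in> annulus (r s)"
  shows "{s..} \<subseteq> time_section (total_domain r) z"
  using assms annulus_mono[of s] by (auto simp: time_section_def total_domain_def)

lemma time_section_sets: "time_section (total_domain r) z \<in> sets lebesgue"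
proof -
  have "time_section (total_domain r) z = (if norm z < 1 then {0..} \<inter> {t \<in> {0..}. r t \<in> {..<norm z}} else {})"
    by (auto simp: time_section_def total_domain_iff)
  moreover have "{t \<in> {0..}. r t \<in> {..<norm z}} \<in> sets lebesgue"
  proof -
    have "r \<in> borel_measurable (lebesgue_on {0..})"
      by (intro continuous_imp_measurable_on_sets_lebesgue r_continuous) simp
    then have "r -` {..<norm z} \<inter> {0..} \<in> sets (lebesgue_on {0..})"
      using measurable_sets[of r "lebesgue_on {0..}" borel "{..<norm z}"] by simp
    then obtain x where "x \<in> sets lebesgue" "r -` {..<norm z} \<inter> {0..} = {0..} \<inter> x"
      by (auto simp: sets_restrict_space)
    then have "r -` {..<norm z} \<inter> {0..} \<in> sets lebesgue" by (simp add: sets.Int)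
    moreover have "{t \<in> {0..}. r t \<in> {..<norm z}} = r -` {..<norm z} \<inter> {0..}" by auto
    ultimately show ?thesis by simp
  qed
  ultimately show ?thesis by auto
qed

lemma time_section_subset: "time_section (total_domain r) z \<subseteq> {0..}"
  by (auto simp: time_section_def total_domain_def)

end

section \<open>The flow in the logarithmic coordinate\<close>

locale whvf_system = nondegenerate_domain_system +
  fixes G :: "complex \<times> real \<Rightarrow> complex"
  assumes whvf: "weak_holomorphic_vector_field d r G"
begin

text \<open>The field in the logarithmic coordinate \<open>\<zeta> = ln z\<close>, in which the annuli become strips.\<close>

definition "F t \<zeta> = G (exp \<zeta>, t) * exp (- \<zeta>)"

lemma G_holomorphic: "t \<ge> 0 \<Longrightarrow> (\<lambda>z. G (z, t)) holomorphic_on annulus (r t)"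
  using whvf by (simp add: weak_holomorphic_vector_field_def)

lemma F_holomorphic:
  assumes "t \<ge> 0"
  shows "F t holomorphic_on {\<zeta>. l t < Re \<zeta> \<and> Re \<zeta> < 0}"
proof -
  have "((\<lambda>z. G (z, t)) \<circ> exp) holomorphic_on {\<zeta>. l t < Re \<zeta> \<and> Re \<zeta> < 0}"
    by (rule holomorphic_on_compose_gen[OF _ G_holomorphic[OF assms]])
      (use annulus_exp_iff[OF assms] in \<open>auto intro: holomorphic_intros\<close>)
  then show ?thesis unfolding F_def o_def by (intro holomorphic_intros)
qed

lemma G_bound:
  assumes "compact K" "K \<subseteq> total_domain r" "snd ` K = {s..T}"
  obtains k where "Ld_on d {s..T} k" "k integrable_on {s..T}" "\<And>t. t \<in> {s..T} \<Longrightarrow> 0 \<le> k t"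
    "\<And>z t. (z, t) \<in> K \<Longrightarrow> norm (G (z, t)) \<le> k t"
proof -
  have "\<exists>k :: real \<Rightarrow> real. Ld_on d (snd ` K) k \<and> (\<forall>t\<in>snd ` K. 0 \<le> k t) \<and> (\<forall>(z, t)\<in>K. norm (G (z, t)) \<le> k t)"
    using whvf assms(1,2) unfolding weak_holomorphic_vector_field_def by blast
  then obtain k where k: "Ld_on d {s..T} k" "\<forall>t\<in>{s..T}. 0 \<le> k t" "\<forall>(z, t)\<in>K. norm (G (z, t)) \<le> k t"
    unfolding assms(3) by blast
  moreover have "k absolutely_integrable_on {s..T}"
    using k(1) by (intro Ld_on_imp_absolutely_integrable[OF d]) auto
  ultimately show ?thesis using that[of k] by (auto simp: absolutely_integrable_on_def)
qed

lemma F_bound: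
  assumes s: "0 \<le> s" and A: "continuous_on {s..T} A" and B: "continuous_on {s..T} B"
    and AB: "\<And>t. t \<in> {s..T} \<Longrightarrow> l t < A t \<and> A t \<le> B t \<and> B t < 0"
  obtains \<kappa> where "\<kappa> integrable_on {s..T}" "\<And>t. t \<in> {s..T} \<Longrightarrow> 0 \<le> \<kappa> t"
    "\<And>t \<zeta>. t \<in> {s..T} \<Longrightarrow> A t \<le> Re \<zeta> \<Longrightarrow> Re \<zeta> \<le> B t \<Longrightarrow> norm (F t \<zeta>) \<le> \<kappa> t"
proof -
  have AB': "\<forall>t\<in>{s..T}. l t < A t \<and> A t \<le> B t \<and> B t < 0" using AB by blast
  note K = compact_tube[OF s A B AB']
  obtain k where "k integrable_on {s..T}" "\<And>t. t \<in> {s..T} \<Longrightarrow> 0 \<le> k t"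
    and kK: "\<And>z t. (z, t) \<in> {(z, t). t \<in> {s..T} \<and> exp (A t) \<le> norm z \<and> norm z \<le> exp (B t)} \<Longrightarrow> norm (G (z, t)) \<le> k t"
    by (rule G_bound[OF K]) (rule that)
  note k = this(1,2) and kK = kK
  have k3: "norm (G (z, t)) \<le> k t" if "t \<in> {s..T}" "exp (A t) \<le> norm z" "norm z \<le> exp (B t)" for z t
    using that by (intro kK) simp
  show ?thesis
  proof (rule that[of "\<lambda>t. exp (- l T) * k t"])
    show "(\<lambda>t. exp (- l T) * k t) integrable_on {s..T}" using k(1) by (rule integrable_on_mult_right)
    fix t assume t: "t \<in> {s..T}"
    then show "0 \<le> exp (- l T) * k t" using k(2) by simp
    fix \<zeta> assume z: "A t \<le> Re \<zeta>" "Re \<zeta> \<le> B t"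
    have "l T \<le> l t" using t s by (intro l_antimono) auto
    then have "exp (- Re \<zeta>) \<le> exp (- l T)" using z AB[OF t] by simp
    moreover have "norm (G (exp \<zeta>, t)) \<le> k t" using z by (intro k3 t) auto
    ultimately have "norm (G (exp \<zeta>, t)) * exp (- Re \<zeta>) \<le> k t * exp (- l T)"
      using k(2)[OF t] by (intro mult_mono) auto
    then show "norm (F t \<zeta>) \<le> exp (- l T) * k t" by (simp add: F_def norm_mult mult.commute)
  qed
qed

lemma G_measurable:
  assumes "0 \<le> s" "z \<in> annulus (r s)"
  shows "(\<lambda>t. G (z, t)) \<in> borel_measurable (lebesgue_on {s..T})"
proof (rule measurable_lebesgue_on_subset[OF _ _ time_section_sets])
  show "(\<lambda>t. G (z, t)) \<in> borel_measurable (lebesgue_on (time_section (total_domain r) z))"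
    using whvf by (simp add: weak_holomorphic_vector_field_def)
  show "{s..T} \<subseteq> time_section (total_domain r) z" using time_section_Ici[OF assms] by auto
qed auto

text \<open>The annuli grow with time, so an earlier position of the path is still in the domain at
  a later time, as \<open>Caratheodory_measurable\<close> requires.\<close>

lemma G_path_measurable:
  assumes s: "0 \<le> s" and w: "continuous_on {s..T} w" "\<And>t. t \<in> {s..T} \<Longrightarrow> w t \<in> annulus (r t)"
  shows "(\<lambda>t. G (w t, t)) \<in> borel_measurable (lebesgue_on {s..T})"
proof (rule Caratheodory_measurable[of s T "\<lambda>t z. G (z, t)" w])
  show "(\<lambda>t. G (w \<sigma>, t)) \<in> borel_measurable (lebesgue_on {\<sigma>..T})" if "\<sigma> \<in> {s..T}" for \<sigma>
    using that s w(2) by (intro G_measurable) auto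
  fix t and \<sigma> :: "nat \<Rightarrow> real" assume t: "t \<in> {s..T}" and \<sigma>: "\<And>n. \<sigma> n \<in> {s..t}" "\<sigma> \<longlonglongrightarrow> t"
  have "(\<lambda>n. w (\<sigma> n)) \<longlonglongrightarrow> w t"
  proof (rule continuous_on_tendsto_compose[OF w(1) \<sigma>(2) t])
    have "\<sigma> n \<in> {s..T}" for n using \<sigma>(1)[of n] t by auto
    then show "\<forall>\<^sub>F n in sequentially. \<sigma> n \<in> {s..T}" by simp
  qed
  moreover have "w (\<sigma> n) \<in> annulus (r t)" for n
  proof -
    have "\<sigma> n \<in> {s..T}" "0 \<le> \<sigma> n" "\<sigma> n \<le> t" using \<sigma>(1)[of n] t s by auto
    then show ?thesis using w(2)[of "\<sigma> n"] annulus_mono by blast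
  qed
  ultimately show "(\<lambda>n. G (w (\<sigma> n), t)) \<longlonglongrightarrow> G (w t, t)"
    using t s w(2)[OF t]
    by (intro continuous_on_tendsto_compose[OF holomorphic_on_imp_continuous_on[OF G_holomorphic]]) auto
qed

lemma G_path_integrable:
  assumes s: "0 \<le> s" and w: "continuous_on {s..T} w" "\<And>t. t \<in> {s..T} \<Longrightarrow> w t \<in> annulus (r t)"
  shows "(\<lambda>t. G (w t, t)) absolutely_integrable_on {s..T}"
    and "(\<lambda>t. G (w t, t) / w t) absolutely_integrable_on {s..T}"
proof -
  define K where "K = (\<lambda>t. (w t, t)) ` {s..T}"
  have "compact K" unfolding K_def by (intro compact_continuous_image continuous_intros w) auto
  moreover have "K \<subseteq> total_domain r" using s w(2) by (auto simp: K_def total_domain_def)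
  moreover have "snd ` K = {s..T}" by (auto simp: K_def image_image)
  ultimately obtain k where k: "k integrable_on {s..T}" "\<And>t. t \<in> {s..T} \<Longrightarrow> 0 \<le> k t"
      "\<And>t. t \<in> {s..T} \<Longrightarrow> norm (G (w t, t)) \<le> k t"
    using G_bound[of K s T] unfolding K_def by (metis (no_types, lifting) imageI)
  have m: "(\<lambda>t. G (w t, t)) \<in> borel_measurable (lebesgue_on {s..T})"
    by (rule G_path_measurable[OF assms])
  show "(\<lambda>t. G (w t, t)) absolutely_integrable_on {s..T}"
    by (rule measurable_bounded_by_integrable_imp_absolutely_integrable[OF m _ k(1,3)]) auto
  have [measurable]: "w \<in> borel_measurable (lebesgue_on {s..T})" by (rule continuous_on_Icc_measurable[OF w(1)])
  note [measurable] = m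
  show "(\<lambda>t. G (w t, t) / w t) absolutely_integrable_on {s..T}"
  proof (rule measurable_bounded_by_integrable_imp_absolutely_integrable)
    show "(\<lambda>t. G (w t, t) / w t) \<in> borel_measurable (lebesgue_on {s..T})" by measurable
    show "(\<lambda>t. k t / r T) integrable_on {s..T}" using k(1) by (rule integrable_on_divide)
    fix t assume t: "t \<in> {s..T}"
    then have "0 < r T" "r T \<le> r t" "r t < norm (w t)"
      using s w(2)[OF t] r_bounds(1)[of T] r_antimono[of t T] by (auto simp: annulus_def)
    then show "norm (G (w t, t) / w t) \<le> k t / r T"
      unfolding norm_divide using k(2,3)[OF t] by (intro frac_le) auto
  qed auto
qed

text \<open>\<open>L T\<close> is a branch of \<open>ln (w T / z)\<close> along the trajectory \<open>w\<close> starting at \<open>z\<close>.\<close>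

theorem semicomplete_log_solution:
  assumes sc: "semicomplete r G" and s: "0 \<le> s" and z: "z \<in> annulus (r s)"
  shows "\<exists>L :: real \<Rightarrow> complex. \<forall>T\<ge>s. continuous_on {s..T} L \<and> z * exp (L T) \<in> annulus (r T) \<and>
    (\<lambda>t. G (z * exp (L t), t) / (z * exp (L t))) absolutely_integrable_on {s..T} \<and>
    L T = integral {s..T} (\<lambda>t. G (z * exp (L t), t) / (z * exp (L t)))"
proof -
  obtain w where w: "locally_abs_continuous_on {s..} w" "\<And>t. t \<ge> s \<Longrightarrow> w t \<in> annulus (r t)"
    "AE t in lebesgue_on {s..}. (w has_vector_derivative G (w t, t)) (at t within {s..})" "w s = z"
  proof -
    have "(z, s) \<in> total_domain r" using s z by (simp add: total_domain_def)
    with sc obtain w where "locally_abs_continuous_on {s..} w" "\<forall>t\<ge>s. (w t, t) \<in> total_domain r"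
      "AE t in lebesgue_on {s..}. (w has_vector_derivative G (w t, t)) (at t within {s..})" "w s = z"
      unfolding semicomplete_def by blast
    then show ?thesis using that[of w] by (simp add: total_domain_def)
  qed
  \<comment> \<open>The logarithm of w / z arises by integrating w' / w, without choosing a branch;
    \<open>linear_ode_exp\<close> then identifies its exponential.\<close>
  define L where "L = (\<lambda>t. integral {s..t} (\<lambda>\<tau>. G (w \<tau>, \<tau>) / w \<tau>))"
  have ac: "abs_continuous_on_interval s T w" if "s \<le> T" for T
    using w(1) that by (auto simp: locally_abs_continuous_on_def)
  then have cw: "continuous_on {s..T} w" if "s \<le> T" for T
    using that by (intro abs_continuous_on_interval_imp_continuous_on) auto
  have exL: "w t = z * exp (L t)" if t: "s \<le> t" for t
  proof -
    have wa: "\<And>u. u \<in> {s..t} \<Longrightarrow> w u \<in> annulus (r u)" using w(2) by auto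
    note int = G_path_integrable[OF s cw[OF t] wa]
    have y: "w u = w s + integral {s..u} (\<lambda>t. G (w t, t))" if u: "u \<in> {s..t}" for u
    proof -
      have "((\<lambda>t. G (w t, t)) has_integral w u - w s) {s..u}"
      proof (rule abs_continuous_on_interval_has_integral_AE)
        show "s \<le> u" "abs_continuous_on_interval s u w" using u ac by auto
        have "AE x in lebesgue. s \<le> x \<longrightarrow> (w has_vector_derivative G (w x, x)) (at x within {s..})"
          using w(3) by (simp add: AE_Ici_iff)
        then show "AE x in lebesgue. x \<in> {s..u} \<longrightarrow> (w has_vector_derivative G (w x, x)) (at x within {s..u})"
          by eventually_elim (auto intro: has_vector_derivative_within_subset)
      qed
      then show ?thesis by (simp add: integral_unique)
    qed
    have "w t = w s * exp (integral {s..t} (\<lambda>\<tau>. G (w \<tau>, \<tau>) / w \<tau>))"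
    proof (rule linear_ode_exp[OF int(2,1) y])
      show "AE u in lebesgue. u \<in> {s..t} \<longrightarrow> G (w u, u) = G (w u, u) / w u * w u"
      proof (intro AE_I2 impI)
        fix u assume "u \<in> {s..t}"
        then have "w u \<noteq> 0" using wa[of u] r_bounds(1)[of u] s annulus_nonzero[of "r u" "w u"] by auto
        then show "G (w u, u) = G (w u, u) / w u * w u" by simp
      qed
    qed (use t in auto)
    then show ?thesis by (simp add: L_def w(4))
  qed
  show ?thesis
  proof (intro exI[of _ L] allI impI conjI)
    fix T assume T: "s \<le> T"
    have wa: "\<And>u. u \<in> {s..T} \<Longrightarrow> w u \<in> annulus (r u)" using w(2) by auto
    note int = G_path_integrable(2)[OF s cw[OF T] wa]
    show "continuous_on {s..T} L"
      unfolding L_def using int by (intro indefinite_integral_continuous_1) (simp add: absolutely_integrable_on_def)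
    show "z * exp (L T) \<in> annulus (r T)" using w(2)[OF T] exL[OF T] by simp
    show "(\<lambda>t. G (z * exp (L t), t) / (z * exp (L t))) absolutely_integrable_on {s..T}"
      by (rule absolutely_integrable_spike_eq[THEN iffD1, OF negligible_empty _ int]) (simp add: exL)
    have "L T = integral {s..T} (\<lambda>\<tau>. G (w \<tau>, \<tau>) / w \<tau>)" by (simp add: L_def)
    also have "\<dots> = integral {s..T} (\<lambda>t. G (z * exp (L t), t) / (z * exp (L t)))"
      by (intro Henstock_Kurzweil_Integration.integral_cong) (simp add: exL)
    finally show "L T = integral {s..T} (\<lambda>t. G (z * exp (L t), t) / (z * exp (L t)))" .
  qed
qed

text \<open>A logarithmic solution is picked separately for each starting point. In the coordinate
  \<zeta> the functions \<zeta> + L solve one equation with right-hand side \<open>F\<close>, whose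
  solutions depend holomorphically on the initial value. As \<open>L\<close> depends on
  \<open>z\<close> and not on a choice of its logarithm, holomorphy descends to the annulus.\<close>

theorem semicomplete_flow:
  assumes sc: "semicomplete r G" and s: "0 \<le> s"
  obtains L :: "complex \<Rightarrow> real \<Rightarrow> complex" where
    "\<And>T. T \<ge> s \<Longrightarrow> (\<lambda>z. L z T) holomorphic_on annulus (r s)"
    "\<And>z T. z \<in> annulus (r s) \<Longrightarrow> T \<ge> s \<Longrightarrow> continuous_on {s..T} (L z)"
    "\<And>z T. z \<in> annulus (r s) \<Longrightarrow> T \<ge> s \<Longrightarrow> z * exp (L z T) \<in> annulus (r T)"
    "\<And>z T. z \<in> annulus (r s) \<Longrightarrow> T \<ge> s \<Longrightarrow>
      (\<lambda>t. G (z * exp (L z t), t) / (z * exp (L z t))) absolutely_integrable_on {s..T}"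
    "\<And>z T. z \<in> annulus (r s) \<Longrightarrow> T \<ge> s \<Longrightarrow>
      L z T = integral {s..T} (\<lambda>t. G (z * exp (L z t), t) / (z * exp (L z t)))"
proof -
  have "\<forall>z\<in>annulus (r s). \<exists>L :: real \<Rightarrow> complex. \<forall>T\<ge>s. continuous_on {s..T} L \<and> z * exp (L T) \<in> annulus (r T) \<and>
    (\<lambda>t. G (z * exp (L t), t) / (z * exp (L t))) absolutely_integrable_on {s..T} \<and>
    L T = integral {s..T} (\<lambda>t. G (z * exp (L t), t) / (z * exp (L t)))"
    using semicomplete_log_solution[OF sc s] by blast
  from bchoice[OF this] obtain L where L: "\<And>z T. z \<in> annulus (r s) \<Longrightarrow> T \<ge> s \<Longrightarrow>
    continuous_on {s..T} (L z) \<and> z * exp (L z T) \<in> annulus (r T) \<and>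
    (\<lambda>t. G (z * exp (L z t), t) / (z * exp (L z t))) absolutely_integrable_on {s..T} \<and>
    L z T = integral {s..T} (\<lambda>t. G (z * exp (L z t), t) / (z * exp (L z t)))"
    by blast
  have Lc: "continuous_on {s..T} (L z)" and La: "z * exp (L z T) \<in> annulus (r T)"
    and Li: "(\<lambda>t. G (z * exp (L z t), t) / (z * exp (L z t))) absolutely_integrable_on {s..T}"
    and Le: "L z T = integral {s..T} (\<lambda>t. G (z * exp (L z t), t) / (z * exp (L z t)))"
    if "z \<in> annulus (r s)" "T \<ge> s" for z T
    using L[OF that] by blast+
  define U where "U = {\<zeta>. l s < Re \<zeta> \<and> Re \<zeta> < 0}"
  have U: "open U" unfolding U_def
    by (intro open_Collect_conj open_halfspace_Re_gt open_halfspace_Re_lt)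
  have Uann: "exp \<zeta> \<in> annulus (r s)" if "\<zeta> \<in> U" for \<zeta> using that annulus_exp_iff[OF s] by (simp add: U_def)
  define X where "X = (\<lambda>\<zeta> t. \<zeta> + L (exp \<zeta>) t)"
  have FX: "F t (X \<zeta> t) = G (exp \<zeta> * exp (L (exp \<zeta>) t), t) / (exp \<zeta> * exp (L (exp \<zeta>) t))" for \<zeta> t
    unfolding F_def X_def exp_minus exp_add divide_inverse ..
  have Xsol: "integral_solution F s T (X \<zeta>)" and Xs: "X \<zeta> s = \<zeta>"
    and Xc: "continuous_on {s..T} (X \<zeta>)"
    and Xstrip: "\<And>t. t \<in> {s..T} \<Longrightarrow> l t < Re (X \<zeta> t) \<and> Re (X \<zeta> t) < 0" if \<zeta>: "\<zeta> \<in> U" and T: "s \<le> T" for \<zeta> T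
  proof -
    have Ls: "L (exp \<zeta>) s = 0" by (subst Le[OF Uann[OF \<zeta>]]) auto
    then show Xs: "X \<zeta> s = \<zeta>" by (simp add: X_def)
    show "integral_solution F s T (X \<zeta>)"
      unfolding integral_solution_def
    proof (intro conjI ballI)
      show "(\<lambda>t. F t (X \<zeta> t)) absolutely_integrable_on {s..T}"
        unfolding FX by (rule Li[OF Uann[OF \<zeta>] T])
      fix t assume "t \<in> {s..T}"
      then have "L (exp \<zeta>) t = integral {s..t} (\<lambda>t. F t (X \<zeta> t))" unfolding FX by (intro Le Uann \<zeta>) simp
      then show "X \<zeta> t = X \<zeta> s + integral {s..t} (\<lambda>\<tau>. F \<tau> (X \<zeta> \<tau>))" unfolding Xs by (simp add: X_def)
    qed
    show "continuous_on {s..T} (X \<zeta>)"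
      unfolding X_def by (intro continuous_intros Lc[OF Uann[OF \<zeta>] T])
    fix t assume t: "t \<in> {s..T}"
    then have "exp (X \<zeta> t) \<in> annulus (r t)" using La[OF Uann[OF \<zeta>], of t] by (simp add: X_def exp_add)
    then show "l t < Re (X \<zeta> t) \<and> Re (X \<zeta> t) < 0" using t s by (subst (asm) annulus_exp_iff) auto
  qed
  have XT: "(\<lambda>\<zeta>. X \<zeta> T) field_differentiable (at \<zeta>0)" if \<zeta>0: "\<zeta>0 \<in> U" and T: "s \<le> T" for \<zeta>0 T
  proof -
    define x where "x = X \<zeta>0"
    have xc: "continuous_on {s..T} x" unfolding x_def by (rule Xc[OF \<zeta>0 T])
    have lc: "continuous_on {s..T} l" using s by (intro continuous_on_subset[OF l_continuous]) auto
    have "continuous_on {s..T} (\<lambda>t. min (Re (x t) - l t) (- Re (x t)))"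
      by (intro continuous_intros xc lc)
    then obtain t0 where t0: "t0 \<in> {s..T}" "\<And>t. t \<in> {s..T} \<Longrightarrow>
        min (Re (x t0) - l t0) (- Re (x t0)) \<le> min (Re (x t) - l t) (- Re (x t))"
      using continuous_attains_inf[of "{s..T}" "\<lambda>t. min (Re (x t) - l t) (- Re (x t))"] T by auto
    \<comment> \<open>\<open>m\<close> is the least distance of the trajectory from the two edges of
      the moving strip. Half of it is kept as a margin for the majorant; the radius e = m / 4 makes
      the discs of radius 2 e fit into the other half.\<close>
    define m where "m = min (Re (x t0) - l t0) (- Re (x t0))"
    have m: "m > 0" using Xstrip[OF \<zeta>0 T t0(1)] by (simp add: m_def x_def)
    have mx: "l t + m \<le> Re (x t)" "Re (x t) \<le> - m" if "t \<in> {s..T}" for t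
      using t0(2)[OF that] by (simp_all add: m_def[symmetric])
    obtain \<kappa> where \<kappa>: "\<kappa> integrable_on {s..T}" "\<And>t. t \<in> {s..T} \<Longrightarrow> 0 \<le> \<kappa> t"
      "\<And>t \<zeta>. t \<in> {s..T} \<Longrightarrow> l t + m / 2 \<le> Re \<zeta> \<Longrightarrow> Re \<zeta> \<le> - m / 2 \<Longrightarrow> norm (F t \<zeta>) \<le> \<kappa> t"
    proof (rule F_bound[of s T "\<lambda>t. l t + m / 2" "\<lambda>_. - m / 2"])
      show "continuous_on {s..T} (\<lambda>t. l t + m / 2)" by (intro continuous_intros lc)
      show "l t < l t + m / 2 \<and> l t + m / 2 \<le> - m / 2 \<and> - m / 2 < 0" if "t \<in> {s..T}" for t
        using mx[OF that] m by auto
    qed (use s in auto)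
    have ball: "l t + m / 2 \<le> Re \<zeta> \<and> Re \<zeta> \<le> - m / 2" if "t \<in> {s..T}" "\<zeta> \<in> ball (x t) (2 * (m / 4))" for t \<zeta>
    proof -
      have "\<bar>Re (\<zeta> - x t)\<bar> \<le> norm (\<zeta> - x t)" by (rule abs_Re_le_cmod)
      also have "\<dots> < m / 2" using that(2) by (simp add: dist_norm norm_minus_commute)
      finally have "\<bar>Re \<zeta> - Re (x t)\<bar> < m / 2" by simp
      then show ?thesis using mx[OF that(1)] by (intro conjI) linarith+
    qed
    show ?thesis
    proof (rule integral_solution_holomorphic_dependence[OF U \<zeta>0 _ _ \<kappa>(1) _ T, where e = "m / 4" and X = X and F = F])
      show "integral_solution F s T (X \<zeta>)" "X \<zeta> s = \<zeta>" if "\<zeta> \<in> U" for \<zeta> using Xsol[OF that T] Xs[OF that T] by auto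
      show "m / 4 > 0" using m by simp
      fix t assume t: "t \<in> {s..T}"
      show "F t holomorphic_on ball (X \<zeta>0 t) (2 * (m / 4))"
      proof (rule holomorphic_on_subset[OF F_holomorphic])
        show "ball (X \<zeta>0 t) (2 * (m / 4)) \<subseteq> {\<zeta>. l t < Re \<zeta> \<and> Re \<zeta> < 0}"
          using ball[OF t] m by (fastforce simp: x_def)
      qed (use t s in auto)
      show "norm (F t z) \<le> \<kappa> t" if "z \<in> ball (X \<zeta>0 t) (2 * (m / 4))" for z
        using ball[OF t, of z] that by (intro \<kappa>(3) t) (auto simp: x_def)
    qed
  qed
  show ?thesis
  proof (rule that[of L])
    fix T assume T: "s \<le> T"
    show "(\<lambda>z. L z T) holomorphic_on annulus (r s)"
      unfolding holomorphic_on_def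
    proof
      fix z assume z: "z \<in> annulus (r s)"
      then have z0: "z \<noteq> 0" using r_bounds(1)[OF s] by (auto simp: annulus_def)
      \<comment> \<open>A branch of the logarithm that is holomorphic near \<open>z\<close> also
        when \<open>z\<close> lies on the branch cut of \<open>Ln\<close>.\<close>
      define g where "g = (\<lambda>u. Ln (u / z) + Ln z)"
      have gexp: "exp (g u) = u" if "u \<noteq> 0" for u using that z0 by (simp add: g_def exp_add)
      have gz: "g z = Ln z" using z0 by (simp add: g_def)
      have "z / z \<notin> \<real>\<^sub>\<le>\<^sub>0" using z0 by simp
      then have gd: "g field_differentiable (at z)"
        unfolding g_def using z0 by (intro derivative_intros field_differentiable_compose[of "\<lambda>u. u / z" z Ln, unfolded o_def] field_differentiable_within_Ln) auto
      have Lz: "Ln z \<in> U" using z z0 annulus_exp_iff[OF s, of "Ln z"] by (simp add: U_def)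
      have "((\<lambda>\<zeta>. X \<zeta> T) \<circ> g) field_differentiable (at z)"
        by (rule field_differentiable_compose[OF gd]) (simp only: gz XT[OF Lz T])
      then have "(\<lambda>u. X (g u) T - g u) field_differentiable (at z)"
        using gd unfolding o_def by (intro derivative_intros)
      then have "(\<lambda>u. X (g u) T - g u) field_differentiable (at z within annulus (r s))"
        by (rule field_differentiable_at_within)
      then show "(\<lambda>z. L z T) field_differentiable (at z within annulus (r s))"
      proof (rule field_differentiable_transform_within[OF zero_less_one z, rotated])
        show "X (g u) T - g u = L u T" if "u \<in> annulus (r s)" for u
        proof -
          have "u \<noteq> 0" using that r_bounds(1)[OF s] by (auto simp: annulus_def)
          then show ?thesis by (simp add: X_def gexp)
        qed
      qed
    qed
  qed (fact Lc La Li Le)+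
qed

end

section \<open>The field and the flow on a fixed circle\<close>

lemma has_vector_derivative_sequentially:
  fixes f :: "real \<Rightarrow> 'a::real_normed_vector"
  assumes f: "(f has_vector_derivative D) (at s within S)" and S: "\<And>j. s + 1 / real (Suc j) \<in> S"
  shows "(\<lambda>j. real (Suc j) *\<^sub>R (f (s + 1 / real (Suc j)) - f s)) \<longlonglongrightarrow> D"
proof (rule LIMSEQ_I)
  fix e :: real assume "e > 0"
  then have "e / 2 > 0" by simp
  then obtain \<delta> where "\<delta> > 0" and \<delta>: "\<And>y. y \<in> S \<Longrightarrow> norm (y - s) < \<delta> \<Longrightarrow> norm (f y - f s - (y - s) *\<^sub>R D) \<le> e / 2 * norm (y - s)"
    using f unfolding has_vector_derivative_def has_derivative_within_alt by blast
  obtain J where J: "1 / real (Suc J) < \<delta>" using \<open>\<delta> > 0\<close> by (meson nat_approx_posE)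
  show "\<exists>J. \<forall>j\<ge>J. norm (real (Suc j) *\<^sub>R (f (s + 1 / real (Suc j)) - f s) - D) < e"
  proof (intro exI[of _ J] allI impI)
    fix j assume "j \<ge> J"
    define c where "c = real (Suc j)"
    have c: "c > 0" by (simp add: c_def)
    have "1 / c \<le> 1 / real (Suc J)" using \<open>j \<ge> J\<close> unfolding c_def by (intro divide_left_mono) auto
    moreover have Sc: "s + 1 / c \<in> S" using S[of j] unfolding c_def .
    ultimately have "norm (f (s + 1 / c) - f s - (s + 1 / c - s) *\<^sub>R D) \<le> e / 2 * norm (s + 1 / c - s)"
      using J c by (intro \<delta>) auto
    then have "norm (f (s + 1 / c) - f s - (1 / c) *\<^sub>R D) \<le> e / 2 * (1 / c)"
      using c by simp
    then have "c * norm (f (s + 1 / c) - f s - (1 / c) *\<^sub>R D) \<le> c * (e / 2 * (1 / c))"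
      using c by (intro mult_left_mono) auto
    moreover have "c *\<^sub>R (f (s + 1 / c) - f s) - D = c *\<^sub>R (f (s + 1 / c) - f s - (1 / c) *\<^sub>R D)"
      using c by (simp add: scaleR_diff_right)
    ultimately have "norm (c *\<^sub>R (f (s + 1 / c) - f s) - D) \<le> c * (e / 2 * (1 / c))"
      using c by (simp only: norm_scaleR abs_of_pos)
    also have "\<dots> < e" using c \<open>e > 0\<close> by simp
    finally show "norm (real (Suc j) *\<^sub>R (f (s + 1 / real (Suc j)) - f s) - D) < e" by (simp add: c_def)
  qed
qed

text \<open>The conjugate of \<open>f\<close> contributes the conjugate coefficient of opposite
  index, with the reciprocal power of the radius. Because the powers differ, values on two circles
  separate the coefficient of index n from that of index -n.\<close>

lemma integral_Re_circle:
  assumes f: "f holomorphic_on annulus r" and r: "0 < r" "r < \<rho>" "\<rho> < 1"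
  shows "integral {0..1} (\<lambda>x. of_real (Re (f (of_real \<rho> * cis2pi x))) * cis2pi x powi (- n)) =
    (laurent_coeff f \<rho> n * of_real (\<rho> powi n) + cnj (laurent_coeff f \<rho> (- n)) * of_real (\<rho> powi (- n))) / 2"
proof -
  define g where "g = (\<lambda>x. f (of_real \<rho> * cis2pi x))"
  have g: "continuous_on {0..1} g" unfolding g_def using r by (intro continuous_on_circle[OF f]) auto
  have E: "continuous_on {0..1} (\<lambda>x. cis2pi x powi m)" for m by (intro continuous_intros) auto
  have I: "(\<lambda>x. g x * cis2pi x powi m) integrable_on {0..1}" "(\<lambda>x. cnj (g x) * cis2pi x powi m) integrable_on {0..1}" for m
    by (intro integrable_continuous_interval continuous_intros g E)+
  have co: "laurent_coeff f \<rho> m * of_real (\<rho> powi m) = integral {0..1} (\<lambda>x. g x * cis2pi x powi (- m))" for m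
  proof -
    have "of_real (\<rho> powi m) * (of_real \<rho> * u) powi (- m) = u powi (- m)" for u :: complex
      using r by (simp add: power_int_mult_distrib power_int_minus)
    then have "y * u powi (- m) = of_real (\<rho> powi m) * (y * (of_real \<rho> * u) powi (- m))" for u y :: complex
      by (metis mult.left_commute)
    then have "integral {0..1} (\<lambda>x. g x * cis2pi x powi (- m)) =
        integral {0..1} (\<lambda>x. of_real (\<rho> powi m) * (f (of_real \<rho> * cis2pi x) * (of_real \<rho> * cis2pi x) powi (- m)))"
      unfolding g_def by (intro Henstock_Kurzweil_Integration.integral_cong)
    also have "\<dots> = of_real (\<rho> powi m) * laurent_coeff f \<rho> m"
      unfolding laurent_coeff_def by (rule Henstock_Kurzweil_Integration.integral_mult_right)
    finally show ?thesis by (simp only: mult.commute)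
  qed
  have cn: "cnj (laurent_coeff f \<rho> (- n)) * of_real (\<rho> powi (- n)) = integral {0..1} (\<lambda>x. cnj (g x) * cis2pi x powi (- n))"
  proof -
    have "cnj (laurent_coeff f \<rho> (- n)) * of_real (\<rho> powi (- n)) = cnj (laurent_coeff f \<rho> (- n) * of_real (\<rho> powi (- n)))" by simp
    also have "\<dots> = cnj (integral {0..1} (\<lambda>x. g x * cis2pi x powi n))" using co[of "- n"] by simp
    also have "\<dots> = integral {0..1} (\<lambda>x. cnj (g x * cis2pi x powi n))"
      by (rule integral_cnj)
    also have "\<dots> = integral {0..1} (\<lambda>x. cnj (g x) * cis2pi x powi (- n))"
    proof -
      have "cnj (cis2pi x powi n) = cis2pi x powi (- n)" for x
        unfolding cis2pi_powi exp_cnj by simp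
      then show ?thesis by simp
    qed
    finally show ?thesis .
  qed
  have "of_real (Re (g x)) * cis2pi x powi (- n) = (g x * cis2pi x powi (- n) + cnj (g x) * cis2pi x powi (- n)) / 2" for x
    by (simp add: complex_add_cnj flip: distrib_right)
  then have "integral {0..1} (\<lambda>x. of_real (Re (g x)) * cis2pi x powi (- n)) =
      integral {0..1} (\<lambda>x. (g x * cis2pi x powi (- n) + cnj (g x) * cis2pi x powi (- n)) / 2)"
    by (intro Henstock_Kurzweil_Integration.integral_cong)
  also have "\<dots> = (integral {0..1} (\<lambda>x. g x * cis2pi x powi (- n)) + integral {0..1} (\<lambda>x. cnj (g x) * cis2pi x powi (- n))) / 2"
    by (simp add: Henstock_Kurzweil_Integration.integral_add[OF I])
  finally show ?thesis unfolding co[symmetric] cn[symmetric] by (simp add: g_def)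
qed

context whvf_system
begin

text \<open>Because \<open>r\<close> is non-increasing, one circle, of radius \<open>rho0\<close>, and its neighbourhood \<open>slice\<close> lie in all \<open>D\<^sub>t\<close>.\<close>

definition "rho0 = (1 + r 0) / 2"
definition "eta = (1 - r 0) / 4"
definition "slice = {z :: complex. rho0 - eta \<le> norm z \<and> norm z \<le> rho0 + eta}"
definition "H t z = G (z, t) / z"
text \<open>A function of the Villat class has the mass of its first measure as zeroth Laurent
  coefficient, which is real. Taking imaginary parts of the zeroth coefficients of G / z in the
  desired formula therefore leaves no other choice of \<open>C\<close>, up to a null set.\<close>

definition "C t = Im (laurent_coeff (H t) rho0 0)"

lemma rho0_bounds: "r 0 < rho0 - eta" "0 < rho0 - eta" "rho0 + eta < 1" "0 < eta" "r 0 < rho0" "rho0 < 1" "0 < rho0" "eta < 1"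
  using r_bounds[of 0] by (auto simp: rho0_def eta_def field_simps)

lemma rho0_annulus: "t \<ge> 0 \<Longrightarrow> r t < rho0"
  using r_antimono[of 0 t] rho0_bounds(5) by simp

lemma slice_annulus: "t \<ge> 0 \<Longrightarrow> slice \<subseteq> annulus (r t)"
  using r_antimono[of 0 t] rho0_bounds by (auto simp: slice_def annulus_def)

lemma cball_slice:
  assumes "norm z = rho0"
  shows "cball z eta \<subseteq> slice"
proof
  fix u assume "u \<in> cball z eta"
  then show "u \<in> slice"
    using norm_triangle_ineq2[of z u] norm_triangle_ineq2[of u z] assms
    by (simp add: slice_def dist_norm norm_minus_commute)
qed

lemma H_holomorphic: "t \<ge> 0 \<Longrightarrow> H t holomorphic_on annulus (r t)"
  unfolding H_def using r_bounds(1)[of t]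
  by (intro holomorphic_intros G_holomorphic) (auto simp: annulus_def)

lemma slice_bound:
  assumes "0 \<le> N"
  obtains h where "Ld_on d {0..N} h" "h integrable_on {0..N}" "\<And>t. t \<in> {0..N} \<Longrightarrow> 0 \<le> h t"
    "\<And>t z. t \<in> {0..N} \<Longrightarrow> z \<in> slice \<Longrightarrow> norm (H t z) \<le> h t"
proof -
  have AB: "\<forall>t\<in>{0..N}. l t < ln (rho0 - eta) \<and> ln (rho0 - eta) \<le> ln (rho0 + eta) \<and> ln (rho0 + eta) < 0"
  proof
    fix t assume "t \<in> {0..N}"
    then have "r t < rho0 - eta" "0 < r t" using r_antimono[of 0 t] r_bounds(1)[of t] rho0_bounds(1) by auto
    then show "l t < ln (rho0 - eta) \<and> ln (rho0 - eta) \<le> ln (rho0 + eta) \<and> ln (rho0 + eta) < 0"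
      using rho0_bounds by (auto simp: l_def ln_less_zero)
  qed
  have K: "{(z, t). t \<in> {0..N} \<and> exp (ln (rho0 - eta)) \<le> norm z \<and> norm z \<le> exp (ln (rho0 + eta))} = {(z, t). t \<in> {0..N} \<and> z \<in> slice}"
    using rho0_bounds by (auto simp: slice_def)
  note tube = compact_tube[OF order_refl continuous_on_const continuous_on_const AB, unfolded K]
  obtain k where k: "Ld_on d {0..N} k" "k integrable_on {0..N}" "\<And>t. t \<in> {0..N} \<Longrightarrow> 0 \<le> k t"
    and kK: "\<And>z t. (z, t) \<in> {(z, t). t \<in> {0..N} \<and> z \<in> slice} \<Longrightarrow> norm (G (z, t)) \<le> k t"
    by (rule G_bound[OF tube]) (rule that)
  define c where "c = 1 / (rho0 - eta)"
  have c: "c > 0" using rho0_bounds by (simp add: c_def)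
  show ?thesis
  proof (rule that[of "\<lambda>t. c * k t"])
    show "Ld_on d {0..N} (\<lambda>t. c * k t)"
    proof (rule Ld_on_dominated2[OF d k(1) k(1), where A = c and B = 0])
      have [measurable]: "k \<in> borel_measurable (lebesgue_on {0..N})" using k(1) by (simp add: Ld_on_def)
      show "(\<lambda>t. c * k t) \<in> borel_measurable (lebesgue_on {0..N})" by measurable
    qed (use c in \<open>auto simp: abs_mult\<close>)
    show "(\<lambda>t. c * k t) integrable_on {0..N}" using k(2) by (rule integrable_on_mult_right)
    show "0 \<le> c * k t" if "t \<in> {0..N}" for t using k(3)[OF that] c by simp
    show "norm (H t z) \<le> c * k t" if "t \<in> {0..N}" "z \<in> slice" for t z
    proof -
      have "norm (G (z, t)) \<le> k t" using that by (intro kK) simp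
      moreover have "rho0 - eta \<le> norm z" using that(2) by (simp add: slice_def)
      ultimately have "norm (G (z, t)) / norm z \<le> k t / (rho0 - eta)"
        using rho0_bounds k(3)[OF that(1)] by (intro frac_le) auto
      then show ?thesis by (simp add: H_def norm_divide c_def)
    qed
  qed
qed

lemma H_measurable:
  assumes "z \<in> slice"
  shows "(\<lambda>t. H t z) \<in> borel_measurable (lebesgue_on {0..N})"
proof -
  have "(\<lambda>t. G (z, t)) \<in> borel_measurable (lebesgue_on {0..N})"
    using slice_annulus[of 0] assms by (intro G_measurable) auto
  then show ?thesis unfolding H_def by (intro borel_measurable_divide) auto
qed

lemma circle_in_slice: "norm z = rho0 \<Longrightarrow> z \<in> slice"
  using rho0_bounds by (simp add: slice_def)

lemma H_integrable:
  assumes "z \<in> slice" "0 \<le> N"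
  shows "(\<lambda>t. H t z) absolutely_integrable_on {0..N}"
proof -
  obtain h where h: "Ld_on d {0..N} h" "h integrable_on {0..N}" "\<And>t. t \<in> {0..N} \<Longrightarrow> 0 \<le> h t"
    "\<And>t z. t \<in> {0..N} \<Longrightarrow> z \<in> slice \<Longrightarrow> norm (H t z) \<le> h t"
    by (rule slice_bound[OF assms(2)]) (rule that)
  show ?thesis
    by (rule measurable_bounded_by_integrable_imp_absolutely_integrable[OF H_measurable[OF assms(1)] _ h(2) h(4)])
      (use assms in auto)
qed

lemma H_Lipschitz:
  assumes t: "t \<ge> 0" and B: "\<And>z. z \<in> slice \<Longrightarrow> norm (H t z) \<le> B" and z: "norm z = rho0"
    and uv: "norm (u - z) \<le> eta / 2" "norm (v - z) \<le> eta / 2"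
  shows "norm (H t u - H t v) \<le> B / (eta / 2) * norm (u - v)"
proof (rule holomorphic_Lipschitz[of "cball z (eta / 2)" _ slice])
  show "H t holomorphic_on slice" by (rule holomorphic_on_subset[OF H_holomorphic[OF t] slice_annulus[OF t]])
  show "cball w (eta / 2) \<subseteq> slice" if "w \<in> cball z (eta / 2)" for w
  proof -
    have "cball w (eta / 2) \<subseteq> cball z eta" using that rho0_bounds(4) by (simp add: cball_subset_cball_iff dist_commute)
    then show ?thesis using cball_slice[OF z] by blast
  qed
qed (use uv rho0_bounds B in \<open>auto simp: dist_norm norm_minus_commute\<close>)

end

context whvf_system
begin

text \<open>
  The Lipschitz estimate of \<open>H\<close> on \<open>slice\<close> extends differentiability at \<open>s\<close> from a countable dense set of
  points of the circle, for which one null set of exceptional \<open>s\<close> suffices, to the whole circle.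
\<close>

lemma flow_average_limit:
  fixes L :: "complex \<Rightarrow> real \<Rightarrow> complex"
  assumes s: "0 \<le> s" "s + 1 \<le> N"
    and h: "h integrable_on {0..N}" "\<And>t. t \<in> {0..N} \<Longrightarrow> 0 \<le> h t"
      "\<And>t z. t \<in> {0..N} \<Longrightarrow> z \<in> slice \<Longrightarrow> norm (H t z) \<le> h t"
    and dh: "((\<lambda>t. integral {0..t} h) has_vector_derivative h s) (at s within {0..N})"
    and dH: "\<And>x. x \<in> \<rat> \<Longrightarrow> ((\<lambda>t. integral {0..t} (\<lambda>\<tau>. H \<tau> (of_real rho0 * cis2pi x))) has_vector_derivative
        H s (of_real rho0 * cis2pi x)) (at s within {0..N})"
    and Lc: "\<And>z T. z \<in> annulus (r s) \<Longrightarrow> T \<ge> s \<Longrightarrow> continuous_on {s..T} (L z)"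
    and Li: "\<And>z T. z \<in> annulus (r s) \<Longrightarrow> T \<ge> s \<Longrightarrow> (\<lambda>t. H t (z * exp (L z t))) absolutely_integrable_on {s..T}"
    and Le: "\<And>z T. z \<in> annulus (r s) \<Longrightarrow> T \<ge> s \<Longrightarrow> L z T = integral {s..T} (\<lambda>t. H t (z * exp (L z t)))"
  shows "\<exists>M J. (\<forall>j\<ge>J. \<forall>x. norm (real (Suc j) *\<^sub>R L (of_real rho0 * cis2pi x) (s + 1 / real (Suc j))) \<le> M) \<and>
    (\<forall>x. (\<lambda>j. real (Suc j) *\<^sub>R L (of_real rho0 * cis2pi x) (s + 1 / real (Suc j))) \<longlonglongrightarrow> H s (of_real rho0 * cis2pi x))"
proof -
  define c where "c = (\<lambda>x. of_real rho0 * cis2pi x)"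
  have c_norm: "norm (c x) = rho0" for x using rho0_bounds by (simp add: c_def norm_mult)
  have c_slice: "c x \<in> slice" for x by (rule circle_in_slice[OF c_norm])
  have c_ann: "c x \<in> annulus (r s)" for x using slice_annulus[OF s(1)] c_slice by blast
  define t where "t = (\<lambda>j. s + 1 / real (Suc j))"
  have tN: "s \<le> t j" "t j \<le> N" "{s..t j} \<subseteq> {0..N}" "t j \<in> {0..N}" for j
  proof -
    have "1 / real (Suc j) \<le> 1" "1 / real (Suc j) \<ge> 0" by auto
    then have "s \<le> t j" "t j \<le> N" using s unfolding t_def by linarith+
    then show "s \<le> t j" "t j \<le> N" "{s..t j} \<subseteq> {0..N}" "t j \<in> {0..N}" using s by auto
  qed
  have diff: "integral {0..t j} q - integral {0..s} q = integral {s..t j} q"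
    if "q integrable_on {0..N}" for q :: "real \<Rightarrow> 'b::banach" and j
  proof -
    have "q integrable_on {0..t j}" using that by (rule integrable_on_subinterval) (use tN in auto)
    from Henstock_Kurzweil_Integration.integral_combine[OF s(1) tN(1) this] show ?thesis by (simp add: diff_eq_eq add.commute)
  qed
  have hs: "h integrable_on {a..b}" if "{a..b} \<subseteq> {0..N}" for a b
    using h(1) that by (rule integrable_on_subinterval)
  define I where "I = (\<lambda>j. integral {s..t j} h)"
  have I0: "I j \<ge> 0" for j unfolding I_def
    using hs[OF tN(3)] h(2) tN(3)[of j] by (intro Henstock_Kurzweil_Integration.integral_nonneg) auto
  have seqN: "s + 1 / real (Suc j) \<in> {0..N}" for j using tN(4)[of j] by (simp add: t_def)
  have "(\<lambda>j. real (Suc j) *\<^sub>R (integral {0..t j} h - integral {0..s} h)) \<longlonglongrightarrow> h s"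
    using has_vector_derivative_sequentially[OF dh seqN] by (simp only: t_def)
  then have "Bseq (\<lambda>j. real (Suc j) * I j)"
    unfolding diff[OF h(1)] I_def by (intro convergent_imp_Bseq convergentI) (simp only: real_scaleR_def)
  \<comment> \<open>\<open>M0\<close> bounds the averages of the majorant over the intervals from
    \<open>s\<close> to \<open>t j\<close>; they converge because the integral of \<open>h\<close>
    is differentiable at \<open>s\<close>.\<close>
  then obtain M0 where M0: "M0 > 0" "\<And>j. norm (real (Suc j) * I j) \<le> M0" by (auto elim!: BseqE)
  have IM: "real (Suc j) * I j \<le> M0" for j using M0(2)[of j] by simp
  have IM': "I j \<le> M0 * (1 / real (Suc j))" for j
    using IM[of j] by (simp add: field_simps)
  \<comment> \<open>As exp 1 \<le> 3, a logarithm of norm at most c0 \<le> 1 moves a point of the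
    circle by at most 3 c0 \<le> eta / 2, the range in which \<open>H_Lipschitz\<close>
    applies.\<close>
  define c0 where "c0 = min 1 (eta / 6)"
  have c0: "c0 > 0" "c0 \<le> 1" "3 * c0 \<le> eta / 2" using rho0_bounds by (auto simp: c0_def)
  have "c0 / M0 > 0" using c0 M0 by simp
  then obtain J where J: "1 / real (Suc J) < c0 / M0" by (meson nat_approx_posE)
  have Ic0: "I j < c0" if "j \<ge> J" for j
  proof -
    have "1 / real (Suc j) \<le> 1 / real (Suc J)" using that by (intro divide_left_mono) auto
    then have "1 / real (Suc j) < c0 / M0" using J by linarith
    then have "M0 * (1 / real (Suc j)) < M0 * (c0 / M0)" using M0(1) by (intro mult_strict_left_mono)
    then show ?thesis using IM'[of j] M0(1) by simp
  qed
  have expd: "norm (c x * exp \<zeta> - c x) \<le> 3 * norm \<zeta>" if "norm \<zeta> \<le> c0" for x \<zeta>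
  proof -
    have "norm (exp \<zeta> - exp 0) \<le> exp 1 * norm (\<zeta> - 0)"
      using that c0 by (intro norm_exp_diff_le) auto
    then have "norm (exp \<zeta> - 1) \<le> exp 1 * norm \<zeta>" by simp
    also have "\<dots> \<le> 3 * norm \<zeta>" using exp_le by (intro mult_right_mono) auto
    finally have "norm (exp \<zeta> - 1) \<le> 3 * norm \<zeta>" .
    moreover have "c x * exp \<zeta> - c x = c x * (exp \<zeta> - 1)" by (simp add: algebra_simps)
    moreover have "norm (c x * (exp \<zeta> - 1)) \<le> 1 * norm (exp \<zeta> - 1)"
      unfolding norm_mult c_norm using rho0_bounds by (intro mult_right_mono) auto
    ultimately show ?thesis by simp
  qed
  have Lbound: "norm (L (c x) \<tau>) \<le> I j"
    if \<tau>: "\<tau> \<in> {s..t j}" and le: "\<And>u. u \<in> {s..\<tau>} \<Longrightarrow> norm (L (c x) u) \<le> c0" for x j \<tau>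
  proof -
    have s\<tau>: "{s..\<tau>} \<subseteq> {0..N}" using \<tau> tN(3)[of j] by auto
    have "norm (L (c x) \<tau>) \<le> integral {s..\<tau>} h"
    proof (subst Le[OF c_ann[of x]])
      show "norm (integral {s..\<tau>} (\<lambda>t. H t (c x * exp (L (c x) t)))) \<le> integral {s..\<tau>} h"
      proof (rule Henstock_Kurzweil_Integration.integral_norm_bound_integral)
        show "(\<lambda>t. H t (c x * exp (L (c x) t))) integrable_on {s..\<tau>}"
          using Li[OF c_ann[of x], of \<tau>] \<tau> by (simp add: absolutely_integrable_on_def)
        show "h integrable_on {s..\<tau>}" by (rule hs[OF s\<tau>])
        fix u assume u: "u \<in> {s..\<tau>}"
        have "norm (c x * exp (L (c x) u) - c x) \<le> eta"
          using expd[OF le[OF u], of x] le[OF u] c0 rho0_bounds by linarith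
        then have "c x * exp (L (c x) u) \<in> slice"
          using cball_slice[OF c_norm, of x] by (auto simp: dist_norm norm_minus_commute)
        then show "norm (H u (c x * exp (L (c x) u))) \<le> h u" using u s\<tau> by (intro h(3)) auto
      qed
    qed (use \<tau> in auto)
    also have "\<dots> \<le> I j" unfolding I_def
      using \<tau> hs[OF s\<tau>] hs[OF tN(3)] h(2) tN(3)[of j] by (intro integral_subset_le) auto
    finally show ?thesis .
  qed
  \<comment> \<open>For j \<ge> J the integral \<open>I j\<close> is below \<open>c0\<close>, so
    \<open>Lbound\<close> improves on its own premise and the trajectories from the whole circle
    stay near their starting points.\<close>
  have Lc0: "norm (L (c x) \<tau>) < c0" if j: "j \<ge> J" and \<tau>: "\<tau> \<in> {s..t j}" for x j \<tau>
  proof (rule continuous_below[of s "t j" "\<lambda>u. norm (L (c x) u)"])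
    show "continuous_on {s..t j} (\<lambda>u. norm (L (c x) u))"
      by (intro continuous_intros Lc c_ann tN)
    show "norm (L (c x) s) < c0" using Le[OF c_ann[of x], of s] c0 by simp
    show "norm (L (c x) v) < c0" if "v \<in> {s..t j}" "\<And>u. u \<in> {s..v} \<Longrightarrow> norm (L (c x) u) \<le> c0" for v
      using Lbound[OF that] Ic0[OF j] by linarith
  qed (rule \<tau>)
  have LI: "norm (L (c x) \<tau>) \<le> I j" if j: "j \<ge> J" and \<tau>: "\<tau> \<in> {s..t j}" for x j \<tau>
    using Lc0[OF j] \<tau> by (intro Lbound) (auto intro: less_imp_le)
  define A where "A = (\<lambda>j z. real (Suc j) *\<^sub>R integral {s..t j} (\<lambda>\<tau>. H \<tau> z))"
  have Hi: "(\<lambda>\<tau>. H \<tau> (c x)) integrable_on {0..N}" for x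
    using H_integrable[OF c_slice, of N x] s by (simp add: absolutely_integrable_on_def)
  have Hi': "(\<lambda>\<tau>. H \<tau> (c x)) integrable_on {s..t j}" for x j
    using Hi tN(3) by (rule integrable_on_subinterval)
  \<comment> \<open>The trajectory moves by O(I j), so freezing the point in the field costs I j
    times O(I j). Division by the time step turns one factor I j into a bounded one, and the other
    tends to 0.\<close>
  have err: "norm (real (Suc j) *\<^sub>R L (c x) (t j) - A j (c x)) \<le> 6 / eta * M0 * (M0 * (1 / real (Suc j)))" if j: "j \<ge> J" for x j
  proof -
    have Lj: "(\<lambda>u. H u (c x * exp (L (c x) u))) integrable_on {s..t j}"
      using Li[OF c_ann[of x] tN(1)[of j]] by (simp add: absolutely_integrable_on_def)
    have "L (c x) (t j) - integral {s..t j} (\<lambda>\<tau>. H \<tau> (c x)) =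
        integral {s..t j} (\<lambda>u. H u (c x * exp (L (c x) u)) - H u (c x))"
      unfolding Henstock_Kurzweil_Integration.integral_diff[OF Lj Hi'] using Le[OF c_ann[of x] tN(1)[of j]] by simp
    also have "norm \<dots> \<le> integral {s..t j} (\<lambda>u. h u * (6 / eta * I j))"
    proof (rule Henstock_Kurzweil_Integration.integral_norm_bound_integral)
      show "(\<lambda>u. H u (c x * exp (L (c x) u)) - H u (c x)) integrable_on {s..t j}"
        using Lj Hi' by (rule Henstock_Kurzweil_Integration.integrable_diff)
      show "(\<lambda>u. h u * (6 / eta * I j)) integrable_on {s..t j}"
        using hs[OF tN(3)] by (rule integrable_on_mult_left)
      fix u assume u: "u \<in> {s..t j}"
      then have uN: "u \<in> {0..N}" using tN(3)[of j] by blast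
      have "norm (c x * exp (L (c x) u) - c x) \<le> 3 * norm (L (c x) u)"
        using Lc0[OF j u, of x] by (intro expd) simp
      then have d1: "norm (c x * exp (L (c x) u) - c x) \<le> 3 * I j"
        using LI[OF j u, of x] by linarith
      have "norm (H u (c x * exp (L (c x) u)) - H u (c x)) \<le> h u / (eta / 2) * norm (c x * exp (L (c x) u) - c x)"
      proof (rule H_Lipschitz[OF _ _ c_norm[of x]])
        show "norm (c x * exp (L (c x) u) - c x) \<le> eta / 2" using d1 Ic0[OF j] c0 by linarith
      qed (use h(3)[OF uN] uN rho0_bounds in auto)
      also have "\<dots> \<le> h u / (eta / 2) * (3 * I j)"
        using h(2)[OF uN] rho0_bounds d1 by (intro mult_left_mono) auto
      finally show "norm (H u (c x * exp (L (c x) u)) - H u (c x)) \<le> h u * (6 / eta * I j)" by (simp add: mult_ac)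
    qed
    also have "\<dots> = I j * (6 / eta * I j)" unfolding I_def by (rule Henstock_Kurzweil_Integration.integral_mult_left)
    finally have "norm (L (c x) (t j) - integral {s..t j} (\<lambda>\<tau>. H \<tau> (c x))) \<le> I j * (6 / eta * I j)" .
    then have "real (Suc j) * norm (L (c x) (t j) - integral {s..t j} (\<lambda>\<tau>. H \<tau> (c x))) \<le> real (Suc j) * (I j * (6 / eta * I j))"
      by (intro mult_left_mono) auto
    also have "\<dots> = 6 / eta * (real (Suc j) * I j) * I j" by (simp only: mult_ac)
    also have "\<dots> \<le> 6 / eta * M0 * (M0 * (1 / real (Suc j)))"
      using IM[of j] IM'[of j] I0[of j] M0(1) rho0_bounds by (intro mult_mono) auto
    finally show ?thesis unfolding A_def scaleR_diff_right[symmetric] norm_scaleR by simp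
  qed
  have Alip: "norm (A j (c x) - A j (c q)) \<le> 2 / eta * M0 * norm (c x - c q)" if near: "norm (c q - c x) \<le> eta / 2" for j x q
  proof -
    have "integral {s..t j} (\<lambda>\<tau>. H \<tau> (c x)) - integral {s..t j} (\<lambda>\<tau>. H \<tau> (c q)) =
        integral {s..t j} (\<lambda>u. H u (c x) - H u (c q))"
      by (rule Henstock_Kurzweil_Integration.integral_diff[OF Hi' Hi', symmetric])
    also have "norm \<dots> \<le> integral {s..t j} (\<lambda>u. h u * (2 / eta * norm (c x - c q)))"
    proof (rule Henstock_Kurzweil_Integration.integral_norm_bound_integral)
      show "(\<lambda>u. H u (c x) - H u (c q)) integrable_on {s..t j}"
        by (rule Henstock_Kurzweil_Integration.integrable_diff[OF Hi' Hi'])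
      show "(\<lambda>u. h u * (2 / eta * norm (c x - c q))) integrable_on {s..t j}"
        using hs[OF tN(3)] by (rule integrable_on_mult_left)
      fix u assume u: "u \<in> {s..t j}"
      then have uN: "u \<in> {0..N}" using tN(3)[of j] by blast
      have "norm (H u (c x) - H u (c q)) \<le> h u / (eta / 2) * norm (c x - c q)"
        by (rule H_Lipschitz[OF _ _ c_norm[of x]]) (use h(3)[OF uN] uN rho0_bounds near in auto)
      then show "norm (H u (c x) - H u (c q)) \<le> h u * (2 / eta * norm (c x - c q))" by (simp add: mult_ac)
    qed
    also have "\<dots> = I j * (2 / eta * norm (c x - c q))" unfolding I_def by (rule Henstock_Kurzweil_Integration.integral_mult_left)
    finally have "real (Suc j) * norm (integral {s..t j} (\<lambda>\<tau>. H \<tau> (c x)) - integral {s..t j} (\<lambda>\<tau>. H \<tau> (c q))) \<le>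
        real (Suc j) * (I j * (2 / eta * norm (c x - c q)))"
      by (intro mult_left_mono) auto
    also have "\<dots> = (real (Suc j) * I j) * (2 / eta * norm (c x - c q))" by (simp only: mult_ac)
    also have "\<dots> \<le> M0 * (2 / eta * norm (c x - c q))"
      using IM[of j] rho0_bounds by (intro mult_right_mono) auto
    finally show ?thesis unfolding A_def scaleR_diff_right[symmetric] norm_scaleR by (simp add: mult_ac)
  qed
  have Alim: "(\<lambda>j. A j (c x)) \<longlonglongrightarrow> H s (c x)" for x
  proof (rule LIMSEQ_I)
    fix e :: real assume e: "e > 0"
    define K where "K = 2 / eta * M0 + 2 / eta * h s + 1"
    have sN: "s \<in> {0..N}" using s by auto
    have hs0: "h s \<ge> 0" by (rule h(2)[OF sN])
    have K: "K > 0" using M0 hs0 rho0_bounds by (auto simp: K_def intro!: add_nonneg_pos)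
    define \<kappa> where "\<kappa> = min (eta / 2) (e / (3 * K))"
    have \<kappa>: "\<kappa> > 0" using rho0_bounds e K by (simp add: \<kappa>_def)
    have "isCont c x" unfolding c_def by (intro continuous_intros)
    then obtain \<delta> where \<delta>: "\<delta> > 0" "\<And>y. dist y x < \<delta> \<Longrightarrow> dist (c y) (c x) < \<kappa>"
      using \<kappa> unfolding continuous_at_eps_delta by blast
    obtain q where q: "q \<in> \<rat>" "x < q" "q < x + \<delta>" using Rats_dense_in_real[of x "x + \<delta>"] \<delta>(1) by auto
    have near: "norm (c q - c x) < \<kappa>" using \<delta>(2)[of q] q by (simp add: dist_real_def dist_norm)
    then have near': "norm (c x - c q) < \<kappa>" "norm (c q - c x) \<le> eta / 2" by (auto simp: norm_minus_commute \<kappa>_def)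
    have small: "2 / eta * m * norm (c x - c q) \<le> e / 3" if "0 \<le> m" "2 / eta * m \<le> K" for m
    proof -
      have "2 / eta * m * norm (c x - c q) \<le> K * (e / (3 * K))"
        using near' that K rho0_bounds by (intro mult_mono) (auto simp: \<kappa>_def)
      then show ?thesis using K by simp
    qed
    have "(\<lambda>j. real (Suc j) *\<^sub>R (integral {0..t j} (\<lambda>\<tau>. H \<tau> (c q)) - integral {0..s} (\<lambda>\<tau>. H \<tau> (c q)))) \<longlonglongrightarrow> H s (c q)"
      using has_vector_derivative_sequentially[OF dH[OF q(1)] seqN] by (simp only: t_def c_def)
    then have "(\<lambda>j. A j (c q)) \<longlonglongrightarrow> H s (c q)" unfolding diff[OF Hi] A_def .
    then obtain J1 where J1: "\<And>j. j \<ge> J1 \<Longrightarrow> norm (A j (c q) - H s (c q)) < e / 3"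
      using e LIMSEQ_D[of _ _ "e / 3"] by (metis divide_pos_pos zero_less_numeral)
    have h3: "norm (H s (c q) - H s (c x)) \<le> e / 3"
    proof -
      have "norm (H s (c x) - H s (c q)) \<le> h s / (eta / 2) * norm (c x - c q)"
        by (rule H_Lipschitz[OF _ _ c_norm[of x]]) (use h(3)[OF sN] sN rho0_bounds near' in auto)
      also have "\<dots> = 2 / eta * h s * norm (c x - c q)" by simp
      also have "\<dots> \<le> e / 3" using hs0 M0 rho0_bounds by (intro small) (auto simp: K_def)
      finally show ?thesis by (simp add: norm_minus_commute)
    qed
    show "\<exists>J1. \<forall>j\<ge>J1. norm (A j (c x) - H s (c x)) < e"
    proof (intro exI[of _ J1] allI impI)
      fix j assume "j \<ge> J1"
      have "norm (A j (c x) - A j (c q)) \<le> 2 / eta * M0 * norm (c x - c q)" by (rule Alip[OF near'(2)])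
      also have "\<dots> \<le> e / 3" using hs0 M0 rho0_bounds by (intro small) (auto simp: K_def)
      finally have "norm (A j (c x) - A j (c q)) \<le> e / 3" .
      moreover have "norm (A j (c x) - H s (c x)) = norm ((A j (c x) - A j (c q)) + (A j (c q) - H s (c q)) + (H s (c q) - H s (c x)))" by simp
      ultimately show "norm (A j (c x) - H s (c x)) < e"
        using J1[OF \<open>j \<ge> J1\<close>] h3
          norm_triangle_ineq[of "(A j (c x) - A j (c q)) + (A j (c q) - H s (c q))" "H s (c q) - H s (c x)"]
          norm_triangle_ineq[of "A j (c x) - A j (c q)" "A j (c q) - H s (c q)"] by linarith
    qed
  qed
  have lim: "(\<lambda>j. real (Suc j) *\<^sub>R L (c x) (t j)) \<longlonglongrightarrow> H s (c x)" for x
  proof -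
    have "(\<lambda>j. real (Suc j) *\<^sub>R L (c x) (t j) - A j (c x)) \<longlonglongrightarrow> 0"
    proof (rule Lim_null_comparison)
      show "\<forall>\<^sub>F j in sequentially. norm (real (Suc j) *\<^sub>R L (c x) (t j) - A j (c x)) \<le> 6 / eta * M0 * (M0 * (1 / real (Suc j)))"
        using err by (intro eventually_sequentiallyI[of J])
      have "(\<lambda>j. 6 / eta * M0 * (M0 * (1 / real (Suc j)))) \<longlonglongrightarrow> 6 / eta * M0 * (M0 * 0)"
        by (intro tendsto_intros LIMSEQ_Suc[OF lim_1_over_n])
      then show "(\<lambda>j. 6 / eta * M0 * (M0 * (1 / real (Suc j)))) \<longlonglongrightarrow> 0" by simp
    qed
    from tendsto_add[OF this Alim[of x]] show ?thesis by simp
  qed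
  have "norm (real (Suc j) *\<^sub>R L (c x) (t j)) \<le> M0" if "j \<ge> J" for j x
  proof -
    have "norm (L (c x) (t j)) \<le> I j" using LI[OF that, of "t j" x] tN(1)[of j] by simp
    then have "real (Suc j) * norm (L (c x) (t j)) \<le> real (Suc j) * I j" by (intro mult_left_mono) auto
    then have "real (Suc j) * norm (L (c x) (t j)) \<le> M0" using IM[of j] by linarith
    then show ?thesis by (simp only: norm_scaleR abs_of_nat)
  qed
  then show ?thesis using lim unfolding t_def c_def by blast
qed

end

section \<open>Positive measures from short-time limits of the flow\<close>

context whvf_system
begin

text \<open>
  Since \<open>r T < norm (w T) < 1\<close>, the functions \<open>- Re L - ln (norm z)\<close> and \<open>Re L + ln (norm z) - l T\<close> are positive.
  On circles that tend to the unit circle and to the inner boundary they are, divided by \<open>T - s\<close>, the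
  densities whose weak limits for \<open>T \<rightarrow> s\<close> are the two measures.
\<close>

lemma semicomplete_representation_at:
  fixes L :: "complex \<Rightarrow> real \<Rightarrow> complex"
  assumes s: "0 \<le> s"
    and Lh: "\<And>T. T \<ge> s \<Longrightarrow> (\<lambda>z. L z T) holomorphic_on annulus (r s)"
    and La: "\<And>z T. z \<in> annulus (r s) \<Longrightarrow> T \<ge> s \<Longrightarrow> z * exp (L z T) \<in> annulus (r T)"
    and dl: "(l has_vector_derivative - Lam s) (at s within {0..})"
    and bd: "\<And>j x. j \<ge> J \<Longrightarrow> norm (real (Suc j) *\<^sub>R L (of_real rho0 * cis2pi x) (s + 1 / real (Suc j))) \<le> M"
    and lim: "\<And>x. (\<lambda>j. real (Suc j) *\<^sub>R L (of_real rho0 * cis2pi x) (s + 1 / real (Suc j))) \<longlonglongrightarrow> H s (of_real rho0 * cis2pi x)"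
  shows "\<exists>m1 m2. sets m1 = sets (restrict_space borel (sphere (0::complex) 1)) \<and>
    sets m2 = sets (restrict_space borel (sphere (0::complex) 1)) \<and>
    emeasure m1 (sphere 0 1) + emeasure m2 (sphere 0 1) = ennreal (Lam s) \<and>
    (\<forall>z\<in>annulus (r s). G (z, s) = z * (\<i> * of_real (C s) -
      ((\<integral>\<xi>. villat_kernel (r s) (z / \<xi>) \<partial>m1) + (\<integral>\<xi>. 1 - villat_kernel (r s) (of_real (r s) * \<xi> / z) \<partial>m2))))"
proof -
  define R where "R = r s"
  have R: "0 < R" "R < 1" using r_bounds[OF s] by (auto simp: R_def)
  have \<rho>: "R < rho0" "rho0 < 1" using rho0_annulus[OF s] rho0_bounds by (auto simp: R_def)
  have ls: "l s < 0" by (rule l_neg[OF s])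
  define k where "k = (\<lambda>j. real (Suc j))"
  have k: "k j > 0" "k j \<ge> 1" for j by (auto simp: k_def)
  define t where "t = (\<lambda>j. s + 1 / k j)"
  have t: "t j \<ge> s" "t j \<ge> 0" for j using k[of j] s by (auto simp: t_def)
  define f where "f = (\<lambda>j z. L z (t j))"
  have f: "f j holomorphic_on annulus R" for j unfolding f_def R_def by (rule Lh[OF t(1)])
  define a where "a = (\<lambda>j n. laurent_coeff (f j) rho0 n)"
  define A where "A = (\<lambda>n. laurent_coeff (H s) rho0 n)"
  have k_inv: "(\<lambda>j. 1 / k j) \<longlonglongrightarrow> 0" unfolding k_def by (rule LIMSEQ_Suc[OF lim_1_over_n])
  \<comment> \<open>The passage to the limit takes place on the circle of radius \<open>rho0\<close>
    alone. By \<open>co\<close> below, the same coefficients describe the flow on the circles near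
    the boundary.\<close>
  have alim: "(\<lambda>j. of_real (k j) * a j n) \<longlonglongrightarrow> A n" for n
  proof -
    have "(\<lambda>j. integral {0..1} (\<lambda>x. (of_real (k (j + J)) * f (j + J) (of_real rho0 * cis2pi x)) * (of_real rho0 * cis2pi x) powi (- n)))
        \<longlonglongrightarrow> integral {0..1} (\<lambda>x. H s (of_real rho0 * cis2pi x) * (of_real rho0 * cis2pi x) powi (- n))"
    proof (rule dominated_convergence(2)[where h = "\<lambda>x. M * rho0 powi (- n)"])
      fix j
      show "(\<lambda>x. (of_real (k (j + J)) * f (j + J) (of_real rho0 * cis2pi x)) * (of_real rho0 * cis2pi x) powi (- n)) integrable_on {0..1}"
        using R \<rho> by (intro integrable_continuous_interval continuous_on_mult continuous_on_const
            continuous_on_circle[OF f] continuous_on_circle_powi) auto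
      fix x :: real
      have "norm (of_real (k (j + J)) * f (j + J) (of_real rho0 * cis2pi x)) \<le> M"
        using bd[of "j + J" x, OF le_add2] unfolding k_def f_def t_def scaleR_conv_of_real .
      then have "norm (of_real (k (j + J)) * f (j + J) (of_real rho0 * cis2pi x)) * rho0 powi (- n) \<le> M * rho0 powi (- n)"
        using rho0_bounds by (intro mult_right_mono) auto
      then show "norm ((of_real (k (j + J)) * f (j + J) (of_real rho0 * cis2pi x)) * (of_real rho0 * cis2pi x) powi (- n)) \<le> M * rho0 powi (- n)"
        using rho0_bounds by (simp add: norm_mult norm_power_int)
    next
      fix x :: real
      have "(\<lambda>j. of_real (k j) * f j (of_real rho0 * cis2pi x)) \<longlonglongrightarrow> H s (of_real rho0 * cis2pi x)"
        using lim[of x] unfolding k_def f_def t_def scaleR_conv_of_real .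
      then show "(\<lambda>j. (of_real (k (j + J)) * f (j + J) (of_real rho0 * cis2pi x)) * (of_real rho0 * cis2pi x) powi (- n))
        \<longlonglongrightarrow> H s (of_real rho0 * cis2pi x) * (of_real rho0 * cis2pi x) powi (- n)"
        by (intro tendsto_intros LIMSEQ_ignore_initial_segment)
    qed auto
    moreover have "integral {0..1} (\<lambda>x. (of_real (k i) * f i (of_real rho0 * cis2pi x)) * (of_real rho0 * cis2pi x) powi (- n)) = of_real (k i) * a i n" for i
      unfolding a_def laurent_coeff_def mult.assoc by (rule Henstock_Kurzweil_Integration.integral_mult_right)
    ultimately have "(\<lambda>j. of_real (k (j + J)) * a (j + J) n) \<longlonglongrightarrow> A n"
      by (simp only: A_def laurent_coeff_def)
    then show ?thesis by (rule LIMSEQ_offset)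
  qed
  \<comment> \<open>Any choice of smaller order than 1 / k would do: the circles reach the boundary,
    while their distance from it, multiplied by \<open>k\<close>, tends to 0. The division by 2
    keeps \<epsilon> below 1 also when k = 1.\<close>
  define \<epsilon> where "\<epsilon> = (\<lambda>j. (1 / k j) ^ 2 / 2)"
  have \<epsilon>: "0 < \<epsilon> j" "\<epsilon> j < 1" for j
  proof -
    have "(1 / k j) ^ 2 \<le> 1" using k[of j] by (intro power_le_one) auto
    then show "0 < \<epsilon> j" "\<epsilon> j < 1" using k[of j] by (auto simp: \<epsilon>_def)
  qed
  have k\<epsilon>: "(\<lambda>j. k j * \<epsilon> j) \<longlonglongrightarrow> 0"
  proof -
    have "k j * \<epsilon> j = 1 / k j / 2" for j using k[of j] by (simp add: \<epsilon>_def power2_eq_square)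
    then show ?thesis using tendsto_divide[OF k_inv tendsto_const[of 2]] by simp
  qed
  have \<epsilon>0: "\<epsilon> \<longlonglongrightarrow> 0"
    unfolding \<epsilon>_def using tendsto_divide[OF tendsto_power[OF k_inv, of 2] tendsto_const[of 2]] by simp
  define u2 where "u2 = (\<lambda>j. l s * \<epsilon> j)"
  define u1 where "u1 = (\<lambda>j. l s * (1 - \<epsilon> j))"
  have expls: "exp (l s) = R" using exp_l[OF s] by (simp add: R_def)
  have rad: "R < exp (u2 j)" "exp (u2 j) < 1" "R < exp (u1 j)" "exp (u1 j) < 1" for j
  proof -
    have "l s < u2 j" "u2 j < 0" "l s < u1 j" "u1 j < 0"
      using ls \<epsilon>[of j] mult_strict_left_mono_neg[of "\<epsilon> j" 1 "l s"] mult_strict_left_mono_neg[of "1 - \<epsilon> j" 1 "l s"]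
      by (auto simp: u1_def u2_def mult_neg_pos)
    then show "R < exp (u2 j)" "exp (u2 j) < 1" "R < exp (u1 j)" "exp (u1 j) < 1" by (auto simp flip: expls)
  qed
  have u2lim: "(\<lambda>j. exp (u2 j)) \<longlonglongrightarrow> 1" and u1lim: "(\<lambda>j. exp (u1 j)) \<longlonglongrightarrow> R"
  proof -
    have "(\<lambda>j. exp (u2 j)) \<longlonglongrightarrow> exp (l s * 0)" unfolding u2_def by (intro tendsto_intros \<epsilon>0)
    then show "(\<lambda>j. exp (u2 j)) \<longlonglongrightarrow> 1" by simp
    have "(\<lambda>j. exp (u1 j)) \<longlonglongrightarrow> exp (l s * (1 - 0))" unfolding u1_def by (intro tendsto_intros \<epsilon>0)
    then show "(\<lambda>j. exp (u1 j)) \<longlonglongrightarrow> R" by (simp add: expls)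
  qed
  define y where "y = (\<lambda>j x. k j * (- u2 j - Re (f j (of_real (exp (u2 j)) * cis2pi x))))"
  define v where "v = (\<lambda>j x. k j * (u1 j - l (t j) + Re (f j (of_real (exp (u1 j)) * cis2pi x))))"
  have norm_flow: "l (t j) < u + Re (f j (of_real (exp u) * cis2pi x)) \<and> u + Re (f j (of_real (exp u) * cis2pi x)) < 0"
    if "R < exp u" "exp u < 1" for j x u
  proof -
    define z where "z = of_real (exp u) * cis2pi x"
    have "z \<in> annulus (r s)" using circle_in_annulus[of R "exp u" x] that R unfolding z_def R_def by simp
    then have "z * exp (f j z) \<in> annulus (r (t j))" unfolding f_def by (rule La[OF _ t(1)])
    moreover have "norm (z * exp (f j z)) = exp (u + Re (f j z))"
      by (simp add: z_def norm_mult exp_add norm_exp_eq_Re)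
    ultimately have "exp (l (t j)) < exp (u + Re (f j z))" "exp (u + Re (f j z)) < 1"
      using exp_l[OF t(2)] by (auto simp: annulus_def)
    then show ?thesis by (simp add: z_def)
  qed
  have ynn: "y j x \<ge> 0" for j x
    using norm_flow[OF rad(1)[of j] rad(2)[of j], of j x] k[of j] unfolding y_def by (intro mult_nonneg_nonneg) auto
  have vnn: "v j x \<ge> 0" for j x
    using norm_flow[OF rad(3)[of j] rad(4)[of j], of j x] k[of j] unfolding v_def by (intro mult_nonneg_nonneg) auto
  have fc: "continuous_on {0..1} (\<lambda>x. f j (of_real \<rho>' * cis2pi x))" if "R < \<rho>'" "\<rho>' < 1" for j \<rho>'
    using R that by (intro continuous_on_circle[OF f]) auto
  have yc: "continuous_on {0..1} (y j)" and vc: "continuous_on {0..1} (v j)" for j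
    unfolding y_def v_def by (intro continuous_intros fc rad)+
  have co: "laurent_coeff (f j) \<rho>' n = a j n" if "R < \<rho>'" "\<rho>' < 1" for j \<rho>' n
    unfolding a_def using R \<rho> that by (intro laurent_coeff_radius[OF f]) auto
  have cE: "continuous_on {0..1} (\<lambda>x. cis2pi x powi m)" for m by (intro continuous_intros) auto
  define B where "B = (\<lambda>j \<rho>' n. (of_real (k j) * a j n * of_real (\<rho>' powi n) + cnj (of_real (k j) * a j (- n)) * of_real (\<rho>' powi (- n))) / 2)"
  have Re_int: "integral {0..1} (\<lambda>x. of_real (k j * (\<beta> + \<sigma> * Re (f j (of_real \<rho>' * cis2pi x)))) * cis2pi x powi (- n)) =
      of_real (k j * \<beta>) * (if n = 0 then 1 else 0) + of_real \<sigma> * B j \<rho>' n"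
    if r': "R < \<rho>'" "\<rho>' < 1" for j \<rho>' n and \<beta> \<sigma> :: real
  proof -
    have I: "(\<lambda>x. of_real (Re (f j (of_real \<rho>' * cis2pi x))) * cis2pi x powi (- n)) integrable_on {0..1}"
      by (intro integrable_continuous_interval continuous_intros fc r' cE)
    have I1: "(\<lambda>x. cis2pi x powi (- n)) integrable_on {0..1}" by (intro integrable_continuous_interval cE)
    have "integral {0..1} (\<lambda>x. of_real (k j * (\<beta> + \<sigma> * Re (f j (of_real \<rho>' * cis2pi x)))) * cis2pi x powi (- n)) =
      integral {0..1} (\<lambda>x. of_real (k j * \<beta>) * cis2pi x powi (- n) +
        of_real (k j * \<sigma>) * (of_real (Re (f j (of_real \<rho>' * cis2pi x))) * cis2pi x powi (- n)))"
      by (intro Henstock_Kurzweil_Integration.integral_cong) (simp add: algebra_simps)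
    also have "\<dots> = of_real (k j * \<beta>) * integral {0..1} (\<lambda>x. cis2pi x powi (- n)) +
        of_real (k j * \<sigma>) * integral {0..1} (\<lambda>x. of_real (Re (f j (of_real \<rho>' * cis2pi x))) * cis2pi x powi (- n))"
      by (subst Henstock_Kurzweil_Integration.integral_add)
        (intro integrable_on_mult_right I I1 | simp only: Henstock_Kurzweil_Integration.integral_mult_right)+
    also have "integral {0..1} (\<lambda>x. cis2pi x powi (- n)) = (if n = 0 then 1 else 0)"
      using integral_cis2pi_powi[of "- n"] by simp
    also have "integral {0..1} (\<lambda>x. of_real (Re (f j (of_real \<rho>' * cis2pi x))) * cis2pi x powi (- n)) =
        (a j n * of_real (\<rho>' powi n) + cnj (a j (- n)) * of_real (\<rho>' powi (- n))) / 2"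
      using integral_Re_circle[OF f R(1) r', of j n] unfolding co[OF r'] .
    finally show ?thesis by (simp add: B_def algebra_simps add_divide_distrib)
  qed
  have yint: "integral {0..1} (\<lambda>x. of_real (y j x) * cis2pi x powi (- n)) = - of_real (k j * u2 j) * (if n = 0 then 1 else 0) - B j (exp (u2 j)) n" for j n
    using Re_int[OF rad(1)[of j] rad(2)[of j], of j "- u2 j" "-1" n] by (simp add: y_def)
  have vint: "integral {0..1} (\<lambda>x. of_real (v j x) * cis2pi x powi (- n)) = of_real (k j * (u1 j - l (t j))) * (if n = 0 then 1 else 0) + B j (exp (u1 j)) n" for j n
    using Re_int[OF rad(3)[of j] rad(4)[of j], of j "u1 j - l (t j)" 1 n] by (simp add: v_def)
  define Bl where "Bl = (\<lambda>\<rho>' n. (A n * of_real (\<rho>' powi n) + cnj (A (- n)) * of_real (\<rho>' powi (- n))) / 2)"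
  have Blim: "(\<lambda>j. B j (\<rho>' j) n) \<longlonglongrightarrow> Bl q n" if "\<rho>' \<longlonglongrightarrow> q" "q \<noteq> 0" for \<rho>' q n
    unfolding B_def Bl_def
    by (intro tendsto_intros tendsto_cnj alim tendsto_of_real tendsto_power_int that) auto
  have ku2: "(\<lambda>j. k j * u2 j) \<longlonglongrightarrow> 0"
    using tendsto_mult[OF tendsto_const[of "l s"] k\<epsilon>] by (simp add: u2_def mult_ac)
  have kl: "(\<lambda>j. k j * (u1 j - l (t j))) \<longlonglongrightarrow> Lam s"
  proof -
    have "(\<lambda>j. real (Suc j) *\<^sub>R (l (s + 1 / real (Suc j)) - l s)) \<longlonglongrightarrow> - Lam s"
      using s by (intro has_vector_derivative_sequentially[OF dl]) auto
    then have "(\<lambda>j. k j * (l (t j) - l s)) \<longlonglongrightarrow> - Lam s" by (simp add: k_def t_def)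
    then have "(\<lambda>j. - (k j * (l (t j) - l s)) - k j * u2 j) \<longlonglongrightarrow> - (- Lam s) - 0"
      by (intro tendsto_intros ku2)
    moreover have "- (k j * (l (t j) - l s)) - k j * u2 j = k j * (u1 j - l (t j))" for j
      by (simp add: u1_def u2_def algebra_simps)
    ultimately show ?thesis by simp
  qed
  define \<delta>n where "\<delta>n = (\<lambda>n::int. if n = 0 then 1 else 0 :: complex)"
  have ylim: "(\<lambda>j. integral {0..1} (\<lambda>x. of_real (y j x) * cis2pi x powi (- n))) \<longlonglongrightarrow> - Bl 1 n" for n
  proof -
    have "(\<lambda>j. - of_real (k j * u2 j) * \<delta>n n - B j (exp (u2 j)) n) \<longlonglongrightarrow> - of_real 0 * \<delta>n n - Bl 1 n"
      by (intro tendsto_intros tendsto_of_real ku2 Blim u2lim) auto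
    then show ?thesis unfolding yint \<delta>n_def by simp
  qed
  have vlim: "(\<lambda>j. integral {0..1} (\<lambda>x. of_real (v j x) * cis2pi x powi (- n))) \<longlonglongrightarrow> of_real (Lam s) * \<delta>n n + Bl R n" for n
  proof -
    have "(\<lambda>j. of_real (k j * (u1 j - l (t j))) * \<delta>n n + B j (exp (u1 j)) n) \<longlonglongrightarrow> of_real (Lam s) * \<delta>n n + Bl R n"
      using R by (intro tendsto_intros tendsto_of_real kl Blim u1lim) auto
    then show ?thesis unfolding vint \<delta>n_def .
  qed
  have real_int: "Re (integral {0..1} (\<lambda>x. of_real (g x) * cis2pi x powi 0)) = integral {0..1} g"
    if "continuous_on {0..1} g" for g :: "real \<Rightarrow> real"
  proof -
    have "((\<lambda>x. complex_of_real (g x)) has_integral of_real (integral {0..1} g)) {0..1}"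
      by (intro has_integral_of_real integrable_integral integrable_continuous_interval that)
    then show ?thesis by (simp add: integral_unique)
  qed
  have y0: "(\<lambda>j. integral {0..1} (y j)) \<longlonglongrightarrow> Re (- Bl 1 0)"
    using tendsto_Re[OF ylim[of 0]] real_int[OF yc] by simp
  have v0: "(\<lambda>j. integral {0..1} (v j)) \<longlonglongrightarrow> Lam s + Re (Bl R 0)"
    using tendsto_Re[OF vlim[of 0]] real_int[OF vc] by (simp add: \<delta>n_def)
  have y0nn: "Re (- Bl 1 0) \<ge> 0"
    by (rule LIMSEQ_le_const[OF y0])
      (auto intro!: Henstock_Kurzweil_Integration.integral_nonneg integrable_continuous_interval yc ynn)
  have v0nn: "Lam s + Re (Bl R 0) \<ge> 0"
    by (rule LIMSEQ_le_const[OF v0])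
      (auto intro!: Henstock_Kurzweil_Integration.integral_nonneg integrable_continuous_interval vc vnn)
  \<comment> \<open>The two subsequences are unrelated. This does no harm, since \<open>ylim\<close>
    and \<open>vlim\<close> hold along the full sequence and determine the moments of both
    limits.\<close>
  obtain m1 s1 where m1: "strict_mono (s1 :: nat \<Rightarrow> nat)" "sets m1 = sets (restrict_space borel (sphere (0::complex) 1))"
    "emeasure m1 (sphere 0 1) = ennreal (Re (- Bl 1 0))"
    "\<forall>n::int. (\<lambda>j. integral {0..1} (\<lambda>x. y (s1 j) x * cis2pi x powi n)) \<longlonglongrightarrow> (\<integral>\<xi>. \<xi> powi n \<partial>m1)"
    using Helly_circle[of y, OF yc ynn y0] by blast
  obtain m2 s2 where m2: "strict_mono (s2 :: nat \<Rightarrow> nat)" "sets m2 = sets (restrict_space borel (sphere (0::complex) 1))"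
    "emeasure m2 (sphere 0 1) = ennreal (Lam s + Re (Bl R 0))"
    "\<forall>n::int. (\<lambda>j. integral {0..1} (\<lambda>x. v (s2 j) x * cis2pi x powi n)) \<longlonglongrightarrow> (\<integral>\<xi>. \<xi> powi n \<partial>m2)"
    using Helly_circle[of v, OF vc vnn v0] by blast
  have e1: "(\<integral>\<xi>. \<xi> powi (- n) \<partial>m1) = - Bl 1 n" for n
    using LIMSEQ_unique[OF m1(4)[rule_format, of "- n"] LIMSEQ_subseq_LIMSEQ[OF ylim[of n] m1(1), unfolded o_def]] .
  have e2: "(\<integral>\<xi>. \<xi> powi (- n) \<partial>m2) = of_real (Lam s) * \<delta>n n + Bl R n" for n
    using LIMSEQ_unique[OF m2(4)[rule_format, of "- n"] LIMSEQ_subseq_LIMSEQ[OF vlim[of n] m2(1), unfolded o_def]] .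
  \<comment> \<open>In degree 0 the radius does not matter. The masses of the two measures are
    therefore - Re (A 0) and Lam s + Re (A 0), which add up to \<open>Lam s\<close>.\<close>
  have Bl0: "Bl q 0 = of_real (Re (A 0))" for q
    by (simp add: Bl_def complex_add_cnj)
  have rep: "H s z = A 0 + (\<integral>\<xi>. 1 \<partial>m1) - ((\<integral>\<xi>. villat_kernel R (z / \<xi>) \<partial>m1) + (\<integral>\<xi>. 1 - villat_kernel R (of_real R * \<xi> / z) \<partial>m2))"
    if z: "z \<in> annulus R" for z
    unfolding A_def
  proof (rule villat_representation[OF R _ \<rho> m1(2) _ m2(2) _ _ z])
    show "H s holomorphic_on annulus R" unfolding R_def by (rule H_holomorphic[OF s])
    show "emeasure m1 (sphere 0 1) < \<infinity>" "emeasure m2 (sphere 0 1) < \<infinity>" by (simp_all add: m1(3) m2(3))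
    fix n :: int assume n: "n \<noteq> 0"
    define X where "X = R powi n"
    have X: "X \<noteq> 0" "R powi (2 * n) = X * X" "R powi (- n) = inverse X"
    proof -
      show "X \<noteq> 0" "R powi (- n) = inverse X" using R by (auto simp: X_def power_int_minus)
      have "R powi (n + n) = R powi n * R powi n" using R by (intro power_int_add) auto
      then show "R powi (2 * n) = X * X" by (simp only: mult_2 X_def)
    qed
    \<comment> \<open>The weight R^n of the second measure makes the two terms with the conjugate of
      A(-n) cancel, since R^n R^(-n) = 1; what remains is the condition of
      \<open>villat_representation\<close>.\<close>
    have "- Bl 1 n + of_real X * Bl R n = - A n * of_real (1 - X * X) / 2"
      unfolding Bl_def X(3) X_def[symmetric] using X(1) by (simp add: field_simps)
    then show "(\<integral>\<xi>. \<xi> powi (- n) \<partial>m1) + of_real (R powi n) * (\<integral>\<xi>. \<xi> powi (- n) \<partial>m2) =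
        - laurent_coeff (H s) rho0 n * of_real (1 - R powi (2 * n)) / 2"
      unfolding e1 e2 X(2) X_def[symmetric] A_def[symmetric] using n by (simp add: \<delta>n_def)
  qed
  have one: "(\<integral>\<xi>. 1 \<partial>m1) = - complex_of_real (Re (A 0))" using e1[of 0] by (simp add: Bl0)
  have A0: "A 0 - of_real (Re (A 0)) = \<i> * of_real (C s)"
    by (simp add: C_def A_def complex_eq_iff)
  have "G (z, s) = z * (\<i> * of_real (C s) -
      ((\<integral>\<xi>. villat_kernel (r s) (z / \<xi>) \<partial>m1) + (\<integral>\<xi>. 1 - villat_kernel (r s) (of_real (r s) * \<xi> / z) \<partial>m2)))"
    if z: "z \<in> annulus (r s)" for z
  proof -
    have "z \<noteq> 0" using z R by (auto simp: annulus_def R_def)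
    then have "G (z, s) = z * H s z" by (simp add: H_def)
    also have "H s z = \<i> * of_real (C s) -
      ((\<integral>\<xi>. villat_kernel (r s) (z / \<xi>) \<partial>m1) + (\<integral>\<xi>. 1 - villat_kernel (r s) (of_real (r s) * \<xi> / z) \<partial>m2))"
      using rep[of z] z one A0 by (simp add: R_def)
    finally show ?thesis .
  qed
  moreover have "emeasure m1 (sphere 0 1) + emeasure m2 (sphere 0 1) = ennreal (Lam s)"
    unfolding m1(3) m2(3) using y0nn v0nn by (subst ennreal_plus[symmetric]) (auto simp: Bl0)
  ultimately show ?thesis using m1(2) m2(2) by blast
qed

text \<open>The exceptional set of times is fixed before any trajectory is chosen. It depends on the
  derivative of \<open>l\<close>, on countably many majorants \<open>h N\<close>, and on the values
  of \<open>H\<close> at the countably many points of the circle with rational parameter.\<close>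

theorem semicomplete_representation:
  assumes sc: "semicomplete r G"
  shows "AE s in lebesgue. 0 \<le> s \<longrightarrow> (\<exists>m1 m2. sets m1 = sets (restrict_space borel (sphere (0::complex) 1)) \<and>
    sets m2 = sets (restrict_space borel (sphere (0::complex) 1)) \<and>
    emeasure m1 (sphere 0 1) + emeasure m2 (sphere 0 1) = ennreal (Lam s) \<and>
    (\<forall>z\<in>annulus (r s). G (z, s) = z * (\<i> * of_real (C s) -
      ((\<integral>\<xi>. villat_kernel (r s) (z / \<xi>) \<partial>m1) + (\<integral>\<xi>. 1 - villat_kernel (r s) (of_real (r s) * \<xi> / z) \<partial>m2)))))"
proof -
  have "\<forall>N::nat. \<exists>h. h integrable_on {0..real N} \<and> (\<forall>t\<in>{0..real N}. 0 \<le> h t) \<and>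
      (\<forall>t\<in>{0..real N}. \<forall>z\<in>slice. norm (H t z) \<le> h t)"
  proof
    fix N :: nat
    obtain h where "Ld_on d {0..real N} h" "h integrable_on {0..real N}" "\<And>t. t \<in> {0..real N} \<Longrightarrow> 0 \<le> h t"
      "\<And>t z. t \<in> {0..real N} \<Longrightarrow> z \<in> slice \<Longrightarrow> norm (H t z) \<le> h t"
      by (rule slice_bound[of "real N"]) (simp, rule that)
    then show "\<exists>h. h integrable_on {0..real N} \<and> (\<forall>t\<in>{0..real N}. 0 \<le> h t) \<and>
      (\<forall>t\<in>{0..real N}. \<forall>z\<in>slice. norm (H t z) \<le> h t)" by blast
  qed
  from choice[OF this] obtain h where h: "\<And>N::nat. h N integrable_on {0..real N}"
    "\<And>(N::nat) t. t \<in> {0..real N} \<Longrightarrow> 0 \<le> h N t"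
    "\<And>(N::nat) t z. t \<in> {0..real N} \<Longrightarrow> z \<in> slice \<Longrightarrow> norm (H t z) \<le> h N t"
    by blast
  have "AE s in lebesgue. \<forall>N::nat. s \<in> {0..real N} \<longrightarrow>
      ((\<lambda>t. integral {0..t} (h N)) has_vector_derivative h N s) (at s within {0..real N})"
    by (intro AE_all_countable[THEN iffD2] allI AE_has_vector_derivative_integral h)
  moreover have "AE s in lebesgue. \<forall>N::nat. \<forall>x\<in>\<rat>. s \<in> {0..real N} \<longrightarrow>
      ((\<lambda>t. integral {0..t} (\<lambda>\<tau>. H \<tau> (of_real rho0 * cis2pi x))) has_vector_derivative H s (of_real rho0 * cis2pi x)) (at s within {0..real N})"
  proof (intro AE_all_countable[THEN iffD2] allI AE_ball_countable[OF countable_rat, THEN iffD2] ballI AE_has_vector_derivative_integral)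
    fix N :: nat and x :: real
    have "norm (of_real rho0 * cis2pi x) = rho0" using rho0_bounds by (simp add: norm_mult)
    then show "(\<lambda>\<tau>. H \<tau> (of_real rho0 * cis2pi x)) integrable_on {0..real N}"
      using H_integrable[OF circle_in_slice, of "of_real rho0 * cis2pi x" "real N"] by (simp add: absolutely_integrable_on_def)
  qed
  ultimately show ?thesis using AE_derivatives
  proof eventually_elim
    case (elim s)
    show ?case
    proof
      assume s: "0 \<le> s"
      obtain N :: nat where N: "s + 1 \<le> real N" using real_arch_simple by blast
      have sN: "s \<in> {0..real N}" using s N by auto
      obtain L where L: "\<And>T. T \<ge> s \<Longrightarrow> (\<lambda>z. L z T) holomorphic_on annulus (r s)"
        "\<And>z T. z \<in> annulus (r s) \<Longrightarrow> T \<ge> s \<Longrightarrow> continuous_on {s..T} (L z)"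
        "\<And>z T. z \<in> annulus (r s) \<Longrightarrow> T \<ge> s \<Longrightarrow> z * exp (L z T) \<in> annulus (r T)"
        "\<And>z T. z \<in> annulus (r s) \<Longrightarrow> T \<ge> s \<Longrightarrow>
          (\<lambda>t. G (z * exp (L z t), t) / (z * exp (L z t))) absolutely_integrable_on {s..T}"
        "\<And>z T. z \<in> annulus (r s) \<Longrightarrow> T \<ge> s \<Longrightarrow>
          L z T = integral {s..T} (\<lambda>t. G (z * exp (L z t), t) / (z * exp (L z t)))"
        by (rule semicomplete_flow[OF sc s]) (rule that)
      have "\<exists>M J. (\<forall>j\<ge>J. \<forall>x. norm (real (Suc j) *\<^sub>R L (of_real rho0 * cis2pi x) (s + 1 / real (Suc j))) \<le> M) \<and>
        (\<forall>x. (\<lambda>j. real (Suc j) *\<^sub>R L (of_real rho0 * cis2pi x) (s + 1 / real (Suc j))) \<longlonglongrightarrow> H s (of_real rho0 * cis2pi x))"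
      proof (rule flow_average_limit[OF s N h])
        show "((\<lambda>t. integral {0..t} (h N)) has_vector_derivative h N s) (at s within {0..real N})"
          using elim(1) sN by blast
        show "((\<lambda>t. integral {0..t} (\<lambda>\<tau>. H \<tau> (of_real rho0 * cis2pi x))) has_vector_derivative H s (of_real rho0 * cis2pi x)) (at s within {0..real N})"
          if "x \<in> \<rat>" for x using elim(2) sN that by blast
      qed (use L in \<open>auto simp: H_def\<close>)
      then obtain M J where MJ: "\<And>j x. j \<ge> J \<Longrightarrow> norm (real (Suc j) *\<^sub>R L (of_real rho0 * cis2pi x) (s + 1 / real (Suc j))) \<le> M"
        "\<And>x. (\<lambda>j. real (Suc j) *\<^sub>R L (of_real rho0 * cis2pi x) (s + 1 / real (Suc j))) \<longlonglongrightarrow> H s (of_real rho0 * cis2pi x)"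
        by blast
      have dl: "(l has_vector_derivative - Lam s) (at s within {0..})" using elim(3) s by blast
      show "\<exists>m1 m2. sets m1 = sets (restrict_space borel (sphere (0::complex) 1)) \<and>
        sets m2 = sets (restrict_space borel (sphere (0::complex) 1)) \<and>
        emeasure m1 (sphere 0 1) + emeasure m2 (sphere 0 1) = ennreal (Lam s) \<and>
        (\<forall>z\<in>annulus (r s). G (z, s) = z * (\<i> * of_real (C s) -
          ((\<integral>\<xi>. villat_kernel (r s) (z / \<xi>) \<partial>m1) + (\<integral>\<xi>. 1 - villat_kernel (r s) (of_real (r s) * \<xi> / z) \<partial>m2))))"
        by (rule semicomplete_representation_at[OF s L(1) L(3) dl MJ])
    qed
  qed
qed

end

section \<open>Measurability in time and the construction of p and C\<close>

lemma lebesgue_on_measurable_AE_cong: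
  fixes f g :: "real \<Rightarrow> 'a::topological_space"
  assumes g: "g \<in> borel_measurable (lebesgue_on S)" and S: "S \<in> sets lebesgue"
    and eq: "AE x in lebesgue. x \<in> S \<longrightarrow> f x = g x"
  shows "f \<in> borel_measurable (lebesgue_on S)"
proof (rule measurableI)
  obtain N where N: "N \<in> null_sets lebesgue" "{x. \<not> (x \<in> S \<longrightarrow> f x = g x)} \<subseteq> N"
    using eq by (auto simp: eventually_ae_filter)
  fix U :: "'a set" assume U: "U \<in> sets borel"
  have "g -` U \<inter> S \<in> sets (lebesgue_on S)" using measurable_sets[OF g U] S by simp
  then have "g -` U \<inter> S \<in> sets lebesgue" using S by (simp add: sets_restrict_space_iff)
  moreover have "negligible N" using N(1) by (simp add: negligible_iff_null_sets)
  then have "f -` U \<inter> S \<inter> N \<in> sets lebesgue"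
    by (rule negligible_imp_sets[OF negligible_subset]) simp
  moreover have "f -` U \<inter> S = (g -` U \<inter> S - N) \<union> (f -` U \<inter> S \<inter> N)"
    using N(2) by auto
  ultimately have "f -` U \<inter> S \<in> sets lebesgue"
    using null_setsD2[OF N(1)] by (metis sets.Diff sets.Un)
  then show "f -` U \<inter> space (lebesgue_on S) \<in> sets (lebesgue_on S)"
    using S by (simp add: sets_restrict_space_iff)
qed auto

lemma borel_measurable_Ici:
  fixes f :: "real \<Rightarrow> 'a::euclidean_space"
  assumes f: "\<And>n::nat. f \<in> borel_measurable (lebesgue_on {0..real n})"
  shows "f \<in> borel_measurable (lebesgue_on {0..})"
proof -
  have "(\<lambda>t. if t \<in> {0..} then f t else 0) \<in> borel_measurable lebesgue"
  proof (rule borel_measurable_LIMSEQ_metric)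
    show "(\<lambda>t. if t \<in> {0..real n} then f t else 0) \<in> borel_measurable lebesgue" for n
      by (rule borel_measurable_if_I[OF f]) simp
    fix t :: real
    obtain N :: nat where N: "t \<le> real N" using real_arch_simple by blast
    show "(\<lambda>n. if t \<in> {0..real n} then f t else 0) \<longlonglongrightarrow> (if t \<in> {0..} then f t else 0)"
      by (rule tendsto_eventually, rule eventually_sequentiallyI[of N]) (use N in auto)
  qed
  then show ?thesis by (rule borel_measurable_if_D)
qed

text \<open>Finite sums over points of the circle carry measurability in time from the values of the
  field to its mean over the circle, and thus to \<open>C\<close>.\<close>

lemma Riemann_sum_tendsto:
  fixes g :: "real \<Rightarrow> 'a::euclidean_space"
  assumes g: "continuous_on {0..1} g"
  shows "(\<lambda>n. (1 / real (Suc n)) *\<^sub>R (\<Sum>k<Suc n. g (real k / real (Suc n)))) \<longlonglongrightarrow> integral {0..1} g"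
proof (rule LIMSEQ_I)
  fix e :: real assume "e > 0"
  then have e2: "e / 2 > 0" by simp
  have "uniformly_continuous_on {0..1} g" by (rule compact_uniformly_continuous[OF g compact_Icc])
  then obtain \<delta> where \<delta>: "\<delta> > 0" "\<And>x y. x \<in> {0..1} \<Longrightarrow> y \<in> {0..1} \<Longrightarrow> dist y x < \<delta> \<Longrightarrow> dist (g y) (g x) < e / 2"
    using e2 unfolding uniformly_continuous_on_def by metis
  obtain N where N: "1 / real (Suc N) < \<delta>" using \<delta>(1) by (meson nat_approx_posE)
  have "norm ((1 / real (Suc n)) *\<^sub>R (\<Sum>k<Suc n. g (real k / real (Suc n))) - integral {0..1} g) < e" if n: "n \<ge> N" for n
  proof -
    define m where "m = Suc n"
    have m: "m > 0" by (simp add: m_def)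
    have "1 / real m \<le> 1 / real (Suc N)" unfolding m_def using n by (intro divide_left_mono) auto
    then have md: "1 / real m < \<delta>" using N by linarith
    have gi: "g integrable_on {a..b}" if "0 \<le> a" "b \<le> 1" for a b
      using that by (intro integrable_continuous_interval continuous_on_subset[OF g]) auto
    have split: "integral {0..real j / real m} g = (\<Sum>k<j. integral {real k / real m..real (Suc k) / real m} g)" if "j \<le> m" for j
      using that
    proof (induction j)
      case (Suc j)
      have "real (Suc j) / real m \<le> 1" using Suc m by simp
      then have "integral {0..real j / real m} g + integral {real j / real m..real (Suc j) / real m} g = integral {0..real (Suc j) / real m} g"
        by (intro Henstock_Kurzweil_Integration.integral_combine gi) (auto intro: divide_right_mono)
      then show ?case using Suc by simp
    qed simp
    have piece: "norm (integral {real k / real m..real (Suc k) / real m} g - (1 / real m) *\<^sub>R g (real k / real m)) \<le> e / 2 * (1 / real m)"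
      if "k < m" for k
    proof -
      have ab: "0 \<le> real k / real m" "real (Suc k) / real m \<le> 1" "real (Suc k) / real m = real k / real m + 1 / real m"
        using that m by (simp, simp add: divide_le_eq_1, simp add: field_simps)
      have const: "integral {real k / real m..real (Suc k) / real m} (\<lambda>_. g (real k / real m)) = (1 / real m) *\<^sub>R g (real k / real m)"
        using ab(3) by simp
      have "norm (integral {real k / real m..real (Suc k) / real m} (\<lambda>x. g x - g (real k / real m))) \<le>
          integral {real k / real m..real (Suc k) / real m} (\<lambda>x. e / 2)"
      proof (rule Henstock_Kurzweil_Integration.integral_norm_bound_integral)
        show "(\<lambda>x. g x - g (real k / real m)) integrable_on {real k / real m..real (Suc k) / real m}"
          using gi[OF ab(1,2)] by (intro Henstock_Kurzweil_Integration.integrable_diff) auto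
        fix x assume x: "x \<in> {real k / real m..real (Suc k) / real m}"
        have "dist (g x) (g (real k / real m)) < e / 2"
        proof (rule \<delta>(2))
          have "real k / real m \<le> real (Suc k) / real m" by (rule divide_right_mono) auto
          then show "x \<in> {0..1}" "real k / real m \<in> {0..1}"
            using x ab(1,2) unfolding atLeastAtMost_iff by linarith+
          have "0 \<le> x - real k / real m" "x - real k / real m \<le> 1 / real m" using x ab(3) by auto
          then show "dist x (real k / real m) < \<delta>" using md unfolding dist_real_def by linarith
        qed
        then show "norm (g x - g (real k / real m)) \<le> e / 2" by (simp add: dist_norm)
      qed auto
      also have "\<dots> = e / 2 * (1 / real m)" using ab(3) by simp
      finally show ?thesis
        using gi[OF ab(1,2)] const by (subst (asm) Henstock_Kurzweil_Integration.integral_diff) auto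
    qed
    have "integral {0..1} g = (\<Sum>k<m. integral {real k / real m..real (Suc k) / real m} g)"
      using split[of m] m by simp
    then have "norm (integral {0..1} g - (1 / real m) *\<^sub>R (\<Sum>k<m. g (real k / real m))) =
      norm (\<Sum>k<m. integral {real k / real m..real (Suc k) / real m} g - (1 / real m) *\<^sub>R g (real k / real m))"
      by (simp add: sum_subtractf scaleR_sum_right)
    also have "\<dots> \<le> (\<Sum>k<m. e / 2 * (1 / real m))" using piece by (intro sum_norm_le) auto
    also have "\<dots> = e / 2" using m by simp
    also have "\<dots> < e" using \<open>e > 0\<close> by simp
    finally show ?thesis by (simp only: m_def norm_minus_commute)
  qed
  then show "\<exists>N. \<forall>n\<ge>N. norm ((1 / real (Suc n)) *\<^sub>R (\<Sum>k<Suc n. g (real k / real (Suc n))) - integral {0..1} g) < e" by blast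
qed

text \<open>Supplies the value of p at times where the representation is missing or
  \<open>Lam\<close> is 0. Measures with the moments of normalised arc length and of the zero
  measure come out of \<open>Helly_circle\<close> for constant sequences, and
  \<open>villat_representation\<close> for the zero function then evaluates the kernel
  integrals.\<close>

lemma one_in_villat_class:
  assumes r: "0 < r" "r < 1"
  shows "(\<lambda>_. 1) \<in> villat_class r"
proof -
  have c1: "(\<lambda>j::nat. integral {0..1} (\<lambda>x::real. 1::real)) \<longlonglongrightarrow> 1" by simp
  obtain m1 s1 where m1: "sets m1 = sets (restrict_space borel (sphere (0::complex) 1))" "emeasure m1 (sphere 0 1) = ennreal 1"
    "\<forall>n::int. (\<lambda>j::nat. integral {0..1} (\<lambda>x. of_real 1 * cis2pi x powi n)) \<longlonglongrightarrow> (\<integral>\<xi>. \<xi> powi n \<partial>m1)"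
    using Helly_circle[of "\<lambda>j x. 1" 1] c1 by auto
  have c0: "(\<lambda>j::nat. integral {0..1} (\<lambda>x::real. 0::real)) \<longlonglongrightarrow> 0" by simp
  obtain m2 s2 where m2: "sets m2 = sets (restrict_space borel (sphere (0::complex) 1))" "emeasure m2 (sphere 0 1) = ennreal 0"
    "\<forall>n::int. (\<lambda>j::nat. integral {0..1} (\<lambda>x. of_real 0 * cis2pi x powi n)) \<longlonglongrightarrow> (\<integral>\<xi>. \<xi> powi n \<partial>m2)"
    using Helly_circle[of "\<lambda>j x. 0" 0] c0 by auto
  have e1: "(\<integral>\<xi>. \<xi> powi n \<partial>m1) = (if n = 0 then 1 else 0)" for n
    using LIMSEQ_unique[OF m1(3)[rule_format, of n], of "integral {0..1} (\<lambda>x. cis2pi x powi n)"] integral_cis2pi_powi[of n] by simp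
  have e2: "(\<integral>\<xi>. \<xi> powi n \<partial>m2) = 0" for n
    using LIMSEQ_unique[OF m2(3)[rule_format, of n], of 0] by simp
  obtain \<rho> where \<rho>: "r < \<rho>" "\<rho> < 1" using dense r(2) by blast
  have "(1::complex) = (\<integral>\<xi>. villat_kernel r (z / \<xi>) \<partial>m1) + (\<integral>\<xi>. 1 - villat_kernel r (of_real r * \<xi> / z) \<partial>m2)"
    if z: "z \<in> annulus r" for z
  proof -
    have "(\<lambda>_. 0) z = laurent_coeff (\<lambda>_. 0) \<rho> 0 + (\<integral>\<xi>. 1 \<partial>m1) -
      ((\<integral>\<xi>. villat_kernel r (z / \<xi>) \<partial>m1) + (\<integral>\<xi>. 1 - villat_kernel r (of_real r * \<xi> / z) \<partial>m2))"
      by (rule villat_representation[OF r _ \<rho> m1(1) _ m2(1) _ _ z])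
        (auto simp: m1(2) m2(2) e1 e2 laurent_coeff_def)
    moreover have "(\<integral>\<xi>. 1 \<partial>m1) = (1::complex)" using e1[of 0] by simp
    ultimately show ?thesis by (simp add: laurent_coeff_def)
  qed
  then show ?thesis unfolding villat_class_def mem_Collect_eq
    by (intro conjI exI[of _ m1] exI[of _ m2] ballI) (auto simp: m1 m2)
qed

text \<open>The flow produces measures of total mass \<open>Lam t\<close>, while the Villat class
  asks for total mass 1; the densities 1 / c make up the difference.\<close>

lemma villat_class_scaled:
  assumes r: "0 < r" "r < 1" and c: "c > 0"
    and m1: "sets m1 = sets (restrict_space borel (sphere (0::complex) 1))"
    and m2: "sets m2 = sets (restrict_space borel (sphere (0::complex) 1))"
    and tot: "emeasure m1 (sphere 0 1) + emeasure m2 (sphere 0 1) = ennreal c"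
    and p: "p holomorphic_on annulus r"
    and rep: "\<And>z. z \<in> annulus r \<Longrightarrow> of_real c * p z =
      (\<integral>\<xi>. villat_kernel r (z / \<xi>) \<partial>m1) + (\<integral>\<xi>. 1 - villat_kernel r (of_real r * \<xi> / z) \<partial>m2)"
  shows "p \<in> villat_class r"
proof -
  define D where "D = (\<lambda>m :: complex measure. density m (\<lambda>_. ennreal (1 / c)))"
  have sp: "sphere 0 1 \<in> sets m1" "sphere 0 1 \<in> sets m2"
    using circle_measure_space(2) m1 m2 by auto
  have fin: "emeasure m1 (sphere 0 1) < \<infinity>" "emeasure m2 (sphere 0 1) < \<infinity>"
    using tot by (metis ennreal_less_top infinity_ennreal_def le_iff_add add.commute order_le_less_trans)+
  have em: "emeasure (D m) (sphere 0 1) = ennreal (1 / c) * emeasure m (sphere 0 1)" if "sphere 0 1 \<in> sets m" for m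
    unfolding D_def using that by (rule emeasure_density_const)
  have "emeasure (D m1) (sphere 0 1) + emeasure (D m2) (sphere 0 1) = ennreal (1 / c) * ennreal c"
    unfolding em[OF sp(1)] em[OF sp(2)] distrib_left[symmetric] tot ..
  also have "\<dots> = 1" using c by (simp flip: ennreal_mult)
  finally have one: "emeasure (D m1) (sphere 0 1) + emeasure (D m2) (sphere 0 1) = 1" .
  have int: "(\<integral>\<xi>. g \<xi> \<partial>(D m)) = of_real (1 / c) * (\<integral>\<xi>. g \<xi> \<partial>m)" if "integrable m g" for m and g :: "complex \<Rightarrow> complex"
  proof -
    have "(\<integral>\<xi>. g \<xi> \<partial>(D m)) = (\<integral>\<xi>. (1 / c) *\<^sub>R g \<xi> \<partial>m)"
      unfolding D_def using that c by (subst integral_density) auto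
    then show ?thesis by (simp add: scaleR_conv_of_real)
  qed
  have "p z = (\<integral>\<xi>. villat_kernel r (z / \<xi>) \<partial>(D m1)) + (\<integral>\<xi>. 1 - villat_kernel r (of_real r * \<xi> / z) \<partial>(D m2))"
    if z: "z \<in> annulus r" for z
  proof -
    have "(\<integral>\<xi>. villat_kernel r (z / \<xi>) \<partial>(D m1)) + (\<integral>\<xi>. 1 - villat_kernel r (of_real r * \<xi> / z) \<partial>(D m2)) =
      of_real (1 / c) * (of_real c * p z)"
      unfolding rep[OF z] int[OF villat_kernel_integral(1)[OF r z m1 fin(1)]] int[OF villat_kernel_integral(3)[OF r z m2 fin(2)]]
      by (rule distrib_left[symmetric])
    also have "\<dots> = p z" using c by simp
    finally show ?thesis by simp
  qed
  moreover have "sets (D m1) = sets (restrict_space borel (sphere 0 1))" "sets (D m2) = sets (restrict_space borel (sphere 0 1))"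
    using m1 m2 by (auto simp: D_def)
  ultimately show ?thesis unfolding villat_class_def using p one by blast
qed

lemma integral_null_space:
  fixes g :: "'a \<Rightarrow> 'b::{banach, second_countable_topology}"
  assumes "emeasure m (space m) = 0"
  shows "(\<integral>x. g x \<partial>m) = 0"
proof (rule integral_eq_zero_AE)
  have "space m \<in> null_sets m" using assms by auto
  then show "AE x in m. g x = 0" by (rule AE_I') auto
qed

lemma (in nondegenerate_domain_system) Lam_measurable: "Lam \<in> borel_measurable (lebesgue_on {0..})"
  using Lam_Ld by (intro borel_measurable_Ici) (auto simp: Ld_on_def)

context whvf_system
begin

text \<open>The mean of \<open>H\<close> over the circle is bounded by the majorant of the field on
  \<open>slice\<close>, which is in L^d; measurability comes from Riemann sums.\<close>

lemma C_Ld: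
  assumes T: "0 \<le> T"
  shows "Ld_on d {0..T} C"
proof -
  obtain h where h: "Ld_on d {0..T} h" "h integrable_on {0..T}" "\<And>t. t \<in> {0..T} \<Longrightarrow> 0 \<le> h t"
    "\<And>t z. t \<in> {0..T} \<Longrightarrow> z \<in> slice \<Longrightarrow> norm (H t z) \<le> h t"
    by (rule slice_bound[OF T]) (rule that)
  have c: "of_real rho0 * cis2pi x \<in> slice" for x
    using rho0_bounds by (intro circle_in_slice) (simp add: norm_mult)
  have cont: "continuous_on {0..1} (\<lambda>x. H t (of_real rho0 * cis2pi x))" if "t \<in> {0..T}" for t
    using that rho0_annulus[of t] rho0_bounds r_bounds(1)[of t]
    by (intro continuous_on_circle[OF H_holomorphic]) auto
  have lc: "laurent_coeff (H t) rho0 0 = integral {0..1} (\<lambda>x. H t (of_real rho0 * cis2pi x))" for t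
    by (simp add: laurent_coeff_def)
  show ?thesis
  proof (rule Ld_on_dominated2[OF d h(1) h(1), where A = 1 and B = 0])
    have "(\<lambda>t. laurent_coeff (H t) rho0 0) \<in> borel_measurable (lebesgue_on {0..T})"
    proof (rule borel_measurable_LIMSEQ_metric)
      show "(\<lambda>t. (1 / real (Suc n)) *\<^sub>R (\<Sum>k<Suc n. H t (of_real rho0 * cis2pi (real k / real (Suc n))))) \<in> borel_measurable (lebesgue_on {0..T})" for n
        by (intro borel_measurable_scaleR borel_measurable_const borel_measurable_sum H_measurable c)
      show "(\<lambda>n. (1 / real (Suc n)) *\<^sub>R (\<Sum>k<Suc n. H t (of_real rho0 * cis2pi (real k / real (Suc n))))) \<longlonglongrightarrow> laurent_coeff (H t) rho0 0"
        if "t \<in> space (lebesgue_on {0..T})" for t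
        unfolding lc using that by (intro Riemann_sum_tendsto cont) simp
    qed
    then show "C \<in> borel_measurable (lebesgue_on {0..T})" unfolding C_def by measurable
    show "AE t in lebesgue_on {0..T}. norm (C t) \<le> 1 * norm (h t) + 0 * norm (h t)"
    proof (rule AE_I2)
      fix t assume "t \<in> space (lebesgue_on {0..T})"
      then have t: "t \<in> {0..T}" by simp
      have "norm (C t) \<le> norm (laurent_coeff (H t) rho0 0)" by (simp add: C_def abs_Im_le_cmod)
      also have "\<dots> \<le> integral {0..1::real} (\<lambda>x. h t)"
        unfolding lc using h(4)[OF t c] cont[OF t]
        by (intro Henstock_Kurzweil_Integration.integral_norm_bound_integral integrable_continuous_interval) auto
      finally show "norm (C t) \<le> 1 * norm (h t) + 0 * norm (h t)" using h(3)[OF t] by simp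
    qed
  qed auto
qed

lemma C_measurable: "C \<in> borel_measurable (lebesgue_on {0..})"
  using C_Ld by (intro borel_measurable_Ici) (auto simp: Ld_on_def)

theorem semicomplete_imp_representation:
  assumes sc: "semicomplete r G"
  shows "\<exists>(p :: complex \<times> real \<Rightarrow> complex) (C :: real \<Rightarrow> real).
      (AE t in lebesgue_on {0..}. \<forall>w\<in>annulus (r t).
         G (w, t) = w * (\<i> * of_real (C t)
           + of_real (vector_derivative r (at t within {0..})) * p (w, t) / of_real (r t))) \<and>
      (\<forall>w\<in>(\<Union>t\<in>{0..}. annulus (r t)).
         (\<lambda>t. p (w, t)) \<in> borel_measurable (lebesgue_on (time_section (total_domain r) w))) \<and>
      (\<forall>t\<ge>0. (\<lambda>w. p (w, t)) \<in> villat_class (r t)) \<and>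
      Ld_loc d {0..} C"
proof -
  define rep where "rep = (\<lambda>s. \<exists>m1 m2. sets m1 = sets (restrict_space borel (sphere (0::complex) 1)) \<and>
    sets m2 = sets (restrict_space borel (sphere (0::complex) 1)) \<and>
    emeasure m1 (sphere 0 1) + emeasure m2 (sphere 0 1) = ennreal (Lam s) \<and>
    (\<forall>z\<in>annulus (r s). G (z, s) = z * (\<i> * of_real (C s) -
      ((\<integral>\<xi>. villat_kernel (r s) (z / \<xi>) \<partial>m1) + (\<integral>\<xi>. 1 - villat_kernel (r s) (of_real (r s) * \<xi> / z) \<partial>m2)))))"
  have AE_rep: "AE s in lebesgue. 0 \<le> s \<longrightarrow> rep s"
    unfolding rep_def by (rule semicomplete_representation[OF sc])
  \<comment> \<open>Where possible the formula is solved for p; elsewhere the constant 1 keeps p in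
    the Villat class at every time. If the representation holds with Lam t = 0, both measures vanish
    and so does r'(t), so the formula holds with this constant too.\<close>
  define p where "p = (\<lambda>(z, t). if rep t \<and> 0 < Lam t then (\<i> * of_real (C t) - G (z, t) / z) / of_real (Lam t) else 1)"
  have "AE t in lebesgue_on {0..}. \<forall>w\<in>annulus (r t).
         G (w, t) = w * (\<i> * of_real (C t) + of_real (vector_derivative r (at t within {0..})) * p (w, t) / of_real (r t))"
    unfolding AE_Ici_iff using AE_rep AE_derivatives
  proof eventually_elim
    case (elim t)
    show ?case
    proof (intro impI ballI)
      assume t: "0 \<le> t"
      fix w assume w: "w \<in> annulus (r t)"
      have rt: "0 < r t" by (rule r_bounds[OF t])
      have w0: "w \<noteq> 0" using w rt by (auto simp: annulus_def)
      have "rep t" and vd: "vector_derivative r (at t within {0..}) = - r t * Lam t" and Lam0: "Lam t \<ge> 0"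
        using elim t by auto
      have vdr: "of_real (vector_derivative r (at t within {0..})) * q / of_real (r t) = - of_real (Lam t) * q" for q :: complex
        unfolding vd using rt by simp
      show "G (w, t) = w * (\<i> * of_real (C t) + of_real (vector_derivative r (at t within {0..})) * p (w, t) / of_real (r t))"
      proof (cases "Lam t = 0")
        case True
        obtain m1 m2 where m: "sets m1 = sets (restrict_space borel (sphere (0::complex) 1))"
          "sets m2 = sets (restrict_space borel (sphere (0::complex) 1))"
          "emeasure m1 (sphere 0 1) + emeasure m2 (sphere 0 1) = ennreal (Lam t)"
          "\<forall>z\<in>annulus (r t). G (z, t) = z * (\<i> * of_real (C t) -
            ((\<integral>\<xi>. villat_kernel (r t) (z / \<xi>) \<partial>m1) + (\<integral>\<xi>. 1 - villat_kernel (r t) (of_real (r t) * \<xi> / z) \<partial>m2)))"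
          using \<open>rep t\<close> unfolding rep_def by blast
        have "emeasure m1 (space m1) = 0" "emeasure m2 (space m2) = 0"
          using m(3) True circle_measure_space(1)[OF m(1)] circle_measure_space(1)[OF m(2)] by auto
        then have "G (w, t) = w * (\<i> * of_real (C t))"
          using m(4) w by (simp add: integral_null_space)
        then show ?thesis unfolding vdr True by simp
      next
        case False
        then have "p (w, t) = (\<i> * of_real (C t) - G (w, t) / w) / of_real (Lam t)"
          using \<open>rep t\<close> Lam0 by (simp add: p_def)
        then have "\<i> * of_real (C t) + - of_real (Lam t) * p (w, t) = G (w, t) / w"
          using False by simp
        then show ?thesis unfolding vdr using w0 by simp
      qed
    qed
  qed
  moreover have "(\<lambda>t. p (w, t)) \<in> borel_measurable (lebesgue_on (time_section (total_domain r) w))"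
    if "w \<in> (\<Union>t\<in>{0..}. annulus (r t))" for w
  proof (rule lebesgue_on_measurable_AE_cong[OF _ time_section_sets])
    let ?E = "time_section (total_domain r) w"
    have [measurable]: "(\<lambda>t. G (w, t)) \<in> borel_measurable (lebesgue_on ?E)"
      using whvf by (simp add: weak_holomorphic_vector_field_def)
    have [measurable]: "C \<in> borel_measurable (lebesgue_on ?E)" "Lam \<in> borel_measurable (lebesgue_on ?E)"
      using measurable_lebesgue_on_subset[OF C_measurable time_section_subset _ time_section_sets]
        measurable_lebesgue_on_subset[OF Lam_measurable time_section_subset _ time_section_sets] by auto
    \<comment> \<open>The condition \<open>rep t\<close> is not known to be measurable. It is
      dropped here, which alters p only on a null set of times.\<close>
    show "(\<lambda>t. if 0 < Lam t then (\<i> * of_real (C t) - G (w, t) / w) / of_real (Lam t) else 1) \<in> borel_measurable (lebesgue_on ?E)"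
      by measurable
    show "AE t in lebesgue. t \<in> ?E \<longrightarrow> p (w, t) =
        (if 0 < Lam t then (\<i> * of_real (C t) - G (w, t) / w) / of_real (Lam t) else 1)"
      using AE_rep by eventually_elim (use time_section_subset in \<open>auto simp: p_def\<close>)
  qed
  moreover have "(\<lambda>w. p (w, t)) \<in> villat_class (r t)" if t: "t \<ge> 0" for t
  proof (cases "rep t \<and> 0 < Lam t")
    case True
    note rt = r_bounds[OF t]
    obtain m1 m2 where m: "sets m1 = sets (restrict_space borel (sphere (0::complex) 1))"
          "sets m2 = sets (restrict_space borel (sphere (0::complex) 1))"
          "emeasure m1 (sphere 0 1) + emeasure m2 (sphere 0 1) = ennreal (Lam t)"
          "\<forall>z\<in>annulus (r t). G (z, t) = z * (\<i> * of_real (C t) -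
            ((\<integral>\<xi>. villat_kernel (r t) (z / \<xi>) \<partial>m1) + (\<integral>\<xi>. 1 - villat_kernel (r t) (of_real (r t) * \<xi> / z) \<partial>m2)))"
      using True unfolding rep_def by blast
    have p: "(\<lambda>w. p (w, t)) = (\<lambda>w. (\<i> * of_real (C t) - H t w) / of_real (Lam t))"
      using True by (simp add: p_def H_def)
    show ?thesis
    proof (rule villat_class_scaled[OF rt _ m(1-3)])
      show "0 < Lam t" using True by blast
      show "(\<lambda>w. p (w, t)) holomorphic_on annulus (r t)"
        unfolding p using True by (intro holomorphic_intros H_holomorphic t) auto
      fix z assume z: "z \<in> annulus (r t)"
      then have "z \<noteq> 0" using rt by (auto simp: annulus_def)
      then have "H t z = \<i> * of_real (C t) -
            ((\<integral>\<xi>. villat_kernel (r t) (z / \<xi>) \<partial>m1) + (\<integral>\<xi>. 1 - villat_kernel (r t) (of_real (r t) * \<xi> / z) \<partial>m2))"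
        using m(4) z by (simp add: H_def)
      then have "\<i> * of_real (C t) - H t z = (\<integral>\<xi>. villat_kernel (r t) (z / \<xi>) \<partial>m1) + (\<integral>\<xi>. 1 - villat_kernel (r t) (of_real (r t) * \<xi> / z) \<partial>m2)"
        by simp
      moreover have "of_real (Lam t) * p (z, t) = \<i> * of_real (C t) - H t z"
        using True by (simp add: p_def H_def)
      ultimately show "of_real (Lam t) * p (z, t) =
        (\<integral>\<xi>. villat_kernel (r t) (z / \<xi>) \<partial>m1) + (\<integral>\<xi>. 1 - villat_kernel (r t) (of_real (r t) * \<xi> / z) \<partial>m2)" by simp
    qed
  next
    case False
    then have "(\<lambda>w. p (w, t)) = (\<lambda>_. 1)" by (auto simp: p_def)
    then show ?thesis using one_in_villat_class[OF r_bounds[OF t]] by simp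
  qed
  moreover have "Ld_loc d {0..} C" by (rule Ld_locI[OF C_Ld])
  ultimately show ?thesis by blast
qed

end

section \<open>Vector fields given by functions of the Villat class\<close>

lemma circle_integral_bounds:
  fixes g :: "complex \<Rightarrow> complex"
  assumes m: "sets m = sets (restrict_space borel (sphere (0::complex) 1))" "emeasure m (sphere 0 1) < \<infinity>"
    and g: "integrable m g"
  shows "(\<And>\<xi>. norm \<xi> = 1 \<Longrightarrow> norm (g \<xi>) \<le> b) \<Longrightarrow> norm (\<integral>\<xi>. g \<xi> \<partial>m) \<le> measure m (sphere 0 1) * b"
    and "(\<And>\<xi>. norm \<xi> = 1 \<Longrightarrow> c \<le> Re (g \<xi>)) \<Longrightarrow> measure m (sphere 0 1) * c \<le> Re (\<integral>\<xi>. g \<xi> \<partial>m)"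
    and "(\<And>\<xi>. norm \<xi> = 1 \<Longrightarrow> Re (g \<xi>) \<le> c) \<Longrightarrow> Re (\<integral>\<xi>. g \<xi> \<partial>m) \<le> measure m (sphere 0 1) * c"
proof -
  note sp = circle_measure_space[OF m(1)]
  have k: "integrable m (\<lambda>_. x)" "(\<integral>\<xi>. x \<partial>m) = measure m (sphere 0 1) * x" for x :: real
    using m(2) sp by (auto simp: integrable_iff_bounded ennreal_mult_less_top)
  have Re: "Re (\<integral>\<xi>. g \<xi> \<partial>m) = (\<integral>\<xi>. Re (g \<xi>) \<partial>m)" "integrable m (\<lambda>\<xi>. Re (g \<xi>))"
    using g by auto
  show "norm (\<integral>\<xi>. g \<xi> \<partial>m) \<le> measure m (sphere 0 1) * b" if "\<And>\<xi>. norm \<xi> = 1 \<Longrightarrow> norm (g \<xi>) \<le> b"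
  proof -
    have "norm (\<integral>\<xi>. g \<xi> \<partial>m) \<le> (\<integral>\<xi>. norm (g \<xi>) \<partial>m)" by (rule integral_norm_bound)
    also have "\<dots> \<le> (\<integral>\<xi>. b \<partial>m)" using g k(1) that sp by (intro integral_mono) auto
    finally show ?thesis by (simp only: k(2))
  qed
  show "measure m (sphere 0 1) * c \<le> Re (\<integral>\<xi>. g \<xi> \<partial>m)" if "\<And>\<xi>. norm \<xi> = 1 \<Longrightarrow> c \<le> Re (g \<xi>)"
    unfolding Re(1) k(2)[symmetric] using Re(2) k(1) that sp by (intro integral_mono) auto
  show "Re (\<integral>\<xi>. g \<xi> \<partial>m) \<le> measure m (sphere 0 1) * c" if "\<And>\<xi>. norm \<xi> = 1 \<Longrightarrow> Re (g \<xi>) \<le> c"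
    unfolding Re(1) k(2)[symmetric] using Re(2) k(1) that sp by (intro integral_mono) auto
qed

text \<open>Total mass 1 makes p an average of kernel values. For the upper bound each kernel is
  written as 1 minus its counterpart at the reflected point \<rho> / z, to which the lower estimates
  apply. The 1 that appears near the inner circle matches the speed - Lam at which ln r
  moves.\<close>

lemma villat_class_bounds:
  assumes p: "p \<in> villat_class \<rho>" and r: "0 < \<rho>" "\<rho> \<le> R" "R < 1" and z: "z \<in> annulus \<rho>"
  shows "norm (p z) \<le> 1 + 2 / (1 - norm z) + 2 / (1 - \<rho> / norm z) + 4 / ((1 - R ^ 2) * (1 - R))"
    and "sqrt R \<le> norm z \<Longrightarrow> - villat_bound R * (- ln (norm z)) \<le> Re (p z)"
    and "sqrt R \<le> \<rho> / norm z \<Longrightarrow> Re (p z) \<le> 1 + villat_bound R * (- ln (\<rho> / norm z))"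
proof -
  obtain m1 m2 where m1: "sets m1 = sets (restrict_space borel (sphere (0::complex) 1))"
    and m2: "sets m2 = sets (restrict_space borel (sphere (0::complex) 1))"
    and tot: "emeasure m1 (sphere 0 1) + emeasure m2 (sphere 0 1) = 1"
    and pz: "p z = (\<integral>\<xi>. villat_kernel \<rho> (z / \<xi>) \<partial>m1) + (\<integral>\<xi>. 1 - villat_kernel \<rho> (of_real \<rho> * \<xi> / z) \<partial>m2)"
    using p z unfolding villat_class_def by blast
  have r1: "\<rho> < 1" using r by simp
  have zb: "\<rho> < norm z" "norm z < 1" "0 < norm z" using z r by (auto simp: annulus_def)
  have fin: "emeasure m1 (sphere 0 1) < \<infinity>" "emeasure m2 (sphere 0 1) < \<infinity>"
    using tot by (metis ennreal_one_less_top infinity_ennreal_def le_iff_add add.commute order_le_less_trans)+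
  define a1 a2 where "a1 = measure m1 (sphere 0 1)" and "a2 = measure m2 (sphere 0 1)"
  have "ennreal a1 + ennreal a2 = 1"
    using tot fin by (simp add: a1_def a2_def emeasure_eq_ennreal_measure)
  then have a: "0 \<le> a1" "0 \<le> a2" "a1 + a2 = 1"
    by (auto simp: a1_def a2_def simp flip: ennreal_plus)
  note i1 = villat_kernel_integral(1)[OF r(1) r1 z m1 fin(1)]
  note i2 = villat_kernel_integral(3)[OF r(1) r1 z m2 fin(2)]
  note b1 = circle_integral_bounds[OF m1 fin(1) i1, folded a1_def]
  note b2 = circle_integral_bounds[OF m2 fin(2) i2, folded a2_def]
  have rot: "z / \<xi> \<in> annulus \<rho>" "norm (z / \<xi>) = norm z" if "norm \<xi> = 1" for \<xi>
    using that z by (auto simp: annulus_rotate norm_divide)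
  have co: "of_real \<rho> * \<xi> / z = of_real \<rho> / (z / \<xi>)" for \<xi> by simp
  have co': "of_real \<rho> / (of_real \<rho> / (z / \<xi>)) = z / \<xi>" for \<xi> using r by simp
  have ref: "of_real \<rho> / (z / \<xi>) \<in> annulus \<rho>" "norm (of_real \<rho> / (z / \<xi>)) = \<rho> / norm z" if "norm \<xi> = 1" for \<xi>
    using annulus_reflect[OF r(1) rot(1)[OF that]] that r unfolding norm_divide by (simp_all add: norm_divide)
  have q: "\<rho> / norm z < 1" using zb by (simp add: divide_less_eq_1)
  define c where "c = 4 / ((1 - R ^ 2) * (1 - R))"
  show "norm (p z) \<le> 1 + 2 / (1 - norm z) + 2 / (1 - \<rho> / norm z) + 4 / ((1 - R ^ 2) * (1 - R))"
  proof -
    define b where "b = 1 + 2 / (1 - norm z) + 2 / (1 - \<rho> / norm z) + c"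
    have "norm (villat_kernel \<rho> (z / \<xi>)) \<le> b" if "norm \<xi> = 1" for \<xi>
    proof -
      have "norm (villat_kernel \<rho> (z / \<xi>)) \<le> 2 / (1 - norm z) + c"
        using norm_villat_kernel_le[OF r rot(1)[OF that]] unfolding rot(2)[OF that] c_def .
      moreover have "0 \<le> 2 / (1 - \<rho> / norm z)" using q by simp
      ultimately show ?thesis unfolding b_def by linarith
    qed
    note n1 = b1(1)[OF this]
    have "norm (1 - villat_kernel \<rho> (of_real \<rho> * \<xi> / z)) \<le> b" if "norm \<xi> = 1" for \<xi>
    proof -
      have "norm (villat_kernel \<rho> (of_real \<rho> * \<xi> / z)) \<le> 2 / (1 - \<rho> / norm z) + c"
        using norm_villat_kernel_le[OF r ref(1)[OF that]] unfolding ref(2)[OF that] c_def co .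
      moreover have "0 \<le> 2 / (1 - norm z)" using zb by simp
      moreover have "norm (1 - villat_kernel \<rho> (of_real \<rho> * \<xi> / z)) \<le> 1 + norm (villat_kernel \<rho> (of_real \<rho> * \<xi> / z))"
        using norm_triangle_ineq4[of 1] by (metis norm_one)
      ultimately show ?thesis unfolding b_def by linarith
    qed
    note n2 = b2(1)[OF this]
    have "norm (p z) \<le> a1 * b + a2 * b" unfolding pz using n1 n2 by (rule norm_triangle_mono)
    also have "\<dots> = b" using a(3) by (simp flip: distrib_right)
    finally show ?thesis by (simp add: b_def c_def)
  qed
  show "- villat_bound R * (- ln (norm z)) \<le> Re (p z)" if s: "sqrt R \<le> norm z"
  proof -
    define b where "b = - villat_bound R * (- ln (norm z))"
    have "b \<le> Re (villat_kernel \<rho> (z / \<xi>))" "b \<le> Re (1 - villat_kernel \<rho> (of_real \<rho> * \<xi> / z))" if "norm \<xi> = 1" for \<xi>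
      using Re_villat_kernel_ge[OF r, of "z / \<xi>"] s zb unfolding rot(2)[OF that] b_def co by blast+
    then have "a1 * b \<le> Re (\<integral>\<xi>. villat_kernel \<rho> (z / \<xi>) \<partial>m1)" "a2 * b \<le> Re (\<integral>\<xi>. 1 - villat_kernel \<rho> (of_real \<rho> * \<xi> / z) \<partial>m2)"
      by (auto intro!: b1(2) b2(2))
    then have "a1 * b + a2 * b \<le> Re (p z)" unfolding pz plus_complex.sel by linarith
    moreover have "a1 * b + a2 * b = b" using a(3) by (simp flip: distrib_right)
    ultimately show ?thesis by (simp add: b_def)
  qed
  show "Re (p z) \<le> 1 + villat_bound R * (- ln (\<rho> / norm z))" if s: "sqrt R \<le> \<rho> / norm z"
  proof -
    define b where "b = 1 + villat_bound R * (- ln (\<rho> / norm z))"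
    have "Re (villat_kernel \<rho> (z / \<xi>)) \<le> b" "Re (1 - villat_kernel \<rho> (of_real \<rho> * \<xi> / z)) \<le> b" if "norm \<xi> = 1" for \<xi>
      using Re_villat_kernel_ge[OF r, of "of_real \<rho> / (z / \<xi>)"] s q unfolding ref(2)[OF that] co' b_def co by auto
    then have "Re (\<integral>\<xi>. villat_kernel \<rho> (z / \<xi>) \<partial>m1) \<le> a1 * b" "Re (\<integral>\<xi>. 1 - villat_kernel \<rho> (of_real \<rho> * \<xi> / z) \<partial>m2) \<le> a2 * b"
      by (auto intro!: b1(3) b2(3))
    then have "Re (p z) \<le> a1 * b + a2 * b" unfolding pz plus_complex.sel by linarith
    moreover have "a1 * b + a2 * b = b" using a(3) by (simp flip: distrib_right)
    ultimately show ?thesis by (simp add: b_def)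
  qed
qed

locale villat_field = nondegenerate_domain_system +
  fixes G p :: "complex \<times> real \<Rightarrow> complex" and C :: "real \<Rightarrow> real"
  assumes hol: "\<And>t. t \<ge> 0 \<Longrightarrow> (\<lambda>w. G (w, t)) holomorphic_on annulus (r t)"
    and rep: "AE t in lebesgue_on {0..}. \<forall>w\<in>annulus (r t).
         G (w, t) = w * (\<i> * of_real (C t)
           + of_real (vector_derivative r (at t within {0..})) * p (w, t) / of_real (r t))"
    and p_measurable: "\<And>w. w \<in> (\<Union>t\<in>{0..}. annulus (r t)) \<Longrightarrow>
         (\<lambda>t. p (w, t)) \<in> borel_measurable (lebesgue_on (time_section (total_domain r) w))"
    and p_villat: "\<And>t. t \<ge> 0 \<Longrightarrow> (\<lambda>w. p (w, t)) \<in> villat_class (r t)"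
    and C_Ld_loc: "Ld_loc d {0..} C"
begin

lemma AE_rep: "AE t in lebesgue. 0 \<le> t \<longrightarrow> Lam t \<ge> 0 \<and>
    (\<forall>w\<in>annulus (r t). G (w, t) = w * (\<i> * of_real (C t) - of_real (Lam t) * p (w, t)))"
  using rep[unfolded AE_Ici_iff] AE_derivatives
proof eventually_elim
  case (elim t)
  show ?case
  proof (intro impI conjI ballI)
    assume t: "0 \<le> t"
    have "r t \<noteq> 0" using r_bounds(1)[OF t] by simp
    then show "G (w, t) = w * (\<i> * of_real (C t) - of_real (Lam t) * p (w, t))" if "w \<in> annulus (r t)" for w
      using elim t that by simp
    show "Lam t \<ge> 0" using elim(2) t by simp
  qed
qed

lemma C_measurable: "C \<in> borel_measurable (lebesgue_on {0..})"
proof (rule borel_measurable_Ici)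
  fix n :: nat
  have "Ld_on d {0..real n} C" using C_Ld_loc unfolding Ld_loc_def by auto
  then show "C \<in> borel_measurable (lebesgue_on {0..real n})" by (simp add: Ld_on_def)
qed

lemma G_section_measurable:
  "(\<lambda>t. G (z, t)) \<in> borel_measurable (lebesgue_on (time_section (total_domain r) z))"
proof (cases "time_section (total_domain r) z = {}")
  case True
  then show ?thesis by (auto intro!: measurableI)
next
  case False
  let ?S = "time_section (total_domain r) z"
  have z: "z \<in> (\<Union>t\<in>{0..}. annulus (r t))" using False by (auto simp: time_section_def total_domain_def)
  have [measurable]: "C \<in> borel_measurable (lebesgue_on ?S)" "Lam \<in> borel_measurable (lebesgue_on ?S)"
    by (rule measurable_lebesgue_on_subset[OF C_measurable time_section_subset _ time_section_sets]
        measurable_lebesgue_on_subset[OF Lam_measurable time_section_subset _ time_section_sets]; simp)+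
  note [measurable] = p_measurable[OF z]
  show ?thesis
  proof (rule lebesgue_on_measurable_AE_cong[OF _ time_section_sets])
    show "(\<lambda>t. z * (\<i> * of_real (C t) - of_real (Lam t) * p (z, t))) \<in> borel_measurable (lebesgue_on ?S)"
      by measurable
    show "AE t in lebesgue. t \<in> ?S \<longrightarrow> G (z, t) = z * (\<i> * of_real (C t) - of_real (Lam t) * p (z, t))"
      using AE_rep by eventually_elim (auto simp: time_section_def total_domain_def)
  qed
qed

text \<open>With R = r 0 the bound of \<open>villat_class_bounds\<close> is a continuous function of
  (z, t) on \<open>K\<close>, as \<open>r\<close> is continuous, so compactness bounds it although
  the inner radius varies.\<close>

lemma p_bounded:
  assumes K: "compact K" "K \<subseteq> total_domain r"
  obtains b where "b \<ge> 0" "\<And>z t. (z, t) \<in> K \<Longrightarrow> norm (p (z, t)) \<le> b"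
proof -
  define c where "c = 4 / ((1 - r 0 ^ 2) * (1 - r 0))"
  define h where "h = (\<lambda>x :: complex \<times> real. 1 + 2 / (1 - norm (fst x)) + 2 / (1 - r (snd x) / norm (fst x)) + c)"
  have zb: "0 \<le> t" "0 < r t" "r t < norm z" "norm z < 1" "0 < norm z" "r t / norm z < 1" if "(z, t) \<in> K" for z t
  proof -
    show t: "0 \<le> t" and z: "r t < norm z" "norm z < 1" using K(2) that by (auto simp: total_domain_iff)
    show "0 < r t" by (rule r_bounds(1)[OF t])
    then show "0 < norm z" "r t / norm z < 1" using z by (auto simp: divide_less_eq_1)
  qed
  have "continuous_on K h"
    unfolding h_def
  proof (intro continuous_intros continuous_on_compose2[OF r_continuous])
    show "\<forall>x\<in>K. 1 - norm (fst x) \<noteq> 0" "\<forall>x\<in>K. norm (fst x) \<noteq> 0" "\<forall>x\<in>K. 1 - r (snd x) / norm (fst x) \<noteq> 0"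
      "snd ` K \<subseteq> {0..}"
      using zb by fastforce+
  qed
  then have "bounded (h ` K)" by (intro compact_imp_bounded compact_continuous_image K)
  then obtain b where b: "b > 0" "\<And>x. x \<in> K \<Longrightarrow> norm (h x) \<le> b" unfolding bounded_pos by auto
  show ?thesis
  proof (rule that[of b])
    fix z t assume zt: "(z, t) \<in> K"
    have "z \<in> annulus (r t)" using zb[OF zt] by (simp add: annulus_def)
    then have "norm (p (z, t)) \<le> h (z, t)"
      unfolding h_def c_def fst_conv snd_conv
      using zb[OF zt] r_antimono[of 0 t] r_bounds(2)[of 0]
      by (intro villat_class_bounds(1)[OF p_villat]) auto
    also have "\<dots> \<le> norm (h (z, t))" by simp
    also have "\<dots> \<le> b" by (rule b(2)[OF zt])
    finally show "norm (p (z, t)) \<le> b" .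
  qed (use b in simp)
qed

theorem weak_holomorphic: "weak_holomorphic_vector_field d r G"
  unfolding weak_holomorphic_vector_field_def
proof (intro conjI allI impI)
  fix K :: "(complex \<times> real) set" assume K: "compact K" "K \<subseteq> total_domain r"
  obtain b where b: "b \<ge> 0" "\<And>z t. (z, t) \<in> K \<Longrightarrow> norm (p (z, t)) \<le> b"
    by (rule p_bounded[OF K]) (rule that)
  have X: "compact (snd ` K)" by (intro compact_continuous_image continuous_intros K)
  have X0: "snd ` K \<subseteq> {0..}" using K(2) by (auto simp: total_domain_def)
  have Xl: "snd ` K \<in> sets lebesgue" using X by (intro fmeasurableD lmeasurable_compact)
  have CX: "Ld_on d (snd ` K) C" using C_Ld_loc X X0 by (auto simp: Ld_loc_def)
  obtain N where N: "snd ` K \<subseteq> {0..N}" "N \<ge> 0"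
  proof -
    obtain N where "\<And>x. x \<in> snd ` K \<Longrightarrow> norm x \<le> N" "N > 0"
      using compact_imp_bounded[OF X] unfolding bounded_pos by blast
    then show ?thesis using X0 by (intro that[of N]) force+
  qed
  have LX: "Ld_on d (snd ` K) Lam" using N Xl by (intro Ld_on_subset[OF Lam_Ld]) auto
  have "\<exists>c. \<forall>z. (z, t) \<in> K \<longrightarrow> norm (G (z, t)) \<le> c" for t
  proof -
    have "{z. (z, t) \<in> K} = fst ` (K \<inter> (UNIV \<times> {t}))" by force
    moreover have "compact (fst ` (K \<inter> (UNIV \<times> {t})))"
      by (intro compact_continuous_image continuous_intros compact_Int_closed[OF K(1)] closed_Times)
    ultimately have Kt: "compact {z. (z, t) \<in> K}" by simp
    have "continuous_on {z. (z, t) \<in> K} (\<lambda>z. G (z, t))"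
    proof (cases "t \<ge> 0")
      case True
      then show ?thesis
        using K(2) by (intro continuous_on_subset[OF holomorphic_on_imp_continuous_on[OF hol]]) (auto simp: total_domain_def)
    next
      case False
      then have "{z. (z, t) \<in> K} = {}" using K(2) by (auto simp: total_domain_def)
      then show ?thesis by simp
    qed
    then have "bounded ((\<lambda>z. G (z, t)) ` {z. (z, t) \<in> K})" by (intro compact_imp_bounded compact_continuous_image Kt)
    then show ?thesis unfolding bounded_iff by auto
  qed
  then obtain c where c: "\<And>t z. (z, t) \<in> K \<Longrightarrow> norm (G (z, t)) \<le> c t" by metis
  define good where "good = (\<lambda>t. \<forall>w\<in>annulus (r t). G (w, t) = w * (\<i> * of_real (C t) - of_real (Lam t) * p (w, t)))"
  \<comment> \<open>The majorant has to hold at every time, whereas membership in L^d ignores null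
    sets. At exceptional times it is the bound \<open>c t\<close> on the compact slice of
    \<open>K\<close>, which exists because \<open>G\<close> is holomorphic, hence continuous, in its
    first argument.\<close>
  define k where "k = (\<lambda>t. if good t then \<bar>C t\<bar> + b * \<bar>Lam t\<bar> else \<bar>c t\<bar>)"
  have AE_k: "AE t in lebesgue. t \<in> snd ` K \<longrightarrow> k t = \<bar>C t\<bar> + b * \<bar>Lam t\<bar>"
    using AE_rep by eventually_elim (use X0 in \<open>auto simp: k_def good_def\<close>)
  have "Ld_on d (snd ` K) k"
  proof (rule Ld_on_dominated2[OF d CX LX _ zero_le_one b(1)])
    have [measurable]: "C \<in> borel_measurable (lebesgue_on (snd ` K))" "Lam \<in> borel_measurable (lebesgue_on (snd ` K))"
      using CX LX by (auto simp: Ld_on_def)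
    show "k \<in> borel_measurable (lebesgue_on (snd ` K))"
      by (rule lebesgue_on_measurable_AE_cong[OF _ Xl AE_k]) measurable
    show "AE t in lebesgue_on (snd ` K). norm (k t) \<le> 1 * norm (C t) + b * norm (Lam t)"
    proof (subst AE_restrict_space_iff)
      show "AE t in lebesgue. t \<in> snd ` K \<longrightarrow> norm (k t) \<le> 1 * norm (C t) + b * norm (Lam t)"
        using AE_k by eventually_elim (use b(1) in simp)
    qed (use Xl in simp)
  qed
  moreover have "0 \<le> k t" for t using b(1) by (simp add: k_def)
  moreover have "norm (G (z, t)) \<le> k t" if zt: "(z, t) \<in> K" for z t
  proof (cases "good t")
    case True
    have z: "z \<in> annulus (r t)" "norm z \<le> 1" using K(2) zt by (auto simp: total_domain_def annulus_def)
    have "norm (G (z, t)) = norm z * norm (\<i> * of_real (C t) - of_real (Lam t) * p (z, t))"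
      using True z(1) by (simp add: good_def norm_mult)
    also have "\<dots> \<le> 1 * norm (\<i> * of_real (C t) - of_real (Lam t) * p (z, t))"
      using z(2) by (intro mult_right_mono) auto
    also have "\<dots> \<le> \<bar>C t\<bar> + \<bar>Lam t\<bar> * norm (p (z, t))"
      using norm_triangle_ineq4[of "\<i> * of_real (C t)" "of_real (Lam t) * p (z, t)"] by (simp add: norm_mult)
    also have "\<dots> \<le> \<bar>C t\<bar> + \<bar>Lam t\<bar> * b"
      using b(2)[OF zt] by (intro add_left_mono mult_left_mono) auto
    finally show ?thesis using True by (simp add: k_def mult.commute)
  qed (use c[OF zt] in \<open>simp add: k_def\<close>)
  ultimately show "\<exists>k :: real \<Rightarrow> real. Ld_on d (snd ` K) k \<and> (\<forall>t\<in>snd ` K. 0 \<le> k t) \<and> (\<forall>(z, t)\<in>K. norm (G (z, t)) \<le> k t)"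
    by (intro exI[of _ k]) auto
qed (use hol G_section_measurable in auto)

end

section \<open>Global solutions and comparison with moving barriers\<close>

lemma exp_integral_has_integral:
  fixes \<kappa> :: "real \<Rightarrow> real"
  assumes \<kappa>: "\<kappa> absolutely_integrable_on {s..T}" and t: "t \<in> {s..T}"
  shows "((\<lambda>\<tau>. c * \<kappa> \<tau> * exp (c * integral {s..\<tau>} \<kappa>)) has_integral exp (c * integral {s..t} \<kappa>) - 1) {s..t}"
proof -
  define I where "I = (\<lambda>\<tau>. integral {s..\<tau>} \<kappa>)"
  have k: "\<kappa> absolutely_integrable_on {s..t}"
    by (rule absolutely_integrable_on_subinterval[OF \<kappa>]) (use t in auto)
  have AC: "abs_continuous_on_interval s t I"
    unfolding I_def by (rule abs_continuous_on_interval_integral[OF k])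
  then have "continuous_on {s..t} I" by (rule abs_continuous_on_interval_imp_continuous_on)
  then obtain Y where Y: "Y > 0" "\<And>\<tau>. \<tau> \<in> {s..t} \<Longrightarrow> norm (I \<tau>) \<le> Y" using continuous_on_Icc_norm_bound by blast
  define A where "A = \<bar>c\<bar> * Y"
  have "dist (exp (c * I u)) (exp (c * I v)) \<le> (exp A * \<bar>c\<bar> + 1) * (dist (I u) (I v) + dist (I u) (I v))"
    if "u \<in> {s..t}" "v \<in> {s..t}" for u v
  proof -
    have b: "norm (complex_of_real (c * I \<tau>)) \<le> A" if "\<tau> \<in> {s..t}" for \<tau>
      using Y(2)[OF that] by (simp only: norm_of_real abs_mult A_def real_norm_def mult_left_mono abs_ge_zero)
    have "dist (exp (c * I u)) (exp (c * I v)) = norm (exp (complex_of_real (c * I u)) - exp (complex_of_real (c * I v)))"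
      by (simp only: exp_of_real dist_norm norm_of_real of_real_diff[symmetric] real_norm_def)
    also have "\<dots> \<le> exp A * norm (complex_of_real (c * I u) - complex_of_real (c * I v))"
      by (rule norm_exp_diff_le[OF b[OF that(1)] b[OF that(2)]])
    also have "\<dots> = exp A * \<bar>c\<bar> * dist (I u) (I v)"
      by (simp only: of_real_diff[symmetric] norm_of_real right_diff_distrib[symmetric] abs_mult dist_real_def mult.assoc)
    also have "\<dots> \<le> (exp A * \<bar>c\<bar> + 1) * (dist (I u) (I v) + dist (I u) (I v))"
      by (intro mult_mono) auto
    finally show ?thesis .
  qed
  then have "abs_continuous_on_interval s t (\<lambda>\<tau>. exp (c * I \<tau>))"
    by (intro abs_continuous_on_interval_dominated2[OF AC AC, of "exp A * \<bar>c\<bar> + 1"]) (auto intro: add_nonneg_pos)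
  moreover have "AE \<tau> in lebesgue. \<tau> \<in> {s..t} \<longrightarrow> (I has_vector_derivative \<kappa> \<tau>) (at \<tau> within {s..t})"
    unfolding I_def by (rule AE_has_vector_derivative_integral) (use k in \<open>simp add: absolutely_integrable_on_def\<close>)
  then have "AE \<tau> in lebesgue. \<tau> \<in> {s..t} \<longrightarrow>
      ((\<lambda>\<tau>. exp (c * I \<tau>)) has_vector_derivative c * \<kappa> \<tau> * exp (c * I \<tau>)) (at \<tau> within {s..t})"
  proof eventually_elim
    case (elim \<tau>)
    show ?case
    proof
      assume "\<tau> \<in> {s..t}"
      then have "(I has_real_derivative \<kappa> \<tau>) (at \<tau> within {s..t})"
        using elim by (simp add: has_real_derivative_iff_has_vector_derivative)
      then have "((\<lambda>\<tau>. exp (c * I \<tau>)) has_real_derivative c * \<kappa> \<tau> * exp (c * I \<tau>)) (at \<tau> within {s..t})"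
        by (auto intro!: derivative_eq_intros)
      then show "((\<lambda>\<tau>. exp (c * I \<tau>)) has_vector_derivative c * \<kappa> \<tau> * exp (c * I \<tau>)) (at \<tau> within {s..t})"
        by (simp add: has_real_derivative_iff_has_vector_derivative)
    qed
  qed
  ultimately have "((\<lambda>\<tau>. c * \<kappa> \<tau> * exp (c * I \<tau>)) has_integral exp (c * I t) - exp (c * I s)) {s..t}"
    by (intro abs_continuous_on_interval_has_integral_AE) (use t in auto)
  then show ?thesis by (simp add: I_def)
qed

text \<open>Picard iteration in the integrated form. The bounds are global in space, so the iterates
  never leave the domain of the field. They are defined without reference to \<open>T\<close>, so
  the limits on different intervals are restrictions of one function and no continuation is
  required.\<close>

theorem integral_solution_exists:
  fixes F :: "real \<Rightarrow> complex \<Rightarrow> complex"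
  assumes m: "\<And>T x. continuous_on {s..T} x \<Longrightarrow> (\<lambda>t. F t (x t)) \<in> borel_measurable (lebesgue_on {s..T})"
    and \<kappa>: "\<And>T. s \<le> T \<Longrightarrow> \<exists>\<kappa>. \<kappa> integrable_on {s..T} \<and> (\<forall>t\<in>{s..T}. 0 \<le> \<kappa> t \<and> (\<forall>z. norm (F t z) \<le> \<kappa> t) \<and>
        (\<forall>z w. norm (F t z - F t w) \<le> \<kappa> t * norm (z - w)))"
  shows "\<exists>x. x s = x0 \<and> (\<forall>T\<ge>s. integral_solution F s T x)"
proof -
  define X where "X = rec_nat (\<lambda>t. x0) (\<lambda>n x t. x0 + integral {s..t} (\<lambda>\<tau>. F \<tau> (x \<tau>)))"
  have X0: "X 0 = (\<lambda>t. x0)" and XS: "X (Suc n) = (\<lambda>t. x0 + integral {s..t} (\<lambda>\<tau>. F \<tau> (X n \<tau>)))" for n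
    by (simp_all add: X_def)
  have ai: "(\<lambda>t. F t (x t)) absolutely_integrable_on {s..T}" if x: "continuous_on {s..T} x" for x T
  proof (cases "s \<le> T")
    case True
    obtain \<kappa> where "\<kappa> integrable_on {s..T}" "\<forall>t\<in>{s..T}. \<forall>z. norm (F t z) \<le> \<kappa> t" using \<kappa>[OF True] by blast
    then show ?thesis by (intro measurable_bounded_by_integrable_imp_absolutely_integrable[OF m[OF x]]) auto
  qed auto
  have Xc: "continuous_on {s..T} (X n)" for n T
  proof (induction n)
    case (Suc n)
    show ?case
      unfolding XS by (rule abs_continuous_on_interval_imp_continuous_on[OF indefinite_integral_AC(1)[OF ai[OF Suc] refl]])
  qed (simp add: X0)
  define x where "x = (\<lambda>t. lim (\<lambda>n. X n t))"
  have main: "continuous_on {s..T} x \<and> (\<forall>t\<in>{s..T}. x t = x0 + integral {s..t} (\<lambda>\<tau>. F \<tau> (x \<tau>)))" if sT: "s \<le> T" for T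
  proof -
    obtain \<kappa> where k: "\<kappa> integrable_on {s..T}" and k0: "\<And>t. t \<in> {s..T} \<Longrightarrow> 0 \<le> \<kappa> t"
      and kb: "\<And>t z. t \<in> {s..T} \<Longrightarrow> norm (F t z) \<le> \<kappa> t"
      and kl: "\<And>t z w. t \<in> {s..T} \<Longrightarrow> norm (F t z - F t w) \<le> \<kappa> t * norm (z - w)"
      using \<kappa>[OF sT] by blast
    have kai: "\<kappa> absolutely_integrable_on {s..T}" using k k0 by (rule nonnegative_absolutely_integrable_1)
    have ki: "\<kappa> integrable_on {s..t}" if "t \<in> {s..T}" for t
      using that by (intro integrable_subinterval_real[OF k]) auto
    \<comment> \<open>With respect to this weight the Picard iteration contracts by the factor \<open>1 / 2\<close> on the whole interval.\<close>
    define E where "E = (\<lambda>t. exp (2 * integral {s..t} \<kappa>))"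
    have E_int: "((\<lambda>\<tau>. \<kappa> \<tau> * E \<tau>) has_integral (E t - 1) / 2) {s..t}" if "t \<in> {s..T}" for t
      using has_integral_mult_right[OF exp_integral_has_integral[OF kai that, of 2], of "1 / 2"] by (simp add: E_def)
    have Fi: "(\<lambda>\<tau>. F \<tau> (X n \<tau>)) integrable_on {s..t}" for n t
      using ai[OF Xc] by (simp add: absolutely_integrable_on_def)
    have diff: "norm (X (Suc n) t - X n t) \<le> (1 / 2) ^ n * E t" if "t \<in> {s..T}" for n t
      using that
    proof (induction n arbitrary: t)
      case 0
      have "norm (X (Suc 0) t - X 0 t) = norm (integral {s..t} (\<lambda>\<tau>. F \<tau> (X 0 \<tau>)))" by (simp add: XS X0)
      also have "\<dots> \<le> integral {s..t} \<kappa>"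
        by (intro Henstock_Kurzweil_Integration.integral_norm_bound_integral Fi ki 0 kb) (use 0 in auto)
      also have "\<dots> \<le> exp (integral {s..t} \<kappa>)" using exp_ge_add_one_self[of "integral {s..t} \<kappa>"] by linarith
      also have "\<dots> \<le> E t"
      proof -
        have "0 \<le> integral {s..t} \<kappa>" using k0 0 by (intro Henstock_Kurzweil_Integration.integral_nonneg ki) auto
        then show ?thesis by (simp add: E_def)
      qed
      finally show ?case by simp
    next
      case (Suc n)
      have "X (Suc (Suc n)) t - X (Suc n) t = integral {s..t} (\<lambda>\<tau>. F \<tau> (X (Suc n) \<tau>)) - integral {s..t} (\<lambda>\<tau>. F \<tau> (X n \<tau>))"
        unfolding XS[of "Suc n"] XS[of n] by simp
      also have "\<dots> = integral {s..t} (\<lambda>\<tau>. F \<tau> (X (Suc n) \<tau>) - F \<tau> (X n \<tau>))"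
        by (rule Henstock_Kurzweil_Integration.integral_diff[symmetric, OF Fi Fi])
      finally have "norm (X (Suc (Suc n)) t - X (Suc n) t) = norm (integral {s..t} (\<lambda>\<tau>. F \<tau> (X (Suc n) \<tau>) - F \<tau> (X n \<tau>)))"
        by simp
      also have "\<dots> \<le> integral {s..t} (\<lambda>\<tau>. (1 / 2) ^ n * (\<kappa> \<tau> * E \<tau>))"
      proof (rule Henstock_Kurzweil_Integration.integral_norm_bound_integral)
        show "(\<lambda>\<tau>. F \<tau> (X (Suc n) \<tau>) - F \<tau> (X n \<tau>)) integrable_on {s..t}"
          by (rule Henstock_Kurzweil_Integration.integrable_diff[OF Fi Fi])
        show "(\<lambda>\<tau>. (1 / 2) ^ n * (\<kappa> \<tau> * E \<tau>)) integrable_on {s..t}"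
          by (rule integrable_on_mult_right, rule has_integral_integrable[OF E_int[OF Suc.prems]])
        fix \<tau> assume "\<tau> \<in> {s..t}"
        then have \<tau>: "\<tau> \<in> {s..T}" using Suc.prems by auto
        have "norm (F \<tau> (X (Suc n) \<tau>) - F \<tau> (X n \<tau>)) \<le> \<kappa> \<tau> * norm (X (Suc n) \<tau> - X n \<tau>)" by (rule kl[OF \<tau>])
        also have "\<dots> \<le> \<kappa> \<tau> * ((1 / 2) ^ n * E \<tau>)" by (rule mult_left_mono[OF Suc.IH[OF \<tau>] k0[OF \<tau>]])
        finally show "norm (F \<tau> (X (Suc n) \<tau>) - F \<tau> (X n \<tau>)) \<le> (1 / 2) ^ n * (\<kappa> \<tau> * E \<tau>)" by (simp only: mult_ac)
      qed
      also have "\<dots> = (1 / 2) ^ n * ((E t - 1) / 2)"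
        by (rule integral_unique, rule has_integral_mult_right, rule E_int[OF Suc.prems])
      also have "\<dots> \<le> (1 / 2) ^ n * (E t / 2)" by (intro mult_left_mono) auto
      finally show ?case by simp
    qed
    have E_mono: "E t \<le> E T" if "t \<in> {s..T}" for t
    proof -
      have "integral {s..t} \<kappa> \<le> integral {s..T} \<kappa>"
        using that k0 by (intro integral_subset_le ki) auto
      then show ?thesis by (simp add: E_def)
    qed
    define S where "S = (\<lambda>t. \<Sum>n. X (Suc n) t - X n t)"
    have "uniform_limit {s..T} (\<lambda>n t. \<Sum>k<n. X (Suc k) t - X k t) S sequentially"
      unfolding S_def
    proof (rule Weierstrass_m_test)
      show "norm (X (Suc n) t - X n t) \<le> (1 / 2) ^ n * E T" if t: "t \<in> {s..T}" for n t
        by (rule order_trans[OF diff[OF t]]) (intro mult_left_mono E_mono[OF t], simp)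
      show "summable (\<lambda>n. (1 / 2) ^ n * E T)" by (intro summable_mult2 summable_geometric) simp
    qed
    then have "uniform_limit {s..T} (\<lambda>n t. x0 + (\<Sum>k<n. X (Suc k) t - X k t)) (\<lambda>t. x0 + S t) sequentially"
      unfolding uniform_limit_iff dist_add_cancel .
    moreover have "x0 + (\<Sum>k<n. X (Suc k) t - X k t) = X n t" for n t
      using sum_lessThan_telescope[of "\<lambda>k. X k t" n] by (simp add: X0)
    ultimately have ul: "uniform_limit {s..T} X (\<lambda>t. x0 + S t) sequentially" by (simp only:)
    have lim: "(\<lambda>n. X n t) \<longlonglongrightarrow> x t" and xS: "x t = x0 + S t" if "t \<in> {s..T}" for t
    proof -
      have "(\<lambda>n. X n t) \<longlonglongrightarrow> x0 + S t" by (rule tendsto_uniform_limitI[OF ul that])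
      moreover from this show "x t = x0 + S t" unfolding x_def by (rule limI)
      ultimately show "(\<lambda>n. X n t) \<longlonglongrightarrow> x t" by simp
    qed
    have "continuous_on {s..T} (\<lambda>t. x0 + S t)"
      by (rule uniform_limit_theorem[OF _ ul]) (simp_all add: Xc)
    then have xc: "continuous_on {s..T} x" by (rule continuous_on_eq) (simp add: xS)
    moreover have "x t = x0 + integral {s..t} (\<lambda>\<tau>. F \<tau> (x \<tau>))" if t: "t \<in> {s..T}" for t
    proof -
      have "(\<lambda>n. integral {s..t} (\<lambda>\<tau>. F \<tau> (X n \<tau>))) \<longlonglongrightarrow> integral {s..t} (\<lambda>\<tau>. F \<tau> (x \<tau>))"
      proof (rule dominated_convergence(2)[OF Fi ki[OF t]])
        fix \<tau> assume "\<tau> \<in> {s..t}"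
        then have \<tau>: "\<tau> \<in> {s..T}" using t by auto
        show "norm (F \<tau> (X n \<tau>)) \<le> \<kappa> \<tau>" for n by (rule kb[OF \<tau>])
        have "(\<lambda>n. \<kappa> \<tau> * norm (X n \<tau> - x \<tau>)) \<longlonglongrightarrow> \<kappa> \<tau> * norm (x \<tau> - x \<tau>)"
          by (intro tendsto_intros lim[OF \<tau>])
        then have z: "(\<lambda>n. \<kappa> \<tau> * norm (X n \<tau> - x \<tau>)) \<longlonglongrightarrow> 0" by simp
        have "(\<lambda>n. F \<tau> (X n \<tau>) - F \<tau> (x \<tau>)) \<longlonglongrightarrow> 0"
          by (rule Lim_null_comparison[OF _ z]) (simp add: kl[OF \<tau>])
        then show "(\<lambda>n. F \<tau> (X n \<tau>)) \<longlonglongrightarrow> F \<tau> (x \<tau>)" by (rule LIM_zero_cancel)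
      qed
      then have "(\<lambda>n. X (Suc n) t) \<longlonglongrightarrow> x0 + integral {s..t} (\<lambda>\<tau>. F \<tau> (x \<tau>))"
        unfolding XS by (intro tendsto_intros)
      moreover have "(\<lambda>n. X (Suc n) t) \<longlonglongrightarrow> x t" by (rule LIMSEQ_Suc[OF lim[OF t]])
      ultimately show ?thesis by (rule LIMSEQ_unique[symmetric])
    qed
    ultimately show ?thesis by blast
  qed
  have xs: "x s = x0" using main[of s] by simp
  then show ?thesis
    unfolding integral_solution_def using main ai by (intro exI[of _ x]) auto
qed

text \<open>If \<open>g t\<close> were negative, take the last time \<sigma> before \<open>t\<close>
  at which \<open>g\<close> is nonnegative. Between \<sigma> and \<open>t\<close> the function
  \<open>g\<close> is negative, so \<open>h\<close> is nonnegative almost everywhere there and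
  \<open>g\<close> cannot decrease. The sign of \<open>h\<close> thus matters only where
  \<open>g\<close> is negative.\<close>

lemma nonneg_of_integral:
  fixes g h :: "real \<Rightarrow> real"
  assumes g: "\<And>t. t \<in> {s..T} \<Longrightarrow> (h has_integral g t - g s) {s..t}" and gs: "0 \<le> g s"
    and h: "AE t in lebesgue. t \<in> {s..T} \<longrightarrow> g t < 0 \<longrightarrow> 0 \<le> h t" and t: "t \<in> {s..T}"
  shows "0 \<le> g t"
proof (rule ccontr)
  assume "\<not> 0 \<le> g t"
  then have gt: "g t < 0" by simp
  have hT: "h integrable_on {s..T}" using g[of T] t by auto
  have eq: "g u = g s + integral {s..u} h" if "u \<in> {s..T}" for u using integral_unique[OF g[OF that]] by simp
  have "continuous_on {s..T} (\<lambda>u. g s + integral {s..u} h)"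
    by (intro continuous_intros indefinite_integral_continuous_1 hT)
  then have "continuous_on {s..T} g" by (rule continuous_on_eq) (rule eq[symmetric])
  then have "continuous_on {s..t} g" by (rule continuous_on_subset) (use t in auto)
  then have "closed ({s..t} \<inter> g -` {0..})" by (intro continuous_closed_preimage) auto
  then have "compact ({s..t} \<inter> g -` {0..})"
    using compact_Int_closed[of "{s..t}" "{s..t} \<inter> g -` {0..}"] by (simp add: Int_absorb1 flip: Int_assoc)
  moreover have "s \<in> {s..t} \<inter> g -` {0..}" using gs t by simp
  ultimately obtain \<sigma> where \<sigma>: "\<sigma> \<in> {s..t} \<inter> g -` {0..}" "\<And>u. u \<in> {s..t} \<inter> g -` {0..} \<Longrightarrow> u \<le> \<sigma>"
    using compact_attains_sup[of "{s..t} \<inter> g -` {0..}"] by blast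
  obtain N where N: "N \<in> null_sets lebesgue" "{t. \<not> (t \<in> {s..T} \<longrightarrow> g t < 0 \<longrightarrow> 0 \<le> h t)} \<subseteq> N"
    using h by (auto simp: eventually_ae_filter)
  have neg: "negligible (insert \<sigma> N)" using N(1) by (simp add: negligible_iff_null_sets)
  have hi: "h integrable_on {\<sigma>..t}" by (rule integrable_subinterval_real[OF hT]) (use \<sigma>(1) t in auto)
  have pos: "max 0 (h u) = h u" if u: "u \<in> {\<sigma>..t} - insert \<sigma> N" for u
  proof -
    have "g u < 0"
    proof (rule ccontr)
      assume "\<not> g u < 0"
      then have "u \<in> {s..t} \<inter> g -` {0..}" using u \<sigma>(1) by auto
      then show False using \<sigma>(2)[of u] u by auto
    qed
    moreover have "u \<in> {s..T}" using u \<sigma>(1) t by auto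
    ultimately have "0 \<le> h u" using N(2) u by auto
    then show ?thesis by simp
  qed
  have "integral {\<sigma>..t} h = integral {\<sigma>..t} (\<lambda>u. max 0 (h u))"
    by (rule integral_spike[OF neg]) (rule pos)
  moreover have "0 \<le> integral {\<sigma>..t} (\<lambda>u. max 0 (h u))"
    by (rule Henstock_Kurzweil_Integration.integral_nonneg[OF integrable_spike[OF hi neg]]) (auto intro: pos)
  moreover have "integral {s..\<sigma>} h + integral {\<sigma>..t} h = integral {s..t} h"
    using \<sigma>(1) t by (intro Henstock_Kurzweil_Integration.integral_combine integrable_subinterval_real[OF hT]) auto
  moreover have "g t = g s + integral {s..t} h" "g \<sigma> = g s + integral {s..\<sigma>} h"
    by (rule eq, use t \<sigma>(1) in auto)+
  moreover have "0 \<le> g \<sigma>" using \<sigma>(1) by simp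
  ultimately show False using gt by linarith
qed

text \<open>For a \<le> b this is the nearest-point projection onto the closed strip. Composition
  with it extends a field from the strip to the whole plane without increasing Lipschitz
  constants.\<close>

definition strip_clamp :: "real \<Rightarrow> real \<Rightarrow> complex \<Rightarrow> complex" where
  "strip_clamp a b \<zeta> = of_real (max a (min b (Re \<zeta>))) + \<i> * of_real (Im \<zeta>)"

lemma Re_strip_clamp [simp]: "Re (strip_clamp a b \<zeta>) = max a (min b (Re \<zeta>))"
  by (simp add: strip_clamp_def)

lemma strip_clamp_id: "a \<le> Re \<zeta> \<Longrightarrow> Re \<zeta> \<le> b \<Longrightarrow> strip_clamp a b \<zeta> = \<zeta>"
  by (auto simp: strip_clamp_def complex_eq_iff)

lemma strip_clamp_contraction: "norm (strip_clamp a b z - strip_clamp a b w) \<le> norm (z - w)"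
proof -
  have "\<bar>Re (strip_clamp a b z - strip_clamp a b w)\<bar> \<le> \<bar>Re (z - w)\<bar>" by auto
  then have "(Re (strip_clamp a b z - strip_clamp a b w))\<^sup>2 \<le> (Re (z - w))\<^sup>2" by (rule abs_le_square_iff[THEN iffD1])
  moreover have "Im (strip_clamp a b z - strip_clamp a b w) = Im (z - w)" by (simp add: strip_clamp_def)
  ultimately show ?thesis unfolding cmod_def by (intro real_sqrt_le_mono) simp
qed

context villat_field
begin

theorem complete: "semicomplete r G"
  unfolding semicomplete_def
proof clarify
  fix z s assume "(z, s) \<in> total_domain r"
  then have s: "0 \<le> s" and z: "z \<in> annulus (r s)" by (auto simp: total_domain_def)
  interpret V: whvf_system d r G by unfold_locales (rule weak_holomorphic)
  define \<zeta>0 where "\<zeta>0 = Ln z"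
  have z0: "z \<noteq> 0" using z r_bounds(1)[OF s] by (auto simp: annulus_def)
  then have exp_\<zeta>0: "exp \<zeta>0 = z" by (simp add: \<zeta>0_def)
  then have \<zeta>0: "l s < Re \<zeta>0" "Re \<zeta>0 < 0" using z annulus_exp_iff[OF s] by auto
  define R where "R = r 0"
  have R: "0 < R" "R < 1" using r_bounds[of 0] by (auto simp: R_def)
  define M where "M = villat_bound R"
  have M: "M \<ge> 0" using villat_bound_nonneg R by (simp add: M_def)
  \<comment> \<open>The first two terms put the starting point into the strip at time
    \<open>s\<close>. The third keeps both edges where \<open>villat_class_bounds\<close> gives
    one-sided estimates; as it equals - l 0 / 2, it also keeps the strip nonempty at all later
    times.\<close>
  define c where "c = min (- Re \<zeta>0) (min (Re \<zeta>0 - l s) (- ln (sqrt R)))"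
  have lnR: "ln (sqrt R) = l 0 / 2" using R by (simp add: ln_sqrt l_def R_def)
  have c: "c > 0" "c \<le> - Re \<zeta>0" "c \<le> Re \<zeta>0 - l s" "c \<le> - ln (sqrt R)"
    using \<zeta>0 l_neg[of 0] lnR by (auto simp: c_def)
  \<comment> \<open>The strip \<open>l + b \<le> Re \<le> - b\<close> is invariant: \<open>Re p \<ge> - M b\<close> on its right and \<open>Re p \<le> 1 + M b\<close> on its
    left boundary, while \<open>l' = - Lam\<close> and \<open>b' = - M Lam b\<close>. Hence truncating the field to it changes no solution.\<close>
  define b where "b = (\<lambda>t. c * exp (M * (l t - l s)))"
  have b_pos: "b t > 0" for t using c by (simp add: b_def)
  have b_anti: "b u \<le> b t" if "s \<le> t" "t \<le> u" for t u
    unfolding b_def using that s c(1) M l_antimono[of t u] by (intro mult_left_mono) (auto intro: mult_left_mono)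
  have bs: "b s = c" by (simp add: b_def)
  have b_le: "b t \<le> - ln (sqrt R)" "l t + 2 * b t \<le> 0" if "s \<le> t" for t
  proof -
    show "b t \<le> - ln (sqrt R)" using b_anti[of s t] that c(4) bs by simp
    moreover have "l t \<le> l 0" by (rule l_antimono) (use that s in auto)
    ultimately show "l t + 2 * b t \<le> 0" using lnR by simp
  qed
  have lc: "continuous_on {s..T} l" for T by (rule continuous_on_subset[OF l_continuous]) (use s in auto)
  have bc: "continuous_on {s..T} b" for T unfolding b_def by (intro continuous_intros lc)
  define cl where "cl = (\<lambda>t. strip_clamp (l t + b t) (- b t))"
  have cl_Re: "l t + b t \<le> Re (cl t \<zeta>)" "Re (cl t \<zeta>) \<le> - b t" if "s \<le> t" for t \<zeta>
    using b_le(2)[OF that] by (auto simp: cl_def)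
  have cl_annulus: "exp (cl t \<zeta>) \<in> annulus (r t)" if "s \<le> t" for t \<zeta>
    using cl_Re[OF that, of \<zeta>] b_pos[of t] that s by (subst annulus_exp_iff) auto
  have "\<exists>x. x s = \<zeta>0 \<and> (\<forall>T\<ge>s. integral_solution (\<lambda>t \<zeta>. V.F t (cl t \<zeta>)) s T x)"
  proof (rule integral_solution_exists)
    fix T and x :: "real \<Rightarrow> complex" assume x: "continuous_on {s..T} x"
    have cc: "continuous_on {s..T} (\<lambda>t. cl t (x t))"
      unfolding cl_def strip_clamp_def by (intro continuous_intros lc bc x)
    have [measurable]: "(\<lambda>t. exp (- cl t (x t))) \<in> borel_measurable (lebesgue_on {s..T})"
      by (intro continuous_on_Icc_measurable continuous_intros cc)
    have [measurable]: "(\<lambda>t. G (exp (cl t (x t)), t)) \<in> borel_measurable (lebesgue_on {s..T})"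
      using cl_annulus by (intro V.G_path_measurable s continuous_intros cc) auto
    show "(\<lambda>t. V.F t (cl t (x t))) \<in> borel_measurable (lebesgue_on {s..T})"
      unfolding V.F_def by measurable
  next
    fix T assume T: "s \<le> T"
    \<comment> \<open>As \<open>b\<close> is non-increasing, its value at \<open>T\<close> is the
      smallest margin on the interval. The majorant is taken for the margin \<beta> / 2, and discs
      of radius \<beta> / 4 around truncated points stay within it. The factor 1 + 4 / \<beta>
      covers both the bound \<kappa> and the Cauchy constant \<kappa> / (\<beta> / 4).\<close>
    define \<beta> where "\<beta> = b T"
    have \<beta>: "\<beta> > 0" "\<And>t. t \<in> {s..T} \<Longrightarrow> \<beta> \<le> b t" using b_pos b_anti[of _ T] by (auto simp: \<beta>_def)
    have AB: "l t < l t + \<beta> / 2 \<and> l t + \<beta> / 2 \<le> - (\<beta> / 2) \<and> - (\<beta> / 2) < 0" if "t \<in> {s..T}" for t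
      using \<beta>(1) \<beta>(2)[OF that] b_le(2)[of t] b_pos[of t] that by auto
    have c1: "continuous_on {s..T} (\<lambda>t. l t + \<beta> / 2)" and c2: "continuous_on {s..T} (\<lambda>t. - (\<beta> / 2))"
      by (intro continuous_intros lc)+
    obtain \<kappa> where k: "\<kappa> integrable_on {s..T}" "\<And>t. t \<in> {s..T} \<Longrightarrow> 0 \<le> \<kappa> t"
      "\<And>t \<zeta>. t \<in> {s..T} \<Longrightarrow> l t + \<beta> / 2 \<le> Re \<zeta> \<Longrightarrow> Re \<zeta> \<le> - (\<beta> / 2) \<Longrightarrow> norm (V.F t \<zeta>) \<le> \<kappa> t"
      by (rule V.F_bound[OF s c1 c2 AB]) (assumption, rule that)
    have "(\<lambda>t. \<kappa> t * (1 + 4 / \<beta>)) integrable_on {s..T}" by (rule integrable_on_mult_left[OF k(1)])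
    moreover have "0 \<le> \<kappa> t * (1 + 4 / \<beta>)" "norm (V.F t (cl t z)) \<le> \<kappa> t * (1 + 4 / \<beta>)"
      "norm (V.F t (cl t z) - V.F t (cl t w)) \<le> \<kappa> t * (1 + 4 / \<beta>) * norm (z - w)" if t: "t \<in> {s..T}" for t z w
    proof -
      have ts: "s \<le> t" "0 \<le> t" using t s by auto
      show "0 \<le> \<kappa> t * (1 + 4 / \<beta>)" using k(2)[OF t] \<beta> by simp
      have \<kappa>4: "\<kappa> t \<le> \<kappa> t * (1 + 4 / \<beta>)" "\<kappa> t / (\<beta> / 4) \<le> \<kappa> t * (1 + 4 / \<beta>)"
        using k(2)[OF t] \<beta>(1) by (auto simp: distrib_left)
      have strip: "l t + \<beta> \<le> Re (cl t \<zeta>)" "Re (cl t \<zeta>) \<le> - \<beta>" for \<zeta>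
        using cl_Re[OF ts(1), of \<zeta>] \<beta>(2)[OF t] by auto
      have "norm (V.F t (cl t z)) \<le> \<kappa> t" using strip[of z] \<beta>(1) by (intro k(3) t) auto
      then show "norm (V.F t (cl t z)) \<le> \<kappa> t * (1 + 4 / \<beta>)" using \<kappa>4(1) by linarith
      have "norm (V.F t (cl t z) - V.F t (cl t w)) \<le> \<kappa> t / (\<beta> / 4) * norm (cl t z - cl t w)"
      proof (rule holomorphic_Lipschitz)
        let ?S = "{\<zeta>. l t + \<beta> \<le> Re \<zeta>} \<inter> {\<zeta>. Re \<zeta> \<le> - \<beta>}"
        let ?U = "{\<zeta>. l t + \<beta> / 2 < Re \<zeta> \<and> Re \<zeta> < - (\<beta> / 2)}"
        show "convex ?S" by (intro convex_Int convex_halfspace_Re_ge convex_halfspace_Re_le)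
        show "V.F t holomorphic_on ?U"
          by (rule holomorphic_on_subset[OF V.F_holomorphic[OF ts(2)]]) (use \<beta>(1) in auto)
        show "cball \<zeta> (\<beta> / 4) \<subseteq> ?U" if "\<zeta> \<in> ?S" for \<zeta>
        proof
          fix u assume "u \<in> cball \<zeta> (\<beta> / 4)"
          then have "\<bar>Re (\<zeta> - u)\<bar> \<le> \<beta> / 4" using abs_Re_le_cmod[of "\<zeta> - u"] by (simp add: dist_norm)
          moreover have "l t + \<beta> \<le> Re \<zeta>" "Re \<zeta> \<le> - \<beta>" using that by auto
          ultimately show "u \<in> ?U" using \<beta>(1) unfolding mem_Collect_eq minus_complex.sel by linarith
        qed
        show "norm (V.F t \<zeta>) \<le> \<kappa> t" if "\<zeta> \<in> ?U" for \<zeta> by (rule k(3)[OF t]) (use that in simp_all)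
        show "cl t z \<in> ?S" "cl t w \<in> ?S" using strip by auto
      qed (use \<beta>(1) in simp)
      also have "\<dots> \<le> \<kappa> t * (1 + 4 / \<beta>) * norm (z - w)"
        unfolding cl_def
        by (rule mult_mono[OF \<kappa>4(2) strip_clamp_contraction]) (use k(2)[OF t] \<beta>(1) in auto)
      finally show "norm (V.F t (cl t z) - V.F t (cl t w)) \<le> \<kappa> t * (1 + 4 / \<beta>) * norm (z - w)" .
    qed
    ultimately show "\<exists>\<kappa>. \<kappa> integrable_on {s..T} \<and> (\<forall>t\<in>{s..T}. 0 \<le> \<kappa> t \<and> (\<forall>z. norm (V.F t (cl t z)) \<le> \<kappa> t) \<and>
        (\<forall>z w. norm (V.F t (cl t z) - V.F t (cl t w)) \<le> \<kappa> t * norm (z - w)))"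
      by (intro exI[of _ "\<lambda>t. \<kappa> t * (1 + 4 / \<beta>)"]) blast
  qed
  then obtain x where xs: "x s = \<zeta>0" and x: "\<And>T. s \<le> T \<Longrightarrow> integral_solution (\<lambda>t \<zeta>. V.F t (cl t \<zeta>)) s T x"
    by blast
  define g where "g = (\<lambda>t. Re (V.F t (cl t (x t))))"
  have AE_g: "AE t in lebesgue. s \<le> t \<longrightarrow> Lam t \<ge> 0 \<and> g t = - (Lam t * Re (p (exp (cl t (x t)), t)))"
    using AE_rep
  proof eventually_elim
    case (elim t)
    show ?case
    proof
      assume t: "s \<le> t"
      have "V.F t (cl t (x t)) = \<i> * of_real (C t) - of_real (Lam t) * p (exp (cl t (x t)), t)"
        using elim cl_annulus[OF t, of "x t"] t s by (simp add: V.F_def exp_minus)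
      then show "Lam t \<ge> 0 \<and> g t = - (Lam t * Re (p (exp (cl t (x t)), t)))"
        using elim t s by (simp add: g_def)
    qed
  qed
  have g_int: "(g has_integral Re (x t) - Re (x s)) {s..t}" if t: "s \<le> t" for t
  proof -
    note X = x[OF t, unfolded integral_solution_def]
    have "(\<lambda>\<tau>. V.F \<tau> (cl \<tau> (x \<tau>))) integrable_on {s..t}"
      using conjunct1[OF X] by (simp add: absolutely_integrable_on_def)
    moreover have "x t = x s + integral {s..t} (\<lambda>\<tau>. V.F \<tau> (cl \<tau> (x \<tau>)))"
      using t by (intro bspec[OF conjunct2[OF X]]) simp
    ultimately have "((\<lambda>\<tau>. V.F \<tau> (cl \<tau> (x \<tau>))) has_integral x t - x s) {s..t}" by (simp add: integrable_integral)
    from has_integral_Re[OF this] show ?thesis by (simp add: g_def)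
  qed
  have l_int: "(Lam has_integral l s - l t) {s..t}" if "s \<le> t" for t by (rule Lam_has_integral[OF s that])
  \<comment> \<open>The integral of \<open>Lam\<close> from \<open>s\<close> to \<tau> is l s - l
    \<tau>, so \<open>b\<close> is c times an exponential of such an integral, and its decay rate is
    M Lam.\<close>
  have b_int: "((\<lambda>\<tau>. M * Lam \<tau> * b \<tau>) has_integral b s - b t) {s..t}" if t: "s \<le> t" for t
  proof -
    have e: "exp (- M * integral {s..\<tau>} Lam) = exp (M * (l \<tau> - l s))" if "s \<le> \<tau>" for \<tau>
      unfolding integral_unique[OF l_int[OF that]] by (simp add: algebra_simps)
    have "((\<lambda>\<tau>. - M * Lam \<tau> * exp (- M * integral {s..\<tau>} Lam)) has_integral exp (- M * integral {s..t} Lam) - 1) {s..t}"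
      by (rule exp_integral_has_integral[OF Lam_absolutely_integrable[OF s, of t]]) (use t in auto)
    note I = has_integral_mult_right[OF this, of "- c"]
    have rhs: "- c * (exp (- M * integral {s..t} Lam) - 1) = b s - b t"
      unfolding e[OF t] bs by (simp add: b_def right_diff_distrib)
    have "((\<lambda>\<tau>. M * Lam \<tau> * b \<tau>) has_integral - c * (exp (- M * integral {s..t} Lam) - 1)) {s..t}"
    proof (rule has_integral_eq[OF _ I])
      fix \<tau> assume "\<tau> \<in> {s..t}"
      then have "s \<le> \<tau>" by simp
      then show "- c * (- M * Lam \<tau> * exp (- M * integral {s..\<tau>} Lam)) = M * Lam \<tau> * b \<tau>"
        unfolding e[OF \<open>s \<le> \<tau>\<close>] b_def by (simp add: mult_ac)
    qed
    then show ?thesis unfolding rhs .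
  qed
  have stay: "l t + b t \<le> Re (x t) \<and> Re (x t) \<le> - b t" if t: "s \<le> t" for t
  proof -
    have sqrt_R: "sqrt R \<le> exp (- b \<tau>)" if "s \<le> \<tau>" for \<tau>
    proof -
      have "exp (ln (sqrt R)) \<le> exp (- b \<tau>)" using b_le(1)[OF that] by simp
      then show ?thesis using R by simp
    qed
    have p_ge: "- M * b \<tau> \<le> Re (p (exp (cl \<tau> (x \<tau>)), \<tau>))" if \<tau>: "s \<le> \<tau>" "Re (cl \<tau> (x \<tau>)) = - b \<tau>" for \<tau>
    proof -
      show ?thesis
        using sqrt_R[OF \<tau>(1)] villat_class_bounds(2)[OF p_villat[of \<tau>] r_bounds(1)[of \<tau>] r_antimono[of 0 \<tau>] r_bounds(2)[of 0] cl_annulus[OF \<tau>(1), of "x \<tau>"]]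
          \<tau> s by (simp add: R_def M_def)
    qed
    have p_le: "Re (p (exp (cl \<tau> (x \<tau>)), \<tau>)) \<le> 1 + M * b \<tau>" if \<tau>: "s \<le> \<tau>" "Re (cl \<tau> (x \<tau>)) = l \<tau> + b \<tau>" for \<tau>
    proof -
      \<comment> \<open>Reflection exchanges the two edges of the strip, so the threshold
        \<open>sqrt R\<close> serves on both sides.\<close>
      have "r \<tau> / exp (l \<tau> + b \<tau>) = exp (- b \<tau>)"
        using \<tau>(1) s by (simp add: exp_add exp_minus divide_inverse flip: exp_l)
      then show ?thesis
        using sqrt_R[OF \<tau>(1)] villat_class_bounds(3)[OF p_villat[of \<tau>] r_bounds(1)[of \<tau>] r_antimono[of 0 \<tau>] r_bounds(2)[of 0] cl_annulus[OF \<tau>(1), of "x \<tau>"]]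
          \<tau> s by (simp add: R_def M_def)
    qed
    \<comment> \<open>Beyond an edge of the strip the truncated field takes its values on that edge,
      so \<open>p_ge\<close> applies although \<open>x\<close> itself lies outside. This is the only
      situation in which \<open>nonneg_of_integral\<close> asks for a sign.\<close>
    have "0 \<le> - Re (x t) - b t"
    proof (rule nonneg_of_integral[where g = "\<lambda>\<tau>. - Re (x \<tau>) - b \<tau>" and h = "\<lambda>\<tau>. - g \<tau> + M * Lam \<tau> * b \<tau>" and s = s and T = t])
      fix \<tau> assume "\<tau> \<in> {s..t}"
      then have \<tau>: "s \<le> \<tau>" by simp
      show "((\<lambda>\<tau>. - g \<tau> + M * Lam \<tau> * b \<tau>) has_integral - Re (x \<tau>) - b \<tau> - (- Re (x s) - b s)) {s..\<tau>}"
        using has_integral_add[OF has_integral_neg[OF g_int[OF \<tau>]] b_int[OF \<tau>]] by (simp add: algebra_simps)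
    next
      show "0 \<le> - Re (x s) - b s" using xs bs c(2) by simp
      show "AE \<tau> in lebesgue. \<tau> \<in> {s..t} \<longrightarrow> - Re (x \<tau>) - b \<tau> < 0 \<longrightarrow> 0 \<le> - g \<tau> + M * Lam \<tau> * b \<tau>"
        using AE_g
      proof eventually_elim
        case (elim \<tau>)
        show ?case
        proof (intro impI)
          assume "\<tau> \<in> {s..t}" and neg: "- Re (x \<tau>) - b \<tau> < 0"
          then have \<tau>: "s \<le> \<tau>" by simp
          have "Re (cl \<tau> (x \<tau>)) = - b \<tau>" using neg b_le(2)[OF \<tau>] by (simp add: cl_def)
          then have "Lam \<tau> * (- M * b \<tau>) \<le> Lam \<tau> * Re (p (exp (cl \<tau> (x \<tau>)), \<tau>))"
            using elim \<tau> by (intro mult_left_mono p_ge) auto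
          then show "0 \<le> - g \<tau> + M * Lam \<tau> * b \<tau>" using elim \<tau> by (simp add: mult_ac)
        qed
      qed
    qed (use t in auto)
    moreover have "0 \<le> Re (x t) - l t - b t"
    proof (rule nonneg_of_integral[where g = "\<lambda>\<tau>. Re (x \<tau>) - l \<tau> - b \<tau>" and h = "\<lambda>\<tau>. g \<tau> + Lam \<tau> + M * Lam \<tau> * b \<tau>" and s = s and T = t])
      fix \<tau> assume "\<tau> \<in> {s..t}"
      then have \<tau>: "s \<le> \<tau>" by simp
      show "((\<lambda>\<tau>. g \<tau> + Lam \<tau> + M * Lam \<tau> * b \<tau>) has_integral Re (x \<tau>) - l \<tau> - b \<tau> - (Re (x s) - l s - b s)) {s..\<tau>}"
        using has_integral_add[OF has_integral_add[OF g_int[OF \<tau>] l_int[OF \<tau>]] b_int[OF \<tau>]] by (simp add: algebra_simps)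
    next
      show "0 \<le> Re (x s) - l s - b s" using xs bs c(3) by simp
      show "AE \<tau> in lebesgue. \<tau> \<in> {s..t} \<longrightarrow> Re (x \<tau>) - l \<tau> - b \<tau> < 0 \<longrightarrow> 0 \<le> g \<tau> + Lam \<tau> + M * Lam \<tau> * b \<tau>"
        using AE_g
      proof eventually_elim
        case (elim \<tau>)
        show ?case
        proof (intro impI)
          assume "\<tau> \<in> {s..t}" and neg: "Re (x \<tau>) - l \<tau> - b \<tau> < 0"
          then have \<tau>: "s \<le> \<tau>" by simp
          have "Re (cl \<tau> (x \<tau>)) = l \<tau> + b \<tau>" using neg b_le(2)[OF \<tau>] by (simp add: cl_def)
          then have "Lam \<tau> * Re (p (exp (cl \<tau> (x \<tau>)), \<tau>)) \<le> Lam \<tau> * (1 + M * b \<tau>)"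
            using elim \<tau> by (intro mult_left_mono p_le) auto
          then show "0 \<le> g \<tau> + Lam \<tau> + M * Lam \<tau> * b \<tau>" using elim \<tau> by (simp add: algebra_simps)
        qed
      qed
    qed (use t in auto)
    ultimately show ?thesis by simp
  qed
  then have cl_x: "cl t (x t) = x t" if "s \<le> t" for t using that by (simp add: cl_def strip_clamp_id)
  define w where "w = (\<lambda>t. exp (x t))"
  have w_annulus: "w t \<in> annulus (r t)" if "s \<le> t" for t
    using cl_annulus[OF that, of "x t"] by (simp add: w_def cl_x[OF that])
  have "locally_abs_continuous_on {s..} w"
    unfolding locally_abs_continuous_on_def
  proof (intro allI impI)
    fix a b' :: real assume ab: "a \<le> b'" "{a..b'} \<subseteq> {s..}"
    then have sab: "s \<le> a" "s \<le> b'" by auto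
    have AC: "abs_continuous_on_interval a b' x"
      by (rule abs_continuous_on_interval_subset[OF integral_solution_AC(1)[OF x[OF sab(2)]]]) (use sab in auto)
    obtain Y where Y: "Y > 0" "\<And>t. t \<in> {a..b'} \<Longrightarrow> norm (x t) \<le> Y"
      using continuous_on_Icc_norm_bound[OF abs_continuous_on_interval_imp_continuous_on[OF AC]] by blast
    show "abs_continuous_on_interval a b' w"
    proof (rule abs_continuous_on_interval_dominated2[OF AC AC, of "exp Y"])
      fix u v assume "u \<in> {a..b'}" "v \<in> {a..b'}"
      then have "dist (w u) (w v) \<le> exp Y * dist (x u) (x v)"
        unfolding w_def dist_norm by (intro norm_exp_diff_le Y)
      also have "\<dots> \<le> exp Y * (dist (x u) (x v) + dist (x u) (x v))" by (intro mult_left_mono) auto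
      finally show "dist (w u) (w v) \<le> exp Y * (dist (x u) (x v) + dist (x u) (x v))" .
    qed simp
  qed
  moreover have "(w t, t) \<in> total_domain r" if "t \<ge> s" for t
    using w_annulus[OF that] that s by (simp add: total_domain_def)
  moreover have "AE t in lebesgue_on {s..}. (w has_vector_derivative G (w t, t)) (at t within {s..})"
  proof -
    \<comment> \<open>Differentiability is known only within bounded intervals. Countably many of
      them contribute one null set, and an interval that reaches beyond \<open>t\<close> determines
      the derivative within \<open>{s..}\<close>.\<close>
    have "AE t in lebesgue. \<forall>n::nat. t \<in> {s..s + real n} \<longrightarrow>
        (x has_vector_derivative V.F t (cl t (x t))) (at t within {s..s + real n})"
      unfolding AE_all_countable using integral_solution_AC(2)[OF x] by simp
    then show ?thesis
      unfolding AE_Ici_iff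
    proof eventually_elim
      case (elim t)
      show ?case
      proof
        assume t: "s \<le> t"
        obtain n :: nat where n: "t - s < real n" using reals_Archimedean2 by blast
        have "at t within {s..s + real n} = at t within {s..}"
          by (rule at_within_nhd[of t "{..<s + real n}"]) (use t n in auto)
        then have "(x has_vector_derivative V.F t (x t)) (at t within {s..})"
          using elim[rule_format, of n] t n cl_x[OF t] by auto
        then have "(exp \<circ> x has_vector_derivative V.F t (x t) * exp (x t)) (at t within {s..})"
          by (rule field_vector_diff_chain_within) (auto intro: derivative_eq_intros)
        moreover have "V.F t (x t) * exp (x t) = G (w t, t)" by (simp add: V.F_def w_def exp_minus)
        ultimately show "(w has_vector_derivative G (w t, t)) (at t within {s..})"
          by (simp add: o_def w_def)
      qed
    qed
  qed
  moreover have "w s = z" by (simp add: w_def xs exp_\<zeta>0)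
  ultimately show "\<exists>w :: real \<Rightarrow> complex. locally_abs_continuous_on {s..} w \<and> (\<forall>t\<ge>s. (w t, t) \<in> total_domain r) \<and>
        (AE t in lebesgue_on {s..}. (w has_vector_derivative G (w t, t)) (at t within {s..})) \<and> w s = z"
    by blast
qed

end

(* The vector field formula determines G only for almost every t, whereas a weak holomorphic vector
   field is required to be holomorphic for every t: the conjunct on holomorphy concerns only the
   exceptional null set of t, on which the formula says nothing. *)
theorem theorem5p6:
  fixes d :: ennreal
    and r :: "real \<Rightarrow> real"
    and G :: "complex \<times> real \<Rightarrow> complex"
  assumes "1 \<le> d"
    and "canonical_domain_system d r"
    and "nondegenerate r"
  shows "weak_holomorphic_vector_field d r G \<and> semicomplete r G \<longleftrightarrow>
    (\<forall>t\<ge>0. (\<lambda>w. G (w, t)) holomorphic_on annulus (r t)) \<and>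
    (\<exists>(p :: complex \<times> real \<Rightarrow> complex) (C :: real \<Rightarrow> real).
      (AE t in lebesgue_on {0..}. \<forall>w\<in>annulus (r t).
         G (w, t) = w * (\<i> * of_real (C t)
           + of_real (vector_derivative r (at t within {0..})) * p (w, t) / of_real (r t))) \<and>
      (\<forall>w\<in>(\<Union>t\<in>{0..}. annulus (r t)).
         (\<lambda>t. p (w, t)) \<in> borel_measurable (lebesgue_on (time_section (total_domain r) w))) \<and>
      (\<forall>t\<ge>0. (\<lambda>w. p (w, t)) \<in> villat_class (r t)) \<and>
      Ld_loc d {0..} C)"
    (is "?L \<longleftrightarrow> ?hol \<and> ?rep")
proof
  assume L: ?L
  then have L1: "weak_holomorphic_vector_field d r G" and L2: "semicomplete r G" by (rule conjunct1, rule conjunct2)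
  interpret whvf_system d r G by (unfold_locales) (fact assms L1)+
  show "?hol \<and> ?rep"
    by (intro conjI allI impI G_holomorphic semicomplete_imp_representation L2)
next
  assume R: "?hol \<and> ?rep"
  then have hol: ?hol and ?rep by (rule conjunct1, rule conjunct2)
  from \<open>?rep\<close> obtain p C where pC: "villat_field d r G p C"
  proof (elim exE conjE)
    fix p C
    assume *: "AE t in lebesgue_on {0..}. \<forall>w\<in>annulus (r t). G (w, t) = w * (\<i> * of_real (C t)
        + of_real (vector_derivative r (at t within {0..})) * p (w, t) / of_real (r t))"
      "\<forall>w\<in>(\<Union>t\<in>{0..}. annulus (r t)). (\<lambda>t. p (w, t)) \<in> borel_measurable (lebesgue_on (time_section (total_domain r) w))"
      "\<forall>t\<ge>0. (\<lambda>w. p (w, t)) \<in> villat_class (r t)" "Ld_loc d {0..} C"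
    have "villat_field d r G p C"
      by unfold_locales (fact assms hol[rule_format] *(1) *(2)[rule_format] *(3)[rule_format] *(4))+
    then show ?thesis by (rule that)
  qed
  show ?L using villat_field.weak_holomorphic[OF pC] villat_field.complete[OF pC] by blast
qed

end
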